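(* Over $\mathsf{ACA}_0^\omega+\mathsf{FIN}$, each of the following statements implies $\mathsf{NIN}_{\mathsf{alt}}'$: (1) The Jordan decomposition theorem for $[0,1]$: every $f:[0,1]\to\mathbb{R}$ of bounded variation is the difference of two non-decreasing functions $g,h:[0,1]\to\mathbb{R}$. (2) $\mathsf{HBU}$ restricted to functions of bounded variation: for every $\Psi:[0,1]\to\mathbb{R}^+$ of bounded variation there are $y_0,\dots,y_k\in[0,1]$ such that $\bigcup_{i\le k}B(y_i,\Psi(y_i))$ covers $[0,1]$. (3) $\mathsf{WHBU}$ restricted to functions of bounded variation: for every $\Psi:[0,1]\to\mathbb{R}^+$ of bounded variation and every $\varepsilon>0$ there are $y_0,\dots,y_k\in[0,1]$ such that $\bigcup_{i\le k}B(y_i,\Psi(y_i))$ has measure at least $1-\varepsilon$.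
   Context: Framework: Kohlenbach's higher-order Reverse Mathematics. $\mathsf{ACA}_0^\omega$ is the base theory $\mathsf{RCA}_0^\omega$ plus Kleene's $(\exists^2)$: $(\exists\varphi^2\le_21)(\forall f^1)[(\exists n)(f(n)=0)\leftrightarrow\varphi(f)=0]$. Sets of reals are given by characteristic functions. $X\subset\mathbb{R}$ is finite with size bound $N$ if among any distinct reals $x_0,\dots,x_N$ some $x_i\notin X$. $\mathsf{FIN}$: (1) $\bigcup_{n\le k}X_n$ is finite for any sequence of finite sets $(X_n)$ and $k$; (2) every finite set of reals is contained in the range of a finite sequence of reals; (3) for $Y^2,k^0$ with $(\forall n\le k)(\exists f\in2^{\mathbb{N}})(Y(f,n)=0)$ there are $f_0,\dots,f_k$ with $Y(f_n,n)=0$ for $n\le k$. $B\subset\mathbb{R}$ is height-width countable if there are $H:\mathbb{R}\to\mathbb{N}$ and $g:\mathbb{N}\to\mathbb{N}$ such that for all $n$ the set $\{x\in B:H(x)<n\}$ is finite with size bound $g(n)$. $\mathsf{NIN}_{\mathsf{alt}}'$: $[0,1]$ is not height-width countable. $f:[a,b]\to\mathbb{R}$ has bounded variation if there is $k_0\in\mathbb{N}$ with $\sum_{i<n}|f(x_i)-f(x_{i+1})|\le k_0$ for every partition $a=x_0<\dots<x_n=b$. $B(x,r)$ is the open ball of radius $r$ around $x$; the measure of a finite union of intervals is its Lebesgue measure. *)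

theory Defs
  imports Main
begin

section \<open>The language of finite types\<close>

datatype ty = N | Fun ty ty  (infixr "\<rightarrow>\<^sub>t" 65)

text \<open>The pure types 1 and 2 of the literature.\<close>

abbreviation T1 :: ty where "T1 \<equiv> N \<rightarrow>\<^sub>t N"
abbreviation T2 :: ty where "T2 \<equiv> T1 \<rightarrow>\<^sub>t N"

datatype cst =
    Zero | One | Plus | Times
  | Pi ty ty
  | Sigma ty ty ty
  | Rec

fun cst_ty :: "cst \<Rightarrow> ty" where
  "cst_ty Zero = N"
| "cst_ty One = N"
| "cst_ty Plus = N \<rightarrow>\<^sub>t N \<rightarrow>\<^sub>t N"
| "cst_ty Times = N \<rightarrow>\<^sub>t N \<rightarrow>\<^sub>t N"
| "cst_ty (Pi \<rho> \<tau>) = \<rho> \<rightarrow>\<^sub>t \<tau> \<rightarrow>\<^sub>t \<rho>"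
| "cst_ty (Sigma \<delta> \<rho> \<tau>) = (\<delta> \<rightarrow>\<^sub>t \<rho> \<rightarrow>\<^sub>t \<tau>) \<rightarrow>\<^sub>t (\<delta> \<rightarrow>\<^sub>t \<rho>) \<rightarrow>\<^sub>t \<delta> \<rightarrow>\<^sub>t \<tau>"
| "cst_ty Rec = (N \<rightarrow>\<^sub>t N \<rightarrow>\<^sub>t N) \<rightarrow>\<^sub>t N \<rightarrow>\<^sub>t N \<rightarrow>\<^sub>t N"

text \<open>Variables carry their type: \<^term>\<open>(i, \<tau>)\<close> is the \<^term>\<open>i\<close>-th variable of type \<^term>\<open>\<tau>\<close>.\<close>

type_synonym var = "nat \<times> ty"

datatype tm = Var var | Con cst | App tm tm  (infixl "\<cdot>" 95)

fun ty_of :: "tm \<Rightarrow> ty option" where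
  "ty_of (Var x) = Some (snd x)"
| "ty_of (Con c) = Some (cst_ty c)"
| "ty_of (t \<cdot> u) =
     (case ty_of t of
        Some (\<sigma> \<rightarrow>\<^sub>t \<tau>) \<Rightarrow> (if ty_of u = Some \<sigma> then Some \<tau> else None)
      | _ \<Rightarrow> None)"

text \<open>Only type-0 objects are compared by prime formulas. The remaining connectives are
  defined classically.\<close>

datatype fm = Eq tm tm | Less tm tm | Falsum | Imp fm fm | All var fm

abbreviation Neg :: "fm \<Rightarrow> fm" where "Neg \<phi> \<equiv> Imp \<phi> Falsum"
abbreviation Conj :: "fm \<Rightarrow> fm \<Rightarrow> fm" where "Conj \<phi> \<psi> \<equiv> Neg (Imp \<phi> (Neg \<psi>))"
abbreviation Disj :: "fm \<Rightarrow> fm \<Rightarrow> fm" where "Disj \<phi> \<psi> \<equiv> Imp (Neg \<phi>) \<psi>"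
abbreviation Ex :: "var \<Rightarrow> fm \<Rightarrow> fm" where "Ex x \<phi> \<equiv> Neg (All x (Neg \<phi>))"

fun wf :: "fm \<Rightarrow> bool" where
  "wf (Eq t u) \<longleftrightarrow> ty_of t = Some N \<and> ty_of u = Some N"
| "wf (Less t u) \<longleftrightarrow> ty_of t = Some N \<and> ty_of u = Some N"
| "wf Falsum \<longleftrightarrow> True"
| "wf (Imp \<phi> \<psi>) \<longleftrightarrow> wf \<phi> \<and> wf \<psi>"
| "wf (All x \<phi>) \<longleftrightarrow> wf \<phi>"

fun qfree :: "fm \<Rightarrow> bool" where
  "qfree (Imp \<phi> \<psi>) \<longleftrightarrow> qfree \<phi> \<and> qfree \<psi>"
| "qfree (All x \<phi>) \<longleftrightarrow> False"
| "qfree _ \<longleftrightarrow> True"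

fun tm_vars :: "tm \<Rightarrow> var set" where
  "tm_vars (Var x) = {x}"
| "tm_vars (Con c) = {}"
| "tm_vars (t \<cdot> u) = tm_vars t \<union> tm_vars u"

fun fv :: "fm \<Rightarrow> var set" where
  "fv (Eq t u) = tm_vars t \<union> tm_vars u"
| "fv (Less t u) = tm_vars t \<union> tm_vars u"
| "fv Falsum = {}"
| "fv (Imp \<phi> \<psi>) = fv \<phi> \<union> fv \<psi>"
| "fv (All x \<phi>) = fv \<phi> - {x}"

fun tm_subst :: "var \<Rightarrow> tm \<Rightarrow> tm \<Rightarrow> tm" where
  "tm_subst x s (Var y) = (if y = x then s else Var y)"
| "tm_subst x s (Con c) = Con c"
| "tm_subst x s (t \<cdot> u) = tm_subst x s t \<cdot> tm_subst x s u"

text \<open>Substitution does not rename bound variables; it is always guarded by \<open>free_for\<close> below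
  (or applied to quantifier-free formulas).\<close>

fun subst :: "var \<Rightarrow> tm \<Rightarrow> fm \<Rightarrow> fm" where
  "subst x s (Eq t u) = Eq (tm_subst x s t) (tm_subst x s u)"
| "subst x s (Less t u) = Less (tm_subst x s t) (tm_subst x s u)"
| "subst x s Falsum = Falsum"
| "subst x s (Imp \<phi> \<psi>) = Imp (subst x s \<phi>) (subst x s \<psi>)"
| "subst x s (All y \<phi>) = (if y = x then All y \<phi> else All y (subst x s \<phi>))"

fun free_for :: "tm \<Rightarrow> var \<Rightarrow> fm \<Rightarrow> bool" where
  "free_for s x (Imp \<phi> \<psi>) \<longleftrightarrow> free_for s x \<phi> \<and> free_for s x \<psi>"
| "free_for s x (All y \<phi>) \<longleftrightarrow> x \<notin> fv (All y \<phi>) \<or> (y \<notin> tm_vars s \<and> free_for s x \<phi>)"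
| "free_for s x _ \<longleftrightarrow> True"


section \<open>Classical many-sorted predicate logic with equality at type 0\<close>

text \<open>\<^term>\<open>A\<close> is the set of axioms, \<^term>\<open>\<Gamma>\<close> the set of open assumptions. Axioms may have
  free variables (parameters) and are understood as universally closed; hence the
  eigenvariable condition concerns only \<^term>\<open>\<Gamma>\<close>.\<close>

inductive deriv :: "fm set \<Rightarrow> fm set \<Rightarrow> fm \<Rightarrow> bool" for A :: "fm set" where
  Axiom: "\<phi> \<in> A \<Longrightarrow> wf \<phi> \<Longrightarrow> deriv A \<Gamma> \<phi>"
| Assm: "\<phi> \<in> \<Gamma> \<Longrightarrow> wf \<phi> \<Longrightarrow> deriv A \<Gamma> \<phi>"
| ImpI: "deriv A (insert \<phi> \<Gamma>) \<psi> \<Longrightarrow> wf \<phi> \<Longrightarrow> deriv A \<Gamma> (Imp \<phi> \<psi>)"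
| ImpE: "deriv A \<Gamma> (Imp \<phi> \<psi>) \<Longrightarrow> deriv A \<Gamma> \<phi> \<Longrightarrow> deriv A \<Gamma> \<psi>"
| Classical: "deriv A (insert (Neg \<phi>) \<Gamma>) Falsum \<Longrightarrow> wf \<phi> \<Longrightarrow> deriv A \<Gamma> \<phi>"
| AllI: "deriv A \<Gamma> \<phi> \<Longrightarrow> (\<And>\<psi>. \<psi> \<in> \<Gamma> \<Longrightarrow> x \<notin> fv \<psi>) \<Longrightarrow> deriv A \<Gamma> (All x \<phi>)"
| AllE: "deriv A \<Gamma> (All x \<phi>) \<Longrightarrow> ty_of t = Some (snd x) \<Longrightarrow> free_for t x \<phi>
          \<Longrightarrow> deriv A \<Gamma> (subst x t \<phi>)"
| Refl: "ty_of t = Some N \<Longrightarrow> deriv A \<Gamma> (Eq t t)"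
| Leibniz: "deriv A \<Gamma> (Eq t u) \<Longrightarrow> deriv A \<Gamma> (subst x t \<phi>) \<Longrightarrow> snd x = N \<Longrightarrow> wf \<phi>
          \<Longrightarrow> free_for t x \<phi> \<Longrightarrow> free_for u x \<phi> \<Longrightarrow> deriv A \<Gamma> (subst x u \<phi>)"

definition proves :: "fm set \<Rightarrow> fm \<Rightarrow> bool"  (infix "\<turnstile>" 50) where
  "A \<turnstile> \<phi> \<longleftrightarrow> deriv A {} \<phi>"


section \<open>Writing formulas with HOL binders\<close>

text \<open>A formula scheme \<^typ>\<open>nat \<Rightarrow> fm\<close> expects the number \<^term>\<open>d\<close> of enclosing quantifiers. The
  quantifier at depth \<^term>\<open>d\<close> binds the variable with index \<^term>\<open>d\<close>, so no macro below can
  capture a variable of the terms it is applied to: these only contain indices smaller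
  than \<^term>\<open>d\<close>. Closed formulas are obtained at depth 0.\<close>

type_synonym sch = "nat \<Rightarrow> fm"

definition eq_s :: "tm \<Rightarrow> tm \<Rightarrow> sch"  (infix "\<^bold>=" 50) where
  "(t \<^bold>= u) d = Eq t u"
definition less_s :: "tm \<Rightarrow> tm \<Rightarrow> sch"  (infix "\<^bold><" 50) where
  "(t \<^bold>< u) d = Less t u"
definition not_s :: "sch \<Rightarrow> sch"  ("\<^bold>\<not> _" [40] 40) where
  "(\<^bold>\<not> F) d = Neg (F d)"
definition and_s :: "sch \<Rightarrow> sch \<Rightarrow> sch"  (infixr "\<^bold>\<and>" 35) where
  "(F \<^bold>\<and> G) d = Conj (F d) (G d)"
definition or_s :: "sch \<Rightarrow> sch \<Rightarrow> sch"  (infixr "\<^bold>\<or>" 30) where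
  "(F \<^bold>\<or> G) d = Disj (F d) (G d)"
definition imp_s :: "sch \<Rightarrow> sch \<Rightarrow> sch"  (infixr "\<^bold>\<longrightarrow>" 25) where
  "(F \<^bold>\<longrightarrow> G) d = Imp (F d) (G d)"
definition iff_s :: "sch \<Rightarrow> sch \<Rightarrow> sch"  (infixr "\<^bold>\<longleftrightarrow>" 25) where
  "(F \<^bold>\<longleftrightarrow> G) = ((F \<^bold>\<longrightarrow> G) \<^bold>\<and> (G \<^bold>\<longrightarrow> F))"

definition all_ty :: "ty \<Rightarrow> (tm \<Rightarrow> sch) \<Rightarrow> sch" where
  "all_ty \<tau> F d = All (d, \<tau>) (F (Var (d, \<tau>)) (Suc d))"
definition ex_ty :: "ty \<Rightarrow> (tm \<Rightarrow> sch) \<Rightarrow> sch" where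
  "ex_ty \<tau> F d = Ex (d, \<tau>) (F (Var (d, \<tau>)) (Suc d))"

definition all_nat :: "(tm \<Rightarrow> sch) \<Rightarrow> sch"  (binder "\<^bold>\<forall>" 10) where
  "all_nat = all_ty N"
definition ex_nat :: "(tm \<Rightarrow> sch) \<Rightarrow> sch"  (binder "\<^bold>\<exists>" 10) where
  "ex_nat = ex_ty N"

abbreviation zero_t :: tm  ("\<^bold>0") where "\<^bold>0 \<equiv> Con Zero"
abbreviation one_t :: tm  ("\<^bold>1") where "\<^bold>1 \<equiv> Con One"
abbreviation plus_t :: "tm \<Rightarrow> tm \<Rightarrow> tm"  (infixl "\<^bold>+" 65) where
  "t \<^bold>+ u \<equiv> Con Plus \<cdot> t \<cdot> u"
abbreviation times_t :: "tm \<Rightarrow> tm \<Rightarrow> tm"  (infixl "\<^bold>*" 70) where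
  "t \<^bold>* u \<equiv> Con Times \<cdot> t \<cdot> u"
abbreviation two_t :: tm  ("\<^bold>2") where "\<^bold>2 \<equiv> \<^bold>1 \<^bold>+ \<^bold>1"

definition le_s :: "tm \<Rightarrow> tm \<Rightarrow> sch"  (infix "\<^bold>\<le>" 50) where
  "(t \<^bold>\<le> u) = (t \<^bold>< u \<^bold>\<or> t \<^bold>= u)"

definition all_lt :: "tm \<Rightarrow> (tm \<Rightarrow> sch) \<Rightarrow> sch" where
  "all_lt k F = (\<^bold>\<forall>i. i \<^bold>< k \<^bold>\<longrightarrow> F i)"
definition ex_lt :: "tm \<Rightarrow> (tm \<Rightarrow> sch) \<Rightarrow> sch" where
  "ex_lt k F = (\<^bold>\<exists>i. i \<^bold>< k \<^bold>\<and> F i)"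
definition all_le :: "tm \<Rightarrow> (tm \<Rightarrow> sch) \<Rightarrow> sch" where
  "all_le k F = (\<^bold>\<forall>i. i \<^bold>\<le> k \<^bold>\<longrightarrow> F i)"
definition ex_le :: "tm \<Rightarrow> (tm \<Rightarrow> sch) \<Rightarrow> sch" where
  "ex_le k F = (\<^bold>\<exists>i. i \<^bold>\<le> k \<^bold>\<and> F i)"

text \<open>Equality at higher types is extensional: \<open>x z\<^sub>1 \<dots> z\<^sub>k = y z\<^sub>1 \<dots> z\<^sub>k\<close> for all \<open>z\<^sub>1, \<dots>, z\<^sub>k\<close>.\<close>

fun eq_ty :: "ty \<Rightarrow> tm \<Rightarrow> tm \<Rightarrow> sch" where
  "eq_ty N t u = (t \<^bold>= u)"
| "eq_ty (\<sigma> \<rightarrow>\<^sub>t \<tau>) t u = all_ty \<sigma> (\<lambda>z. eq_ty \<tau> (t \<cdot> z) (u \<cdot> z))"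


section \<open>The axiom systems\<close>

text \<open>The basic axioms are those of second-order arithmetic.\<close>

definition basic_axioms :: "fm set" where
  "basic_axioms = (\<lambda>F. F 0) `
    {\<^bold>\<forall>m. \<^bold>\<not> m \<^bold>+ \<^bold>1 \<^bold>= \<^bold>0,
     \<^bold>\<forall>m. \<^bold>\<forall>n. m \<^bold>+ \<^bold>1 \<^bold>= n \<^bold>+ \<^bold>1 \<^bold>\<longrightarrow> m \<^bold>= n,
     \<^bold>\<forall>m. m \<^bold>+ \<^bold>0 \<^bold>= m,
     \<^bold>\<forall>m. \<^bold>\<forall>n. m \<^bold>+ (n \<^bold>+ \<^bold>1) \<^bold>= (m \<^bold>+ n) \<^bold>+ \<^bold>1,
     \<^bold>\<forall>m. m \<^bold>* \<^bold>0 \<^bold>= \<^bold>0,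
     \<^bold>\<forall>m. \<^bold>\<forall>n. m \<^bold>* (n \<^bold>+ \<^bold>1) \<^bold>= m \<^bold>* n \<^bold>+ m,
     \<^bold>\<forall>m. \<^bold>\<not> m \<^bold>< \<^bold>0,
     \<^bold>\<forall>m. \<^bold>\<forall>n. m \<^bold>< n \<^bold>+ \<^bold>1 \<^bold>\<longleftrightarrow> m \<^bold>< n \<^bold>\<or> m \<^bold>= n}"

definition Pi_axiom :: "ty \<Rightarrow> ty \<Rightarrow> sch" where
  "Pi_axiom \<rho> \<tau> = all_ty \<rho> (\<lambda>x. all_ty \<tau> (\<lambda>y. eq_ty \<rho> (Con (Pi \<rho> \<tau>) \<cdot> x \<cdot> y) x))"

definition Sigma_axiom :: "ty \<Rightarrow> ty \<Rightarrow> ty \<Rightarrow> sch" where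
  "Sigma_axiom \<delta> \<rho> \<tau> =
     all_ty (\<delta> \<rightarrow>\<^sub>t \<rho> \<rightarrow>\<^sub>t \<tau>) (\<lambda>x. all_ty (\<delta> \<rightarrow>\<^sub>t \<rho>) (\<lambda>y. all_ty \<delta> (\<lambda>z.
       eq_ty \<tau> (Con (Sigma \<delta> \<rho> \<tau>) \<cdot> x \<cdot> y \<cdot> z) (x \<cdot> z \<cdot> (y \<cdot> z)))))"

definition Rec_axiom :: sch where
  "Rec_axiom = all_ty (N \<rightarrow>\<^sub>t N \<rightarrow>\<^sub>t N) (\<lambda>f. \<^bold>\<forall>m.
     Con Rec \<cdot> f \<cdot> m \<cdot> \<^bold>0 \<^bold>= m \<^bold>\<and>
     (\<^bold>\<forall>n. Con Rec \<cdot> f \<cdot> m \<cdot> (n \<^bold>+ \<^bold>1) \<^bold>= f \<cdot> n \<cdot> (Con Rec \<cdot> f \<cdot> m \<cdot> n)))"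

definition ext_axiom :: "ty \<Rightarrow> ty \<Rightarrow> sch" where
  "ext_axiom \<rho> \<tau> = all_ty \<rho> (\<lambda>x. all_ty \<rho> (\<lambda>y. all_ty (\<rho> \<rightarrow>\<^sub>t \<tau>) (\<lambda>\<phi>.
     eq_ty \<rho> x y \<^bold>\<longrightarrow> eq_ty \<tau> (\<phi> \<cdot> x) (\<phi> \<cdot> y))))"

text \<open>In both schemata \<^term>\<open>\<phi>\<close> may contain further free variables of any type.\<close>

definition qf_induction :: "fm set" where
  "qf_induction =
    {Imp (Conj (subst (i, N) \<^bold>0 \<phi>)
               (All (i, N) (Imp \<phi> (subst (i, N) (Var (i, N) \<^bold>+ \<^bold>1) \<phi>))))
         (All (i, N) \<phi>) | i \<phi>. wf \<phi> \<and> qfree \<phi>}"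

definition QF_AC_1_0 :: "fm set" where
  "QF_AC_1_0 =
    {Imp (All (i, T1) (Ex (j, N) \<phi>))
         (Ex (k, T2) (All (i, T1) (subst (j, N) (Var (k, T2) \<cdot> Var (i, T1)) \<phi>)))
      | i j k \<phi>. wf \<phi> \<and> qfree \<phi> \<and> (k, T2) \<notin> fv \<phi>}"

definition RCA0_omega :: "fm set" where
  "RCA0_omega = basic_axioms
     \<union> {Pi_axiom \<rho> \<tau> 0 | \<rho> \<tau>. True}
     \<union> {Sigma_axiom \<delta> \<rho> \<tau> 0 | \<delta> \<rho> \<tau>. True}
     \<union> {Rec_axiom 0}
     \<union> {ext_axiom \<rho> \<tau> 0 | \<rho> \<tau>. True}
     \<union> qf_induction \<union> QF_AC_1_0"

definition Kleene_E2 :: sch where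
  "Kleene_E2 = ex_ty T2 (\<lambda>\<phi>. all_ty T1 (\<lambda>f. \<phi> \<cdot> f \<^bold>\<le> \<^bold>1) \<^bold>\<and>
     all_ty T1 (\<lambda>f. (\<^bold>\<exists>n. f \<cdot> n \<^bold>= \<^bold>0) \<^bold>\<longleftrightarrow> \<phi> \<cdot> f \<^bold>= \<^bold>0))"

definition ACA0_omega :: "fm set" where
  "ACA0_omega = RCA0_omega \<union> {Kleene_E2 0}"


section \<open>Rational numbers\<close>

text \<open>A triple \<^term>\<open>(a, b, d)\<close> of type-0 terms stands for the rational number \<open>(a - b) / d\<close>, where
  \<open>d\<close> is positive.\<close>

type_synonym rat3 = "tm \<times> tm \<times> tm"

fun rat_plus :: "rat3 \<Rightarrow> rat3 \<Rightarrow> rat3" where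
  "rat_plus (a, b, d) (a', b', d') = (a \<^bold>* d' \<^bold>+ a' \<^bold>* d, b \<^bold>* d' \<^bold>+ b' \<^bold>* d, d \<^bold>* d')"
fun rat_minus :: "rat3 \<Rightarrow> rat3" where
  "rat_minus (a, b, d) = (b, a, d)"
fun rat_less :: "rat3 \<Rightarrow> rat3 \<Rightarrow> sch" where
  "rat_less (a, b, d) (a', b', d') = (a \<^bold>* d' \<^bold>+ b' \<^bold>* d \<^bold>< a' \<^bold>* d \<^bold>+ b \<^bold>* d')"
definition rat_le :: "rat3 \<Rightarrow> rat3 \<Rightarrow> sch" where
  "rat_le p q = (\<^bold>\<not> rat_less q p)"

text \<open>\<open>pow2 n\<close> is \<open>2\<^sup>n\<close>, obtained by iterating \<open>y \<mapsto> y + y\<close>; here \<open>id_t\<close> is the identity.\<close>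

definition id_t :: tm where
  "id_t = Con (Sigma N (N \<rightarrow>\<^sub>t N) N) \<cdot> Con (Pi N (N \<rightarrow>\<^sub>t N)) \<cdot> Con (Pi N N)"
definition double_t :: tm where
  "double_t = Con (Sigma N N N) \<cdot> Con Plus \<cdot> id_t"
definition pow2 :: "tm \<Rightarrow> tm" where
  "pow2 n = Con Rec \<cdot> (Con (Pi (N \<rightarrow>\<^sub>t N) N) \<cdot> double_t) \<cdot> \<^bold>1 \<cdot> n"

text \<open>Every number \<open>q\<close> codes a rational: if \<open>q = (m + c)(m + c + 1)/2 + m\<close> (Cantor pairing),
  then \<open>q\<close> codes \<open>(m/2)/(c + 1)\<close> for even \<open>m\<close> and \<open>-((m + 1)/2)/(c + 1)\<close> for odd \<open>m\<close>.
  The formula says that \<open>q\<close> codes \<open>(a - b)/(c + 1)\<close> with \<open>a = 0\<close> or \<open>b = 0\<close>; \<open>a\<close>, \<open>b\<close>, \<open>c\<close> are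
  uniquely determined by \<open>q\<close>.\<close>

definition rat_code :: "tm \<Rightarrow> tm \<Rightarrow> tm \<Rightarrow> tm \<Rightarrow> sch" where
  "rat_code q a b c = (\<^bold>\<exists>m.
     \<^bold>2 \<^bold>* q \<^bold>= (m \<^bold>+ c) \<^bold>* (m \<^bold>+ c \<^bold>+ \<^bold>1) \<^bold>+ \<^bold>2 \<^bold>* m \<^bold>\<and>
     ((b \<^bold>= \<^bold>0 \<^bold>\<and> m \<^bold>= \<^bold>2 \<^bold>* a) \<^bold>\<or> (a \<^bold>= \<^bold>0 \<^bold>\<and> \<^bold>1 \<^bold>\<le> b \<^bold>\<and> m \<^bold>+ \<^bold>1 \<^bold>= \<^bold>2 \<^bold>* b)))"

definition with_rat :: "tm \<Rightarrow> (rat3 \<Rightarrow> sch) \<Rightarrow> sch" where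
  "with_rat q K = (\<^bold>\<exists>a. \<^bold>\<exists>b. \<^bold>\<exists>c. rat_code q a b c \<^bold>\<and> K (a, b, c \<^bold>+ \<^bold>1))"


section \<open>Real numbers\<close>

text \<open>A real is a type-1 object \<open>x\<close>, read as a sequence of codes of rationals, with
  \<open>|x\<^sub>n - x\<^sub>n\<^sub>+\<^sub>i| < 2\<^sup>-\<^sup>n\<close> for all \<open>n\<close> and \<open>i\<close>.

  A real expression is given through its rational approximations: \<open>X n K\<close> states that the
  \<open>n\<close>-th approximation of \<open>X\<close> satisfies \<open>K\<close>.\<close>

type_synonym rexp = "tm \<Rightarrow> (rat3 \<Rightarrow> sch) \<Rightarrow> sch"

definition rl :: "tm \<Rightarrow> rexp" where
  "rl x n K = with_rat (x \<cdot> n) K"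
definition rnat :: "tm \<Rightarrow> rexp" where
  "rnat t n K = K (t, \<^bold>0, \<^bold>1)"
definition rplus :: "rexp \<Rightarrow> rexp \<Rightarrow> rexp"  (infixl "\<oplus>" 65) where
  "(X \<oplus> Y) n K = X (n \<^bold>+ \<^bold>1) (\<lambda>p. Y (n \<^bold>+ \<^bold>1) (\<lambda>q. K (rat_plus p q)))"
definition rminus :: "rexp \<Rightarrow> rexp \<Rightarrow> rexp"  (infixl "\<ominus>" 65) where
  "X \<ominus> Y = X \<oplus> (\<lambda>n K. Y n (\<lambda>q. K (rat_minus q)))"
definition rabs :: "rexp \<Rightarrow> rexp" where
  "rabs X n K = X n (\<lambda>(a, b, d). \<^bold>\<exists>c. (a \<^bold>= b \<^bold>+ c \<^bold>\<or> b \<^bold>= a \<^bold>+ c) \<^bold>\<and> K (c, \<^bold>0, d))"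

definition is_real :: "tm \<Rightarrow> sch" where
  "is_real x = (\<^bold>\<forall>n. \<^bold>\<forall>i. rl x n (\<lambda>p. rl x (n \<^bold>+ i) (\<lambda>q.
     rat_less p (rat_plus q (\<^bold>1, \<^bold>0, pow2 n)) \<^bold>\<and> rat_less q (rat_plus p (\<^bold>1, \<^bold>0, pow2 n)))))"

text \<open>\<open>X = Y\<close> iff \<open>|X\<^sub>n - Y\<^sub>n| \<le> 2\<^sup>-\<^sup>n\<^sup>+\<^sup>1\<close> for all \<open>n\<close>, and \<open>X < Y\<close> iff \<open>X\<^sub>n + 2\<^sup>-\<^sup>n\<^sup>+\<^sup>1 < Y\<^sub>n\<close> for some \<open>n\<close>.\<close>

definition req :: "rexp \<Rightarrow> rexp \<Rightarrow> sch"  (infix "=\<^sub>R" 50) where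
  "(X =\<^sub>R Y) = (\<^bold>\<forall>n. X n (\<lambda>p. Y n (\<lambda>q.
     rat_le p (rat_plus q (\<^bold>2, \<^bold>0, pow2 n)) \<^bold>\<and> rat_le q (rat_plus p (\<^bold>2, \<^bold>0, pow2 n)))))"
definition rless :: "rexp \<Rightarrow> rexp \<Rightarrow> sch"  (infix "<\<^sub>R" 50) where
  "(X <\<^sub>R Y) = (\<^bold>\<exists>n. X n (\<lambda>p. Y n (\<lambda>q. rat_less (rat_plus p (\<^bold>2, \<^bold>0, pow2 n)) q)))"
definition rle :: "rexp \<Rightarrow> rexp \<Rightarrow> sch"  (infix "\<le>\<^sub>R" 50) where
  "(X \<le>\<^sub>R Y) = (\<^bold>\<not> Y <\<^sub>R X)"

definition all_real :: "(tm \<Rightarrow> sch) \<Rightarrow> sch"  (binder "\<^bold>\<forall>\<^sub>R" 10) where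
  "all_real F = all_ty T1 (\<lambda>x. is_real x \<^bold>\<longrightarrow> F x)"
definition ex_real :: "(tm \<Rightarrow> sch) \<Rightarrow> sch"  (binder "\<^bold>\<exists>\<^sub>R" 10) where
  "ex_real F = ex_ty T1 (\<lambda>x. is_real x \<^bold>\<and> F x)"

definition in_Icc :: "rexp \<Rightarrow> rexp \<Rightarrow> tm \<Rightarrow> sch" where
  "in_Icc A B x = (A \<le>\<^sub>R rl x \<^bold>\<and> rl x \<le>\<^sub>R B)"
definition in_Ioo :: "rexp \<Rightarrow> rexp \<Rightarrow> tm \<Rightarrow> sch" where
  "in_Ioo A B x = (A <\<^sub>R rl x \<^bold>\<and> rl x <\<^sub>R B)"
abbreviation in_unit :: "tm \<Rightarrow> sch" where
  "in_unit \<equiv> in_Icc (rnat \<^bold>0) (rnat \<^bold>1)"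
definition in_ball :: "rexp \<Rightarrow> rexp \<Rightarrow> tm \<Rightarrow> sch" where
  "in_ball Y R x = (rabs (rl x \<ominus> Y) <\<^sub>R R)"

text \<open>\<open>s = \<Sum>i<n. Z i\<close>, by recursion: \<open>S\<close> is the sequence of partial sums.\<close>

definition is_sum :: "(tm \<Rightarrow> rexp) \<Rightarrow> tm \<Rightarrow> tm \<Rightarrow> sch" where
  "is_sum Z n s = ex_ty (N \<rightarrow>\<^sub>t T1) (\<lambda>S.
     all_le n (\<lambda>i. is_real (S \<cdot> i)) \<^bold>\<and>
     rl (S \<cdot> \<^bold>0) =\<^sub>R rnat \<^bold>0 \<^bold>\<and>
     all_lt n (\<lambda>i. rl (S \<cdot> (i \<^bold>+ \<^bold>1)) =\<^sub>R rl (S \<cdot> i) \<oplus> Z i) \<^bold>\<and>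
     rl s =\<^sub>R rl (S \<cdot> n))"


section \<open>Sets of reals and functions on the reals\<close>

definition is_set :: "tm \<Rightarrow> sch" where
  "is_set X = ((\<^bold>\<forall>\<^sub>R x. X \<cdot> x \<^bold>\<le> \<^bold>1) \<^bold>\<and>
     (\<^bold>\<forall>\<^sub>R x. \<^bold>\<forall>\<^sub>R y. rl x =\<^sub>R rl y \<^bold>\<longrightarrow> X \<cdot> x \<^bold>= X \<cdot> y))"
definition mem :: "tm \<Rightarrow> tm \<Rightarrow> sch" where
  "mem X x = (X \<cdot> x \<^bold>= \<^bold>1)"

text \<open>Finiteness of the collection of all reals satisfying \<^term>\<open>P\<close>. As everywhere below, a finite
  sequence \<open>x\<^sub>0, \<dots>, x\<^sub>k\<close> of reals is an initial segment of an object of type \<open>0 \<rightarrow> 1\<close>.\<close>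

definition finite_bound :: "(tm \<Rightarrow> sch) \<Rightarrow> tm \<Rightarrow> sch" where
  "finite_bound P k = all_ty (N \<rightarrow>\<^sub>t T1) (\<lambda>x.
     all_le k (\<lambda>i. is_real (x \<cdot> i)) \<^bold>\<and>
     all_le k (\<lambda>i. all_le k (\<lambda>j. (\<^bold>\<not> i \<^bold>= j) \<^bold>\<longrightarrow> (\<^bold>\<not> rl (x \<cdot> i) =\<^sub>R rl (x \<cdot> j)))) \<^bold>\<longrightarrow>
     ex_le k (\<lambda>i. \<^bold>\<not> P (x \<cdot> i)))"
definition is_finite :: "(tm \<Rightarrow> sch) \<Rightarrow> sch" where
  "is_finite P = (\<^bold>\<exists>k. finite_bound P k)"

definition real_to_nat :: "tm \<Rightarrow> sch" where
  "real_to_nat H = (\<^bold>\<forall>\<^sub>R x. \<^bold>\<forall>\<^sub>R y. rl x =\<^sub>R rl y \<^bold>\<longrightarrow> H \<cdot> x \<^bold>= H \<cdot> y)"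

definition height_width_countable :: "(tm \<Rightarrow> sch) \<Rightarrow> sch" where
  "height_width_countable B = ex_ty T2 (\<lambda>H. ex_ty T1 (\<lambda>g.
     real_to_nat H \<^bold>\<and> (\<^bold>\<forall>n. finite_bound (\<lambda>x. B x \<^bold>\<and> H \<cdot> x \<^bold>< n) (g \<cdot> n))))"

text \<open>\<open>f : [A, B] \<rightarrow> \<real>\<close>, where \<open>f\<close> is an object of type \<open>1 \<rightarrow> 1\<close>.\<close>

definition real_fun :: "rexp \<Rightarrow> rexp \<Rightarrow> tm \<Rightarrow> sch" where
  "real_fun A B f =
    ((\<^bold>\<forall>\<^sub>R x. in_Icc A B x \<^bold>\<longrightarrow> is_real (f \<cdot> x)) \<^bold>\<and>
     (\<^bold>\<forall>\<^sub>R x. \<^bold>\<forall>\<^sub>R y. in_Icc A B x \<^bold>\<and> in_Icc A B y \<^bold>\<and> rl x =\<^sub>R rl y \<^bold>\<longrightarrow>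
        rl (f \<cdot> x) =\<^sub>R rl (f \<cdot> y)))"

definition positive_fun :: "rexp \<Rightarrow> rexp \<Rightarrow> tm \<Rightarrow> sch" where
  "positive_fun A B f =
     (real_fun A B f \<^bold>\<and> (\<^bold>\<forall>\<^sub>R x. in_Icc A B x \<^bold>\<longrightarrow> rnat \<^bold>0 <\<^sub>R rl (f \<cdot> x)))"

definition nondecreasing :: "rexp \<Rightarrow> rexp \<Rightarrow> tm \<Rightarrow> sch" where
  "nondecreasing A B f = (\<^bold>\<forall>\<^sub>R x. \<^bold>\<forall>\<^sub>R y.
     in_Icc A B x \<^bold>\<and> in_Icc A B y \<^bold>\<and> rl x \<le>\<^sub>R rl y \<^bold>\<longrightarrow> rl (f \<cdot> x) \<le>\<^sub>R rl (f \<cdot> y))"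

definition is_partition :: "rexp \<Rightarrow> rexp \<Rightarrow> tm \<Rightarrow> tm \<Rightarrow> sch" where
  "is_partition A B n x =
    (all_le n (\<lambda>i. is_real (x \<cdot> i)) \<^bold>\<and>
     rl (x \<cdot> \<^bold>0) =\<^sub>R A \<^bold>\<and> rl (x \<cdot> n) =\<^sub>R B \<^bold>\<and>
     all_lt n (\<lambda>i. rl (x \<cdot> i) <\<^sub>R rl (x \<cdot> (i \<^bold>+ \<^bold>1))))"

definition bounded_variation :: "rexp \<Rightarrow> rexp \<Rightarrow> tm \<Rightarrow> sch" where
  "bounded_variation A B f = (\<^bold>\<exists>k. \<^bold>\<forall>n. all_ty (N \<rightarrow>\<^sub>t T1) (\<lambda>x.
     is_partition A B n x \<^bold>\<longrightarrow>
     (\<^bold>\<forall>\<^sub>R s. is_sum (\<lambda>i. rabs (rl (f \<cdot> (x \<cdot> i)) \<ominus> rl (f \<cdot> (x \<cdot> (i \<^bold>+ \<^bold>1))))) n s \<^bold>\<longrightarrow>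
        rl s \<le>\<^sub>R rnat k)))"

text \<open>The measure of a finite union \<^term>\<open>P\<close> of open intervals is the total length of
  finitely many pairwise disjoint open intervals with union \<^term>\<open>P\<close>.\<close>

definition has_measure :: "(tm \<Rightarrow> sch) \<Rightarrow> tm \<Rightarrow> sch" where
  "has_measure P m = (\<^bold>\<exists>l. ex_ty (N \<rightarrow>\<^sub>t T1) (\<lambda>a. ex_ty (N \<rightarrow>\<^sub>t T1) (\<lambda>b.
     all_lt l (\<lambda>j. is_real (a \<cdot> j) \<^bold>\<and> is_real (b \<cdot> j) \<^bold>\<and> rl (a \<cdot> j) \<le>\<^sub>R rl (b \<cdot> j)) \<^bold>\<and>
     all_lt l (\<lambda>i. all_lt l (\<lambda>j. (\<^bold>\<not> i \<^bold>= j) \<^bold>\<longrightarrow>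
       (\<^bold>\<not> (\<^bold>\<exists>\<^sub>R x. in_Ioo (rl (a \<cdot> i)) (rl (b \<cdot> i)) x \<^bold>\<and> in_Ioo (rl (a \<cdot> j)) (rl (b \<cdot> j)) x)))) \<^bold>\<and>
     (\<^bold>\<forall>\<^sub>R x. P x \<^bold>\<longleftrightarrow> ex_lt l (\<lambda>j. in_Ioo (rl (a \<cdot> j)) (rl (b \<cdot> j)) x)) \<^bold>\<and>
     is_sum (\<lambda>j. rl (b \<cdot> j) \<ominus> rl (a \<cdot> j)) l m)))"


section \<open>The principles\<close>

definition FIN_union :: sch where
  "FIN_union = all_ty (N \<rightarrow>\<^sub>t T1 \<rightarrow>\<^sub>t N) (\<lambda>X.
     (\<^bold>\<forall>n. is_set (X \<cdot> n) \<^bold>\<and> is_finite (mem (X \<cdot> n))) \<^bold>\<longrightarrow>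
     (\<^bold>\<forall>k. is_finite (\<lambda>x. ex_le k (\<lambda>n. mem (X \<cdot> n) x))))"

definition FIN_enum :: sch where
  "FIN_enum = all_ty (T1 \<rightarrow>\<^sub>t N) (\<lambda>X. is_set X \<^bold>\<and> is_finite (mem X) \<^bold>\<longrightarrow>
     (\<^bold>\<exists>k. ex_ty (N \<rightarrow>\<^sub>t T1) (\<lambda>x. all_lt k (\<lambda>i. is_real (x \<cdot> i)) \<^bold>\<and>
        (\<^bold>\<forall>\<^sub>R y. mem X y \<^bold>\<longrightarrow> ex_lt k (\<lambda>i. rl y =\<^sub>R rl (x \<cdot> i))))))"

text \<open>The functional \<open>Y\<close> of two arguments is curried.\<close>

definition FIN_choice :: sch where
  "FIN_choice = all_ty (T1 \<rightarrow>\<^sub>t N \<rightarrow>\<^sub>t N) (\<lambda>Y. \<^bold>\<forall>k.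
     all_le k (\<lambda>n. ex_ty T1 (\<lambda>f. (\<^bold>\<forall>i. f \<cdot> i \<^bold>\<le> \<^bold>1) \<^bold>\<and> Y \<cdot> f \<cdot> n \<^bold>= \<^bold>0)) \<^bold>\<longrightarrow>
     ex_ty (N \<rightarrow>\<^sub>t T1) (\<lambda>f. all_le k (\<lambda>n. Y \<cdot> (f \<cdot> n) \<cdot> n \<^bold>= \<^bold>0)))"

definition FIN :: "fm set" where
  "FIN = {FIN_union 0, FIN_enum 0, FIN_choice 0}"

definition NIN_alt' :: sch where
  "NIN_alt' = (\<^bold>\<not> height_width_countable in_unit)"

definition Jordan :: sch where
  "Jordan = all_ty (T1 \<rightarrow>\<^sub>t T1) (\<lambda>f.
     real_fun (rnat \<^bold>0) (rnat \<^bold>1) f \<^bold>\<and> bounded_variation (rnat \<^bold>0) (rnat \<^bold>1) f \<^bold>\<longrightarrow>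
     ex_ty (T1 \<rightarrow>\<^sub>t T1) (\<lambda>g. ex_ty (T1 \<rightarrow>\<^sub>t T1) (\<lambda>h.
       real_fun (rnat \<^bold>0) (rnat \<^bold>1) g \<^bold>\<and> nondecreasing (rnat \<^bold>0) (rnat \<^bold>1) g \<^bold>\<and>
       real_fun (rnat \<^bold>0) (rnat \<^bold>1) h \<^bold>\<and> nondecreasing (rnat \<^bold>0) (rnat \<^bold>1) h \<^bold>\<and>
       (\<^bold>\<forall>\<^sub>R x. in_unit x \<^bold>\<longrightarrow> rl (f \<cdot> x) =\<^sub>R rl (g \<cdot> x) \<ominus> rl (h \<cdot> x)))))"

definition HBU_BV :: sch where
  "HBU_BV = all_ty (T1 \<rightarrow>\<^sub>t T1) (\<lambda>\<Psi>.
     positive_fun (rnat \<^bold>0) (rnat \<^bold>1) \<Psi> \<^bold>\<and> bounded_variation (rnat \<^bold>0) (rnat \<^bold>1) \<Psi> \<^bold>\<longrightarrow>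
     (\<^bold>\<exists>k. ex_ty (N \<rightarrow>\<^sub>t T1) (\<lambda>y.
       all_le k (\<lambda>i. is_real (y \<cdot> i) \<^bold>\<and> in_unit (y \<cdot> i)) \<^bold>\<and>
       (\<^bold>\<forall>\<^sub>R x. in_unit x \<^bold>\<longrightarrow> ex_le k (\<lambda>i. in_ball (rl (y \<cdot> i)) (rl (\<Psi> \<cdot> (y \<cdot> i))) x)))))"

text \<open>The measure is that of the union as a subset of the real line; it is not intersected
  with the unit interval.\<close>

definition WHBU_BV :: sch where
  "WHBU_BV = all_ty (T1 \<rightarrow>\<^sub>t T1) (\<lambda>\<Psi>.
     positive_fun (rnat \<^bold>0) (rnat \<^bold>1) \<Psi> \<^bold>\<and> bounded_variation (rnat \<^bold>0) (rnat \<^bold>1) \<Psi> \<^bold>\<longrightarrow>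
     (\<^bold>\<forall>\<^sub>R \<epsilon>. rnat \<^bold>0 <\<^sub>R rl \<epsilon> \<^bold>\<longrightarrow>
       (\<^bold>\<exists>k. ex_ty (N \<rightarrow>\<^sub>t T1) (\<lambda>y.
         all_le k (\<lambda>i. is_real (y \<cdot> i) \<^bold>\<and> in_unit (y \<cdot> i)) \<^bold>\<and>
         (\<^bold>\<exists>\<^sub>R m. has_measure (\<lambda>x. ex_le k (\<lambda>i. in_ball (rl (y \<cdot> i)) (rl (\<Psi> \<cdot> (y \<cdot> i))) x)) m \<^bold>\<and>
            rnat \<^bold>1 \<ominus> rl \<epsilon> \<le>\<^sub>R rl m)))))"

end

theory Submission
  imports Defs "HOL-Library.Countable" "HOL-Computational_Algebra.Fraction_Field"
begin

text \<open>By completeness it suffices to refute the three principles in every model of the axioms in which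
  some \<open>H\<close> and \<open>g\<close> witness that \<open>[0,1]\<close> is height-width countable. The numbers of such a model form a
  possibly nonstandard ordered semiring, and its reals take values in the Cauchy completion of the
  field of fractions of this semiring; sums, counts and inductions are restricted to functions
  definable in the model, which arithmetical comprehension makes a rich class.

  Let \<open>h(x) = H(x) + 4 + g(H(x) + 1)\<close> and \<open>\<Psi>(x) = 2^(-h(x))\<close>. At most \<open>g(b + 1)\<close> points have height \<open>b\<close>, so
  sums of \<open>\<Psi>\<close> over finitely many distinct points are at most \<open>1/8\<close>. Hence \<open>\<Psi>\<close> has bounded variation,
  whereas finitely many balls \<open>B(y, \<Psi>(y))\<close> have total length at most \<open>1/4\<close>, which is measured by counting
  the points of a fine grid; this refutes both covering principles. If \<open>\<Psi> = p - q\<close> with \<open>p\<close>, \<open>q\<close>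
  non-decreasing, then repeatedly passing to a quarter of an interval with at most half of the
  increment of \<open>p + q\<close> leads to a point \<open>x\<close> and an interval on which \<open>\<Psi> > \<Psi>(x)/2\<close>. There \<open>H\<close> is bounded,
  although the interval contains arbitrarily many points.\<close>

subsection \<open>Syntax\<close>

text \<open>The obstacle is that nothing standard may be assumed about the countermodel. Its numbers
  need not be well-founded, so every induction, sum, count and choice must be shown to take place
  inside it. Hence each internal induction opens with a case \<open>dfn\<close>, inequalities
  between reals are first put into the definable form \<open>cmp8\<close> or \<open>rlt\<close>, and
  estimates are phrased for numbers of the model, such as \<Psi> multiplied by a common denominator
  \<open>2^m\<close>, and not for HOL sums. Ordered fields over these numbers are wanted as types
  with class instances, but a type cannot depend on a model fixed within a proof; so one
  countermodel \<open>S0\<close> is chosen globally and \<open>mnat\<close> is carved out of it. The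
  constants of \<open>h\<close> come from a geometric series: fewer than \<open>2^g(b + 1)\<close>
  points have height \<open>b\<close>, and each has weight \<open>2^-(b + 4 + g(b + 1))\<close>; so
  level \<open>b\<close> weighs less than \<open>2^-(b + 4)\<close>, and all levels together weigh
  at most \<open>1/8\<close>.\<close>

instance ty :: countable by countable_datatype
instance cst :: countable by countable_datatype
text \<open>Codes of terms become the elements of the model, which therefore has type
  \<open>nat str\<close>; codes of formulas number the stages of the Henkin construction.\<close>

instance tm :: countable by countable_datatype
instance fm :: countable by countable_datatype

lemma ty_of_tm_subst: "ty_of s = Some (snd x) \<Longrightarrow> ty_of (tm_subst x s t) = ty_of t"
  by (induction t) (auto split: option.splits ty.splits)

lemma wf_subst: "ty_of s = Some (snd x) \<Longrightarrow> wf \<phi> \<Longrightarrow> wf (subst x s \<phi>)"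
  by (induction \<phi>) (auto simp: ty_of_tm_subst)

lemma tm_subst_id: "tm_subst x (Var x) t = t"
  by (induction t) auto

lemma subst_id: "subst x (Var x) \<phi> = \<phi>"
  by (induction \<phi>) (auto simp: tm_subst_id)

lemma free_for_self: "free_for (Var x) x \<phi>"
  by (induction \<phi>) auto

lemma finite_tm_vars: "finite (tm_vars t)"
  by (induction t) auto

lemma wf_deriv: "deriv A \<Gamma> \<phi> \<Longrightarrow> wf \<phi>"
proof (induction rule: deriv.induct)
  case (Leibniz \<Gamma> t u x \<phi>)
  then show ?case by (auto intro!: wf_subst)
qed (auto intro!: wf_subst)

fun avars :: "fm \<Rightarrow> var set" where
  "avars (Eq t u) = tm_vars t \<union> tm_vars u"
| "avars (Less t u) = tm_vars t \<union> tm_vars u"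
| "avars Falsum = {}"
| "avars (Imp \<phi> \<psi>) = avars \<phi> \<union> avars \<psi>"
| "avars (All x \<phi>) = insert x (avars \<phi>)"

lemma finite_avars: "finite (avars \<phi>)"
  by (induction \<phi>) (auto simp: finite_tm_vars)

lemma fv_avars: "fv \<phi> \<subseteq> avars \<phi>"
  by (induction \<phi>) auto

lemma ty_of_App:
  assumes "ty_of (t \<cdot> u) = Some \<tau>"
  obtains \<sigma> where "ty_of t = Some (\<sigma> \<rightarrow>\<^sub>t \<tau>)" "ty_of u = Some \<sigma>"
  using assms by (auto split: option.splits ty.splits if_splits)

subsection \<open>Theorems form a Hilbert system\<close>

lemma proves_MP: "A \<turnstile> Imp \<phi> \<psi> \<Longrightarrow> A \<turnstile> \<phi> \<Longrightarrow> A \<turnstile> \<psi>"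
  unfolding proves_def by (rule deriv.ImpE)

lemma proves_GEN: "A \<turnstile> \<phi> \<Longrightarrow> A \<turnstile> All x \<phi>"
  unfolding proves_def by (rule deriv.AllI) auto

lemma proves_K: "wf \<phi> \<Longrightarrow> wf \<psi> \<Longrightarrow> A \<turnstile> Imp \<phi> (Imp \<psi> \<phi>)"
  unfolding proves_def by (intro deriv.ImpI deriv.Assm) auto

lemma proves_S:
  assumes "wf \<phi>" "wf \<psi>" "wf \<chi>"
  shows "A \<turnstile> Imp (Imp \<phi> (Imp \<psi> \<chi>)) (Imp (Imp \<phi> \<psi>) (Imp \<phi> \<chi>))"
proof -
  let ?\<Gamma> = "{\<phi>, Imp \<phi> \<psi>, Imp \<phi> (Imp \<psi> \<chi>)}"
  have 1: "deriv A ?\<Gamma> \<phi>" "deriv A ?\<Gamma> (Imp \<phi> \<psi>)" "deriv A ?\<Gamma> (Imp \<phi> (Imp \<psi> \<chi>))"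
    using assms by (simp_all add: deriv.Assm)
  have "deriv A ?\<Gamma> \<chi>"
    using deriv.ImpE[OF deriv.ImpE[OF 1(3,1)] deriv.ImpE[OF 1(2,1)]] .
  then show ?thesis
    unfolding proves_def by (intro deriv.ImpI) (use assms in simp_all)
qed

lemma proves_DN:
  assumes "wf \<phi>"
  shows "A \<turnstile> Imp (Neg (Neg \<phi>)) \<phi>"
proof -
  have "deriv A {Neg \<phi>, Neg (Neg \<phi>)} Falsum"
    by (rule deriv.ImpE[of _ _ "Neg \<phi>"]; rule deriv.Assm; simp add: assms)
  then show ?thesis
    unfolding proves_def by (rule deriv.ImpI[OF deriv.Classical]) (simp_all add: assms)
qed

lemma proves_inst:
  assumes "wf (All x \<phi>)" "ty_of t = Some (snd x)" "free_for t x \<phi>"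
  shows "A \<turnstile> Imp (All x \<phi>) (subst x t \<phi>)"
  unfolding proves_def using assms by (intro deriv.ImpI deriv.AllE deriv.Assm) auto

lemma deriv_AllE_self: "deriv A \<Gamma> (All x \<phi>) \<Longrightarrow> deriv A \<Gamma> \<phi>"
  using deriv.AllE[of A \<Gamma> x \<phi> "Var x"] by (simp add: subst_id free_for_self)

lemma proves_distrib:
  assumes "wf \<phi>" "wf \<psi>"
  shows "A \<turnstile> Imp (All x (Imp \<phi> \<psi>)) (Imp (All x \<phi>) (All x \<psi>))"
proof -
  let ?\<Gamma> = "{All x \<phi>, All x (Imp \<phi> \<psi>)}"
  have "deriv A ?\<Gamma> (Imp \<phi> \<psi>)" "deriv A ?\<Gamma> \<phi>"
    by (rule deriv_AllE_self[where x = x], rule deriv.Assm; simp add: assms)+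
  then have "deriv A ?\<Gamma> \<psi>"
    by (rule deriv.ImpE)
  then have "deriv A ?\<Gamma> (All x \<psi>)"
    by (rule deriv.AllI) auto
  then show ?thesis
    unfolding proves_def by (intro deriv.ImpI) (simp_all add: assms)
qed

lemma proves_vacuous:
  assumes "wf \<phi>" "x \<notin> fv \<phi>"
  shows "A \<turnstile> Imp \<phi> (All x \<phi>)"
  unfolding proves_def by (rule deriv.ImpI, rule deriv.AllI, rule deriv.Assm) (use assms in auto)

lemma proves_Leibniz:
  assumes "ty_of t = Some N" "ty_of u = Some N" "snd x = N" "wf \<phi>" "free_for t x \<phi>" "free_for u x \<phi>"
  shows "A \<turnstile> Imp (Eq t u) (Imp (subst x t \<phi>) (subst x u \<phi>))"
  unfolding proves_def
  by (rule deriv.ImpI, rule deriv.ImpI, rule deriv.Leibniz[where t = t])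
    (use assms in \<open>auto intro!: deriv.Assm wf_subst\<close>)

lemma wf_proves: "A \<turnstile> \<phi> \<Longrightarrow> wf \<phi>"
  unfolding proves_def by (rule wf_deriv)

text \<open>Consequence from a possibly infinite set \<open>T\<close> by modus ponens alone. The
  theorems of \<open>A\<close> are already closed under generalisation, so the deduction theorem for
  \<open>pv\<close> carries no eigenvariable condition.\<close>

inductive pv :: "fm set \<Rightarrow> fm set \<Rightarrow> fm \<Rightarrow> bool" for A T where
  ax: "A \<turnstile> \<phi> \<Longrightarrow> pv A T \<phi>"
| asm: "\<phi> \<in> T \<Longrightarrow> wf \<phi> \<Longrightarrow> pv A T \<phi>"
| mp: "pv A T (Imp \<phi> \<psi>) \<Longrightarrow> pv A T \<phi> \<Longrightarrow> pv A T \<psi>"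

lemma wf_pv: "pv A T \<phi> \<Longrightarrow> wf \<phi>"
  by (induction rule: pv.induct) (auto dest: wf_proves)

lemma pv_mono: "pv A T \<phi> \<Longrightarrow> T \<subseteq> T' \<Longrightarrow> pv A T' \<phi>"
  by (induction rule: pv.induct) (auto intro: pv.intros)

lemma pv_compact: "pv A T \<phi> \<Longrightarrow> \<exists>F. finite F \<and> F \<subseteq> T \<and> pv A F \<phi>"
proof (induction rule: pv.induct)
  case (ax \<phi>)
  then show ?case by (intro exI[of _ "{}"]) (auto intro: pv.intros)
next
  case (asm \<phi>)
  then show ?case by (intro exI[of _ "{\<phi>}"]) (auto intro: pv.intros)
next
  case (mp \<phi> \<psi>)
  then obtain F G where "finite F" "F \<subseteq> T" "pv A F (Imp \<phi> \<psi>)" "finite G" "G \<subseteq> T" "pv A G \<phi>"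
    by blast
  then show ?case
    by (intro exI[of _ "F \<union> G"]) (auto intro: pv.mp pv_mono)
qed

lemma pv_empty: "pv A {} \<phi> \<Longrightarrow> A \<turnstile> \<phi>"
  by (induction rule: pv.induct) (auto intro: proves_MP)

lemma pv_K: "pv A T \<psi> \<Longrightarrow> wf \<phi> \<Longrightarrow> pv A T (Imp \<phi> \<psi>)"
  using pv.mp pv.ax proves_K wf_pv by metis

lemma pv_refl:
  assumes "wf \<phi>"
  shows "pv A T (Imp \<phi> \<phi>)"
proof (rule pv.ax)
  show "A \<turnstile> Imp \<phi> \<phi>"
    unfolding proves_def by (rule deriv.ImpI[OF deriv.Assm]) (simp_all add: assms)
qed

lemma pv_deduction: "pv A (insert \<phi> T) \<psi> \<Longrightarrow> wf \<phi> \<Longrightarrow> pv A T (Imp \<phi> \<psi>)"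
proof (induction rule: pv.induct)
  case (ax \<psi>)
  then show ?case by (auto intro: pv_K pv.ax)
next
  case (asm \<psi>)
  then show ?case by (auto intro: pv_K pv.asm pv_refl)
next
  case (mp \<psi> \<chi>)
  have "wf \<psi>" "wf \<chi>" using mp.hyps wf_pv by fastforce+
  then show ?case using mp proves_S[of \<phi> \<psi> \<chi>] by (meson pv.mp pv.ax)
qed

lemma pv_contra: "pv A (insert (Neg \<phi>) T) Falsum \<Longrightarrow> wf \<phi> \<Longrightarrow> pv A T \<phi>"
  using pv_deduction[of A "Neg \<phi>" T Falsum] proves_DN[of \<phi> A] by (auto intro: pv.mp pv.ax)

lemma pv_trans:
  assumes "pv A T (Imp \<phi> \<psi>)" "pv A T (Imp \<psi> \<chi>)"
  shows "pv A T (Imp \<phi> \<chi>)"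
proof (rule pv_deduction)
  show w: "wf \<phi>" using wf_pv[OF assms(1)] by simp
  have "pv A (insert \<phi> T) \<psi>"
    by (rule pv.mp[OF pv_mono[OF assms(1)] pv.asm]) (use w in auto)
  then show "pv A (insert \<phi> T) \<chi>"
    by (rule pv.mp[OF pv_mono[OF assms(2)], rotated]) auto
qed

lemma pv_Falsum: "pv A T Falsum \<Longrightarrow> wf \<phi> \<Longrightarrow> pv A T \<phi>"
  by (rule pv_contra) (auto intro: pv_mono)

lemma proves_trans: "A \<turnstile> Imp \<phi> \<psi> \<Longrightarrow> A \<turnstile> Imp \<psi> \<chi> \<Longrightarrow> A \<turnstile> Imp \<phi> \<chi>"
  using pv_trans[of A "{}" \<phi> \<psi> \<chi>] by (auto intro: pv.ax pv_empty)

lemma proves_Imp_All: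
  assumes "A \<turnstile> Imp \<phi> \<psi>" "x \<notin> fv \<phi>"
  shows "A \<turnstile> Imp \<phi> (All x \<psi>)"
proof -
  have "wf \<phi>" "wf \<psi>" using wf_proves[OF assms(1)] by auto
  then show ?thesis
    using proves_MP[OF proves_distrib proves_GEN[OF assms(1)]] proves_vacuous[OF _ assms(2)]
      proves_trans by blast
qed

lemma proves_All_mono: "A \<turnstile> Imp \<phi> \<psi> \<Longrightarrow> A \<turnstile> Imp (All x \<phi>) (All x \<psi>)"
  using proves_MP[OF proves_distrib proves_GEN] wf_proves by fastforce

lemma proves_Imp_mono:
  assumes "A \<turnstile> Imp \<phi>' \<phi>" "A \<turnstile> Imp \<psi> \<psi>'"
  shows "A \<turnstile> Imp (Imp \<phi> \<psi>) (Imp \<phi>' \<psi>')"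
proof (rule pv_empty)
  have w: "wf \<phi>'" "wf \<phi>" "wf \<psi>" using assms[THEN wf_proves] by auto
  let ?T = "{\<phi>', Imp \<phi> \<psi>}"
  have "pv A ?T \<psi>'"
    using assms w by (intro pv.mp[OF pv.ax[OF assms(2)]] pv.mp[of _ _ \<phi> \<psi>] pv.mp[OF pv.ax[OF assms(1)]] pv.asm) auto
  then show "pv A {} (Imp (Imp \<phi> \<psi>) (Imp \<phi>' \<psi>'))"
    using w by (intro pv_deduction) auto
qed

subsection \<open>Parallel substitution with canonical bound variables\<close>

text \<open>A quantifier whose scope has height \<open>h\<close> is renamed to bind the index \<open>e h\<close>. As heights
  decrease inwards, nothing is captured if the substituted terms avoid the range of \<open>e\<close>.\<close>

fun hgt :: "fm \<Rightarrow> nat" where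
  "hgt (Imp \<phi> \<psi>) = max (hgt \<phi>) (hgt \<psi>)"
| "hgt (All x \<phi>) = Suc (hgt \<phi>)"
| "hgt _ = 0"

fun tinst :: "(var \<Rightarrow> tm) \<Rightarrow> tm \<Rightarrow> tm" where
  "tinst \<rho> (Var x) = \<rho> x"
| "tinst \<rho> (Con c) = Con c"
| "tinst \<rho> (t \<cdot> u) = tinst \<rho> t \<cdot> tinst \<rho> u"

fun inst :: "(nat \<Rightarrow> nat) \<Rightarrow> (var \<Rightarrow> tm) \<Rightarrow> fm \<Rightarrow> fm" where
  "inst e \<rho> (Eq t u) = Eq (tinst \<rho> t) (tinst \<rho> u)"
| "inst e \<rho> (Less t u) = Less (tinst \<rho> t) (tinst \<rho> u)"
| "inst e \<rho> Falsum = Falsum"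
| "inst e \<rho> (Imp \<phi> \<psi>) = Imp (inst e \<rho> \<phi>) (inst e \<rho> \<psi>)"
| "inst e \<rho> (All x \<phi>) =
     (let v = (e (hgt \<phi>), snd x) in All v (inst e (\<rho>(x := Var v)) \<phi>))"

lemma tinst_Var: "tinst Var t = t"
  by (induction t) auto

lemma tinst_cong: "(\<And>z. z \<in> tm_vars t \<Longrightarrow> \<rho> z = \<rho>' z) \<Longrightarrow> tinst \<rho> t = tinst \<rho>' t"
  by (induction t) auto

lemma inst_cong: "(\<And>z. z \<in> fv \<phi> \<Longrightarrow> \<rho> z = \<rho>' z) \<Longrightarrow> inst e \<rho> \<phi> = inst e \<rho>' \<phi>"
proof (induction \<phi> arbitrary: \<rho> \<rho>')
  case (Imp \<phi> \<psi>)
  then show ?case by (metis UnCI fv.simps(4) inst.simps(4))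
next
  case (All x \<phi>)
  have "inst e (\<rho>(x := t)) \<phi> = inst e (\<rho>'(x := t)) \<phi>" for t
    by (rule All.IH) (use All.prems in auto)
  then show ?case by (simp add: Let_def)
qed (auto intro: tinst_cong)

lemma tm_subst_tinst: "tm_subst v s (tinst \<rho> t) = tinst (\<lambda>z. tm_subst v s (\<rho> z)) t"
  by (induction t) auto

text \<open>A variable whose index differs from those of the canonical binders is never bound inside
  \<open>inst\<close>, so substituting for it affects only the assigned terms.\<close>

lemma inst_subst:
  "(\<And>h. h < hgt \<phi> \<Longrightarrow> fst v \<noteq> e h) \<Longrightarrow>
    subst v s (inst e \<rho> \<phi>) = inst e (\<lambda>z. tm_subst v s (\<rho> z)) \<phi>"
proof (induction \<phi> arbitrary: \<rho>)
  case (All x \<phi>)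
  have "v \<noteq> (e (hgt \<phi>), snd x)" using All.prems[of "hgt \<phi>"] by auto
  moreover have "(\<lambda>z. tm_subst v s ((\<rho>(x := Var w)) z)) = (\<lambda>z. tm_subst v s (\<rho> z))(x := Var w)"
    if "v \<noteq> w" for w
    using that by auto
  ultimately show ?case using All by (simp add: Let_def)
qed (auto simp: tm_subst_tinst)

lemma ty_of_tinst: "(\<And>z. ty_of (\<rho> z) = Some (snd z)) \<Longrightarrow> ty_of (tinst \<rho> t) = ty_of t"
  by (induction t) (auto split: option.splits ty.splits)

lemma wf_inst: "(\<And>z. ty_of (\<rho> z) = Some (snd z)) \<Longrightarrow> wf (inst e \<rho> \<phi>) \<longleftrightarrow> wf \<phi>"
  by (induction \<phi> arbitrary: \<rho>) (auto simp: ty_of_tinst Let_def)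

lemma tm_vars_tinst: "tm_vars (tinst \<rho> t) = (\<Union>z\<in>tm_vars t. tm_vars (\<rho> z))"
  by (induction t) auto

lemma fv_inst: "fv (inst e \<rho> \<phi>) \<subseteq> (\<Union>z\<in>fv \<phi>. tm_vars (\<rho> z))"
proof (induction \<phi> arbitrary: \<rho>)
  case (All x \<phi>)
  show ?case
    using All.IH[of "\<rho>(x := Var (e (hgt \<phi>), snd x))"] by (fastforce simp: Let_def split: if_splits)
next
  case (Imp \<phi> \<psi>)
  then show ?case by fastforce
qed (auto simp: tm_vars_tinst)

lemma avars_inst: "v \<in> avars (inst e \<rho> \<phi>) \<Longrightarrow> (\<exists>z\<in>fv \<phi>. v \<in> tm_vars (\<rho> z)) \<or> (\<exists>h<hgt \<phi>. fst v = e h)"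
proof (induction \<phi> arbitrary: \<rho>)
  case (All x \<phi>)
  show ?case
  proof (cases "fst v = e (hgt \<phi>)")
    case True
    then show ?thesis by (intro disjI2 exI[of _ "hgt \<phi>"]) simp
  next
    case False
    then have "v \<in> avars (inst e (\<rho>(x := Var (e (hgt \<phi>), snd x))) \<phi>)"
      using All.prems by (auto simp: Let_def)
    from All.IH[OF this] False show ?thesis
      by (auto split: if_splits intro: less_SucI)
  qed
next
  case (Imp \<phi> \<psi>)
  from Imp.prems consider "v \<in> avars (inst e \<rho> \<phi>)" | "v \<in> avars (inst e \<rho> \<psi>)" by auto
  then show ?case
  proof cases
    case 1
    from Imp.IH(1)[OF this] show ?thesis by (auto simp: less_max_iff_disj)
  next
    case 2
    from Imp.IH(2)[OF this] show ?thesis by (auto simp: less_max_iff_disj)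
  qed
qed (auto simp: tm_vars_tinst)

lemma hgt_inst: "hgt (inst e \<rho> \<phi>) = hgt \<phi>"
  by (induction \<phi> arbitrary: \<rho>) (auto simp: Let_def)

lemma free_for_inst:
  "(\<And>y h. y \<in> tm_vars s \<Longrightarrow> h < hgt \<phi> \<Longrightarrow> fst y \<noteq> e h) \<Longrightarrow> free_for s v (inst e \<rho> \<phi>)"
proof (induction \<phi> arbitrary: \<rho>)
  case (All x \<phi>)
  have "(e (hgt \<phi>), snd x) \<notin> tm_vars s"
    using All.prems[of "(e (hgt \<phi>), snd x)" "hgt \<phi>"] by auto
  then show ?case
    using All.IH All.prems by (simp add: Let_def)
qed (auto simp: less_max_iff_disj)

lemma tinst_tinst: "tinst \<rho> (tinst \<sigma> t) = tinst (\<lambda>z. tinst \<rho> (\<sigma> z)) t"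
  by (induction t) auto

text \<open>Nested binders have different heights, so injectivity of \<open>e\<close> keeps their
  canonical names apart; the condition on \<open>\<sigma>\<close> excludes capture of the variables
  in its terms.\<close>

lemma inst_inst:
  assumes "inj e"
  shows "\<forall>z\<in>fv \<phi>. \<forall>y\<in>tm_vars (\<sigma> z). \<forall>h<hgt \<phi>. fst y \<noteq> e h \<Longrightarrow>
    inst e' \<rho> (inst e \<sigma> \<phi>) = inst e' (\<lambda>z. tinst \<rho> (\<sigma> z)) \<phi>"
proof (induction \<phi> arbitrary: \<rho> \<sigma>)
  case (All x \<phi>)
  define v where "v = (e (hgt \<phi>), snd x)"
  define w where "w = (e' (hgt \<phi>), snd x)"
  have "inst e' (\<rho>(v := Var w)) (inst e (\<sigma>(x := Var v)) \<phi>)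
      = inst e' (\<lambda>z. tinst (\<rho>(v := Var w)) ((\<sigma>(x := Var v)) z)) \<phi>"
  proof (rule All.IH, intro ballI allI impI)
    fix z y h assume *: "z \<in> fv \<phi>" "y \<in> tm_vars ((\<sigma>(x := Var v)) z)" "h < hgt \<phi>"
    show "fst y \<noteq> e h"
    proof (cases "z = x")
      case True
      then show ?thesis using * injD[OF assms, of "hgt \<phi>" h] by (auto simp: v_def)
    next
      case False
      then show ?thesis using * All.prems by simp
    qed
  qed
  also have "\<dots> = inst e' ((\<lambda>z. tinst \<rho> (\<sigma> z))(x := Var w)) \<phi>"
  proof (rule inst_cong)
    fix z assume z: "z \<in> fv \<phi>"
    have "tinst (\<rho>(v := Var w)) (\<sigma> z) = tinst \<rho> (\<sigma> z)" if "z \<noteq> x"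
    proof (rule tinst_cong)
      fix y assume "y \<in> tm_vars (\<sigma> z)"
      then have "fst y \<noteq> e (hgt \<phi>)" using All.prems z that by simp
      then show "(\<rho>(v := Var w)) y = \<rho> y" by (auto simp: v_def)
    qed
    then show "tinst (\<rho>(v := Var w)) ((\<sigma>(x := Var v)) z) = ((\<lambda>z. tinst \<rho> (\<sigma> z))(x := Var w)) z"
      by simp
  qed
  finally show ?case by (simp add: Let_def hgt_inst v_def w_def)
next
  case (Imp \<phi> \<psi>)
  have "inst e' \<rho> (inst e \<sigma> \<phi>) = inst e' (\<lambda>z. tinst \<rho> (\<sigma> z)) \<phi>"
    "inst e' \<rho> (inst e \<sigma> \<psi>) = inst e' (\<lambda>z. tinst \<rho> (\<sigma> z)) \<psi>"
    by (rule Imp.IH; use Imp.prems in \<open>auto simp: less_max_iff_disj\<close>)+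
  then show ?case by simp
qed (auto simp: tinst_tinst)

subsection \<open>Alpha-equivalence with canonical variants\<close>

text \<open>In the quantifier case a renaming is an instance of the quantified formula followed by
  generalisation. It can be reversed because the new variable does not occur in
  \<open>\<phi>\<close> and the old one has no canonical index.\<close>

lemma pe_inst:
  assumes "inj e"
  shows "wf \<phi> \<Longrightarrow> \<forall>v\<in>avars \<phi>. \<forall>h<hgt \<phi>. fst v \<noteq> e h \<Longrightarrow>
    A \<turnstile> Imp \<phi> (inst e Var \<phi>) \<and> A \<turnstile> Imp (inst e Var \<phi>) \<phi>"
proof (induction \<phi>)
  case (All x \<phi>)
  define v where "v = (e (hgt \<phi>), snd x)"
  define \<phi>' where "\<phi>' = inst e Var \<phi>"
  define \<psi> where "\<psi> = inst e (Var(x := Var v)) \<phi>"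
  have ty: "snd v = snd x" by (simp add: v_def)
  have IH: "A \<turnstile> Imp \<phi> \<phi>'" "A \<turnstile> Imp \<phi>' \<phi>"
    using All.IH All.prems by (auto simp: \<phi>'_def)
  then have wf': "wf \<phi>'" using wf_proves by fastforce
  have x: "fst x \<noteq> e h" if "h \<le> hgt \<phi>" for h
    using All.prems that by (auto simp: less_Suc_eq_le)
  have v: "fst v \<noteq> e h" if "h < hgt \<phi>" for h
    using injD[OF assms, of "hgt \<phi>" h] that by (auto simp: v_def)
  have v_nin: "v \<notin> avars \<phi>"
    using All.prems(2) by (metis avars.simps(5) fst_conv hgt.simps(2) insertCI lessI v_def)
  have fv': "fv \<phi>' \<subseteq> fv \<phi>"
    using fv_inst[of e Var \<phi>] by (auto simp: \<phi>'_def)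
  have fv\<psi>: "fv \<psi> \<subseteq> insert v (fv \<phi> - {x})"
    using fv_inst[of e "Var(x := Var v)" \<phi>] by (auto simp: \<psi>_def split: if_splits)
  have 1: "\<psi> = subst x (Var v) \<phi>'"
  proof -
    have "(\<lambda>z. tm_subst x (Var v) (Var z)) = Var(x := Var v)" by auto
    then show ?thesis using x by (simp add: \<phi>'_def \<psi>_def inst_subst)
  qed
  have 2: "\<phi>' = subst v (Var x) \<psi>"
  proof -
    have "subst v (Var x) \<psi> = inst e (\<lambda>z. tm_subst v (Var x) ((Var(x := Var v)) z)) \<phi>"
      unfolding \<psi>_def by (rule inst_subst) (rule v)
    also have "\<dots> = \<phi>'"
      unfolding \<phi>'_def by (rule inst_cong) (use v_nin fv_avars[of \<phi>] in auto)
    finally show ?thesis by simp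
  qed
  have wf\<psi>: "wf \<psi>"
    using wf' ty by (simp add: 1 wf_subst)
  have "A \<turnstile> Imp (All x \<phi>') \<psi>"
    unfolding 1 by (rule proves_inst) (use wf' ty v in \<open>auto simp: \<phi>'_def intro!: free_for_inst\<close>)
  then have 3: "A \<turnstile> Imp (All x \<phi>') (All v \<psi>)"
    by (rule proves_Imp_All) (use v_nin fv' fv_avars[of \<phi>] in auto)
  have "free_for (Var x) v \<psi>"
    unfolding \<psi>_def by (rule free_for_inst) (use x in auto)
  then have "A \<turnstile> Imp (All v \<psi>) \<phi>'"
    unfolding 2 by (intro proves_inst) (use wf\<psi> ty in auto)
  then have 4: "A \<turnstile> Imp (All v \<psi>) (All x \<phi>')"
    by (rule proves_Imp_All) (use fv\<psi> in auto)
  have "inst e Var (All x \<phi>) = All v \<psi>"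
    by (simp add: Let_def v_def \<psi>_def)
  then show ?case
    using proves_trans[OF proves_All_mono[OF IH(1)] 3] proves_trans[OF 4 proves_All_mono[OF IH(2)]] by simp
next
  case (Imp \<phi> \<psi>)
  then have "A \<turnstile> Imp \<phi> (inst e Var \<phi>)" "A \<turnstile> Imp (inst e Var \<phi>) \<phi>"
    "A \<turnstile> Imp \<psi> (inst e Var \<psi>)" "A \<turnstile> Imp (inst e Var \<psi>) \<psi>"
    by auto
  then show ?case by (simp add: proves_Imp_mono)
qed (auto simp: tinst_Var intro!: pv_empty pv_refl)

text \<open>Renaming first to odd indices beyond those of \<open>\<phi>\<close> makes room for the even ones.\<close>

lemma pe_sentence:
  assumes "wf \<phi>" "fv \<phi> = {}"
  shows "A \<turnstile> Imp \<phi> (inst (\<lambda>h. 2 * h) \<rho> \<phi>)" "A \<turnstile> Imp (inst (\<lambda>h. 2 * h) \<rho> \<phi>) \<phi>"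
proof -
  obtain K where K: "\<forall>v\<in>avars \<phi>. fst v < K"
    using finite_nat_set_iff_bounded[of "fst ` avars \<phi>"] finite_avars[of \<phi>] by auto
  define e where "e = (\<lambda>h::nat. Suc (2 * (K + h)))"
  have e: "inj e" by (auto simp: inj_def e_def)
  define \<psi> where "\<psi> = inst e Var \<phi>"
  have "\<forall>v\<in>avars \<phi>. \<forall>h<hgt \<phi>. fst v \<noteq> e h"
    using K by (fastforce simp: e_def)
  note 1 = pe_inst[OF e assms(1) this, of A, folded \<psi>_def]
  have "\<forall>v\<in>avars \<psi>. \<exists>h. fst v = e h"
    using avars_inst[of _ e Var \<phi>] assms(2) by (fastforce simp: \<psi>_def)
  moreover have "e h \<noteq> 2 * k" for h k unfolding e_def by presburger
  ultimately have "\<forall>v\<in>avars \<psi>. \<forall>h<hgt \<psi>. fst v \<noteq> 2 * h"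
    by metis
  moreover have "wf \<psi>" using 1 wf_proves by fastforce
  ultimately have 2: "A \<turnstile> Imp \<psi> (inst (\<lambda>h. 2 * h) Var \<psi>)" "A \<turnstile> Imp (inst (\<lambda>h. 2 * h) Var \<psi>) \<psi>"
    using pe_inst[of "\<lambda>h::nat. 2 * h" \<psi> A] by (auto simp: inj_def)
  have "inst (\<lambda>h. 2 * h) Var \<psi> = inst (\<lambda>h. 2 * h) (\<lambda>z. tinst Var (Var z)) \<phi>"
    unfolding \<psi>_def by (rule inst_inst[OF e]) (simp add: assms)
  also have "\<dots> = inst (\<lambda>h. 2 * h) \<rho> \<phi>"
    by (rule inst_cong) (simp add: assms)
  finally have "inst (\<lambda>h. 2 * h) Var \<psi> = inst (\<lambda>h. 2 * h) \<rho> \<phi>" .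
  then show "A \<turnstile> Imp \<phi> (inst (\<lambda>h. 2 * h) \<rho> \<phi>)" "A \<turnstile> Imp (inst (\<lambda>h. 2 * h) \<rho> \<phi>) \<phi>"
    using 1 2 proves_trans by metis+
qed

subsection \<open>Henkin sets\<close>

definition con :: "fm set \<Rightarrow> fm set \<Rightarrow> bool" where
  "con A T \<longleftrightarrow> \<not> pv A T Falsum"

lemma Lindenbaum:
  assumes "con A T"
  obtains M where "T \<subseteq> M" "con A M" "\<And>\<phi>. wf \<phi> \<Longrightarrow> \<phi> \<in> M \<or> Neg \<phi> \<in> M"
proof -
  define \<A> where "\<A> = {M. T \<subseteq> M \<and> con A M}"
  have "\<exists>M\<in>\<A>. \<forall>X\<in>\<A>. M \<subseteq> X \<longrightarrow> X = M"
  proof (rule subset_Zorn_nonempty)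
    show "\<A> \<noteq> {}" using assms unfolding \<A>_def by blast
    fix \<C> assume C: "\<C> \<noteq> {}" "subset.chain \<A> \<C>"
    have "con A (\<Union>\<C>)"
      unfolding con_def
    proof
      assume "pv A (\<Union>\<C>) Falsum"
      from pv_compact[OF this] obtain F where F: "finite F" "F \<subseteq> \<Union>\<C>" "pv A F Falsum" by blast
      obtain X where "X \<in> \<C>" "F \<subseteq> X"
        using finite_subset_Union_chain[OF F(1,2) C] by blast
      moreover have "X \<in> \<A>" using C(2) \<open>X \<in> \<C>\<close> unfolding subset.chain_def by blast
      ultimately show False using pv_mono[OF F(3)] unfolding \<A>_def con_def by blast
    qed
    moreover obtain X where "X \<in> \<C>" "X \<in> \<A>" using C unfolding subset.chain_def by blast
    ultimately show "\<Union>\<C> \<in> \<A>" unfolding \<A>_def by blast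
  qed
  then obtain M where M': "M \<in> \<A>" "\<forall>X\<in>\<A>. M \<subseteq> X \<longrightarrow> X = M" by (rule bexE)
  have M: "T \<subseteq> M" "con A M" using M'(1) unfolding \<A>_def by simp_all
  have max: "X = M" if "M \<subseteq> X" "con A X" for X
  proof -
    have "X \<in> \<A>" using subset_trans[OF M(1) that(1)] that(2) unfolding \<A>_def by simp
    then show ?thesis using M'(2) that(1) by simp
  qed
  have "\<phi> \<in> M \<or> Neg \<phi> \<in> M" if w: "wf \<phi>" for \<phi>
  proof (rule ccontr)
    assume *: "\<not> (\<phi> \<in> M \<or> Neg \<phi> \<in> M)"
    then have "pv A (insert \<phi> M) Falsum" "pv A (insert (Neg \<phi>) M) Falsum"
      using max[of "insert \<phi> M"] max[of "insert (Neg \<phi>) M"] by (auto simp: con_def)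
    then have "pv A M (Neg \<phi>)" "pv A M \<phi>"
      using w by (auto intro: pv_deduction pv_contra)
    then have "pv A M Falsum" by (rule pv.mp)
    then show False using M(2) unfolding con_def by blast
  qed
  then show ?thesis by (rule that[OF M])
qed

text \<open>Witness variables get odd indices because the canonical bound variables of
  \<open>inst (\<lambda>h. 2 * h)\<close> have even ones; terms built from witnesses can then be
  substituted everywhere without capture.\<close>

definition fresh :: "var set \<Rightarrow> nat" where
  "fresh V = (SOME i. odd i \<and> (\<forall>\<tau>. (i, \<tau>) \<notin> V))"

lemma fresh:
  assumes "finite V"
  shows "odd (fresh V)" "(fresh V, \<tau>) \<notin> V"
proof -
  obtain K where K: "\<forall>v\<in>V. fst v < K"
    using finite_nat_set_iff_bounded[of "fst ` V"] assms by auto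
  then have "odd (2 * K + 1) \<and> (\<forall>\<tau>. (2 * K + 1, \<tau>) \<notin> V)" by fastforce
  from someI[of "\<lambda>i. odd i \<and> (\<forall>\<tau>. (i, \<tau>) \<notin> V)", OF this]
  show "odd (fresh V)" "(fresh V, \<tau>) \<notin> V" by (auto simp: fresh_def)
qed

definition hvar :: "var \<Rightarrow> fm \<Rightarrow> fm set \<Rightarrow> var" where
  "hvar x \<phi> \<Gamma> = (fresh (insert x (avars \<phi> \<union> \<Union>(avars ` \<Gamma>))), snd x)"

fun hstep :: "fm \<Rightarrow> fm set \<Rightarrow> fm set" where
  "hstep (All x \<phi>) \<Gamma> = (if wf \<phi> then insert (Imp (subst x (Var (hvar x \<phi> \<Gamma>)) \<phi>) (All x \<phi>)) \<Gamma> else \<Gamma>)"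
| "hstep _ \<Gamma> = \<Gamma>"

text \<open>Every universal formula is treated at the stage given by its code, when the set is still
  finite and a fresh variable is available.\<close>

primrec henkin :: "fm \<Rightarrow> nat \<Rightarrow> fm set" where
  "henkin \<phi> 0 = {Neg \<phi>}"
| "henkin \<phi> (Suc n) = hstep (from_nat n) (henkin \<phi> n)"

lemma tm_subst_inv: "y \<notin> tm_vars t \<Longrightarrow> tm_subst y (Var x) (tm_subst x (Var y) t) = t"
  by (induction t) auto

lemma subst_inv: "y \<notin> avars \<phi> \<Longrightarrow> subst y (Var x) (subst x (Var y) \<phi>) = \<phi>"
proof (induction \<phi>)
  case (All z \<phi>)
  have "subst y (Var x) \<phi> = \<phi>"
  proof -
    have "tm_subst y s t = t" if "y \<notin> tm_vars t" for s t using that by (induction t) auto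
    then have "subst y s \<chi> = \<chi>" if "y \<notin> avars \<chi>" for s \<chi> using that by (induction \<chi>) auto
    then show ?thesis using All.prems by simp
  qed
  then show ?case using All by auto
qed (auto simp: tm_subst_inv)

lemma free_for_subst: "y \<notin> avars \<phi> \<Longrightarrow> free_for (Var x) y (subst x (Var y) \<phi>)"
proof (induction \<phi>)
  case (All z \<phi>)
  then show ?case using fv_avars[of \<phi>] by auto
qed auto

lemma fv_subst: "fv (subst x (Var y) \<phi>) \<subseteq> insert y (fv \<phi> - {x})"
proof (induction \<phi>)
  have *: "tm_vars (tm_subst x (Var y) t) \<subseteq> insert y (tm_vars t - {x})" for t
    by (induction t) auto
  {
    case (Eq t u)
    then show ?case using *[of t] *[of u] by auto
  next
    case (Less t u)
    then show ?case using *[of t] *[of u] by auto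
  }
qed auto

lemma pv_GEN: "pv A T \<phi> \<Longrightarrow> \<forall>\<psi>\<in>T. x \<notin> fv \<psi> \<Longrightarrow> pv A T (All x \<phi>)"
proof (induction rule: pv.induct)
  case (ax \<phi>)
  then show ?case by (auto intro: pv.ax proves_GEN)
next
  case (asm \<phi>)
  have "A \<turnstile> Imp \<phi> (All x \<phi>)" by (rule proves_vacuous) (use asm in auto)
  from pv.mp[OF pv.ax[OF this] pv.asm[OF asm(1,2)]] show ?case .
next
  case (mp \<phi> \<psi>)
  then have "wf \<phi>" "wf \<psi>" using wf_pv by fastforce+
  note d = pv.ax[OF proves_distrib[OF this]]
  show ?case by (rule pv.mp[OF pv.mp[OF d]]) (use mp in auto)
qed

text \<open>If the new implication were refutable, \<open>\<Gamma>\<close> would prove its premise,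
  whose variable is fresh; generalisation would then give the conclusion, and hence the implication
  itself.\<close>

lemma con_hstep:
  assumes "finite \<Gamma>" "con A \<Gamma>"
  shows "con A (hstep \<psi> \<Gamma>)"
proof (cases "\<exists>x \<phi>. \<psi> = All x \<phi> \<and> wf \<phi>")
  case True
  then obtain x \<phi> where \<psi>: "\<psi> = All x \<phi>" "wf \<phi>" by blast
  define y where "y = hvar x \<phi> \<Gamma>"
  have fin: "finite (insert x (avars \<phi> \<union> \<Union>(avars ` \<Gamma>)))"
    using assms finite_avars by auto
  have y: "y \<noteq> x" "y \<notin> avars \<phi>" "\<And>\<chi>. \<chi> \<in> \<Gamma> \<Longrightarrow> y \<notin> avars \<chi>" "snd y = snd x"
    using fresh(2)[OF fin, of "snd x"] by (auto simp: y_def hvar_def)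
  let ?s = "subst x (Var y) \<phi>"
  have ws: "wf ?s" using \<psi> y by (auto intro: wf_subst)
  show ?thesis
    unfolding con_def
  proof
    assume "pv A (hstep \<psi> \<Gamma>) Falsum"
    then have *: "pv A \<Gamma> (Neg (Imp ?s (All x \<phi>)))"
      using \<psi> ws by (auto simp: y_def intro: pv_deduction)
    have "pv A \<Gamma> ?s"
    proof (rule pv_contra[OF _ ws])
      have "pv A (insert ?s (insert (Neg ?s) \<Gamma>)) (All x \<phi>)"
        by (rule pv_Falsum, rule pv.mp[of _ _ ?s]; (rule pv.asm)?) (use \<psi> ws in auto)
      then have "pv A (insert (Neg ?s) \<Gamma>) (Imp ?s (All x \<phi>))"
        using ws by (rule pv_deduction)
      then show "pv A (insert (Neg ?s) \<Gamma>) Falsum"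
        by (rule pv.mp[OF pv_mono[OF *], rotated]) auto
    qed
    then have 1: "pv A \<Gamma> (All y ?s)"
      by (rule pv_GEN) (use y fv_avars in blast)
    have "A \<turnstile> Imp (All y ?s) \<phi>"
      using proves_inst[of y ?s "Var x" A] ws y by (simp add: subst_inv free_for_subst)
    then have "A \<turnstile> Imp (All y ?s) (All x \<phi>)"
      by (rule proves_Imp_All) (use fv_subst[of x y \<phi>] in auto)
    from pv.mp[OF pv.ax[OF this] 1] have "pv A \<Gamma> (All x \<phi>)" .
    then have "pv A \<Gamma> (Imp ?s (All x \<phi>))" using ws by (rule pv_K)
    from pv.mp[OF * this] show False using assms unfolding con_def by simp
  qed
next
  case False
  then have "hstep \<psi> \<Gamma> = \<Gamma>" by (cases \<psi>) auto
  then show ?thesis using assms by simp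
qed

lemma finite_hstep: "finite \<Gamma> \<Longrightarrow> finite (hstep \<psi> \<Gamma>)"
  by (cases \<psi>) auto

lemma hstep_mono: "\<Gamma> \<subseteq> hstep \<psi> \<Gamma>"
  by (cases \<psi>) auto

lemma finite_henkin: "finite (henkin \<phi> n)"
  by (induction n) (auto intro: finite_hstep)

lemma con_henkin: "con A {Neg \<phi>} \<Longrightarrow> con A (henkin \<phi> n)"
  by (induction n) (auto intro: con_hstep finite_henkin)

lemma henkin_mono: "m \<le> n \<Longrightarrow> henkin \<phi> m \<subseteq> henkin \<phi> n"
  by (rule lift_Suc_mono_le[of "henkin \<phi>"]) (auto intro: subsetD[OF hstep_mono])

locale henkin_theory =
  fixes A T :: "fm set"
  assumes con: "con A T"
    and complete: "\<And>\<phi>. wf \<phi> \<Longrightarrow> \<phi> \<in> T \<or> Neg \<phi> \<in> T"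
    and witness: "\<And>x \<phi>. wf \<phi> \<Longrightarrow> All x \<phi> \<notin> T \<Longrightarrow>
      \<exists>y. odd (fst y) \<and> snd y = snd x \<and> subst x (Var y) \<phi> \<notin> T"
begin

lemma not_both: "pv A T (Neg \<phi>) \<Longrightarrow> \<not> pv A T \<phi>"
  using con pv.mp unfolding con_def by metis

lemma closed:
  assumes "pv A T \<phi>"
  shows "\<phi> \<in> T"
proof (rule ccontr)
  assume "\<phi> \<notin> T"
  then have "Neg \<phi> \<in> T" using complete[OF wf_pv[OF assms]] by simp
  then have "pv A T (Neg \<phi>)" by (rule pv.asm) (simp add: wf_pv[OF assms])
  with assms not_both show False by simp
qed

lemma in_Neg: "wf \<phi> \<Longrightarrow> Neg \<phi> \<in> T \<longleftrightarrow> \<phi> \<notin> T"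
  using complete[of \<phi>] not_both[of \<phi>] pv.asm[of \<phi> T A] pv.asm[of "Neg \<phi>" T A] by auto

lemma in_Imp: "wf \<phi> \<Longrightarrow> wf \<psi> \<Longrightarrow> Imp \<phi> \<psi> \<in> T \<longleftrightarrow> (\<phi> \<in> T \<longrightarrow> \<psi> \<in> T)"
proof (intro iffI impI)
  assume *: "wf \<phi>" "wf \<psi>"
  show "\<psi> \<in> T" if "Imp \<phi> \<psi> \<in> T" "\<phi> \<in> T"
    using pv.mp[OF pv.asm[OF that(1), of A] pv.asm[OF that(2), of A]] closed * by auto
  show "Imp \<phi> \<psi> \<in> T" if "\<phi> \<in> T \<longrightarrow> \<psi> \<in> T"
  proof (cases "\<phi> \<in> T")
    case True
    then have "pv A T \<psi>" by (intro pv.asm) (use that * in auto)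
    then show ?thesis by (rule closed[OF pv_K]) (use * in simp)
  next
    case False
    then have "pv A T (Neg \<phi>)" using * in_Neg by (intro pv.asm) auto
    then have "pv A (insert \<phi> T) Falsum"
      by (rule pv.mp[OF pv_mono pv.asm]) (use * in auto)
    then show ?thesis by (rule closed[OF pv_deduction[OF pv_Falsum]]) (use * in auto)
  qed
qed

lemma in_All:
  assumes "wf \<phi>" "All x \<phi> \<in> T" "ty_of t = Some (snd x)" "free_for t x \<phi>"
  shows "subst x t \<phi> \<in> T"
  by (rule closed, rule pv.mp[OF pv.ax[OF proves_inst] pv.asm]) (use assms in auto)

lemma in_iff: "A \<turnstile> Imp \<phi> \<psi> \<Longrightarrow> A \<turnstile> Imp \<psi> \<phi> \<Longrightarrow> \<phi> \<in> T \<longleftrightarrow> \<psi> \<in> T"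
  using in_Imp closed pv.ax wf_proves by (metis wf.simps(4))

end

text \<open>The Henkin implications are added before the maximal extension is taken and remain in
  it: if a universal formula is outside the extension, so is its witness instance.\<close>

lemma henkin_theory_exists:
  assumes "wf \<phi>" "\<not> A \<turnstile> \<phi>"
  obtains T where "henkin_theory A T" "\<phi> \<notin> T"
proof -
  have "con A {Neg \<phi>}"
    unfolding con_def using assms pv_contra[of A \<phi> "{}"] pv_empty by auto
  then have conn: "con A (henkin \<phi> n)" for n by (rule con_henkin)
  have "con A (\<Union>n. henkin \<phi> n)"
    unfolding con_def
  proof
    assume "pv A (\<Union>n. henkin \<phi> n) Falsum"
    from pv_compact[OF this] obtain F where F: "finite F" "F \<subseteq> (\<Union>n. henkin \<phi> n)" "pv A F Falsum" by blast
    have "\<exists>n. F \<subseteq> henkin \<phi> n"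
      using F(1,2)
    proof (induction F)
      case (insert \<psi> F)
      then obtain m n where "F \<subseteq> henkin \<phi> m" "\<psi> \<in> henkin \<phi> n" by auto
      then have "insert \<psi> F \<subseteq> henkin \<phi> (max m n)"
        using henkin_mono[of m "max m n" \<phi>] henkin_mono[of n "max m n" \<phi>] by auto
      then show ?case by blast
    qed auto
    then obtain n where "F \<subseteq> henkin \<phi> n" by blast
    from pv_mono[OF F(3) this] show False using conn[of n] unfolding con_def by simp
  qed
  from Lindenbaum[OF this] obtain T where T: "(\<Union>n. henkin \<phi> n) \<subseteq> T" "con A T"
    "\<And>\<phi>. wf \<phi> \<Longrightarrow> \<phi> \<in> T \<or> Neg \<phi> \<in> T" by blast
  have mp: "\<chi> \<in> T" if "Imp \<psi> \<chi> \<in> T" "\<psi> \<in> T" "wf \<psi>" "wf \<chi>" for \<psi> \<chi>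
  proof (rule ccontr)
    assume "\<chi> \<notin> T"
    then have "pv A T (Neg \<chi>)" using T(3)[of \<chi>] that by (intro pv.asm) auto
    moreover have "pv A T \<chi>"
      by (rule pv.mp[OF pv.asm pv.asm]) (use that in auto)
    ultimately have "pv A T Falsum" by (rule pv.mp)
    then show False using T(2) unfolding con_def by simp
  qed
  have "henkin_theory A T"
  proof
    fix x \<psi> assume \<psi>: "wf \<psi>" "All x \<psi> \<notin> T"
    define n where "n = to_nat (All x \<psi>)"
    define y where "y = hvar x \<psi> (henkin \<phi> n)"
    have "finite (insert x (avars \<psi> \<union> \<Union>(avars ` henkin \<phi> n)))"
      using finite_avars finite_henkin by auto
    from fresh(1)[OF this] have y: "odd (fst y)" "snd y = snd x" by (auto simp: y_def hvar_def)
    have "Imp (subst x (Var y) \<psi>) (All x \<psi>) \<in> henkin \<phi> (Suc n)"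
      using \<psi> by (simp add: n_def y_def)
    then have "Imp (subst x (Var y) \<psi>) (All x \<psi>) \<in> T" using T(1) by blast
    moreover have "wf (subst x (Var y) \<psi>)" using \<psi> y by (simp add: wf_subst)
    ultimately have "subst x (Var y) \<psi> \<notin> T"
      using \<psi> mp[of "subst x (Var y) \<psi>" "All x \<psi>"] by auto
    then show "\<exists>y. odd (fst y) \<and> snd y = snd x \<and> subst x (Var y) \<psi> \<notin> T" using y by blast
  qed (use T in auto)
  moreover have "Neg \<phi> \<in> T" using T(1) UN_upper[of 0 UNIV "henkin \<phi>"] by auto
  then have "\<phi> \<notin> T" using henkin_theory.in_Neg[OF calculation] assms by simp
  ultimately show ?thesis using that by blast
qed

subsection \<open>Structures and the term model\<close>

record 'm str =
  dom :: "ty \<Rightarrow> 'm set"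
  ap :: "'m \<Rightarrow> 'm \<Rightarrow> 'm"
  cs :: "cst \<Rightarrow> 'm"
  eqr :: "'m \<Rightarrow> 'm \<Rightarrow> bool"
  ltr :: "'m \<Rightarrow> 'm \<Rightarrow> bool"

fun val :: "'m str \<Rightarrow> (var \<Rightarrow> 'm) \<Rightarrow> tm \<Rightarrow> 'm" where
  "val S \<rho> (Var x) = \<rho> x"
| "val S \<rho> (Con c) = cs S c"
| "val S \<rho> (t \<cdot> u) = ap S (val S \<rho> t) (val S \<rho> u)"

fun sat :: "'m str \<Rightarrow> (var \<Rightarrow> 'm) \<Rightarrow> fm \<Rightarrow> bool" where
  "sat S \<rho> (Eq t u) \<longleftrightarrow> eqr S (val S \<rho> t) (val S \<rho> u)"
| "sat S \<rho> (Less t u) \<longleftrightarrow> ltr S (val S \<rho> t) (val S \<rho> u)"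
| "sat S \<rho> Falsum \<longleftrightarrow> False"
| "sat S \<rho> (Imp \<phi> \<psi>) \<longleftrightarrow> (sat S \<rho> \<phi> \<longrightarrow> sat S \<rho> \<psi>)"
| "sat S \<rho> (All x \<phi>) \<longleftrightarrow> (\<forall>a\<in>dom S (snd x). sat S (\<rho>(x := a)) \<phi>)"

definition env :: "'m str \<Rightarrow> (var \<Rightarrow> 'm) set" where
  "env S = {\<rho>. \<forall>x. \<rho> x \<in> dom S (snd x)}"

lemma env_D: "\<rho> \<in> env S \<Longrightarrow> \<rho> x \<in> dom S (snd x)"
  unfolding env_def by blast

lemma env_upd: "\<rho> \<in> env S \<Longrightarrow> a \<in> dom S (snd x) \<Longrightarrow> \<rho>(x := a) \<in> env S"
  by (auto simp: env_def)

fun eqx :: "'m str \<Rightarrow> ty \<Rightarrow> 'm \<Rightarrow> 'm \<Rightarrow> bool" where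
  "eqx S N a b \<longleftrightarrow> eqr S a b"
| "eqx S (\<sigma> \<rightarrow>\<^sub>t \<tau>) a b \<longleftrightarrow> (\<forall>c\<in>dom S \<sigma>. eqx S \<tau> (ap S a c) (ap S b c))"

lemma val_upd: "x \<notin> tm_vars t \<Longrightarrow> val S (\<rho>(x := a)) t = val S \<rho> t"
  by (induction t) auto

lemma sat_eq_ty:
  "\<forall>v\<in>tm_vars t \<union> tm_vars u. fst v < d \<Longrightarrow>
    sat S \<rho> (eq_ty \<tau> t u d) \<longleftrightarrow> eqx S \<tau> (val S \<rho> t) (val S \<rho> u)"
proof (induction \<tau> arbitrary: t u d \<rho>)
  case N
  then show ?case by (simp add: eq_s_def)
next
  case (Fun \<sigma> \<tau>)
  have "(d, \<sigma>) \<notin> tm_vars t" "(d, \<sigma>) \<notin> tm_vars u" using Fun.prems by (metis UnCI fst_conv less_irrefl)+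
  moreover have "\<forall>v\<in>tm_vars t \<union> tm_vars u. fst v < Suc d"
    using Fun.prems less_SucI by blast
  then have "\<forall>v\<in>tm_vars (t \<cdot> Var (d, \<sigma>)) \<union> tm_vars (u \<cdot> Var (d, \<sigma>)). fst v < Suc d"
    by (simp add: ball_Un)
  ultimately show ?case
    using Fun.IH(2) by (simp add: all_ty_def val_upd fun_upd_same del: fun_upd_apply)
qed

context henkin_theory
begin

definition TM :: "tm str" where
  "TM = \<lparr>dom = (\<lambda>\<tau>. {t. ty_of t = Some \<tau> \<and> (\<forall>y\<in>tm_vars t. odd (fst y))}), ap = App, cs = Con,
    eqr = (\<lambda>t u. Eq t u \<in> T), ltr = (\<lambda>t u. Less t u \<in> T)\<rparr>"

lemma ap_TM: "ap TM = App"
  by (simp add: TM_def)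

lemma eqr_TM: "eqr TM t u \<longleftrightarrow> Eq t u \<in> T"
  by (simp add: TM_def)

lemma ltr_TM: "ltr TM t u \<longleftrightarrow> Less t u \<in> T"
  by (simp add: TM_def)

lemma val_TM: "val TM \<rho> t = tinst \<rho> t"
  by (induction t) (auto simp: TM_def)

text \<open>Induction on the formula. For a quantifier, \<open>witness\<close> supplies a
  counterexample among the elements of the model, and conversely every element may be substituted
  because the canonical bound indices are even.\<close>

lemma truth: "\<rho> \<in> env TM \<Longrightarrow> wf \<phi> \<Longrightarrow> sat TM \<rho> \<phi> \<longleftrightarrow> inst (\<lambda>h. 2 * h) \<rho> \<phi> \<in> T"
proof (induction \<phi> arbitrary: \<rho>)
  case (Imp \<phi> \<psi>)
  have "ty_of (\<rho> z) = Some (snd z)" for z using Imp.prems(1) by (simp add: env_def TM_def del: split_paired_All)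
  with Imp show ?case by (simp add: in_Imp wf_inst)
next
  case (All x \<phi>)
  define v where "v = (2 * hgt \<phi>, snd x)"
  define \<psi> where "\<psi> = inst (\<lambda>h. 2 * h) (\<rho>(x := Var v)) \<phi>"
  have \<rho>: "ty_of (\<rho> z) = Some (snd z)" "\<And>y. y \<in> tm_vars (\<rho> z) \<Longrightarrow> odd (fst y)" for z
    using All.prems(1) by (simp_all add: env_def TM_def del: split_paired_All)
  have wf\<psi>: "wf \<psi>" unfolding \<psi>_def
    by (subst wf_inst) (use All.prems \<rho> in \<open>auto simp: v_def\<close>)
  have sub: "subst v t \<psi> = inst (\<lambda>h. 2 * h) (\<rho>(x := t)) \<phi>" for t
  proof -
    have "subst v t \<psi> = inst (\<lambda>h. 2 * h) (\<lambda>z. tm_subst v t ((\<rho>(x := Var v)) z)) \<phi>"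
      unfolding \<psi>_def by (rule inst_subst) (auto simp: v_def)
    also have "(\<lambda>z. tm_subst v t ((\<rho>(x := Var v)) z)) = \<rho>(x := t)"
    proof
      fix z
      have "v \<notin> tm_vars (\<rho> z)" using \<rho>(2)[of v z] by (auto simp: v_def)
      moreover have "tm_subst v t s = s" if "v \<notin> tm_vars s" for s using that by (induction s) auto
      ultimately show "tm_subst v t ((\<rho>(x := Var v)) z) = (\<rho>(x := t)) z" by auto
    qed
    finally show ?thesis .
  qed
  have IH: "sat TM (\<rho>(x := t)) \<phi> \<longleftrightarrow> subst v t \<psi> \<in> T" if "t \<in> dom TM (snd x)" for t
    unfolding sub by (rule All.IH[OF env_upd]) (use All.prems that in auto)
  have "sat TM \<rho> (All x \<phi>) \<longleftrightarrow> (\<forall>t\<in>dom TM (snd x). subst v t \<psi> \<in> T)"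
    using IH by simp
  also have "\<dots> \<longleftrightarrow> All v \<psi> \<in> T"
  proof
    assume *: "\<forall>t\<in>dom TM (snd x). subst v t \<psi> \<in> T"
    show "All v \<psi> \<in> T"
    proof (rule ccontr)
      assume "All v \<psi> \<notin> T"
      then obtain y where "odd (fst y)" "snd y = snd v" "subst v (Var y) \<psi> \<notin> T"
        using witness wf\<psi> by blast
      then show False using * by (auto simp: TM_def v_def)
    qed
  next
    assume *: "All v \<psi> \<in> T"
    show "\<forall>t\<in>dom TM (snd x). subst v t \<psi> \<in> T"
    proof
      fix t assume t: "t \<in> dom TM (snd x)"
      have "free_for t v \<psi>"
        unfolding \<psi>_def by (rule free_for_inst) (use t in \<open>auto simp: TM_def\<close>)
      then show "subst v t \<psi> \<in> T"
        using in_All[OF wf\<psi> *] t by (auto simp: TM_def v_def)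
    qed
  qed
  finally show ?case by (simp add: Let_def v_def \<psi>_def)
next
  case Falsum
  have "Falsum \<notin> T" using con pv.asm[of Falsum T A] unfolding con_def by auto
  then show ?case by simp
qed (auto simp: val_TM eqr_TM ltr_TM)

lemma sat_sentence:
  assumes "wf \<phi>" "fv \<phi> = {}" "\<rho> \<in> env TM"
  shows "sat TM \<rho> \<phi> \<longleftrightarrow> \<phi> \<in> T"
  using truth[OF assms(3,1)] in_iff pe_sentence[OF assms(1,2)] by blast

end

subsection \<open>The extensional quotient\<close>

text \<open>Truth is demanded of closed theorems; axioms with parameters are used through their
  universal closures. Nonemptiness of \<open>env\<close> says that every type is inhabited, and
  equality of type 0 is genuine equality, so that HOL rewriting applies.\<close>

definition is_model :: "fm set \<Rightarrow> 'm str \<Rightarrow> bool" where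
  "is_model A S \<longleftrightarrow>
    (\<forall>a b. eqr S a b \<longleftrightarrow> a = b) \<and>
    (\<forall>c. cs S c \<in> dom S (cst_ty c)) \<and>
    (\<forall>\<sigma> \<tau>. \<forall>f\<in>dom S (\<sigma> \<rightarrow>\<^sub>t \<tau>). \<forall>a\<in>dom S \<sigma>. ap S f a \<in> dom S \<tau>) \<and>
    (\<forall>\<sigma> \<tau>. \<forall>f\<in>dom S (\<sigma> \<rightarrow>\<^sub>t \<tau>). \<forall>g\<in>dom S (\<sigma> \<rightarrow>\<^sub>t \<tau>). (\<forall>a\<in>dom S \<sigma>. ap S f a = ap S g a) \<longrightarrow> f = g) \<and>
    env S \<noteq> {} \<and>
    (\<forall>\<phi>. A \<turnstile> \<phi> \<longrightarrow> fv \<phi> = {} \<longrightarrow> (\<forall>\<rho>\<in>env S. sat S \<rho> \<phi>))"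

lemma fv_eq_ty: "fv (eq_ty \<tau> t u d) \<subseteq> tm_vars t \<union> tm_vars u"
proof (induction \<tau> arbitrary: t u d)
  case N
  then show ?case by (simp add: eq_s_def)
next
  case (Fun \<sigma> \<tau>)
  show ?case using Fun.IH(2)[of "t \<cdot> Var (d, \<sigma>)" "u \<cdot> Var (d, \<sigma>)" "Suc d"]
    by (auto simp: all_ty_def)
qed

lemma fv_ext_axiom: "fv (ext_axiom \<rho> \<tau> 0) = {}"
  using fv_eq_ty[of \<rho> "Var (0, \<rho>)" "Var (1, \<rho>)" 3]
    fv_eq_ty[of \<tau> "Var (2, \<rho> \<rightarrow>\<^sub>t \<tau>) \<cdot> Var (0, \<rho>)" "Var (2, \<rho> \<rightarrow>\<^sub>t \<tau>) \<cdot> Var (1, \<rho>)" 3]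
  by (auto simp: ext_axiom_def all_ty_def imp_s_def numeral_eq_Suc)

locale ext_henkin_theory = henkin_theory +
  assumes ext: "A \<turnstile> ext_axiom \<rho> \<tau> 0"
begin

abbreviation "Tm \<equiv> dom TM"
abbreviation "rel \<equiv> eqx TM"

lemma Tm_App: "f \<in> Tm (\<sigma> \<rightarrow>\<^sub>t \<tau>) \<Longrightarrow> t \<in> Tm \<sigma> \<Longrightarrow> f \<cdot> t \<in> Tm \<tau>"
  by (auto simp: TM_def)

text \<open>Index 0 is even, so \<open>(0, N)\<close> never occurs in an element of the term model
  and can mark the position of a replacement.\<close>

lemma Tm_subst: "t \<in> Tm \<tau> \<Longrightarrow> tm_subst (0, N) s t = t"
proof -
  have "tm_subst x s t = t" if "x \<notin> tm_vars t" for x using that by (induction t) auto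
  moreover assume "t \<in> Tm \<tau>"
  ultimately show ?thesis by (force simp: TM_def)
qed

lemma Leibniz:
  assumes "t \<in> Tm N" "u \<in> Tm N" "rel N t u" "wf \<phi>" "qfree \<phi>" "subst (0, N) t \<phi> \<in> T"
  shows "subst (0, N) u \<phi> \<in> T"
proof (rule closed)
  have "free_for s x \<phi>" for s x using assms(5) by (induction \<phi>) auto
  then have "A \<turnstile> Imp (Eq t u) (Imp (subst (0, N) t \<phi>) (subst (0, N) u \<phi>))"
    using assms by (intro proves_Leibniz) (auto simp: TM_def)
  from pv.mp[OF pv.mp[OF pv.ax[OF this] pv.asm] pv.asm] show "pv A T (subst (0, N) u \<phi>)"
    using assms by (auto simp: TM_def wf_subst)
qed

lemma rel_refl: "t \<in> Tm \<tau> \<Longrightarrow> rel \<tau> t t"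
proof (induction \<tau> arbitrary: t)
  case N
  then have "Eq t t \<in> T" by (intro closed pv.ax) (auto simp: TM_def proves_def intro: deriv.Refl)
  then show ?case by (simp add: TM_def)
next
  case (Fun \<sigma> \<tau>)
  then show ?case using Tm_App by (simp add: ap_TM)
qed

lemma rel_sym: "t \<in> Tm \<tau> \<Longrightarrow> u \<in> Tm \<tau> \<Longrightarrow> rel \<tau> t u \<Longrightarrow> rel \<tau> u t"
proof (induction \<tau> arbitrary: t u)
  case N
  then have "Eq t t \<in> T" using rel_refl[of t N] by (simp add: TM_def)
  then have "subst (0, N) u (Eq (Var (0, N)) t) \<in> T"
    using N by (intro Leibniz[of t u]) (auto simp: Tm_subst, auto simp: TM_def)
  then show ?case using N by (simp add: Tm_subst) (simp add: TM_def)
next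
  case (Fun \<sigma> \<tau>)
  have "rel \<tau> (ap TM u c) (ap TM t c)" if "c \<in> Tm \<sigma>" for c
    using Fun.IH(2)[of "ap TM t c" "ap TM u c"] Fun.prems that Tm_App[of _ \<sigma> \<tau> c]
    by (auto simp: TM_def)
  then show ?case by simp
qed

lemma rel_trans: "s \<in> Tm \<tau> \<Longrightarrow> t \<in> Tm \<tau> \<Longrightarrow> u \<in> Tm \<tau> \<Longrightarrow> rel \<tau> s t \<Longrightarrow> rel \<tau> t u \<Longrightarrow> rel \<tau> s u"
proof (induction \<tau> arbitrary: s t u)
  case N
  then have "Eq s t \<in> T" by (simp add: TM_def)
  then have "subst (0, N) u (Eq s (Var (0, N))) \<in> T"
    using N by (intro Leibniz[of t u]) (auto simp: Tm_subst, auto simp: TM_def)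
  then show ?case using N by (simp add: Tm_subst) (simp add: TM_def)
next
  case (Fun \<sigma> \<tau>)
  have "rel \<tau> (ap TM s c) (ap TM u c)" if "c \<in> Tm \<sigma>" for c
    using Fun.IH(2)[of "ap TM s c" "ap TM t c" "ap TM u c"] Fun.prems that Tm_App[of _ \<sigma> \<tau> c]
    by (auto simp: TM_def)
  then show ?case by simp
qed

lemma rel_Less:
  assumes "t \<in> Tm N" "u \<in> Tm N" "t' \<in> Tm N" "u' \<in> Tm N" "rel N t t'" "rel N u u'" "Less t u \<in> T"
  shows "Less t' u' \<in> T"
proof -
  have "subst (0, N) t' (Less (Var (0, N)) u) \<in> T"
    using assms by (intro Leibniz[of t t']) (auto simp: Tm_subst, auto simp: TM_def)
  then have "Less t' u \<in> T" using assms by (simp add: Tm_subst)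
  then have "subst (0, N) u' (Less t' (Var (0, N))) \<in> T"
    using assms by (intro Leibniz[of u u']) (auto simp: Tm_subst, auto simp: TM_def)
  then show ?thesis using assms by (simp add: Tm_subst)
qed

lemma Var_env: "(\<lambda>(i, \<tau>). Var (Suc (2 * i), \<tau>)) \<in> env TM"
  by (auto simp: env_def TM_def)

text \<open>This is the truth of the extensionality axiom in the term model; it is what makes
  \<open>rel\<close> a congruence.\<close>

lemma rel_ap:
  assumes "f \<in> Tm (\<sigma> \<rightarrow>\<^sub>t \<tau>)" "t \<in> Tm \<sigma>" "u \<in> Tm \<sigma>" "rel \<sigma> t u"
  shows "rel \<tau> (f \<cdot> t) (f \<cdot> u)"
proof -
  have "ext_axiom \<sigma> \<tau> 0 \<in> T" by (intro closed pv.ax ext)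
  then have "sat TM (\<lambda>(i, \<tau>). Var (Suc (2 * i), \<tau>)) (ext_axiom \<sigma> \<tau> 0)"
    using sat_sentence[OF wf_proves[OF ext] fv_ext_axiom Var_env] by simp
  then show ?thesis
    using assms by (simp add: ext_axiom_def all_ty_def imp_s_def sat_eq_ty ap_TM)
qed

lemma rel_App:
  assumes "f \<in> Tm (\<sigma> \<rightarrow>\<^sub>t \<tau>)" "g \<in> Tm (\<sigma> \<rightarrow>\<^sub>t \<tau>)" "t \<in> Tm \<sigma>" "u \<in> Tm \<sigma>" "rel (\<sigma> \<rightarrow>\<^sub>t \<tau>) f g" "rel \<sigma> t u"
  shows "rel \<tau> (f \<cdot> t) (g \<cdot> u)"
proof (rule rel_trans[OF _ _ _ rel_ap[OF assms(1,3,4,6)]])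
  show "rel \<tau> (f \<cdot> u) (g \<cdot> u)" using assms by (simp add: ap_TM)
qed (use assms Tm_App in blast)+

text \<open>The chosen representative depends only on the class, and its code stands for the class.
  So the quotient again consists of natural numbers, and \<open>from_nat\<close> recovers a
  representative.\<close>

definition cl :: "tm \<Rightarrow> nat" where
  "cl t = to_nat (SOME u. \<exists>\<tau>. ty_of t = Some \<tau> \<and> u \<in> Tm \<tau> \<and> rel \<tau> u t)"

definition QS :: "nat str" where
  "QS = \<lparr>dom = (\<lambda>\<tau>. cl ` Tm \<tau>), ap = (\<lambda>a b. cl (from_nat a \<cdot> from_nat b)), cs = (\<lambda>c. cl (Con c)),
    eqr = (=), ltr = (\<lambda>a b. Less (from_nat a) (from_nat b) \<in> T)\<rparr>"

lemma eqr_QS: "eqr QS a b \<longleftrightarrow> a = b"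
  by (simp add: QS_def)

lemma ltr_QS: "ltr QS a b \<longleftrightarrow> Less (from_nat a) (from_nat b) \<in> T"
  by (simp add: QS_def)

lemma ty_Tm: "t \<in> Tm \<tau> \<Longrightarrow> ty_of t = Some \<tau>"
  by (auto simp: TM_def)

lemma cl_rep:
  assumes "t \<in> Tm \<tau>"
  shows "from_nat (cl t) \<in> Tm \<tau> \<and> rel \<tau> (from_nat (cl t)) t"
proof -
  have "\<exists>u. \<exists>\<tau>. ty_of t = Some \<tau> \<and> u \<in> Tm \<tau> \<and> rel \<tau> u t"
    using assms rel_refl ty_Tm by blast
  from someI_ex[OF this] show ?thesis using ty_Tm[OF assms] by (auto simp: cl_def)
qed

lemma cl_eq:
  assumes "t \<in> Tm \<tau>" "u \<in> Tm \<tau>"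
  shows "cl t = cl u \<longleftrightarrow> rel \<tau> t u"
proof
  assume "cl t = cl u"
  then show "rel \<tau> t u"
    using cl_rep[OF assms(1)] cl_rep[OF assms(2)] assms rel_sym rel_trans by metis
next
  assume *: "rel \<tau> t u"
  have "(\<exists>\<tau>. ty_of t = Some \<tau> \<and> s \<in> Tm \<tau> \<and> rel \<tau> s t) \<longleftrightarrow> (\<exists>\<tau>. ty_of u = Some \<tau> \<and> s \<in> Tm \<tau> \<and> rel \<tau> s u)" for s
    using assms[THEN ty_Tm] assms * rel_sym[OF assms *] rel_trans[of s \<tau> t u] rel_trans[of s \<tau> u t] by auto
  then show "cl t = cl u" by (simp add: cl_def)
qed

lemma cl_App:
  assumes "f \<in> Tm (\<sigma> \<rightarrow>\<^sub>t \<tau>)" "t \<in> Tm \<sigma>"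
  shows "ap QS (cl f) (cl t) = cl (f \<cdot> t)"
proof -
  have "rel \<tau> (from_nat (cl f) \<cdot> from_nat (cl t)) (f \<cdot> t)"
    using cl_rep[OF assms(1)] cl_rep[OF assms(2)] assms by (intro rel_App[of _ \<sigma>]) auto
  then show ?thesis
    using cl_eq[of _ \<tau>] cl_rep[OF assms(1)] cl_rep[OF assms(2)] Tm_App assms by (auto simp: QS_def)
qed

lemma val_Tm: "\<rho> \<in> env TM \<Longrightarrow> ty_of t = Some \<tau> \<Longrightarrow> val TM \<rho> t \<in> Tm \<tau>"
proof (induction t arbitrary: \<tau>)
  case (Var x)
  then show ?case using env_D[of \<rho> TM x] by simp
next
  case (Con c)
  then show ?case by (simp add: TM_def)
next
  case (App t u)
  from App.prems(2) obtain \<sigma> where "ty_of t = Some (\<sigma> \<rightarrow>\<^sub>t \<tau>)" "ty_of u = Some \<sigma>" by (rule ty_of_App)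
  then have "val TM \<rho> t \<in> Tm (\<sigma> \<rightarrow>\<^sub>t \<tau>)" "val TM \<rho> u \<in> Tm \<sigma>" using App by blast+
  then show ?case by (simp add: ap_TM Tm_App)
qed

lemma val_QS: "\<rho> \<in> env TM \<Longrightarrow> ty_of t = Some \<tau> \<Longrightarrow> val QS (cl \<circ> \<rho>) t = cl (val TM \<rho> t)"
proof (induction t arbitrary: \<tau>)
  case (App t u)
  from App.prems(2) obtain \<sigma> where *: "ty_of t = Some (\<sigma> \<rightarrow>\<^sub>t \<tau>)" "ty_of u = Some \<sigma>" by (rule ty_of_App)
  have "val TM \<rho> (t \<cdot> u) = val TM \<rho> t \<cdot> val TM \<rho> u" by (simp add: ap_TM)
  then show ?case
    using App.IH(1)[OF App.prems(1) *(1)] App.IH(2)[OF App.prems(1) *(2)]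
      cl_App[OF val_Tm[OF App.prems(1) *(1)] val_Tm[OF App.prems(1) *(2)]] by simp
qed (auto simp: QS_def TM_def)

lemma sat_QS: "\<rho> \<in> env TM \<Longrightarrow> wf \<phi> \<Longrightarrow> sat QS (cl \<circ> \<rho>) \<phi> \<longleftrightarrow> sat TM \<rho> \<phi>"
proof (induction \<phi> arbitrary: \<rho>)
  case (Eq t u)
  then have "val TM \<rho> t \<in> Tm N" "val TM \<rho> u \<in> Tm N" using val_Tm by auto
  moreover have "val QS (cl \<circ> \<rho>) t = cl (val TM \<rho> t)" "val QS (cl \<circ> \<rho>) u = cl (val TM \<rho> u)"
    using Eq val_QS by simp_all
  ultimately show ?case
    using cl_eq[of "val TM \<rho> t" N "val TM \<rho> u"] unfolding sat.simps eqr_QS by simp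
next
  case (Less t u)
  then have *: "val TM \<rho> t \<in> Tm N" "val TM \<rho> u \<in> Tm N" using val_Tm by auto
  note c = cl_rep[OF *(1)] cl_rep[OF *(2)]
  have "Less (from_nat (cl (val TM \<rho> t))) (from_nat (cl (val TM \<rho> u))) \<in> T \<longleftrightarrow> Less (val TM \<rho> t) (val TM \<rho> u) \<in> T"
  proof
    show "Less (val TM \<rho> t) (val TM \<rho> u) \<in> T" if "Less (from_nat (cl (val TM \<rho> t))) (from_nat (cl (val TM \<rho> u))) \<in> T"
      by (rule rel_Less[OF _ _ * _ _ that]) (use c in simp_all)
    show "Less (from_nat (cl (val TM \<rho> t))) (from_nat (cl (val TM \<rho> u))) \<in> T" if "Less (val TM \<rho> t) (val TM \<rho> u) \<in> T"
      by (rule rel_Less[OF * _ _ _ _ that]) (use c * rel_sym in blast)+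
  qed
  moreover have "val QS (cl \<circ> \<rho>) t = cl (val TM \<rho> t)" "val QS (cl \<circ> \<rho>) u = cl (val TM \<rho> u)"
    using Less val_QS by simp_all
  ultimately show ?case unfolding sat.simps ltr_QS ltr_TM by simp
next
  case (All x \<phi>)
  have upd: "(cl \<circ> \<rho>)(x := cl t) = cl \<circ> \<rho>(x := t)" for t by auto
  have dom: "dom QS \<tau> = cl ` Tm \<tau>" for \<tau> by (simp add: QS_def)
  have "sat QS (cl \<circ> \<rho>) (All x \<phi>) \<longleftrightarrow> (\<forall>t\<in>Tm (snd x). sat QS (cl \<circ> \<rho>(x := t)) \<phi>)"
    unfolding sat.simps dom ball_simps upd ..
  also have "\<dots> \<longleftrightarrow> (\<forall>t\<in>Tm (snd x). sat TM (\<rho>(x := t)) \<phi>)"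
  proof (rule ball_cong[OF refl])
    fix t assume "t \<in> Tm (snd x)"
    then show "sat QS (cl \<circ> \<rho>(x := t)) \<phi> \<longleftrightarrow> sat TM (\<rho>(x := t)) \<phi>"
      using All.prems by (intro All.IH env_upd) simp_all
  qed
  finally show ?case by (simp only: sat.simps)
qed auto

lemma env_QS: "\<rho> \<in> env QS \<Longrightarrow> \<exists>\<rho>'\<in>env TM. \<rho> = cl \<circ> \<rho>'"
proof -
  assume "\<rho> \<in> env QS"
  then have "\<forall>x. \<exists>t. t \<in> Tm (snd x) \<and> \<rho> x = cl t" by (auto simp: env_def QS_def)
  then obtain \<rho>' where \<rho>': "\<forall>x. \<rho>' x \<in> Tm (snd x) \<and> \<rho> x = cl (\<rho>' x)" by (rule choice[THEN exE])
  then have "\<rho>' \<in> env TM" "\<rho> = cl \<circ> \<rho>'" unfolding env_def fun_eq_iff by simp_all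
  then show ?thesis by blast
qed

lemma is_model_QS: "is_model A QS"
  unfolding is_model_def
proof (intro conjI allI ballI impI)
  show "eqr QS a b \<longleftrightarrow> a = b" for a b by (simp add: QS_def)
  show "cs QS c \<in> dom QS (cst_ty c)" for c by (auto simp: QS_def TM_def)
  show "env QS \<noteq> {}"
  proof -
    have "cl \<circ> (\<lambda>(i, \<tau>). Var (Suc (2 * i), \<tau>)) \<in> env QS"
      using Var_env unfolding env_def by (simp add: QS_def)
    then show ?thesis by blast
  qed
  fix \<sigma> \<tau> f assume f: "f \<in> dom QS (\<sigma> \<rightarrow>\<^sub>t \<tau>)"
  then obtain f' where f': "f' \<in> Tm (\<sigma> \<rightarrow>\<^sub>t \<tau>)" "f = cl f'" by (auto simp: QS_def)
  show "ap QS f a \<in> dom QS \<tau>" if a: "a \<in> dom QS \<sigma>" for a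
  proof -
    obtain a' where a': "a' \<in> Tm \<sigma>" "a = cl a'" using a by (auto simp: QS_def)
    have "ap QS f a = cl (f' \<cdot> a')" using cl_App[OF f'(1) a'(1)] f' a' by simp
    moreover have "f' \<cdot> a' \<in> Tm \<tau>" using f' a' Tm_App by blast
    ultimately show ?thesis by (auto simp: QS_def)
  qed
  fix g assume g: "g \<in> dom QS (\<sigma> \<rightarrow>\<^sub>t \<tau>)" and e: "\<forall>a\<in>dom QS \<sigma>. ap QS f a = ap QS g a"
  then obtain g' where g': "g' \<in> Tm (\<sigma> \<rightarrow>\<^sub>t \<tau>)" "g = cl g'" by (auto simp: QS_def)
  have "rel \<tau> (ap TM f' t) (ap TM g' t)" if t: "t \<in> Tm \<sigma>" for t
  proof -
    have "cl t \<in> dom QS \<sigma>" using t by (simp add: QS_def)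
    then have "cl (f' \<cdot> t) = cl (g' \<cdot> t)"
      using e f' g' cl_App[OF f'(1) t] cl_App[OF g'(1) t] by auto
    then have "rel \<tau> (f' \<cdot> t) (g' \<cdot> t)" using cl_eq Tm_App f' g' t by blast
    then show ?thesis by (simp add: TM_def)
  qed
  then have "rel (\<sigma> \<rightarrow>\<^sub>t \<tau>) f' g'" by simp
  then show "f = g" using cl_eq[OF f'(1) g'(1)] f' g' by simp
next
  fix \<phi> \<rho> assume *: "A \<turnstile> \<phi>" "fv \<phi> = {}" "\<rho> \<in> env QS"
  then obtain \<rho>' where \<rho>': "\<rho>' \<in> env TM" "\<rho> = cl \<circ> \<rho>'" using env_QS by blast
  have "\<phi> \<in> T" using * by (intro closed pv.ax)
  then show "sat QS \<rho> \<phi>"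
    using \<rho>' sat_QS sat_sentence[OF wf_proves[OF *(1)] *(2)] wf_proves[OF *(1)] by simp
qed

end

theorem completeness:
  assumes "\<And>\<rho> \<tau>. A \<turnstile> ext_axiom \<rho> \<tau> 0" "wf \<phi>" "fv \<phi> = {}"
    and sat: "\<And>(S :: nat str) \<rho>. is_model A S \<Longrightarrow> \<rho> \<in> env S \<Longrightarrow> sat S \<rho> \<phi>"
  shows "A \<turnstile> \<phi>"
proof (rule ccontr)
  assume "\<not> A \<turnstile> \<phi>"
  then obtain T where T: "henkin_theory A T" "\<phi> \<notin> T" using henkin_theory_exists assms(2) by blast
  interpret ext_henkin_theory A T
    using T(1) assms(1) by (simp add: ext_henkin_theory_def ext_henkin_theory_axioms_def)
  let ?\<rho> = "\<lambda>(i, \<tau>). Var (Suc (2 * i), \<tau>)"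
  have "cl \<circ> ?\<rho> \<in> env QS"
    using Var_env unfolding env_def by (simp add: QS_def)
  from sat[OF is_model_QS this] have "sat TM ?\<rho> \<phi>"
    using sat_QS[OF Var_env assms(2)] by simp
  then show False using sat_sentence[OF assms(2,3) Var_env] T(2) by simp
qed

subsection \<open>The ring of differences of an ordered semiring\<close>

definition diffrel :: "'a::linordered_semidom \<times> 'a \<Rightarrow> 'a \<times> 'a \<Rightarrow> bool" where
  "diffrel = (\<lambda>(a, b) (c, d). a + d = c + b)"

lemma equivp_diffrel: "equivp (diffrel :: 'a::linordered_semidom \<times> 'a \<Rightarrow> _)"
proof (rule equivpI)
  show "transp (diffrel :: 'a \<times> 'a \<Rightarrow> _)"
  proof (rule transpI)
    fix x y z :: "'a \<times> 'a"
    assume *: "diffrel x y" "diffrel y z"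
    obtain a b c d e f where [simp]: "x = (a, b)" "y = (c, d)" "z = (e, f)"
      by (cases x; cases y; cases z)
    have "(a + f) + (c + d) = (a + d) + (c + f)" by (simp add: ac_simps)
    also have "\<dots> = (c + b) + (e + d)" using * by (simp add: diffrel_def)
    also have "\<dots> = (e + b) + (c + d)" by (simp add: ac_simps)
    finally show "diffrel x z" by (simp add: diffrel_def)
  qed
qed (auto simp: reflp_def symp_def diffrel_def)

quotient_type (overloaded) 'a diff = "'a::linordered_semidom \<times> 'a" / diffrel
  morphisms Rep_Diff Abs_Diff
  by (rule equivp_diffrel)

instantiation diff :: (linordered_semidom) comm_ring_1
begin

lift_definition zero_diff :: "'a diff" is "(0, 0)" .
lift_definition one_diff :: "'a diff" is "(1, 0)" .
lift_definition plus_diff :: "'a diff \<Rightarrow> 'a diff \<Rightarrow> 'a diff" is "\<lambda>(a, b) (c, d). (a + c, b + d)"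
  by (clarsimp simp: diffrel_def) (metis (no_types, lifting) add.assoc add.left_commute)
lift_definition uminus_diff :: "'a diff \<Rightarrow> 'a diff" is "\<lambda>(a, b). (b, a)"
  by (clarsimp simp: diffrel_def) (metis add.commute)
definition minus_diff :: "'a diff \<Rightarrow> 'a diff \<Rightarrow> 'a diff" where "minus_diff x y = x + - y"
lift_definition times_diff :: "'a diff \<Rightarrow> 'a diff \<Rightarrow> 'a diff"
  is "\<lambda>(a, b) (c, d). (a * c + b * d, a * d + b * c)"
proof (unfold diffrel_def, clarify)
  fix s t u v w x y z :: 'a
  assume "s + v = u + t" and "w + z = y + x"
  then have "(s + v) * w + (u + t) * x + u * (w + z) + v * (y + x) =
             (u + t) * w + (s + v) * x + u * (y + x) + v * (w + z)"
    by simp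
  then have "((s * w + t * x) + (u * z + v * y)) + (v * w + u * x + u * w + v * x) =
      ((u * y + v * z) + (s * x + t * w)) + (v * w + u * x + u * w + v * x)"
    by (simp add: algebra_simps)
  then show "(s * w + t * x) + (u * z + v * y) = (u * y + v * z) + (s * x + t * w)"
    by (simp only: add_right_cancel)
qed

instance
proof
  show "a + b + c = a + (b + c)" "a + b = b + a" "0 + a = a" "- a + a = 0"
    "a * b * c = a * (b * c)" "a * b = b * a" "1 * a = a" "(a + b) * c = a * c + b * c"
    for a b c :: "'a diff"
    by (transfer; clarsimp simp: diffrel_def algebra_simps)+
  show "(0 :: 'a diff) \<noteq> 1" by transfer (simp add: diffrel_def)
qed (rule minus_diff_def)

end

instantiation diff :: (linordered_semidom) linordered_idom
begin

lift_definition less_eq_diff :: "'a diff \<Rightarrow> 'a diff \<Rightarrow> bool" is "\<lambda>(a, b) (c, d). a + d \<le> c + b"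
proof (unfold diffrel_def, clarify)
  fix s t u v w x y z :: 'a
  assume *: "s + v = u + t" "w + z = y + x"
  have "s + x \<le> w + t \<longleftrightarrow> s + x + (v + z) \<le> w + t + (v + z)" by simp
  also have "s + x + (v + z) = (s + v) + (x + z)" by (simp add: ac_simps)
  also have "w + t + (v + z) = (w + z) + (t + v)" by (simp add: ac_simps)
  also have "(s + v) + (x + z) \<le> (w + z) + (t + v) \<longleftrightarrow> (u + z) + (t + x) \<le> (y + v) + (t + x)"
    unfolding * by (simp add: ac_simps)
  also have "\<dots> \<longleftrightarrow> u + z \<le> y + v" by simp
  finally show "s + x \<le> w + t \<longleftrightarrow> u + z \<le> y + v" .
qed

definition less_diff :: "'a diff \<Rightarrow> 'a diff \<Rightarrow> bool" where "less_diff x y \<longleftrightarrow> x \<le> y \<and> \<not> y \<le> x"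
definition abs_diff :: "'a diff \<Rightarrow> 'a diff" where "abs_diff x = (if x < 0 then - x else x)"
definition sgn_diff :: "'a diff \<Rightarrow> 'a diff" where "sgn_diff x = (if x = 0 then 0 else if 0 < x then 1 else - 1)"

lemma mult_pos_diff: "0 < x * y" if "0 < x" "0 < (y :: 'a diff)"
proof -
  have aux: "a * d + b * c < a * c + b * d" if *: "b < a" "d < c" for a b c d :: 'a
  proof -
    define r s where "r = a - b" and "s = c - d"
    have a: "a = b + r" and c: "c = d + s" using * by (auto simp: r_def s_def)
    have "0 < r" "0 < s" using * unfolding a c by auto
    then have "0 < r * s" by simp
    then show ?thesis unfolding a c by (simp add: algebra_simps)
  qed
  show ?thesis
    using that unfolding less_diff_def by transfer (clarsimp simp: not_le aux less_imp_le)
qed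

instance
proof
  fix a b c :: "'a diff"
  show "a < b \<longleftrightarrow> a \<le> b \<and> \<not> b \<le> a" by (rule less_diff_def)
  show "a \<le> a" by transfer auto
  show "a \<le> b \<Longrightarrow> b \<le> c \<Longrightarrow> a \<le> c"
  proof (transfer, clarsimp)
    fix a b c d e f :: 'a
    assume "a + d \<le> c + b" "c + f \<le> e + d"
    then have "(a + d) + (c + f) \<le> (c + b) + (e + d)" by (rule add_mono)
    then have "(a + f) + (c + d) \<le> (e + b) + (c + d)" by (simp add: ac_simps)
    then show "a + f \<le> e + b" by simp
  qed
  show "a \<le> b \<Longrightarrow> b \<le> a \<Longrightarrow> a = b" by transfer (auto simp: diffrel_def)
  show "a \<le> b \<or> b \<le> a" by transfer auto
  show le: "a \<le> b \<Longrightarrow> c + a \<le> c + b"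
    by transfer (clarsimp simp: algebra_simps)
  show "\<bar>a\<bar> = (if a < 0 then - a else a)" by (rule abs_diff_def)
  show "sgn a = (if a = 0 then 0 else if 0 < a then 1 else - 1)" by (rule sgn_diff_def)
  show "c * a < c * b" if "a < b" "0 < c"
  proof -
    have le: "x \<le> y \<longleftrightarrow> z + x \<le> z + y" for x y z :: "'a diff"
      by transfer (clarsimp simp: algebra_simps)
    have lt: "x < y \<longleftrightarrow> 0 < y - x" for x y :: "'a diff"
      unfolding less_diff_def using le[of x y "- x"] le[of y x "- x"] by simp
    have "0 < c * (b - a)" using that lt mult_pos_diff by blast
    then show ?thesis using lt[of "c * a" "c * b"] by (simp add: right_diff_distrib)
  qed
qed

end

lift_definition of_sd :: "'a::linordered_semidom \<Rightarrow> 'a diff" is "\<lambda>a. (a, 0)" .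

lemma of_sd_simps: "of_sd 0 = 0" "of_sd 1 = 1" "of_sd (a + b) = of_sd a + of_sd b"
  "of_sd (a * b) = of_sd a * of_sd b" "of_sd a \<le> of_sd b \<longleftrightarrow> a \<le> b"
  by (transfer; simp add: diffrel_def)+

lemma diff_cases: "\<exists>a b. x = of_sd a - of_sd b"
  unfolding minus_diff_def
  by transfer (auto simp: diffrel_def)

subsection \<open>The ordered field of fractions\<close>

text \<open>The embedding of the semiring into the ordered field of fractions of its ring of
  differences.\<close>

definition nk :: "'a::linordered_semidom \<Rightarrow> 'a diff fract" where
  "nk a = Fract (of_sd a) 1"

lemma nk_simps [simp]: "nk 0 = 0" "nk 1 = 1" "nk (a + b) = nk a + nk b" "nk (a * b) = nk a * nk b"
  "nk a \<le> nk b \<longleftrightarrow> a \<le> b"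
  by (simp_all add: nk_def of_sd_simps Zero_fract_def One_fract_def)

lemma nk_less [simp]: "nk a < nk b \<longleftrightarrow> a < b"
  by (simp add: less_le_not_le)

lemma nk_eq [simp]: "nk a = nk b \<longleftrightarrow> a = b"
  by (simp add: order_eq_iff)

lemma nk_nonneg [simp]: "0 \<le> nk a \<longleftrightarrow> 0 \<le> a"
  using nk_simps(5)[of 0 a] by (simp del: nk_simps(5))

lemma nk_pos [simp]: "0 < nk a \<longleftrightarrow> 0 < a"
  using nk_less[of 0 a] by (simp del: nk_less)

lemma nk_zero [simp]: "nk a = 0 \<longleftrightarrow> a = 0"
  using nk_eq[of a 0] by (simp del: nk_eq)

lemma nk_numeral [simp]: "nk (numeral w) = numeral w"
  by (induction w) (simp_all only: numeral.simps nk_simps)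

text \<open>The form mirrors the triples \<open>rat3\<close> of the formal language: a numerator
  given as a difference, and a positive denominator.\<close>

lemma fract_cases:
  fixes x :: "'a::linordered_semidom diff fract"
  obtains a b d where "0 < d" "x = (nk a - nk b) / nk d"
proof -
  obtain p q where x: "x = Fract p q" "0 < q"
  proof (cases x)
    case (Fract p q)
    then show ?thesis
      using that[of p q] that[of "- p" "- q"] by (cases "0 < q") (auto simp: eq_fract not_less)
  qed
  obtain a b where p: "p = of_sd a - of_sd b" using diff_cases by blast
  obtain c d where q: "q = of_sd c - of_sd d" using diff_cases by blast
  have "d < c" using x(2) unfolding q by (simp add: of_sd_simps less_le_not_le)
  define e where "e = c - d"
  have c: "c = d + e" using \<open>d < c\<close> by (auto simp: e_def)
  then have "0 < e" using \<open>d < c\<close> by simp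
  have "q = of_sd e" by (simp add: q c of_sd_simps)
  moreover have "of_sd e \<noteq> 0" using x(2) \<open>q = of_sd e\<close> by simp
  ultimately have "x = (nk a - nk b) / nk e"
    by (simp add: x p nk_def divide_fract)
  with \<open>0 < e\<close> that show ?thesis by blast
qed

subsection \<open>Cauchy completion of an ordered field\<close>

text \<open>Nets are indexed by small positive field elements, which are cofinal in every ordered field,
  archimedean or not.\<close>

definition small :: "'a::linordered_field filter" where
  "small = (INF d\<in>{0<..}. principal {0<..<d})"

lemma eventually_small: "eventually P small \<longleftrightarrow> (\<exists>d>0. \<forall>e. 0 < e \<longrightarrow> e < d \<longrightarrow> P (e :: 'a::linordered_field))"
proof -
  have "eventually P small \<longleftrightarrow> (\<exists>d\<in>{0 :: 'a<..}. eventually P (principal {0<..<d}))"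
    unfolding small_def
  proof (rule eventually_INF_base)
    show "{0 :: 'a<..} \<noteq> {}" using zero_less_one by blast
    fix a b :: 'a assume "a \<in> {0<..}" "b \<in> {0<..}"
    then show "\<exists>x\<in>{0<..}. principal {0<..<x} \<le> inf (principal {0<..<a}) (principal {0<..<b})"
      by (intro bexI[of _ "min a b"]) auto
  qed
  then show ?thesis unfolding eventually_principal Bex_def Ball_def greaterThan_iff greaterThanLessThan_iff by blast
qed

lemma small_nontrivial [simp]: "small \<noteq> (bot :: 'a::linordered_field filter)"
proof
  assume "small = (bot :: 'a filter)"
  then have "eventually (\<lambda>_. False) (small :: 'a filter)" by simp
  then show False unfolding eventually_small using dense by blast
qed

text \<open>For each radius there is one field element near which the net eventually stays. Values
  at two indices are never compared, so eventual properties can be combined pointwise.\<close>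

definition cauchy :: "('a::linordered_field \<Rightarrow> 'a) \<Rightarrow> bool" where
  "cauchy X \<longleftrightarrow> (\<forall>r>0. \<exists>c. \<forall>\<^sub>F e in small. \<bar>X e - c\<bar> < r)"

definition vanishes :: "('a::linordered_field \<Rightarrow> 'a) \<Rightarrow> bool" where
  "vanishes X \<longleftrightarrow> (\<forall>r>0. \<forall>\<^sub>F e in small. \<bar>X e\<bar> < r)"

lemma cauchyD: "cauchy X \<Longrightarrow> 0 < r \<Longrightarrow> \<exists>c. \<forall>\<^sub>F e in small. \<bar>X e - c\<bar> < r"
  by (simp add: cauchy_def)

lemma vanishesD: "vanishes X \<Longrightarrow> 0 < r \<Longrightarrow> \<forall>\<^sub>F e in small. \<bar>X e\<bar> < r"
  by (simp add: vanishes_def)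

lemma cauchy_const [simp]: "cauchy (\<lambda>e. c)"
  by (auto simp: cauchy_def intro!: exI[of _ c])

lemma cauchy_add:
  assumes "cauchy X" "cauchy Y"
  shows "cauchy (\<lambda>e. X e + Y e)"
  unfolding cauchy_def
proof (intro allI impI)
  fix r :: 'a assume "0 < r"
  then have r: "0 < r / 2" by simp
  obtain c d where "\<forall>\<^sub>F e in small. \<bar>X e - c\<bar> < r / 2" "\<forall>\<^sub>F e in small. \<bar>Y e - d\<bar> < r / 2"
    using cauchyD[OF assms(1) r] cauchyD[OF assms(2) r] by blast
  then have "\<forall>\<^sub>F e in small. \<bar>X e + Y e - (c + d)\<bar> < r"
    by eventually_elim (auto simp: abs_if split: if_splits)
  then show "\<exists>c. \<forall>\<^sub>F e in small. \<bar>X e + Y e - c\<bar> < r" by blast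
qed

lemma cauchy_minus:
  assumes "cauchy X"
  shows "cauchy (\<lambda>e. - X e)"
  unfolding cauchy_def
proof (intro allI impI)
  fix r :: 'a assume "0 < r"
  then obtain c where "\<forall>\<^sub>F e in small. \<bar>X e - c\<bar> < r"
    using cauchyD[OF assms] by blast
  then have "\<forall>\<^sub>F e in small. \<bar>- X e - (- c)\<bar> < r"
    by eventually_elim (auto simp: abs_if split: if_splits)
  then show "\<exists>c. \<forall>\<^sub>F e in small. \<bar>- X e - c\<bar> < r" by blast
qed

lemma cauchy_bounded:
  assumes "cauchy X"
  obtains b where "0 < b" "\<forall>\<^sub>F e in small. \<bar>X e\<bar> < b"
proof -
  obtain c where "\<forall>\<^sub>F e in small. \<bar>X e - c\<bar> < 1" using cauchyD[OF assms zero_less_one] by blast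
  then have "\<forall>\<^sub>F e in small. \<bar>X e\<bar> < \<bar>c\<bar> + 1"
    by eventually_elim (auto simp: abs_if split: if_splits)
  then show ?thesis by (rule that[rotated]) (simp add: add_nonneg_pos)
qed

lemma abs_mult_diff:
  fixes x y c d :: "'a::linordered_field"
  assumes "\<bar>x\<bar> < b" "\<bar>d\<bar> < b" "\<bar>x - c\<bar> < r / (2 * b)" "\<bar>y - d\<bar> < r / (2 * b)" "0 < b"
  shows "\<bar>x * y - c * d\<bar> < r"
proof -
  have "x * y - c * d = x * (y - d) + d * (x - c)" by (simp add: algebra_simps)
  then have "\<bar>x * y - c * d\<bar> \<le> \<bar>x\<bar> * \<bar>y - d\<bar> + \<bar>d\<bar> * \<bar>x - c\<bar>"
    by (metis abs_mult abs_triangle_ineq)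
  also have "\<dots> < b * (r / (2 * b)) + b * (r / (2 * b))"
    using assms by (intro add_strict_mono mult_strict_mono) auto
  finally show ?thesis using assms(5) by (simp add: field_simps)
qed

lemma cauchy_mult:
  assumes "cauchy X" "cauchy Y"
  shows "cauchy (\<lambda>e. X e * Y e)"
  unfolding cauchy_def
proof (intro allI impI)
  fix r :: 'a assume r: "0 < r"
  obtain b where b: "0 < b" "\<forall>\<^sub>F e in small. \<bar>X e\<bar> < b" using cauchy_bounded[OF assms(1)] by blast
  obtain b' where b': "0 < b'" "\<forall>\<^sub>F e in small. \<bar>Y e\<bar> < b'" using cauchy_bounded[OF assms(2)] by blast
  \<comment> \<open>\<open>b\<close> bounds \<open>X\<close>, and the approximation \<open>d\<close>
    of \<open>Y\<close> stays below \<open>b' + s\<close> with \<open>s\<close> at most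
    \<open>r\<close>; so \<open>B\<close> bounds both quantities that \<open>abs_mult_diff\<close>
    asks for.\<close>
  define B where "B = b + b' + r"
  have B: "0 < B" using b b' r by (simp add: B_def)
  define s where "s = min (r / (2 * B)) r"
  have s: "0 < s" using r B by (simp add: s_def)
  obtain c d where cd: "\<forall>\<^sub>F e in small. \<bar>X e - c\<bar> < s" "\<forall>\<^sub>F e in small. \<bar>Y e - d\<bar> < s"
    using cauchyD[OF assms(1) s] cauchyD[OF assms(2) s] by blast
  obtain e where "\<bar>Y e - d\<bar> < s" "\<bar>Y e\<bar> < b'"
    using eventually_happens'[OF small_nontrivial eventually_conj[OF cd(2) b'(2)]] by blast
  then have d: "\<bar>d\<bar> < B" using b(1) by (auto simp: abs_if B_def s_def split: if_splits)
  from b(2) cd have "\<forall>\<^sub>F e in small. \<bar>X e * Y e - c * d\<bar> < r"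
  proof eventually_elim
    case (elim e)
    then show ?case
      using d B b' r by (intro abs_mult_diff[of _ B]) (auto simp: B_def s_def)
  qed
  then show "\<exists>c. \<forall>\<^sub>F e in small. \<bar>X e * Y e - c\<bar> < r" by blast
qed

lemma vanishes_add: "vanishes X \<Longrightarrow> vanishes Y \<Longrightarrow> vanishes (\<lambda>e. X e + Y e)"
  unfolding vanishes_def
proof (intro allI impI)
  fix r :: 'a
  assume *: "\<forall>r>0. \<forall>\<^sub>F e in small. \<bar>X e\<bar> < r" "\<forall>r>0. \<forall>\<^sub>F e in small. \<bar>Y e\<bar> < r" "0 < r"
  then have "\<forall>\<^sub>F e in small. \<bar>X e\<bar> < r / 2" "\<forall>\<^sub>F e in small. \<bar>Y e\<bar> < r / 2"
    by (meson half_gt_zero)+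
  then show "\<forall>\<^sub>F e in small. \<bar>X e + Y e\<bar> < r"
    by eventually_elim (auto simp: abs_if split: if_splits)
qed

lemma vanishes_minus: "vanishes X \<Longrightarrow> vanishes (\<lambda>e. - X e)"
  by (simp add: vanishes_def)

lemma vanishes_mult:
  assumes "cauchy X" "vanishes Y"
  shows "vanishes (\<lambda>e. X e * Y e)"
  unfolding vanishes_def
proof (intro allI impI)
  fix r :: 'a assume r: "0 < r"
  obtain b where b: "0 < b" "\<forall>\<^sub>F e in small. \<bar>X e\<bar> < b" using cauchy_bounded[OF assms(1)] by blast
  have "\<forall>\<^sub>F e in small. \<bar>Y e\<bar> < r / b" using assms(2) r b by (intro vanishesD) auto
  with b(2) show "\<forall>\<^sub>F e in small. \<bar>X e * Y e\<bar> < r"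
  proof eventually_elim
    case (elim e)
    then have "\<bar>X e\<bar> * \<bar>Y e\<bar> < b * (r / b)" using b(1) by (intro mult_strict_mono') auto
    then show ?case using b(1) by (simp add: abs_mult)
  qed
qed

definition cmplrel :: "('a::linordered_field \<Rightarrow> 'a) \<Rightarrow> ('a \<Rightarrow> 'a) \<Rightarrow> bool" where
  "cmplrel X Y \<longleftrightarrow> cauchy X \<and> cauchy Y \<and> vanishes (\<lambda>e. X e - Y e)"

lemma cmplrel_refl: "cauchy X \<Longrightarrow> cmplrel X X"
  by (simp add: cmplrel_def vanishes_def)

quotient_type (overloaded) 'a cmpl = "'a::linordered_field \<Rightarrow> 'a" / partial: cmplrel
  morphisms Rep_Cmpl Abs_Cmpl
proof (rule part_equivpI)
  show "\<exists>X :: 'a \<Rightarrow> 'a. cmplrel X X" by (blast intro: cmplrel_refl cauchy_const)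
  show "symp (cmplrel :: ('a \<Rightarrow> 'a) \<Rightarrow> _)"
    by (rule sympI) (auto simp: cmplrel_def vanishes_def abs_minus_commute)
  show "transp (cmplrel :: ('a \<Rightarrow> 'a) \<Rightarrow> _)"
  proof (rule transpI)
    fix X Y Z :: "'a \<Rightarrow> 'a" assume "cmplrel X Y" "cmplrel Y Z"
    then show "cmplrel X Z"
      using vanishes_add[of "\<lambda>e. X e - Y e" "\<lambda>e. Y e - Z e"] by (simp add: cmplrel_def)
  qed
qed

instantiation cmpl :: (linordered_field) comm_ring_1
begin

lift_definition zero_cmpl :: "'a cmpl" is "\<lambda>e. 0" by (simp add: cmplrel_refl)
lift_definition one_cmpl :: "'a cmpl" is "\<lambda>e. 1" by (simp add: cmplrel_refl)
lift_definition plus_cmpl :: "'a cmpl \<Rightarrow> 'a cmpl \<Rightarrow> 'a cmpl" is "\<lambda>X Y e. X e + Y e"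
proof -
  fix X Y Z W :: "'a \<Rightarrow> 'a" assume "cmplrel X Y" "cmplrel Z W"
  then show "cmplrel (\<lambda>e. X e + Z e) (\<lambda>e. Y e + W e)"
    using vanishes_add[of "\<lambda>e. X e - Y e" "\<lambda>e. Z e - W e"]
    by (simp add: cmplrel_def cauchy_add algebra_simps)
qed
lift_definition uminus_cmpl :: "'a cmpl \<Rightarrow> 'a cmpl" is "\<lambda>X e. - X e"
proof -
  fix X Y :: "'a \<Rightarrow> 'a" assume "cmplrel X Y"
  then show "cmplrel (\<lambda>e. - X e) (\<lambda>e. - Y e)"
    using vanishes_minus[of "\<lambda>e. X e - Y e"] by (simp add: cmplrel_def cauchy_minus)
qed
lift_definition times_cmpl :: "'a cmpl \<Rightarrow> 'a cmpl \<Rightarrow> 'a cmpl" is "\<lambda>X Y e. X e * Y e"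
proof -
  fix X Y Z W :: "'a \<Rightarrow> 'a" assume *: "cmplrel X Y" "cmplrel Z W"
  have "vanishes (\<lambda>e. X e * (Z e - W e) + W e * (X e - Y e))"
    using * by (intro vanishes_add vanishes_mult) (auto simp: cmplrel_def)
  then show "cmplrel (\<lambda>e. X e * Z e) (\<lambda>e. Y e * W e)"
    using * by (simp add: cmplrel_def cauchy_mult algebra_simps)
qed
definition minus_cmpl :: "'a cmpl \<Rightarrow> 'a cmpl \<Rightarrow> 'a cmpl" where "minus_cmpl x y = x + - y"

instance
proof
  show "a + b + c = a + (b + c)" "a + b = b + a" "0 + a = a" "- a + a = 0"
    "a * b * c = a * (b * c)" "a * b = b * a" "1 * a = a" "(a + b) * c = a * c + b * c"
    for a b c :: "'a cmpl"
    by (transfer; simp add: cmplrel_def cauchy_add cauchy_mult cauchy_minus algebra_simps vanishes_def)+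
  show "(0 :: 'a cmpl) \<noteq> 1"
    by transfer (auto simp: cmplrel_def vanishes_def eventually_const_iff intro!: exI[of _ 1])
qed (rule minus_cmpl_def)

end

text \<open>Eventual positivity alone would not survive a vanishing perturbation; a positive lower
  bound does.\<close>

definition posnet :: "('a::linordered_field \<Rightarrow> 'a) \<Rightarrow> bool" where
  "posnet X \<longleftrightarrow> (\<exists>r>0. \<forall>\<^sub>F e in small. r < X e)"

lemma posnet_cong:
  assumes "posnet X" "vanishes (\<lambda>e. X e - Y e)"
  shows "posnet Y"
proof -
  obtain r where r: "0 < r" "\<forall>\<^sub>F e in small. r < X e" using assms(1) by (auto simp: posnet_def)
  then have "\<forall>\<^sub>F e in small. \<bar>X e - Y e\<bar> < r / 2" using assms(2) by (intro vanishesD) auto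
  with r(2) have "\<forall>\<^sub>F e in small. r / 2 < Y e"
    by eventually_elim (auto simp: abs_if split: if_splits)
  then show ?thesis using r(1) by (auto simp: posnet_def intro!: exI[of _ "r / 2"])
qed

lift_definition pos_cmpl :: "'a::linordered_field cmpl \<Rightarrow> bool" is posnet
proof -
  fix X Y :: "'a \<Rightarrow> 'a" assume *: "cmplrel X Y"
  then have "vanishes (\<lambda>e. Y e - X e)"
    using vanishes_minus[of "\<lambda>e. X e - Y e"] by (simp add: cmplrel_def)
  with * show "posnet X \<longleftrightarrow> posnet Y"
    using posnet_cong[of X Y] posnet_cong[of Y X] by (auto simp: cmplrel_def)
qed

lemma pos_cmpl_add: "pos_cmpl x \<Longrightarrow> pos_cmpl y \<Longrightarrow> pos_cmpl (x + y)"
proof (transfer fixing: )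
  fix X Y :: "'a \<Rightarrow> 'a" assume "posnet X" "posnet Y"
  then obtain r s where rs: "0 < r" "0 < s" and ev: "\<forall>\<^sub>F e in small. r < X e" "\<forall>\<^sub>F e in small. s < Y e"
    by (auto simp: posnet_def)
  from ev have "\<forall>\<^sub>F e in small. r + s < X e + Y e" by eventually_elim (rule add_strict_mono)
  then show "posnet (\<lambda>e. X e + Y e)" using rs unfolding posnet_def by (intro exI[of _ "r + s"]) simp
qed

lemma pos_cmpl_mult: "pos_cmpl x \<Longrightarrow> pos_cmpl y \<Longrightarrow> pos_cmpl (x * y)"
proof (transfer fixing: )
  fix X Y :: "'a \<Rightarrow> 'a" assume "posnet X" "posnet Y"
  then obtain r s where rs: "0 < r" "0 < s" and ev: "\<forall>\<^sub>F e in small. r < X e" "\<forall>\<^sub>F e in small. s < Y e"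
    by (auto simp: posnet_def)
  from ev have "\<forall>\<^sub>F e in small. r * s < X e * Y e"
    by eventually_elim (use rs in \<open>auto intro: mult_strict_mono\<close>)
  then show "posnet (\<lambda>e. X e * Y e)" using rs unfolding posnet_def by (intro exI[of _ "r * s"]) simp
qed

lemma pos_cmpl_0: "\<not> pos_cmpl 0"
  by transfer (auto simp: posnet_def eventually_const_iff)

text \<open>If \<open>X\<close> does not vanish at scale \<open>r\<close>, an approximation
  \<open>k\<close> to within \<open>r / 3\<close> cannot have absolute value below
  \<open>2 * r / 3\<close>, and the sign of \<open>k\<close> then decides the sign of
  \<open>X\<close>.\<close>

lemma pos_cmpl_cases: "x = 0 \<or> pos_cmpl x \<or> pos_cmpl (- x)"
proof (transfer fixing: )
  fix X :: "'a \<Rightarrow> 'a" assume X: "cmplrel X X"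
  then have c: "cauchy X" by (simp add: cmplrel_def)
  show "cmplrel X (\<lambda>e. 0) \<or> posnet X \<or> posnet (\<lambda>e. - X e)"
  proof (cases "vanishes X")
    case True
    then show ?thesis using c by (simp add: cmplrel_def)
  next
    case False
    then obtain r where r: "0 < r" "\<not> (\<forall>\<^sub>F e in small. \<bar>X e\<bar> < r)" by (auto simp: vanishes_def)
    then obtain k where k: "\<forall>\<^sub>F e in small. \<bar>X e - k\<bar> < r / 3" using cauchyD[OF c, of "r / 3"] by auto
    consider "2 * r / 3 \<le> k" | "k \<le> - (2 * r / 3)" | "\<bar>k\<bar> < 2 * r / 3" by linarith
    then show ?thesis
    proof cases
      case 1
      from k have "\<forall>\<^sub>F e in small. r / 3 < X e"
        by eventually_elim (use 1 in \<open>auto simp: abs_if split: if_splits\<close>)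
      then show ?thesis using r(1) unfolding posnet_def by (intro disjI2 disjI1 exI[of _ "r / 3"]) simp
    next
      case 2
      from k have "\<forall>\<^sub>F e in small. r / 3 < - X e"
        by eventually_elim (use 2 in \<open>auto simp: abs_if split: if_splits\<close>)
      then show ?thesis using r(1) unfolding posnet_def by (intro disjI2 exI[of _ "r / 3"]) simp
    next
      case 3
      from k have "\<forall>\<^sub>F e in small. \<bar>X e\<bar> < r"
        by eventually_elim (use 3 in \<open>auto simp: abs_if split: if_splits\<close>)
      then show ?thesis using r(2) by simp
    qed
  qed
qed

instantiation cmpl :: (linordered_field) linordered_idom
begin

definition less_cmpl :: "'a cmpl \<Rightarrow> 'a cmpl \<Rightarrow> bool" where "less_cmpl x y \<longleftrightarrow> pos_cmpl (y - x)"
definition less_eq_cmpl :: "'a cmpl \<Rightarrow> 'a cmpl \<Rightarrow> bool" where "less_eq_cmpl x y \<longleftrightarrow> x = y \<or> pos_cmpl (y - x)"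
definition abs_cmpl :: "'a cmpl \<Rightarrow> 'a cmpl" where "abs_cmpl x = (if x < 0 then - x else x)"
definition sgn_cmpl :: "'a cmpl \<Rightarrow> 'a cmpl" where "sgn_cmpl x = (if x = 0 then 0 else if 0 < x then 1 else - 1)"

instance
proof
  fix a b c :: "'a cmpl"
  have asym: "\<not> (pos_cmpl (a - b) \<and> pos_cmpl (b - a))" for a b :: "'a cmpl"
    using pos_cmpl_add[of "a - b" "b - a"] pos_cmpl_0 by auto
  show "a < b \<longleftrightarrow> a \<le> b \<and> \<not> b \<le> a"
    using asym[of a b] pos_cmpl_0 by (auto simp: less_cmpl_def less_eq_cmpl_def)
  show "a \<le> a" by (simp add: less_eq_cmpl_def)
  show "a \<le> b \<Longrightarrow> b \<le> c \<Longrightarrow> a \<le> c"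
    using pos_cmpl_add[of "b - a" "c - b"] by (auto simp: less_eq_cmpl_def)
  show "a \<le> b \<Longrightarrow> b \<le> a \<Longrightarrow> a = b"
    using asym[of a b] by (auto simp: less_eq_cmpl_def)
  show "a \<le> b \<or> b \<le> a"
    using pos_cmpl_cases[of "a - b"] by (auto simp: less_eq_cmpl_def)
  show "a \<le> b \<Longrightarrow> c + a \<le> c + b" by (auto simp: less_eq_cmpl_def)
  show "\<bar>a\<bar> = (if a < 0 then - a else a)" by (rule abs_cmpl_def)
  show "sgn a = (if a = 0 then 0 else if 0 < a then 1 else - 1)" by (rule sgn_cmpl_def)
  show "a < b \<Longrightarrow> 0 < c \<Longrightarrow> c * a < c * b"
    using pos_cmpl_mult[of c "b - a"] by (auto simp: less_cmpl_def right_diff_distrib)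
qed

end

lift_definition kr :: "'a::linordered_field \<Rightarrow> 'a cmpl" is "\<lambda>a e. a"
  by (simp add: cmplrel_refl)

lemma kr_simps [simp]: "kr 0 = 0" "kr 1 = 1" "kr (a + b) = kr a + kr b" "kr (- a) = - kr a" "kr (a * b) = kr a * kr b"
  by (transfer; simp add: cmplrel_refl)+

lemma kr_diff [simp]: "kr (a - b) = kr a - kr b"
  using kr_simps(3)[of a "- b"] by simp

lemma kr_numeral [simp]: "kr (numeral w) = numeral w"
  by (induction w) (simp_all only: numeral.simps kr_simps)

lemma kr_pos [simp]: "0 < kr a \<longleftrightarrow> 0 < a"
proof -
  have "pos_cmpl (kr a) \<longleftrightarrow> 0 < a"
    by transfer (auto simp: posnet_def eventually_const_iff dest: dense)
  then show ?thesis by (simp add: less_cmpl_def)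
qed

lemma kr_less [simp]: "kr a < kr b \<longleftrightarrow> a < b"
  using kr_pos[of "b - a"] by (simp del: kr_pos)

lemma kr_le [simp]: "kr a \<le> kr b \<longleftrightarrow> a \<le> b"
  by (simp add: not_less[symmetric])

lemma kr_eq [simp]: "kr a = kr b \<longleftrightarrow> a = b"
  by (simp add: order_eq_iff)

lemma kr_abs [simp]: "kr \<bar>a\<bar> = \<bar>kr a\<bar>"
  using kr_less[of a 0] by (simp add: abs_if)

lemma cmpl_dense:
  assumes "0 < r"
  obtains q where "\<bar>x - kr q\<bar> \<le> kr r"
proof -
  \<comment> \<open>Subtraction on the completion is defined and not lifted, so differences are
    rewritten as sums before the transfer.\<close>
  have "\<exists>q. \<not> pos_cmpl (x - kr q - kr r) \<and> \<not> pos_cmpl (kr q - x - kr r)"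
    unfolding diff_conv_add_uminus
  proof (transfer fixing: r)
    fix X :: "'a \<Rightarrow> 'a" assume "cmplrel X X"
    then obtain c where c: "\<forall>\<^sub>F e in small. \<bar>X e - c\<bar> < r"
      using cauchyD assms by (auto simp: cmplrel_def)
    have "\<not> posnet Y" if "\<forall>\<^sub>F e in small. Y e < 0" for Y :: "'a \<Rightarrow> 'a"
    proof
      assume "posnet Y"
      then obtain s where s: "0 < s" "\<forall>\<^sub>F e in small. s < Y e" by (auto simp: posnet_def)
      show False
        using eventually_happens'[OF small_nontrivial eventually_conj[OF s(2) that]] s(1) by auto
    qed
    note n = this
    have "\<forall>\<^sub>F e in small. X e + - c + - r < 0" "\<forall>\<^sub>F e in small. c + - X e + - r < 0"
      using c by (eventually_elim, auto simp: abs_if split: if_splits)+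
    then show "\<exists>q. \<not> posnet (\<lambda>e. X e + - q + - r) \<and> \<not> posnet (\<lambda>e. q + - X e + - r)"
      by (intro exI[of _ c] conjI n)
  qed
  then obtain q where "\<not> kr r < x - kr q" "\<not> kr r < kr q - x" by (auto simp: less_cmpl_def)
  then show ?thesis by (intro that[of q]) (auto simp: abs_if)
qed

lemma cmpl_arch:
  assumes "0 < x"
  obtains r where "0 < r" "kr r \<le> x"
proof -
  have "pos_cmpl x \<Longrightarrow> \<exists>r>0. pos_cmpl (x + - kr r)"
  proof (transfer fixing: )
    fix X :: "'a \<Rightarrow> 'a" assume "posnet X"
    then obtain r where r: "0 < r" "\<forall>\<^sub>F e in small. r < X e" by (auto simp: posnet_def)
    from r(2) have "\<forall>\<^sub>F e in small. r / 2 < X e + - (r / 2)" by eventually_elim simp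
    then have "posnet (\<lambda>e. X e + - (r / 2))"
      using r(1) unfolding posnet_def by (meson half_gt_zero)
    then show "\<exists>r>0. posnet (\<lambda>e. X e + - r)" using r(1) by (meson half_gt_zero)
  qed
  then obtain r where "0 < r" "kr r < x" using assms by (auto simp: less_cmpl_def)
  then show ?thesis using that by auto
qed

text \<open>Weak bounds that hold eventually pass to the limit unchanged. This will give the value
  of a model real together with the error \<open>2^-n\<close> of its n-th approximation.\<close>

lemma cmpl_limit:
  assumes "cauchy X"
  obtains x where "\<And>c r. \<forall>\<^sub>F e in small. \<bar>X e - c\<bar> \<le> r \<Longrightarrow> \<bar>x - kr c\<bar> \<le> kr r"
proof -
  have neg: "\<not> posnet Y" if "\<forall>\<^sub>F e in small. Y e \<le> 0" for Y :: "'a \<Rightarrow> 'a"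
  proof
    assume "posnet Y"
    then obtain s where s: "0 < s" "\<forall>\<^sub>F e in small. s < Y e" by (auto simp: posnet_def)
    show False
      using eventually_happens'[OF small_nontrivial eventually_conj[OF s(2) that]] s(1) by auto
  qed
  have "\<exists>x. \<forall>c r. (\<forall>\<^sub>F e in small. \<bar>X e - c\<bar> \<le> r) \<longrightarrow>
      \<not> pos_cmpl (x + - kr c + - kr r) \<and> \<not> pos_cmpl (kr c + - x + - kr r)"
  proof (transfer fixing: X)
    show "\<exists>x\<in>{x. cmplrel x x}. \<forall>c r. (\<forall>\<^sub>F e in small. \<bar>X e - c\<bar> \<le> r) \<longrightarrow>
      \<not> posnet (\<lambda>e. x e + - c + - r) \<and> \<not> posnet (\<lambda>e. c + - x e + - r)"
    proof (intro bexI[of _ X] allI impI conjI)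
      fix c r assume *: "\<forall>\<^sub>F e in small. \<bar>X e - c\<bar> \<le> r"
      have "\<forall>\<^sub>F e in small. X e + - c + - r \<le> 0" "\<forall>\<^sub>F e in small. c + - X e + - r \<le> 0"
        using * by (eventually_elim, auto simp: abs_if split: if_splits)+
      then show "\<not> posnet (\<lambda>e. X e + - c + - r)" "\<not> posnet (\<lambda>e. c + - X e + - r)"
        using neg by simp_all
    qed (simp add: assms cmplrel_refl)
  qed
  then obtain x where x: "\<And>c r. \<forall>\<^sub>F e in small. \<bar>X e - c\<bar> \<le> r \<Longrightarrow>
      \<not> kr r < x - kr c \<and> \<not> kr r < kr c - x" by (auto simp: less_cmpl_def)
  have "\<bar>x - kr c\<bar> \<le> kr r" if "\<forall>\<^sub>F e in small. \<bar>X e - c\<bar> \<le> r" for c r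
    using x[OF that] by (auto simp: abs_if)
  then show ?thesis by (rule that)
qed

subsection \<open>Combinatory completeness in models of arithmetical comprehension\<close>

lemmas sch_defs = eq_s_def less_s_def not_s_def and_s_def or_s_def imp_s_def iff_s_def all_ty_def
  ex_ty_def all_nat_def ex_nat_def le_s_def all_lt_def ex_lt_def all_le_def ex_le_def

lemma wf_eq_ty: "ty_of t = Some \<tau> \<Longrightarrow> ty_of u = Some \<tau> \<Longrightarrow> wf (eq_ty \<tau> t u d)"
  by (induction \<tau> arbitrary: t u d) (simp_all add: sch_defs)

lemma wf_Pi_axiom: "wf (Pi_axiom \<rho> \<tau> d)"
  by (auto simp: Pi_axiom_def all_ty_def intro!: wf_eq_ty)

lemma wf_Sigma_axiom: "wf (Sigma_axiom \<delta> \<rho> \<tau> d)"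
  by (auto simp: Sigma_axiom_def all_ty_def intro!: wf_eq_ty)

lemma wf_ext_axiom: "wf (ext_axiom \<rho> \<tau> d)"
  by (auto simp: ext_axiom_def all_ty_def imp_s_def intro!: wf_eq_ty)

lemma fv_Pi_axiom: "fv (Pi_axiom \<rho> \<tau> 0) = {}"
  using fv_eq_ty[of \<rho> "Con (Pi \<rho> \<tau>) \<cdot> Var (0, \<rho>) \<cdot> Var (1, \<tau>)" "Var (0, \<rho>)" 2]
  by (auto simp: Pi_axiom_def all_ty_def numeral_eq_Suc)

lemma fv_Sigma_axiom: "fv (Sigma_axiom \<delta> \<rho> \<tau> 0) = {}"
  using fv_eq_ty[of \<tau> "Con (Sigma \<delta> \<rho> \<tau>) \<cdot> Var (0, \<delta> \<rightarrow>\<^sub>t \<rho> \<rightarrow>\<^sub>t \<tau>) \<cdot> Var (1, \<delta> \<rightarrow>\<^sub>t \<rho>) \<cdot> Var (2, \<delta>)"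
    "Var (0, \<delta> \<rightarrow>\<^sub>t \<rho> \<rightarrow>\<^sub>t \<tau>) \<cdot> Var (2, \<delta>) \<cdot> (Var (1, \<delta> \<rightarrow>\<^sub>t \<rho>) \<cdot> Var (2, \<delta>))" 3]
  by (auto simp: Sigma_axiom_def all_ty_def numeral_eq_Suc)

lemma val_tm_subst: "val S \<rho> (tm_subst x s t) = val S (\<rho>(x := val S \<rho> s)) t"
  by (induction t) auto

lemma sat_subst: "qfree \<phi> \<Longrightarrow> sat S \<rho> (subst x s \<phi>) \<longleftrightarrow> sat S (\<rho>(x := val S \<rho> s)) \<phi>"
  by (induction \<phi>) (auto simp: val_tm_subst)

lemma fv_subst_qfree: "qfree \<phi> \<Longrightarrow> fv (subst x s \<phi>) \<subseteq> (fv \<phi> - {x}) \<union> tm_vars s"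
proof -
  have "tm_vars (tm_subst x s t) \<subseteq> (tm_vars t - {x}) \<union> tm_vars s" for t by (induction t) auto
  then show "qfree \<phi> \<Longrightarrow> ?thesis" by (induction \<phi>) (simp_all, blast+)
qed

lemma val_cong: "(\<And>z. z \<in> tm_vars t \<Longrightarrow> \<rho> z = \<rho>' z) \<Longrightarrow> val S \<rho> t = val S \<rho>' t"
  by (induction t) auto

lemma sat_cong: "(\<And>z. z \<in> fv \<phi> \<Longrightarrow> \<rho> z = \<rho>' z) \<Longrightarrow> sat S \<rho> \<phi> \<longleftrightarrow> sat S \<rho>' \<phi>"
proof (induction \<phi> arbitrary: \<rho> \<rho>')
  case (Eq t u)
  then show ?case using val_cong[of t \<rho> \<rho>'] val_cong[of u \<rho> \<rho>'] by simp
next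
  case (Less t u)
  then show ?case using val_cong[of t \<rho> \<rho>'] val_cong[of u \<rho> \<rho>'] by simp
next
  case (Imp \<phi> \<psi>)
  then show ?case by (metis UnCI fv.simps(4) sat.simps(4))
next
  case (All x \<phi>)
  have "sat S (\<rho>(x := a)) \<phi> \<longleftrightarrow> sat S (\<rho>'(x := a)) \<phi>" for a
    by (rule All.IH) (use All.prems in auto)
  then show ?case by simp
qed simp

text \<open>Definability is tracked by de Bruijn contexts: a definable object is a function of an
  assignment \<open>e\<close> of the types \<open>G\<close>.\<close>

locale aca_model =
  fixes A :: "fm set" and S :: "nat str"
  assumes model: "is_model A S" and ACA: "ACA0_omega \<subseteq> A"
begin

abbreviation "D \<equiv> dom S"
abbreviation app (infixl "\<bullet>" 95) where "f \<bullet> a \<equiv> ap S f a"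

lemma eqr [simp]: "eqr S a b \<longleftrightarrow> a = b"
  using model unfolding is_model_def by blast

lemma cs_D: "cs S c \<in> D (cst_ty c)"
  using model unfolding is_model_def by blast

lemma ap_D: "f \<in> D (\<sigma> \<rightarrow>\<^sub>t \<tau>) \<Longrightarrow> a \<in> D \<sigma> \<Longrightarrow> f \<bullet> a \<in> D \<tau>"
  using model unfolding is_model_def by blast

lemma D_ext: "f \<in> D (\<sigma> \<rightarrow>\<^sub>t \<tau>) \<Longrightarrow> g \<in> D (\<sigma> \<rightarrow>\<^sub>t \<tau>) \<Longrightarrow> (\<And>a. a \<in> D \<sigma> \<Longrightarrow> f \<bullet> a = g \<bullet> a) \<Longrightarrow> f = g"
  using model unfolding is_model_def by blast

lemma sat_proves:
  assumes "A \<turnstile> \<phi>" "fv \<phi> = {}"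
  obtains \<rho> where "\<rho> \<in> env S" "sat S \<rho> \<phi>"
  using model assms unfolding is_model_def by blast

lemma sat_axiom:
  assumes "\<phi> \<in> ACA0_omega" "wf \<phi>" "fv \<phi> = {}"
  obtains \<rho> where "\<rho> \<in> env S" "sat S \<rho> \<phi>"
proof -
  have "A \<turnstile> \<phi>" unfolding proves_def using assms ACA by (intro deriv.Axiom) auto
  from sat_proves[OF this assms(3)] that show ?thesis by blast
qed

lemma eqx_iff: "a \<in> D \<tau> \<Longrightarrow> b \<in> D \<tau> \<Longrightarrow> eqx S \<tau> a b \<longleftrightarrow> a = b"
proof (induction \<tau> arbitrary: a b)
  case (Fun \<sigma> \<tau>)
  have "eqx S (\<sigma> \<rightarrow>\<^sub>t \<tau>) a b \<longleftrightarrow> (\<forall>c\<in>D \<sigma>. a \<bullet> c = b \<bullet> c)"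
    using Fun.IH(2) Fun.prems ap_D by auto
  then show ?case using D_ext[OF Fun.prems] by auto
qed simp

lemma Pi_D: "cs S (Pi \<sigma> \<tau>) \<in> D (\<sigma> \<rightarrow>\<^sub>t \<tau> \<rightarrow>\<^sub>t \<sigma>)"
  using cs_D[of "Pi \<sigma> \<tau>"] by simp

lemma Sigma_D: "cs S (Sigma \<delta> \<sigma> \<tau>) \<in> D ((\<delta> \<rightarrow>\<^sub>t \<sigma> \<rightarrow>\<^sub>t \<tau>) \<rightarrow>\<^sub>t (\<delta> \<rightarrow>\<^sub>t \<sigma>) \<rightarrow>\<^sub>t \<delta> \<rightarrow>\<^sub>t \<tau>)"
  using cs_D[of "Sigma \<delta> \<sigma> \<tau>"] by simp

lemma Pi_app: 
  assumes "a \<in> D \<sigma>" "b \<in> D \<tau>"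
  shows "cs S (Pi \<sigma> \<tau>) \<bullet> a \<bullet> b = a"
proof -
  have "Pi_axiom \<sigma> \<tau> 0 \<in> ACA0_omega" unfolding ACA0_omega_def RCA0_omega_def by blast
  from sat_axiom[OF this wf_Pi_axiom fv_Pi_axiom] obtain \<rho> where "sat S \<rho> (Pi_axiom \<sigma> \<tau> 0)" by blast
  then have "eqx S \<sigma> (cs S (Pi \<sigma> \<tau>) \<bullet> a \<bullet> b) a"
    using assms by (simp add: Pi_axiom_def all_ty_def sat_eq_ty)
  then show ?thesis
    using eqx_iff[of _ \<sigma>] assms ap_D[OF ap_D[OF Pi_D]] by blast
qed

lemma Sigma_app: 
  assumes "f \<in> D (\<delta> \<rightarrow>\<^sub>t \<sigma> \<rightarrow>\<^sub>t \<tau>)" "g \<in> D (\<delta> \<rightarrow>\<^sub>t \<sigma>)" "a \<in> D \<delta>"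
  shows "cs S (Sigma \<delta> \<sigma> \<tau>) \<bullet> f \<bullet> g \<bullet> a = f \<bullet> a \<bullet> (g \<bullet> a)"
proof -
  have "Sigma_axiom \<delta> \<sigma> \<tau> 0 \<in> ACA0_omega" unfolding ACA0_omega_def RCA0_omega_def by blast
  from sat_axiom[OF this wf_Sigma_axiom fv_Sigma_axiom] obtain \<rho> where "sat S \<rho> (Sigma_axiom \<delta> \<sigma> \<tau> 0)" by blast
  then have "eqx S \<tau> (cs S (Sigma \<delta> \<sigma> \<tau>) \<bullet> f \<bullet> g \<bullet> a) (f \<bullet> a \<bullet> (g \<bullet> a))"
    using assms by (simp add: Sigma_axiom_def all_ty_def sat_eq_ty)
  moreover have "f \<bullet> a \<bullet> (g \<bullet> a) \<in> D \<tau>" using assms ap_D by blast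
  moreover have "cs S (Sigma \<delta> \<sigma> \<tau>) \<bullet> f \<bullet> g \<bullet> a \<in> D \<tau>"
    using ap_D[OF ap_D[OF ap_D[OF Sigma_D]]] assms by blast
  ultimately show ?thesis using eqx_iff[of _ \<tau>] by blast
qed

definition genv :: "(nat \<Rightarrow> ty) \<Rightarrow> (nat \<Rightarrow> nat) set" where
  "genv G = {e. \<forall>i. e i \<in> D (G i)}"

inductive dfn0 :: "(nat \<Rightarrow> ty) \<Rightarrow> ty \<Rightarrow> ((nat \<Rightarrow> nat) \<Rightarrow> nat) \<Rightarrow> bool" for G where
  const: "p \<in> D \<tau> \<Longrightarrow> dfn0 G \<tau> (\<lambda>e. p)"
| var: "dfn0 G (G i) (\<lambda>e. e i)"
| app: "dfn0 G (\<sigma> \<rightarrow>\<^sub>t \<tau>) F \<Longrightarrow> dfn0 G \<sigma> X \<Longrightarrow> dfn0 G \<tau> (\<lambda>e. F e \<bullet> X e)"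

lemma dfn0_D: "dfn0 G \<tau> F \<Longrightarrow> e \<in> genv G \<Longrightarrow> F e \<in> D \<tau>"
  by (induction rule: dfn0.induct) (auto simp: genv_def intro: ap_D)

text \<open>Agreement is required on well-typed assignments only, so a definition may be rewritten
  by any equation that is valid there.\<close>

definition dfn :: "(nat \<Rightarrow> ty) \<Rightarrow> ty \<Rightarrow> ((nat \<Rightarrow> nat) \<Rightarrow> nat) \<Rightarrow> bool" where
  "dfn G \<tau> F \<longleftrightarrow> (\<exists>F'. dfn0 G \<tau> F' \<and> (\<forall>e\<in>genv G. F e = F' e))"

lemma dfn_D: "dfn G \<tau> F \<Longrightarrow> e \<in> genv G \<Longrightarrow> F e \<in> D \<tau>"
  by (auto simp: dfn_def intro: dfn0_D)

lemma dfn_const: "p \<in> D \<tau> \<Longrightarrow> dfn G \<tau> (\<lambda>e. p)"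
  unfolding dfn_def using dfn0.const by blast

lemma dfn_var: "G i = \<tau> \<Longrightarrow> dfn G \<tau> (\<lambda>e. e i)"
  unfolding dfn_def using dfn0.var[of G i] by blast

lemma dfn_app:
  assumes "dfn G (\<sigma> \<rightarrow>\<^sub>t \<tau>) F" "dfn G \<sigma> X"
  shows "dfn G \<tau> (\<lambda>e. F e \<bullet> X e)"
proof -
  obtain F' X' where "dfn0 G (\<sigma> \<rightarrow>\<^sub>t \<tau>) F'" "\<forall>e\<in>genv G. F e = F' e" "dfn0 G \<sigma> X'" "\<forall>e\<in>genv G. X e = X' e"
    using assms by (auto simp: dfn_def)
  then show ?thesis
    unfolding dfn_def by (intro exI[of _ "\<lambda>e. F' e \<bullet> X' e"]) (auto intro: dfn0.app)
qed

lemma dfn_cong: "(\<And>e. e \<in> genv G \<Longrightarrow> F e = F' e) \<Longrightarrow> dfn G \<tau> F \<longleftrightarrow> dfn G \<tau> F'"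
  by (auto simp: dfn_def)

lemma genv_case: "a \<in> D \<sigma> \<Longrightarrow> e \<in> genv G \<Longrightarrow> case_nat a e \<in> genv (case_nat \<sigma> G)"
  by (auto simp: genv_def split: nat.splits)

lemma genv_caseD: "e \<in> genv (case_nat \<sigma> G) \<Longrightarrow> e 0 \<in> D \<sigma>" "e \<in> genv (case_nat \<sigma> G) \<Longrightarrow> (\<lambda>i. e (Suc i)) \<in> genv G"
  unfolding genv_def by (force dest: spec[of _ 0] spec[of _ "Suc _"])+

text \<open>Bracket abstraction: constants and the other variables go through \<open>Pi\<close>, the
  abstracted variable becomes the identity built from \<open>Sigma\<close> and two copies of
  \<open>Pi\<close>, and applications go through \<open>Sigma\<close>.\<close>

lemma dfn0_lam: "dfn0 (case_nat \<sigma> G) \<tau> F \<Longrightarrow>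
  \<exists>F'. dfn0 G (\<sigma> \<rightarrow>\<^sub>t \<tau>) F' \<and> (\<forall>e\<in>genv G. \<forall>a\<in>D \<sigma>. F' e \<bullet> a = F (case_nat a e))"
proof (induction rule: dfn0.induct)
  case (const p \<tau>)
  then have "dfn0 G (\<sigma> \<rightarrow>\<^sub>t \<tau>) (\<lambda>e. cs S (Pi \<tau> \<sigma>) \<bullet> p)"
    by (intro dfn0.app[where \<sigma> = \<tau>] dfn0.const Pi_D)
  then show ?case using Pi_app const by blast
next
  case (var i)
  show ?case
  proof (cases i)
    case 0
    let ?I = "cs S (Sigma \<sigma> (\<sigma> \<rightarrow>\<^sub>t \<sigma>) \<sigma>) \<bullet> cs S (Pi \<sigma> (\<sigma> \<rightarrow>\<^sub>t \<sigma>)) \<bullet> cs S (Pi \<sigma> \<sigma>)"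
    have "?I \<in> D (\<sigma> \<rightarrow>\<^sub>t \<sigma>)" by (rule ap_D[OF ap_D[OF Sigma_D Pi_D] Pi_D])
    moreover have "?I \<bullet> a = a" if "a \<in> D \<sigma>" for a
      using that Sigma_app[OF Pi_D Pi_D that] Pi_app[OF that ap_D[OF Pi_D that]] by simp
    ultimately show ?thesis
      using 0 dfn0.const by (intro exI[of _ "\<lambda>e. ?I"]) auto
  next
    case (Suc j)
    have "dfn0 G (\<sigma> \<rightarrow>\<^sub>t G j) (\<lambda>e. cs S (Pi (G j) \<sigma>) \<bullet> e j)"
      by (intro dfn0.app[where \<sigma> = "G j"] dfn0.const dfn0.var Pi_D)
    then show ?thesis using Suc Pi_app by (auto simp: genv_def)
  qed
next
  case (app \<rho> \<tau> F X)
  then obtain F' X' where F': "dfn0 G (\<sigma> \<rightarrow>\<^sub>t \<rho> \<rightarrow>\<^sub>t \<tau>) F'" "\<forall>e\<in>genv G. \<forall>a\<in>D \<sigma>. F' e \<bullet> a = F (case_nat a e)"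
    and X': "dfn0 G (\<sigma> \<rightarrow>\<^sub>t \<rho>) X'" "\<forall>e\<in>genv G. \<forall>a\<in>D \<sigma>. X' e \<bullet> a = X (case_nat a e)"
    by blast
  have "dfn0 G (\<sigma> \<rightarrow>\<^sub>t \<tau>) (\<lambda>e. cs S (Sigma \<sigma> \<rho> \<tau>) \<bullet> F' e \<bullet> X' e)"
    by (rule dfn0.app[OF dfn0.app[OF dfn0.const[OF Sigma_D] F'(1)] X'(1)])
  moreover have "cs S (Sigma \<sigma> \<rho> \<tau>) \<bullet> F' e \<bullet> X' e \<bullet> a = F (case_nat a e) \<bullet> X (case_nat a e)"
    if "e \<in> genv G" "a \<in> D \<sigma>" for e a
    using that F' X' Sigma_app[OF dfn0_D[OF F'(1)] dfn0_D[OF X'(1)]] by simp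
  ultimately show ?case by blast
qed

text \<open>Extensionality of the model makes the abstraction unique, so it can be described by its
  values without naming a combinator term.\<close>

definition Lam :: "ty \<Rightarrow> ty \<Rightarrow> (nat \<Rightarrow> nat) \<Rightarrow> nat" where
  "Lam \<sigma> \<tau> F = (THE f. f \<in> D (\<sigma> \<rightarrow>\<^sub>t \<tau>) \<and> (\<forall>a\<in>D \<sigma>. f \<bullet> a = F a))"

lemma Lam_eq:
  assumes "f \<in> D (\<sigma> \<rightarrow>\<^sub>t \<tau>)" "\<And>a. a \<in> D \<sigma> \<Longrightarrow> f \<bullet> a = F a"
  shows "Lam \<sigma> \<tau> F = f"
  unfolding Lam_def
proof (rule the_equality)
  show "f \<in> D (\<sigma> \<rightarrow>\<^sub>t \<tau>) \<and> (\<forall>a\<in>D \<sigma>. f \<bullet> a = F a)" using assms by blast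
  fix g assume g: "g \<in> D (\<sigma> \<rightarrow>\<^sub>t \<tau>) \<and> (\<forall>a\<in>D \<sigma>. g \<bullet> a = F a)"
  show "g = f" by (rule D_ext) (use g assms in auto)
qed

lemma dfn_lam_aux:
  assumes "dfn (case_nat \<sigma> G) \<tau> (\<lambda>e. F (\<lambda>i. e (Suc i)) (e 0))"
  obtains F' where "dfn0 G (\<sigma> \<rightarrow>\<^sub>t \<tau>) F'" "\<And>e. e \<in> genv G \<Longrightarrow> Lam \<sigma> \<tau> (F e) = F' e"
    "\<And>e a. e \<in> genv G \<Longrightarrow> a \<in> D \<sigma> \<Longrightarrow> F' e \<bullet> a = F e a"
proof -
  obtain H where H: "dfn0 (case_nat \<sigma> G) \<tau> H"
    "\<forall>e\<in>genv (case_nat \<sigma> G). F (\<lambda>i. e (Suc i)) (e 0) = H e" using assms by (auto simp: dfn_def)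
  obtain F' where F': "dfn0 G (\<sigma> \<rightarrow>\<^sub>t \<tau>) F'" "\<forall>e\<in>genv G. \<forall>a\<in>D \<sigma>. F' e \<bullet> a = H (case_nat a e)"
    using dfn0_lam[OF H(1)] by blast
  have *: "F' e \<bullet> a = F e a" if "e \<in> genv G" "a \<in> D \<sigma>" for e a
    using F'(2) H(2) genv_case[OF that(2,1)] that by fastforce
  have "Lam \<sigma> \<tau> (F e) = F' e" if "e \<in> genv G" for e
    by (rule Lam_eq[OF dfn0_D[OF F'(1) that]]) (rule *[OF that])
  with F'(1) * that show ?thesis by blast
qed

lemma dfn_Lam:
  assumes "dfn (case_nat \<sigma> G) \<tau> (\<lambda>e. F (\<lambda>i. e (Suc i)) (e 0))"
  shows "dfn G (\<sigma> \<rightarrow>\<^sub>t \<tau>) (\<lambda>e. Lam \<sigma> \<tau> (F e))"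
  using dfn_lam_aux[OF assms] unfolding dfn_def by metis

lemma Lam_app:
  assumes "dfn (case_nat \<sigma> G) \<tau> (\<lambda>e. F (\<lambda>i. e (Suc i)) (e 0))" "e \<in> genv G" "a \<in> D \<sigma>"
  shows "Lam \<sigma> \<tau> (F e) \<bullet> a = F e a"
  using dfn_lam_aux[OF assms(1)] assms by metis

lemma dfn_weaken:
  assumes "dfn G \<tau> F"
  shows "dfn (case_nat \<sigma> G) \<tau> (\<lambda>e. F (\<lambda>i. e (Suc i)))"
proof -
  obtain F' where F': "dfn0 G \<tau> F'" "\<forall>e\<in>genv G. F e = F' e" using assms by (auto simp: dfn_def)
  have "dfn0 (case_nat \<sigma> G) \<tau> (\<lambda>e. F' (\<lambda>i. e (Suc i)))"
    using F'(1)
  proof (induction rule: dfn0.induct)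
    case (var i)
    then show ?case using dfn0.var[of "case_nat \<sigma> G" "Suc i"] by simp
  qed (auto intro: dfn0.intros)
  moreover have "\<forall>e\<in>genv (case_nat \<sigma> G). F (\<lambda>i. e (Suc i)) = F' (\<lambda>i. e (Suc i))"
    using F'(2) genv_caseD(2) by blast
  ultimately show ?thesis unfolding dfn_def by blast
qed

subsection \<open>Arithmetic in the model\<close>

abbreviation zr where "zr \<equiv> cs S Zero"
abbreviation on where "on \<equiv> cs S One"
abbreviation pl where "pl a b \<equiv> cs S Plus \<bullet> a \<bullet> b"
abbreviation ti where "ti a b \<equiv> cs S Times \<bullet> a \<bullet> b"

lemma zr_D [simp]: "zr \<in> D N" and on_D [simp]: "on \<in> D N"
  using cs_D[of Zero] cs_D[of One] by simp_all

lemma pl_D [simp]: "a \<in> D N \<Longrightarrow> b \<in> D N \<Longrightarrow> pl a b \<in> D N"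
  using cs_D[of Plus] by (auto intro: ap_D)

lemma ti_D [simp]: "a \<in> D N \<Longrightarrow> b \<in> D N \<Longrightarrow> ti a b \<in> D N"
  using cs_D[of Times] by (auto intro: ap_D)

lemma dfn_pl: "dfn G N a \<Longrightarrow> dfn G N b \<Longrightarrow> dfn G N (\<lambda>e. pl (a e) (b e))"
  using cs_D[of Plus] by (auto intro!: dfn_app[where \<sigma> = N] dfn_const)

lemma dfn_ti: "dfn G N a \<Longrightarrow> dfn G N b \<Longrightarrow> dfn G N (\<lambda>e. ti (a e) (b e))"
  using cs_D[of Times] by (auto intro!: dfn_app[where \<sigma> = N] dfn_const)

lemma basic:
  assumes "F \<in> {\<^bold>\<forall>m. \<^bold>\<not> m \<^bold>+ \<^bold>1 \<^bold>= \<^bold>0,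
     \<^bold>\<forall>m. \<^bold>\<forall>n. m \<^bold>+ \<^bold>1 \<^bold>= n \<^bold>+ \<^bold>1 \<^bold>\<longrightarrow> m \<^bold>= n,
     \<^bold>\<forall>m. m \<^bold>+ \<^bold>0 \<^bold>= m,
     \<^bold>\<forall>m. \<^bold>\<forall>n. m \<^bold>+ (n \<^bold>+ \<^bold>1) \<^bold>= (m \<^bold>+ n) \<^bold>+ \<^bold>1,
     \<^bold>\<forall>m. m \<^bold>* \<^bold>0 \<^bold>= \<^bold>0,
     \<^bold>\<forall>m. \<^bold>\<forall>n. m \<^bold>* (n \<^bold>+ \<^bold>1) \<^bold>= m \<^bold>* n \<^bold>+ m,
     \<^bold>\<forall>m. \<^bold>\<not> m \<^bold>< \<^bold>0,
     \<^bold>\<forall>m. \<^bold>\<forall>n. m \<^bold>< n \<^bold>+ \<^bold>1 \<^bold>\<longleftrightarrow> m \<^bold>< n \<^bold>\<or> m \<^bold>= n}"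
  obtains \<rho> where "sat S \<rho> (F 0)"
proof -
  have "F 0 \<in> ACA0_omega"
    unfolding ACA0_omega_def RCA0_omega_def basic_axioms_def by (intro UnI1) (rule imageI[OF assms])
  moreover have "wf (F 0)" "fv (F 0) = {}"
    using assms by (auto simp: sch_defs)
  ultimately show ?thesis using sat_axiom that by blast
qed

lemma peano:
  assumes "a \<in> D N" "b \<in> D N"
  shows "pl a on \<noteq> zr" "pl a on = pl b on \<Longrightarrow> a = b" "pl a zr = a" "pl a (pl b on) = pl (pl a b) on"
    "ti a zr = zr" "ti a (pl b on) = pl (ti a b) a" "\<not> ltr S a zr" "ltr S a (pl b on) \<longleftrightarrow> ltr S a b \<or> a = b"
proof -
  show "pl a on \<noteq> zr"
    by (rule basic[of "\<^bold>\<forall>m. \<^bold>\<not> m \<^bold>+ \<^bold>1 \<^bold>= \<^bold>0"]) (use assms in \<open>auto simp: sch_defs\<close>)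
  show "pl a on = pl b on \<Longrightarrow> a = b"
    by (rule basic[of "\<^bold>\<forall>m. \<^bold>\<forall>n. m \<^bold>+ \<^bold>1 \<^bold>= n \<^bold>+ \<^bold>1 \<^bold>\<longrightarrow> m \<^bold>= n"]) (use assms in \<open>auto simp: sch_defs\<close>)
  show "pl a zr = a"
    by (rule basic[of "\<^bold>\<forall>m. m \<^bold>+ \<^bold>0 \<^bold>= m"]) (use assms in \<open>auto simp: sch_defs\<close>)
  show "pl a (pl b on) = pl (pl a b) on"
    by (rule basic[of "\<^bold>\<forall>m. \<^bold>\<forall>n. m \<^bold>+ (n \<^bold>+ \<^bold>1) \<^bold>= (m \<^bold>+ n) \<^bold>+ \<^bold>1"]) (use assms in \<open>auto simp: sch_defs\<close>)
  show "ti a zr = zr"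
    by (rule basic[of "\<^bold>\<forall>m. m \<^bold>* \<^bold>0 \<^bold>= \<^bold>0"]) (use assms in \<open>auto simp: sch_defs\<close>)
  show "ti a (pl b on) = pl (ti a b) a"
    by (rule basic[of "\<^bold>\<forall>m. \<^bold>\<forall>n. m \<^bold>* (n \<^bold>+ \<^bold>1) \<^bold>= m \<^bold>* n \<^bold>+ m"]) (use assms in \<open>auto simp: sch_defs\<close>)
  show "\<not> ltr S a zr"
    by (rule basic[of "\<^bold>\<forall>m. \<^bold>\<not> m \<^bold>< \<^bold>0"]) (use assms in \<open>auto simp: sch_defs\<close>)
  show "ltr S a (pl b on) \<longleftrightarrow> ltr S a b \<or> a = b"
    by (rule basic[of "\<^bold>\<forall>m. \<^bold>\<forall>n. m \<^bold>< n \<^bold>+ \<^bold>1 \<^bold>\<longleftrightarrow> m \<^bold>< n \<^bold>\<or> m \<^bold>= n"]) (use assms in \<open>auto simp: sch_defs\<close>)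
qed

lemma Rec_D: "cs S Rec \<in> D ((N \<rightarrow>\<^sub>t N \<rightarrow>\<^sub>t N) \<rightarrow>\<^sub>t N \<rightarrow>\<^sub>t N \<rightarrow>\<^sub>t N)"
  using cs_D[of Rec] by simp

lemma Rec_app:
  assumes "f \<in> D (N \<rightarrow>\<^sub>t N \<rightarrow>\<^sub>t N)" "m \<in> D N" "n \<in> D N"
  shows "cs S Rec \<bullet> f \<bullet> m \<bullet> zr = m" "cs S Rec \<bullet> f \<bullet> m \<bullet> (pl n on) = f \<bullet> n \<bullet> (cs S Rec \<bullet> f \<bullet> m \<bullet> n)"
proof -
  have "Rec_axiom 0 \<in> ACA0_omega" unfolding ACA0_omega_def RCA0_omega_def by blast
  moreover have "wf (Rec_axiom 0)" "fv (Rec_axiom 0) = {}" by (auto simp: Rec_axiom_def sch_defs)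
  ultimately obtain \<rho> where "sat S \<rho> (Rec_axiom 0)" using sat_axiom by blast
  then show "cs S Rec \<bullet> f \<bullet> m \<bullet> zr = m" "cs S Rec \<bullet> f \<bullet> m \<bullet> (pl n on) = f \<bullet> n \<bullet> (cs S Rec \<bullet> f \<bullet> m \<bullet> n)"
    using assms by (auto simp: Rec_axiom_def sch_defs)
qed

text \<open>The axiom has the free variable \<open>(0, T1)\<close>. Closing it by generalisation
  lets an arbitrary type-1 object \<open>f\<close> of the model serve as parameter.\<close>

lemma qf_ind:
  assumes "wf \<phi>" "qfree \<phi>" "fv \<phi> \<subseteq> {(0, T1), (1, N)}"
    and "f \<in> D T1" "sat S ((\<lambda>_. f)((1, N) := zr)) \<phi>"
    "\<And>a. a \<in> D N \<Longrightarrow> sat S ((\<lambda>_. f)((1, N) := a)) \<phi> \<Longrightarrow> sat S ((\<lambda>_. f)((1, N) := pl a on)) \<phi>" "b \<in> D N"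
  shows "sat S ((\<lambda>_. f)((1, N) := b)) \<phi>"
proof -
  note sub = sat_subst[OF assms(2)] and fvs = fv_subst_qfree[OF assms(2)]
  define \<psi> where "\<psi> = Imp (Conj (subst (1, N) \<^bold>0 \<phi>)
               (All (1, N) (Imp \<phi> (subst (1, N) (Var (1, N) \<^bold>+ \<^bold>1) \<phi>))))
         (All (1, N) \<phi>)"
  have "\<psi> \<in> ACA0_omega"
    using assms(1,2) by (auto simp: ACA0_omega_def RCA0_omega_def qf_induction_def \<psi>_def)
  moreover have "wf \<psi>" using assms(1) by (auto simp: \<psi>_def wf_subst)
  ultimately have "A \<turnstile> \<psi>" unfolding proves_def using ACA by (intro deriv.Axiom) auto
  then have "A \<turnstile> All (0, T1) \<psi>" by (rule proves_GEN)
  moreover have "fv (All (0, T1) \<psi>) = {}"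
    using assms(3) fvs[of "(1, N)" "\<^bold>0"] fvs[of "(1, N)" "Var (1, N) \<^bold>+ \<^bold>1"] by (auto simp: \<psi>_def)
  ultimately obtain \<rho> where "sat S \<rho> (All (0, T1) \<psi>)" using sat_proves by blast
  then have *: "sat S (\<rho>((0, T1) := f)) \<psi>" using assms(4) by simp
  have c: "sat S (\<rho>((0, T1) := f, (1, N) := a)) \<phi> \<longleftrightarrow> sat S ((\<lambda>_. f)((1, N) := a)) \<phi>" for a
    by (rule sat_cong) (use assms(3) in auto)
  show ?thesis
    using * assms(5,6,7) by (simp add: \<psi>_def sub c del: One_nat_def)
qed

text \<open>Commutativity is not yet available. This one instance of it already evaluates the
  recursor at \<open>on\<close>, on which the pairs \<open>pr\<close> and with them the calculus of
  definable predicates rest.\<close>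

lemma zero_pl_one: "pl zr on = on"
proof -
  \<comment> \<open>A dummy value for the type-1 parameter of \<open>qf_ind\<close>.\<close>
  have "Lam N N (\<lambda>_. zr) \<in> D T1"
    using dfn_D[OF dfn_Lam[of N "\<lambda>_. N" N "\<lambda>_ _. zr"], of "\<lambda>_. zr"] by (simp add: dfn_const genv_def)
  from qf_ind[OF _ _ _ this, of "Eq (\<^bold>0 \<^bold>+ Var (1, N)) (Var (1, N))" on]
  have "(pl zr zr = zr) \<Longrightarrow> (\<And>a. a \<in> D N \<Longrightarrow> pl zr a = a \<Longrightarrow> pl zr (pl a on) = pl a on) \<Longrightarrow> ?thesis"
    by simp
  then show ?thesis using peano(3)[OF zr_D zr_D] peano(4)[OF zr_D] by metis
qed

lemma T1_ind:
  assumes "f \<in> D T1" "f \<bullet> zr = on" "\<And>a. a \<in> D N \<Longrightarrow> f \<bullet> a = on \<Longrightarrow> f \<bullet> (pl a on) = on" "b \<in> D N"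
  shows "f \<bullet> b = on"
  using qf_ind[of "Eq (Var (0, T1) \<cdot> Var (1, N)) \<^bold>1" f b] assms by auto

text \<open>Index 0 is the argument, 1 the value, 2 the choice functional and 3 a type-2 parameter,
  which is closed off by generalisation.\<close>

lemma QF_AC:
  assumes "wf \<phi>" "qfree \<phi>" "fv \<phi> \<subseteq> {(0, T1), (1, N), (3, T2)}" "p \<in> D T2"
    and "\<And>f. f \<in> D T1 \<Longrightarrow> \<exists>n\<in>D N. sat S ((\<lambda>_. p)((0, T1) := f, (1, N) := n)) \<phi>"
  obtains k where "k \<in> D T2" "\<And>f. f \<in> D T1 \<Longrightarrow> sat S ((\<lambda>_. p)((0, T1) := f, (1, N) := k \<bullet> f)) \<phi>"
proof -
  note sub = sat_subst[OF assms(2)] and fvs = fv_subst_qfree[OF assms(2)]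
  define \<psi> where "\<psi> = Imp (All (0, T1) (Ex (1, N) \<phi>))
    (Ex (2, T2) (All (0, T1) (subst (1, N) (Var (2, T2) \<cdot> Var (0, T1)) \<phi>)))"
  have "(2, T2) \<notin> fv \<phi>" using assms(3) by auto
  then have "\<psi> \<in> ACA0_omega"
    using assms(1,2) unfolding ACA0_omega_def RCA0_omega_def QF_AC_1_0_def \<psi>_def by blast
  moreover have "wf \<psi>" using assms(1) by (auto simp: \<psi>_def wf_subst)
  ultimately have "A \<turnstile> \<psi>" unfolding proves_def using ACA by (intro deriv.Axiom) auto
  then have "A \<turnstile> All (3, T2) \<psi>" by (rule proves_GEN)
  moreover have "fv (All (3, T2) \<psi>) = {}"
    using assms(3) fvs[of "(1, N)" "Var (2, T2) \<cdot> Var (0, T1)"] by (auto simp: \<psi>_def)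
  ultimately obtain \<rho> where "sat S \<rho> (All (3, T2) \<psi>)" using sat_proves by blast
  then have *: "sat S (\<rho>((3, T2) := p)) \<psi>" using assms(4) by simp
  have c: "sat S (\<rho>((3, T2) := p, (0, T1) := f, (1, N) := a)) \<phi> \<longleftrightarrow> sat S ((\<lambda>_. p)((0, T1) := f, (1, N) := a)) \<phi>"
    "sat S (\<rho>((3, T2) := p, (2, T2) := k, (0, T1) := f, (1, N) := a)) \<phi> \<longleftrightarrow> sat S ((\<lambda>_. p)((0, T1) := f, (1, N) := a)) \<phi>" for f a k
    by (rule sat_cong; use assms(3) in auto)+
  have "\<exists>k\<in>D T2. \<forall>f\<in>D T1. sat S ((\<lambda>_. p)((0, T1) := f, (1, N) := k \<bullet> f)) \<phi>"
    using * assms(5) by (simp add: \<psi>_def sub c del: One_nat_def)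
  with that show ?thesis by blast
qed

end

section \<open>Definable predicates: connectives, number quantifiers, choice and induction\<close>

context aca_model
begin

lemma dfn_weaken2: "dfn G \<tau> F \<Longrightarrow> dfn (case_nat \<sigma> (case_nat \<sigma>' G)) \<tau> (\<lambda>e. F (\<lambda>i. e (Suc (Suc i))))"
  using dfn_weaken[OF dfn_weaken[of G \<tau> F \<sigma>'], of \<sigma>] by simp

text \<open>Two numbers become the values of one function at \<open>zr\<close> and
  \<open>on\<close>. The functionals provided by QF-AC take a function as argument, so in this form
  they can decide relations between two numbers.\<close>

definition pr :: "nat \<Rightarrow> nat \<Rightarrow> nat" where
  "pr x y = cs S Rec \<bullet> (Lam N (N \<rightarrow>\<^sub>t N) (\<lambda>_. Lam N N (\<lambda>_. y))) \<bullet> x"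

lemma dfn_pr: 
  assumes "dfn G N F" "dfn G N F'"
  shows "dfn G T1 (\<lambda>e. pr (F e) (F' e))"
  unfolding pr_def
  by (intro dfn_app[where \<sigma> = N] dfn_app[where \<sigma> = "N \<rightarrow>\<^sub>t N \<rightarrow>\<^sub>t N"] dfn_const[OF Rec_D] dfn_Lam dfn_weaken2 assms)

lemma genv_N: "(\<lambda>_. zr) \<in> genv (\<lambda>_. N)"
  by (simp add: genv_def)

lemma pr_D: "x \<in> D N \<Longrightarrow> y \<in> D N \<Longrightarrow> pr x y \<in> D T1"
  using dfn_D[OF dfn_pr[of "\<lambda>_. N" "\<lambda>_. x" "\<lambda>_. y"] genv_N] by (simp add: dfn_const)

lemma pr_app:
  assumes "x \<in> D N" "y \<in> D N"
  shows "pr x y \<bullet> zr = x" "pr x y \<bullet> on = y"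
proof -
  let ?L = "Lam N N (\<lambda>_. y)"
  have 1: "dfn G T1 (\<lambda>_. ?L)" for G
    by (intro dfn_Lam dfn_const assms)
  then have 2: "dfn G (N \<rightarrow>\<^sub>t N \<rightarrow>\<^sub>t N) (\<lambda>_. Lam N (N \<rightarrow>\<^sub>t N) (\<lambda>_. ?L))" for G
    by (rule dfn_Lam)
  have L: "?L \<in> D T1" "Lam N (N \<rightarrow>\<^sub>t N) (\<lambda>_. ?L) \<in> D (N \<rightarrow>\<^sub>t N \<rightarrow>\<^sub>t N)"
    using dfn_D[OF 1 genv_N] dfn_D[OF 2 genv_N] .
  have 3: "Lam N (N \<rightarrow>\<^sub>t N) (\<lambda>_. ?L) \<bullet> a = ?L" if "a \<in> D N" for a
    using Lam_app[OF 1 genv_N that] by simp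
  have 4: "?L \<bullet> a = y" if "a \<in> D N" for a
    using Lam_app[of N "\<lambda>_. N" N "\<lambda>_ _. y", OF dfn_const genv_N that] assms by simp
  show x: "pr x y \<bullet> zr = x" using Rec_app(1)[OF L(2) assms(1) zr_D] by (simp add: pr_def)
  have "pr x y \<bullet> (pl zr on) = y"
    using Rec_app(2)[OF L(2) assms(1) zr_D] x assms 3 4 by (simp add: pr_def)
  then show "pr x y \<bullet> on = y" by (simp add: zero_pl_one)
qed

definition b01 :: "bool \<Rightarrow> nat" where "b01 P = (if P then on else zr)"

lemma b01_D [simp]: "b01 P \<in> D N"
  by (simp add: b01_def)

lemma on_zr: "on \<noteq> zr"
  using peano(1)[OF zr_D zr_D] zero_pl_one by simp

lemma b01_eq: "b01 P = on \<longleftrightarrow> P" "b01 P = zr \<longleftrightarrow> \<not> P"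
  using on_zr by (auto simp: b01_def)

definition dfnP :: "(nat \<Rightarrow> ty) \<Rightarrow> ((nat \<Rightarrow> nat) \<Rightarrow> bool) \<Rightarrow> bool" where
  "dfnP G P \<longleftrightarrow> dfn G N (\<lambda>e. b01 (P e))"

lemma dfnP_cong: "(\<And>e. e \<in> genv G \<Longrightarrow> P e = P' e) \<Longrightarrow> dfnP G P \<longleftrightarrow> dfnP G P'"
  unfolding dfnP_def by (rule dfn_cong) simp

lemma dfn_congI: "dfn G \<tau> F \<Longrightarrow> (\<And>e. e \<in> genv G \<Longrightarrow> F e = F' e) \<Longrightarrow> dfn G \<tau> F'"
  using dfn_cong[of G F F' \<tau>] by simp

lemma dfnP_congI: "dfnP G P \<Longrightarrow> (\<And>e. e \<in> genv G \<Longrightarrow> P e = P' e) \<Longrightarrow> dfnP G P'"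
  using dfnP_cong[of G P P'] by simp

text \<open>The graph of the characteristic function is quantifier-free, so QF-AC produces the
  function itself.\<close>

lemma eq_functional:
  obtains k where "k \<in> D T2" "\<And>f. f \<in> D T1 \<Longrightarrow> k \<bullet> f = b01 (f \<bullet> zr = f \<bullet> on)"
proof -
  let ?e = "Eq (Var (0, T1) \<cdot> \<^bold>0) (Var (0, T1) \<cdot> \<^bold>1)"
  let ?\<phi> = "Disj (Conj (Eq (Var (1, N)) \<^bold>1) ?e) (Conj (Eq (Var (1, N)) \<^bold>0) (Neg ?e))"
  have T2: "Lam T1 N (\<lambda>_. zr) \<in> D T2"
    by (rule dfn_D[OF dfn_Lam genv_N]) (simp add: dfn_const)
  have iff: "sat S ((\<lambda>_. p)((0, T1) := f, (1, N) := n)) ?\<phi> \<longleftrightarrow>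
      (n = on \<and> f \<bullet> zr = f \<bullet> on) \<or> (n = zr \<and> \<not> f \<bullet> zr = f \<bullet> on)" for p f n
    by simp blast
  then have ex: "\<exists>n\<in>D N. sat S ((\<lambda>_. p)((0, T1) := f, (1, N) := n)) ?\<phi>" for p f
    using zr_D on_D by blast
  obtain k where k: "k \<in> D T2" "\<And>f. f \<in> D T1 \<Longrightarrow> sat S ((\<lambda>_. Lam T1 N (\<lambda>_. zr))((0, T1) := f, (1, N) := k \<bullet> f)) ?\<phi>"
    by (rule QF_AC[of ?\<phi> "Lam T1 N (\<lambda>_. zr)", OF _ _ _ T2 ex]) (simp, simp, simp, rule that)
  have "k \<bullet> f = b01 (f \<bullet> zr = f \<bullet> on)" if "f \<in> D T1" for f
    using k(2)[OF that] unfolding iff b01_def by presburger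
  with k(1) that show ?thesis by blast
qed

lemma less_functional:
  obtains k where "k \<in> D T2" "\<And>f. f \<in> D T1 \<Longrightarrow> k \<bullet> f = b01 (ltr S (f \<bullet> zr) (f \<bullet> on))"
proof -
  let ?e = "Less (Var (0, T1) \<cdot> \<^bold>0) (Var (0, T1) \<cdot> \<^bold>1)"
  let ?\<phi> = "Disj (Conj (Eq (Var (1, N)) \<^bold>1) ?e) (Conj (Eq (Var (1, N)) \<^bold>0) (Neg ?e))"
  have T2: "Lam T1 N (\<lambda>_. zr) \<in> D T2"
    by (rule dfn_D[OF dfn_Lam genv_N]) (simp add: dfn_const)
  have iff: "sat S ((\<lambda>_. p)((0, T1) := f, (1, N) := n)) ?\<phi> \<longleftrightarrow>
      (n = on \<and> ltr S (f \<bullet> zr) (f \<bullet> on)) \<or> (n = zr \<and> \<not> ltr S (f \<bullet> zr) (f \<bullet> on))" for p f n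
    by simp blast
  then have ex: "\<exists>n\<in>D N. sat S ((\<lambda>_. p)((0, T1) := f, (1, N) := n)) ?\<phi>" for p f
    using zr_D on_D by blast
  obtain k where k: "k \<in> D T2" "\<And>f. f \<in> D T1 \<Longrightarrow> sat S ((\<lambda>_. Lam T1 N (\<lambda>_. zr))((0, T1) := f, (1, N) := k \<bullet> f)) ?\<phi>"
    by (rule QF_AC[of ?\<phi> "Lam T1 N (\<lambda>_. zr)", OF _ _ _ T2 ex]) (simp, simp, simp, rule that)
  have "k \<bullet> f = b01 (ltr S (f \<bullet> zr) (f \<bullet> on))" if "f \<in> D T1" for f
    using k(2)[OF that] unfolding iff b01_def by presburger
  with k(1) that show ?thesis by blast
qed

lemma dfnP_eq:
  assumes "dfn G N F" "dfn G N F'"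
  shows "dfnP G (\<lambda>e. F e = F' e)"
proof -
  obtain k where k: "k \<in> D T2" "\<And>f. f \<in> D T1 \<Longrightarrow> k \<bullet> f = b01 (f \<bullet> zr = f \<bullet> on)"
    by (rule eq_functional) (rule that)
  have "dfn G N (\<lambda>e. k \<bullet> pr (F e) (F' e))"
    by (intro dfn_app[where \<sigma> = T1] dfn_const k dfn_pr assms)
  moreover have "k \<bullet> pr (F e) (F' e) = b01 (F e = F' e)" if "e \<in> genv G" for e
    using that k(2) pr_D pr_app dfn_D[OF assms(1) that] dfn_D[OF assms(2) that] by simp
  ultimately show ?thesis unfolding dfnP_def by (rule dfn_congI)
qed

lemma dfnP_ltr:
  assumes "dfn G N F" "dfn G N F'"
  shows "dfnP G (\<lambda>e. ltr S (F e) (F' e))"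
proof -
  obtain k where k: "k \<in> D T2" "\<And>f. f \<in> D T1 \<Longrightarrow> k \<bullet> f = b01 (ltr S (f \<bullet> zr) (f \<bullet> on))"
    by (rule less_functional) (rule that)
  have "dfn G N (\<lambda>e. k \<bullet> pr (F e) (F' e))"
    by (intro dfn_app[where \<sigma> = T1] dfn_const k dfn_pr assms)
  moreover have "k \<bullet> pr (F e) (F' e) = b01 (ltr S (F e) (F' e))" if "e \<in> genv G" for e
    using that k(2) pr_D pr_app dfn_D[OF assms(1) that] dfn_D[OF assms(2) that] by simp
  ultimately show ?thesis unfolding dfnP_def by (rule dfn_congI)
qed

text \<open>The case distinction is an evaluation of the pair \<open>pr (Y e) (X e)\<close> at the
  truth value.\<close>

lemma dfn_if:
  assumes "dfnP G P" "dfn G N X" "dfn G N Y"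
  shows "dfn G N (\<lambda>e. if P e then X e else Y e)"
proof -
  have "dfn G N (\<lambda>e. pr (Y e) (X e) \<bullet> b01 (P e))"
    by (intro dfn_app[where \<sigma> = N] dfn_pr assms assms(1)[unfolded dfnP_def])
  moreover have "pr (Y e) (X e) \<bullet> b01 (P e) = (if P e then X e else Y e)" if "e \<in> genv G" for e
    using pr_app dfn_D[OF assms(2) that] dfn_D[OF assms(3) that] by (simp add: b01_def)
  ultimately show ?thesis by (rule dfn_congI)
qed

lemma dfnP_not:
  assumes "dfnP G P"
  shows "dfnP G (\<lambda>e. \<not> P e)"
  unfolding dfnP_def
  by (rule dfn_congI[OF dfn_if[OF assms dfn_const[OF zr_D] dfn_const[OF on_D]]]) (simp add: b01_def)

lemma dfnP_conj: "dfnP G P \<Longrightarrow> dfnP G Q \<Longrightarrow> dfnP G (\<lambda>e. P e \<and> Q e)"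
proof -
  assume *: "dfnP G P" "dfnP G Q"
  show ?thesis
    unfolding dfnP_def
    by (rule dfn_congI[OF dfn_if[OF *(1) *(2)[unfolded dfnP_def] dfn_const[OF zr_D]]]) (simp add: b01_def)
qed

lemma dfnP_disj: "dfnP G P \<Longrightarrow> dfnP G Q \<Longrightarrow> dfnP G (\<lambda>e. P e \<or> Q e)"
  using dfnP_not[OF dfnP_conj[OF dfnP_not dfnP_not], of G P Q] by simp

lemma dfnP_imp:
  assumes "dfnP G P" "dfnP G Q"
  shows "dfnP G (\<lambda>e. P e \<longrightarrow> Q e)"
  by (rule dfnP_congI[OF dfnP_disj[OF dfnP_not[OF assms(1)] assms(2)]]) blast

lemma dfnP_iff:
  assumes "dfnP G P" "dfnP G Q"
  shows "dfnP G (\<lambda>e. P e \<longleftrightarrow> Q e)"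
  by (rule dfnP_congI[OF dfnP_conj[OF dfnP_imp[OF assms] dfnP_imp[OF assms(2,1)]]]) blast

lemma dfnP_const: "dfnP G (\<lambda>e. P)"
  by (simp add: dfnP_def dfn_const)

lemma E2:
  obtains E where "E \<in> D T2" "\<And>f. f \<in> D T1 \<Longrightarrow> E \<bullet> f = zr \<longleftrightarrow> (\<exists>n\<in>D N. f \<bullet> n = zr)"
proof -
  have "Kleene_E2 0 \<in> ACA0_omega" by (auto simp: ACA0_omega_def)
  moreover have "wf (Kleene_E2 0)" "fv (Kleene_E2 0) = {}" by (auto simp: Kleene_E2_def sch_defs)
  ultimately obtain \<rho> where "sat S \<rho> (Kleene_E2 0)" using sat_axiom by blast
  then have "\<exists>E\<in>D T2. \<forall>f\<in>D T1. E \<bullet> f = zr \<longleftrightarrow> (\<exists>n\<in>D N. f \<bullet> n = zr)"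
    by (simp add: Kleene_E2_def sch_defs) (erule bexE, rule bexI, blast)
  with that show ?thesis by blast
qed

text \<open>The search operator of Feferman. With \<open>E\<close> as parameter, "if
  \<open>E\<close> announces a zero of \<open>f\<close>, then \<open>n\<close> is one" is
  quantifier-free and solvable in \<open>n\<close> for every \<open>f\<close>, so QF-AC
  applies.\<close>

lemma Mu:
  obtains m where "m \<in> D T2" "\<And>f n. f \<in> D T1 \<Longrightarrow> n \<in> D N \<Longrightarrow> f \<bullet> n = zr \<Longrightarrow> f \<bullet> (m \<bullet> f) = zr"
proof -
  obtain E where E: "E \<in> D T2" "\<And>f. f \<in> D T1 \<Longrightarrow> E \<bullet> f = zr \<longleftrightarrow> (\<exists>n\<in>D N. f \<bullet> n = zr)"
    using E2 by blast
  let ?\<phi> = "Imp (Eq (Var (3, T2) \<cdot> Var (0, T1)) \<^bold>0) (Eq (Var (0, T1) \<cdot> Var (1, N)) \<^bold>0)"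
  have ex: "\<exists>n\<in>D N. sat S ((\<lambda>_. E)((0, T1) := f, (1, N) := n)) ?\<phi>" if "f \<in> D T1" for f
  proof -
    have "sat S ((\<lambda>_. E)((0, T1) := f, (1, N) := n)) ?\<phi> \<longleftrightarrow> (E \<bullet> f = zr \<longrightarrow> f \<bullet> n = zr)" for n by simp
    then show ?thesis using E(2)[OF that] zr_D by blast
  qed
  obtain k where k: "k \<in> D T2" "\<And>f. f \<in> D T1 \<Longrightarrow> sat S ((\<lambda>_. E)((0, T1) := f, (1, N) := k \<bullet> f)) ?\<phi>"
    by (rule QF_AC[of ?\<phi> E, OF _ _ _ E(1) ex]) (simp, simp, simp, assumption, rule that)
  have "f \<bullet> (k \<bullet> f) = zr" if "f \<in> D T1" "n \<in> D N" "f \<bullet> n = zr" for f n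
    using k(2)[OF that(1)] E(2)[OF that(1)] that by auto
  with k(1) that show ?thesis by blast
qed

text \<open>\<open>E\<close> is applied to the characteristic function of the complement, whose
  zeros are the witnesses. Closure under number quantifiers makes every arithmetical predicate
  definable.\<close>

lemma dfnP_ex:
  assumes "dfnP (case_nat N G) (\<lambda>e. P (\<lambda>i. e (Suc i)) (e 0))"
  shows "dfnP G (\<lambda>e. \<exists>a\<in>D N. P e a)"
proof -
  obtain E where E: "E \<in> D T2" "\<And>f. f \<in> D T1 \<Longrightarrow> E \<bullet> f = zr \<longleftrightarrow> (\<exists>n\<in>D N. f \<bullet> n = zr)"
    using E2 by blast
  have 1: "dfn (case_nat N G) N (\<lambda>e. b01 (\<not> P (\<lambda>i. e (Suc i)) (e 0)))"
    using dfnP_not[OF assms] by (simp add: dfnP_def)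
  let ?L = "\<lambda>e. Lam N N (\<lambda>a. b01 (\<not> P e a))"
  have 2: "dfn G T1 ?L" by (rule dfn_Lam) (rule 1)
  have "dfnP G (\<lambda>e. E \<bullet> ?L e = zr)"
    by (intro dfnP_eq dfn_app[where \<sigma> = T1] dfn_const E 2 zr_D)
  moreover have "E \<bullet> ?L e = zr \<longleftrightarrow> (\<exists>a\<in>D N. P e a)" if "e \<in> genv G" for e
    using E(2)[OF dfn_D[OF 2 that]] Lam_app[of N G N "\<lambda>e a. b01 (\<not> P e a)", OF 1 that] by (auto simp: b01_eq)
  ultimately show ?thesis by (rule dfnP_congI)
qed

lemma dfnP_all:
  assumes "dfnP (case_nat N G) (\<lambda>e. P (\<lambda>i. e (Suc i)) (e 0))"
  shows "dfnP G (\<lambda>e. \<forall>a\<in>D N. P e a)"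
  using dfnP_not[OF dfnP_ex[OF dfnP_not[OF assms]]] by simp

lemma dfn_choice:
  assumes "dfnP (case_nat N G) (\<lambda>e. P (\<lambda>i. e (Suc i)) (e 0))"
  obtains F where "dfn G N F" "\<And>e a. e \<in> genv G \<Longrightarrow> a \<in> D N \<Longrightarrow> P e a \<Longrightarrow> P e (F e)"
proof -
  obtain m where m: "m \<in> D T2" "\<And>f n. f \<in> D T1 \<Longrightarrow> n \<in> D N \<Longrightarrow> f \<bullet> n = zr \<Longrightarrow> f \<bullet> (m \<bullet> f) = zr"
    using Mu by blast
  have 1: "dfn (case_nat N G) N (\<lambda>e. b01 (\<not> P (\<lambda>i. e (Suc i)) (e 0)))"
    using dfnP_not[OF assms] by (simp add: dfnP_def)
  let ?L = "\<lambda>e. Lam N N (\<lambda>a. b01 (\<not> P e a))"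
  have 2: "dfn G T1 ?L" by (rule dfn_Lam) (rule 1)
  have 3: "dfn G N (\<lambda>e. m \<bullet> ?L e)" by (intro dfn_app[where \<sigma> = T1] dfn_const m 2)
  have "P e (m \<bullet> ?L e)" if "e \<in> genv G" "a \<in> D N" "P e a" for e a
    using m(2)[OF dfn_D[OF 2 that(1)] that(2)] that dfn_D[OF 3 that(1)]
      Lam_app[of N G N "\<lambda>e a. b01 (\<not> P e a)", OF 1 that(1)] by (auto simp: b01_eq)
  with 3 that show ?thesis by blast
qed

text \<open>When the relation is the graph of \<open>F\<close>, the search of
  \<open>dfn_choice\<close> can only find the value of \<open>F\<close>.\<close>

lemma dfn_graph:
  assumes "dfnP (case_nat N G) (\<lambda>e. F (\<lambda>i. e (Suc i)) = e 0)" "\<And>e. e \<in> genv G \<Longrightarrow> F e \<in> D N"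
  shows "dfn G N F"
proof -
  obtain F' where F': "dfn G N F'" "\<And>e a. e \<in> genv G \<Longrightarrow> a \<in> D N \<Longrightarrow> F e = a \<Longrightarrow> F e = F' e"
    using dfn_choice[of G "\<lambda>e a. F e = a"] assms(1) by blast
  show ?thesis
    by (rule dfn_congI[OF F'(1)]) (use F'(2) assms(2) in metis)
qed

lemma case_nat_N: "case_nat N (\<lambda>_. N) = (\<lambda>_. N)"
  by (auto split: nat.splits)

text \<open>Comprehension turns \<open>P\<close> into a type-1 object, to which the quantifier-free
  induction of the model applies.\<close>

lemma ind:
  assumes "dfnP (\<lambda>_. N) (\<lambda>e. P (e 0))" "P zr" "\<And>a. a \<in> D N \<Longrightarrow> P a \<Longrightarrow> P (pl a on)" "a \<in> D N"
  shows "P a"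
proof -
  have 1: "dfn (case_nat N (\<lambda>_. N)) N (\<lambda>e. b01 (P (e 0)))"
    using assms(1) unfolding case_nat_N dfnP_def .
  let ?L = "Lam N N (\<lambda>a. b01 (P a))"
  have "?L \<in> D T1" by (rule dfn_D[OF dfn_Lam genv_N]) (rule 1)
  note L = this
  have L_app: "?L \<bullet> a = on \<longleftrightarrow> P a" if "a \<in> D N" for a
    using Lam_app[of N "\<lambda>_. N" N "\<lambda>_ a. b01 (P a)", OF 1 genv_N that] by (simp add: b01_eq)
  have "?L \<bullet> a = on"
  proof (rule T1_ind[OF L _ _ assms(4)])
    show "?L \<bullet> zr = on" using L_app[OF zr_D] assms(2) by blast
    show "?L \<bullet> (pl b on) = on" if "b \<in> D N" "?L \<bullet> b = on" for b
      using L_app[OF that(1)] L_app[OF pl_D[OF that(1) on_D]] assms(3) that by blast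
  qed
  then show ?thesis using L_app[OF assms(4)] by blast
qed

section \<open>Semiring laws and the order on the numbers of the model\<close>

lemmas dfn_arith = dfnP_eq dfnP_ltr dfnP_imp dfnP_conj dfnP_disj dfnP_iff dfnP_ex dfn_pl dfn_ti

lemma dfn_v: "dfn (\<lambda>_. N) N (\<lambda>e. e i)" "dfn (case_nat N (\<lambda>_. N)) N (\<lambda>e. e i)"
  by (rule dfn_var; simp add: case_nat_N)+

lemmas pe = peano(3)[OF _ zr_D] peano(4) peano(5)[OF _ zr_D] peano(6) peano(7)[OF _ zr_D] peano(8)

lemma pl_0: "a \<in> D N \<Longrightarrow> pl zr a = a"
  by (rule ind[where P = "\<lambda>a. pl zr a = a"]; (intro dfn_arith dfn_v dfn_const)?) (simp_all add: pe)

lemma pl_Suc: "a \<in> D N \<Longrightarrow> b \<in> D N \<Longrightarrow> pl (pl a on) b = pl (pl a b) on"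
  by (rule ind[where P = "\<lambda>b. pl (pl a on) b = pl (pl a b) on"]; (intro dfn_arith dfn_v dfn_const)?)
    (simp_all add: pe)

lemma pl_comm: "a \<in> D N \<Longrightarrow> b \<in> D N \<Longrightarrow> pl a b = pl b a"
  by (rule ind[where P = "\<lambda>b. pl a b = pl b a"]; (intro dfn_arith dfn_v dfn_const)?)
    (simp_all add: pe pl_0 pl_Suc)

lemma pl_assoc: "a \<in> D N \<Longrightarrow> b \<in> D N \<Longrightarrow> c \<in> D N \<Longrightarrow> pl (pl a b) c = pl a (pl b c)"
  by (rule ind[where P = "\<lambda>c. pl (pl a b) c = pl a (pl b c)"]; (intro dfn_arith dfn_v dfn_const)?)
    (simp_all add: pe)

lemma ti_0: "a \<in> D N \<Longrightarrow> ti zr a = zr"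
  by (rule ind[where P = "\<lambda>a. ti zr a = zr"]; (intro dfn_arith dfn_v dfn_const)?) (simp_all add: pe)

lemma pl_left_comm: "a \<in> D N \<Longrightarrow> b \<in> D N \<Longrightarrow> c \<in> D N \<Longrightarrow> pl a (pl b c) = pl b (pl a c)"
  using pl_assoc[of a b c] pl_assoc[of b a c] pl_comm[of a b] by simp

lemma ti_Suc: "a \<in> D N \<Longrightarrow> b \<in> D N \<Longrightarrow> ti (pl a on) b = pl (ti a b) b"
proof (rule ind[where P = "\<lambda>b. ti (pl a on) b = pl (ti a b) b"]; (intro dfn_arith dfn_v dfn_const)?)
  fix b assume *: "a \<in> D N" "b \<in> D N" "ti (pl a on) b = pl (ti a b) b"
  have "ti (pl a on) (pl b on) = pl (pl (ti a b) b) (pl a on)" using * by (simp add: peano(6))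
  also have "\<dots> = pl (pl (ti a b) a) (pl b on)"
    using * pl_assoc[of "ti a b" b "pl a on"] pl_assoc[of "ti a b" a "pl b on"]
      pl_left_comm[of b a on] by simp
  finally show "ti (pl a on) (pl b on) = pl (ti a (pl b on)) (pl b on)" using * by (simp add: peano(6))
qed (simp_all add: pe)

lemma ti_comm: "a \<in> D N \<Longrightarrow> b \<in> D N \<Longrightarrow> ti a b = ti b a"
  by (rule ind[where P = "\<lambda>b. ti a b = ti b a"]; (intro dfn_arith dfn_v dfn_const)?)
    (simp_all add: pe ti_0 ti_Suc)

lemma ti_pl: "a \<in> D N \<Longrightarrow> b \<in> D N \<Longrightarrow> c \<in> D N \<Longrightarrow> ti a (pl b c) = pl (ti a b) (ti a c)"
  by (rule ind[where P = "\<lambda>c. ti a (pl b c) = pl (ti a b) (ti a c)"]; (intro dfn_arith dfn_v dfn_const)?)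
    (simp_all add: pe pl_assoc[symmetric])

lemma ti_assoc: "a \<in> D N \<Longrightarrow> b \<in> D N \<Longrightarrow> c \<in> D N \<Longrightarrow> ti (ti a b) c = ti a (ti b c)"
proof (rule ind[where P = "\<lambda>c. ti (ti a b) c = ti a (ti b c)"]; (intro dfn_arith dfn_v dfn_const)?)
  fix c assume *: "a \<in> D N" "b \<in> D N" "c \<in> D N" "ti (ti a b) c = ti a (ti b c)"
  have "ti (ti a b) (pl c on) = pl (ti a (ti b c)) (ti a b)"
    using * peano(6)[of "ti a b" c] by simp
  also have "\<dots> = ti a (pl (ti b c) b)" using * ti_pl[of a "ti b c" b] by simp
  also have "\<dots> = ti a (ti b (pl c on))" using * peano(6)[of b c] by simp
  finally show "ti (ti a b) (pl c on) = ti a (ti b (pl c on))" .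
qed (simp_all add: pe)

lemma pl_cancel:
  assumes "a \<in> D N" "b \<in> D N" "c \<in> D N" "pl a c = pl b c"
  shows "a = b"
proof -
  have "pl a c = pl b c \<longrightarrow> a = b"
  proof (rule ind[where P = "\<lambda>c. pl a c = pl b c \<longrightarrow> a = b"]; (intro dfn_arith dfn_v dfn_const)?)
    show "pl a (pl c on) = pl b (pl c on) \<longrightarrow> a = b" if "c \<in> D N" "pl a c = pl b c \<longrightarrow> a = b" for c
      using that assms peano(2)[of "pl a c" "pl b c"] by (simp add: pe)
  qed (use assms in \<open>simp_all add: pe\<close>)
  with assms show ?thesis by simp
qed

lemma zr_cases:
  assumes "a \<in> D N"
  shows "a = zr \<or> (\<exists>b\<in>D N. a = pl b on)"
  by (rule ind[where P = "\<lambda>a. a = zr \<or> (\<exists>b\<in>D N. a = pl b on)"]; (intro dfn_arith dfn_v dfn_const)?)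
    (use assms in auto)

lemma pl_total:
  assumes "a \<in> D N" "b \<in> D N"
  shows "\<exists>k\<in>D N. b = pl a k \<or> a = pl b k"
proof (rule ind[where P = "\<lambda>b. \<exists>k\<in>D N. b = pl a k \<or> a = pl b k"]; (intro dfn_arith dfn_v dfn_const)?)
  fix b assume b: "b \<in> D N" "\<exists>k\<in>D N. b = pl a k \<or> a = pl b k"
  then obtain k where k: "k \<in> D N" "b = pl a k \<or> a = pl b k" by blast
  then show "\<exists>k\<in>D N. pl b on = pl a k \<or> a = pl (pl b on) k"
  proof (elim disjE)
    assume "b = pl a k"
    then show ?thesis using k assms by (intro bexI[of _ "pl k on"]) (auto simp: pe)
  next
    assume a: "a = pl b k"
    from zr_cases[OF k(1)] show ?thesis
    proof
      assume "k = zr"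
      then show ?thesis using a b by (intro bexI[of _ on]) (auto simp: pe)
    next
      assume "\<exists>c\<in>D N. k = pl c on"
      then obtain c where "c \<in> D N" "k = pl c on" by blast
      then show ?thesis using a b by (intro bexI[of _ c]) (auto simp: pl_Suc pe)
    qed
  qed
qed (use assms in \<open>auto simp: pl_0\<close>)

lemma ltr_iff:
  assumes "a \<in> D N" "b \<in> D N"
  shows "ltr S a b \<longleftrightarrow> (\<exists>k\<in>D N. b = pl a (pl k on))"
proof (rule ind[where P = "\<lambda>b. ltr S a b \<longleftrightarrow> (\<exists>k\<in>D N. b = pl a (pl k on))"]; (intro dfn_arith dfn_v dfn_const)?)
  show "ltr S a zr \<longleftrightarrow> (\<exists>k\<in>D N. zr = pl a (pl k on))"
    using assms peano(1)[OF pl_D zr_D] by (auto simp: pe) (metis pl_D)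
  fix b assume b: "b \<in> D N" "ltr S a b \<longleftrightarrow> (\<exists>k\<in>D N. b = pl a (pl k on))"
  have "(\<exists>k\<in>D N. pl b on = pl a (pl k on)) \<longleftrightarrow> (\<exists>k\<in>D N. b = pl a k)"
  proof (rule bex_cong[OF refl])
    fix k assume k: "k \<in> D N"
    have "pl a (pl k on) = pl (pl a k) on" using k assms by (simp add: pe)
    then show "pl b on = pl a (pl k on) \<longleftrightarrow> b = pl a k"
      using peano(2)[of b "pl a k"] k b(1) assms by auto
  qed
  also have "\<dots> \<longleftrightarrow> (\<exists>k\<in>D N. b = pl a (pl k on)) \<or> a = b"
    using zr_cases assms by (metis on_D peano(3) pl_D zr_D)
  finally show "ltr S a (pl b on) \<longleftrightarrow> (\<exists>k\<in>D N. pl b on = pl a (pl k on))"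
    using b assms by (simp add: peano(8))
qed (use assms in simp_all)

lemma ti_nonzero: "a \<in> D N \<Longrightarrow> b \<in> D N \<Longrightarrow> a \<noteq> zr \<Longrightarrow> b \<noteq> zr \<Longrightarrow> ti a b \<noteq> zr"
proof -
  assume *: "a \<in> D N" "b \<in> D N" "a \<noteq> zr" "b \<noteq> zr"
  then obtain c d where c: "c \<in> D N" "a = pl c on" and d: "d \<in> D N" "b = pl d on"
    using zr_cases by blast
  then have "ti a b = pl (pl (ti a d) c) on" using * by (simp add: pe)
  then show ?thesis using peano(1)[of "pl (ti a d) c"] c d * by simp
qed

end

text \<open>All that \<open>mnat\<close> needs in order to become an ordered semiring, stated
  outside the locale so that it also covers the dummy case. The clause about \<open>k\<close> yields
  the order by differences and makes it linear.\<close>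

definition arith :: "nat set \<Rightarrow> nat \<Rightarrow> nat \<Rightarrow> (nat \<Rightarrow> nat \<Rightarrow> nat) \<Rightarrow> (nat \<Rightarrow> nat \<Rightarrow> nat) \<Rightarrow> bool" where
  "arith C z u p t \<longleftrightarrow> z \<in> C \<and> u \<in> C \<and> u \<noteq> z \<and>
    (\<forall>a\<in>C. \<forall>b\<in>C. p a b \<in> C \<and> t a b \<in> C \<and> p a b = p b a \<and> t a b = t b a \<and> (p a b = z \<longrightarrow> a = z)
      \<and> (t a b = z \<longrightarrow> a = z \<or> b = z) \<and> (\<exists>k\<in>C. b = p a k \<or> a = p b k)) \<and>
    (\<forall>a\<in>C. \<forall>b\<in>C. \<forall>c\<in>C. p (p a b) c = p a (p b c) \<and> t (t a b) c = t a (t b c)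
      \<and> t a (p b c) = p (t a b) (t a c) \<and> (p a c = p b c \<longrightarrow> a = b)) \<and>
    (\<forall>a\<in>C. p a z = a \<and> t a u = a \<and> t a z = z)"

lemma (in aca_model) arith_model: "arith (D N) zr on pl ti"
proof -
  have one: "ti a on = a" if "a \<in> D N" for a
    using peano(5,6)[OF that zr_D] pl_0 that zero_pl_one by simp
  have zs: "a = zr" if ab: "a \<in> D N" "b \<in> D N" "pl a b = zr" for a b
  proof (rule ccontr)
    assume "a \<noteq> zr"
    then obtain c where "c \<in> D N" "a = pl c on" using zr_cases[OF ab(1)] by blast
    then show False using ab peano(1)[of "pl c b" zr] by (simp add: pl_Suc)
  qed
  have nz: "a = zr \<or> b = zr" if "a \<in> D N" "b \<in> D N" "ti a b = zr" for a b
    using ti_nonzero[OF that(1,2)] that(3) by blast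
  show ?thesis
    unfolding arith_def
    by (intro conjI ballI impI;
        (rule zr_D on_D on_zr pl_D ti_D pl_comm ti_comm pl_total pl_assoc ti_assoc ti_pl nz one
          peano(3)[OF _ zr_D] peano(5)[OF _ zr_D] zs pl_cancel; assumption))
qed

subsection \<open>A fixed countermodel and its natural numbers as a type\<close>

definition goals :: "fm set" where
  "goals = {(Jordan \<^bold>\<longrightarrow> NIN_alt') 0, (HBU_BV \<^bold>\<longrightarrow> NIN_alt') 0, (WHBU_BV \<^bold>\<longrightarrow> NIN_alt') 0}"

text \<open>If one of the goals is unprovable, this is a countermodel. In the other case the standard natural
  numbers serve as a dummy, so that the type \<open>mnat\<close> is an ordered semiring unconditionally.\<close>

definition S0 :: "nat str" where
  "S0 = (SOME S. is_model (ACA0_omega \<union> FIN) S \<and> (\<exists>\<phi>\<in>goals. \<exists>\<rho>\<in>env S. \<not> sat S \<rho> \<phi>))"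

definition good :: bool where "good \<longleftrightarrow> is_model (ACA0_omega \<union> FIN) S0"

definition "Nc = (if good then dom S0 N else UNIV)"
definition "Nz = (if good then cs S0 Zero else 0)"
definition "Nu = (if good then cs S0 One else 1)"
definition "Np = (if good then (\<lambda>a b. ap S0 (ap S0 (cs S0 Plus) a) b) else (+))"
definition "Nt = (if good then (\<lambda>a b. ap S0 (ap S0 (cs S0 Times) a) b) else (\<lambda>a b. a * b))"

lemma arith_Nc: "arith Nc Nz Nu Np Nt"
proof (cases good)
  case True
  then interpret aca_model "ACA0_omega \<union> FIN" S0 by unfold_locales (auto simp: good_def)
  show ?thesis using arith_model True by (simp add: Nc_def Nz_def Nu_def Np_def Nt_def)
next
  case False
  have "\<exists>k. b = a + k \<or> a = b + k" for a b :: nat by presburger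
  with False show ?thesis
    by (simp add: arith_def Nc_def Nz_def Nu_def Np_def Nt_def distrib_left)
qed

typedef mnat = Nc
  using arith_Nc by (auto simp: arith_def)

abbreviation "rp \<equiv> Rep_mnat"
abbreviation "ab \<equiv> Abs_mnat"

lemmas rp = Rep_mnat and rp_ab = Abs_mnat_inverse and ab_rp = Rep_mnat_inverse
  and rp_inject = Rep_mnat_inject

lemma Nc_laws:
  assumes "a \<in> Nc" "b \<in> Nc"
  shows "Np a b = Np b a" "Nt a b = Nt b a" "Np a b = Nz \<Longrightarrow> a = Nz" "Nt a b = Nz \<Longrightarrow> a = Nz \<or> b = Nz"
    "\<exists>k\<in>Nc. b = Np a k \<or> a = Np b k"
    "Np a Nz = a" "Nt a Nu = a" "Nt a Nz = Nz" "Nz \<in> Nc" "Nu \<in> Nc" "Nu \<noteq> Nz" "Np a b \<in> Nc" "Nt a b \<in> Nc"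
  using arith_Nc assms unfolding arith_def by (elim conjE, blast)+

lemma Nc_laws3:
  assumes "a \<in> Nc" "b \<in> Nc" "c \<in> Nc"
  shows "Np (Np a b) c = Np a (Np b c)" "Nt (Nt a b) c = Nt a (Nt b c)"
    "Nt a (Np b c) = Np (Nt a b) (Nt a c)" "Np a c = Np b c \<Longrightarrow> a = b"
  using arith_Nc assms unfolding arith_def by (elim conjE, blast)+

instantiation mnat :: comm_semiring_1
begin

definition "0 = ab Nz"
definition "1 = ab Nu"
definition "a + b = ab (Np (rp a) (rp b))"
definition "a * b = ab (Nt (rp a) (rp b))"

lemma rp_simps: "rp (0 :: mnat) = Nz" "rp (1 :: mnat) = Nu" "rp (a + b) = Np (rp a) (rp b)"
  "rp (a * b) = Nt (rp a) (rp b)"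
  using arith_Nc rp[of a] rp[of b]
  by (simp_all add: zero_mnat_def one_mnat_def plus_mnat_def times_mnat_def arith_def rp_ab)

instance
proof
  fix a b c :: mnat
  note 2 = Nc_laws[OF rp rp] and 3 = Nc_laws3[OF rp rp rp]
  show "a + b + c = a + (b + c)" unfolding rp_inject[symmetric] rp_simps by (rule 3)
  show comm: "a + b = b + a" for a b :: mnat unfolding rp_inject[symmetric] rp_simps by (rule 2)
  show "0 + a = a" unfolding comm[of 0] unfolding rp_inject[symmetric] rp_simps by (rule 2)
  show "a * b * c = a * (b * c)" unfolding rp_inject[symmetric] rp_simps by (rule 3)
  show mcomm: "a * b = b * a" for a b :: mnat unfolding rp_inject[symmetric] rp_simps by (rule 2)
  show "1 * a = a" unfolding mcomm[of 1] unfolding rp_inject[symmetric] rp_simps by (rule 2)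
  show "(a + b) * c = a * c + b * c"
    unfolding mcomm[of _ c] unfolding rp_inject[symmetric] rp_simps by (rule 3)
  show z: "a * 0 = 0" unfolding rp_inject[symmetric] rp_simps by (rule 2)
  show "0 * a = 0" using z mcomm[of 0 a] by simp
  show "(0 :: mnat) \<noteq> 1" unfolding rp_inject[symmetric] rp_simps by (rule not_sym) (rule 2)
qed

end

lemma mnat_cancel: "a + c = b + c \<Longrightarrow> a = (b :: mnat)"
  unfolding rp_inject[symmetric] rp_simps by (rule Nc_laws3(4)[OF rp rp rp])

lemma mnat_add_0: "a + b = 0 \<Longrightarrow> a = (0 :: mnat)"
  unfolding rp_inject[symmetric] rp_simps by (rule Nc_laws(3)[OF rp rp])

lemma mnat_mult_0: "a * b = 0 \<Longrightarrow> a = 0 \<or> b = (0 :: mnat)"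
  unfolding rp_inject[symmetric] rp_simps by (rule Nc_laws(4)[OF rp rp])

lemma mnat_total: "\<exists>k. b = a + k \<or> a = b + (k :: mnat)"
proof -
  obtain k where "k \<in> Nc" "rp b = Np (rp a) k \<or> rp a = Np (rp b) k"
    using Nc_laws(5)[OF rp rp] by blast
  then show ?thesis
    by (intro exI[of _ "ab k"]) (auto simp: rp_inject[symmetric] rp_simps rp_ab)
qed

instantiation mnat :: linorder
begin

definition "a \<le> (b :: mnat) \<longleftrightarrow> (\<exists>k. b = a + k)"
definition "a < (b :: mnat) \<longleftrightarrow> a \<le> b \<and> \<not> b \<le> a"

instance
proof
  fix a b c :: mnat
  show "a < b \<longleftrightarrow> a \<le> b \<and> \<not> b \<le> a" by (rule less_mnat_def)
  show "a \<le> a" unfolding less_eq_mnat_def by (rule exI[of _ 0]) simp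
  show "a \<le> b \<Longrightarrow> b \<le> c \<Longrightarrow> a \<le> c" unfolding less_eq_mnat_def by (metis add.assoc)
  show "a = b" if ab: "a \<le> b" "b \<le> a"
  proof -
    obtain k l where kl: "b = a + k" "a = b + l" using ab unfolding less_eq_mnat_def by blast
    then have "a = a + k + l" by metis
    then have "(k + l) + a = 0 + a" by (metis add.assoc add.commute add_0)
    then have "k + l = 0" by (rule mnat_cancel)
    then have "k = 0" by (rule mnat_add_0)
    then show ?thesis using kl(1) by simp
  qed
  show "a \<le> b \<or> b \<le> a" unfolding less_eq_mnat_def using mnat_total by metis
qed

end

instantiation mnat :: linordered_semidom
begin

definition "a - (b :: mnat) = (if b \<le> a then THE k. a = b + k else 0)"

lemma mnat_diff: "(b + k) - b = (k :: mnat)"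
proof -
  have "b \<le> b + k" unfolding less_eq_mnat_def by blast
  then show ?thesis unfolding minus_mnat_def
    by (auto intro!: the_equality) (metis add.commute mnat_cancel)
qed

lemma mnat_le_cancel: "a + c \<le> b + c \<longleftrightarrow> a \<le> (b :: mnat)"
  unfolding less_eq_mnat_def
proof
  show "\<exists>k. b + c = a + c + k \<Longrightarrow> \<exists>k. b = a + k"
    by (metis add.assoc add.commute mnat_cancel)
qed (metis add.assoc add.commute)

lemma mnat_diff_cancel: "(a + c) - (b + c) = a - (b :: mnat)"
proof (cases "b \<le> a")
  case True
  then obtain k where "a = b + k" unfolding less_eq_mnat_def by blast
  then show ?thesis using mnat_diff[of b k] mnat_diff[of "b + c" k] by (simp add: ac_simps)
next
  case False
  then show ?thesis by (simp add: minus_mnat_def mnat_le_cancel)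
qed

lemma mnat_0_le: "0 \<le> (a :: mnat)"
  unfolding less_eq_mnat_def by (rule exI[of _ a]) simp

lemma mnat_0_diff: "0 - a = (0 :: mnat)"
  using mnat_diff[of 0 0] mnat_0_le[of a] antisym[of a 0] by (auto simp: minus_mnat_def)

instance
proof
  fix a b c :: mnat
  have le: "\<exists>k. b = a + k" if "a \<le> b" for a b :: mnat using that by (simp add: less_eq_mnat_def)
  show "a + b - a = b" by (rule mnat_diff)
  show "a - b - c = a - (b + c)"
  proof (cases "b \<le> a")
    case True
    then obtain k where k: "a = b + k" using le by blast
    have "a - (b + c) = k - c" using mnat_diff_cancel[of k b c] by (simp add: k add.commute)
    then show ?thesis using mnat_diff k by simp
  next
    case False
    then have "a \<le> b" by simp
    then obtain k where k: "b = a + k" using le by blast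
    have "a - b = 0" using mnat_diff_cancel[of 0 a k] mnat_0_diff by (simp add: k add.commute)
    moreover have "a - (b + c) = 0" using mnat_diff_cancel[of 0 a "k + c"] mnat_0_diff by (simp add: k ac_simps)
    ultimately show ?thesis using mnat_0_diff by simp
  qed
  show "a * (b - c) = a * b - a * c"
  proof (cases "c \<le> b")
    case True
    then obtain k where "b = c + k" using le by blast
    then show ?thesis using mnat_diff by (simp add: distrib_left)
  next
    case False
    then have "b \<le> c" by simp
    then obtain k where k: "c = b + k" using le by blast
    have "b - c = 0" using mnat_diff_cancel[of 0 b k] mnat_0_diff by (simp add: k add.commute)
    moreover have "a * b - a * c = 0"
      using mnat_diff_cancel[of 0 "a * b" "a * k"] mnat_0_diff by (simp add: k distrib_left add.commute)
    ultimately show ?thesis by simp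
  qed
  show "a \<noteq> 0 \<Longrightarrow> b \<noteq> 0 \<Longrightarrow> a * b \<noteq> 0" using mnat_mult_0 by blast
  show "a \<le> b \<Longrightarrow> c + a \<le> c + b" using mnat_le_cancel[of a c b] by (simp add: add.commute)
  show "0 < (1 :: mnat)"
    unfolding less_mnat_def using mnat_0_le antisym[of 0 "1 :: mnat"] by auto
  show "c * a < c * b" if "a < b" "0 < c"
  proof -
    obtain k where k: "b = a + k" using le[OF less_imp_le[OF \<open>a < b\<close>]] by blast
    have "k \<noteq> 0" using k that(1) by auto
    then have "c * k \<noteq> 0" using that(2) mnat_mult_0 by (metis less_irrefl)
    have "c * a \<le> c * b" unfolding k distrib_left less_eq_mnat_def by blast
    moreover have "c * a \<noteq> c * b"
    proof
      assume "c * a = c * b"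
      then have "0 + c * a = c * k + c * a" by (simp add: k distrib_left add.commute)
      then have "0 = c * k" by (rule mnat_cancel)
      then show False using \<open>c * k \<noteq> 0\<close> by simp
    qed
    ultimately show ?thesis by simp
  qed
  show "b \<le> a \<Longrightarrow> a - b + b = a"
    using mnat_diff le by (metis add.commute)
qed

end

lemma mnat_nonneg [simp]: "0 \<le> (a :: mnat)"
  by (rule mnat_0_le)

lemma mnat_pos [simp]: "0 < (a :: mnat) \<longleftrightarrow> a \<noteq> 0"
  using mnat_0_le[of a] by (auto simp: less_le)

type_synonym mrat = "mnat diff fract"
type_synonym mreal = "mrat cmpl"

section \<open>Passing from elements of the countermodel to the type \<open>mnat\<close>\<close>

locale countermodel =
  assumes good
begin

sublocale aca_model "ACA0_omega \<union> FIN" S0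
  by unfold_locales (use countermodel_axioms in \<open>auto simp: countermodel_def good_def\<close>)

abbreviation "M \<equiv> S0"
abbreviation mapp (infixl "\<bullet>" 95) where "f \<bullet> a \<equiv> ap S0 f a"

lemma Nc: "Nc = D N" and Nops: "Nz = zr" "Nu = on" "Np = pl" "Nt = ti"
  using countermodel_axioms by (auto simp: countermodel_def Nc_def Nz_def Nu_def Np_def Nt_def)

lemma rp_D [simp]: "rp n \<in> D N"
  using rp[of n] by (simp add: Nc)

lemma rp_ab_D: "a \<in> D N \<Longrightarrow> rp (ab a) = a"
  by (simp add: rp_ab Nc)

lemma rp_op: "rp 0 = zr" "rp 1 = on" "rp (a + b) = pl (rp a) (rp b)" "rp (a * b) = ti (rp a) (rp b)"
  by (simp_all add: rp_simps Nops)

lemma ball_D: "(\<forall>a\<in>D N. P a) \<longleftrightarrow> (\<forall>n. P (rp n))"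
  using rp_ab_D rp_D by metis

lemma bex_D: "(\<exists>a\<in>D N. P a) \<longleftrightarrow> (\<exists>n. P (rp n))"
  using rp_ab_D rp_D by metis

lemma ltr_rp: "ltr M (rp a) (rp b) \<longleftrightarrow> a < b"
proof -
  have "ltr M (rp a) (rp b) \<longleftrightarrow> (\<exists>k. b = a + (k + 1))"
    unfolding ltr_iff[OF rp_D rp_D] bex_D rp_op[symmetric] rp_inject ..
  also have "\<dots> \<longleftrightarrow> a < b"
  proof
    assume "a < b"
    then have *: "b = a + (b - a)" by simp
    then have "b - a \<noteq> 0" using \<open>a < b\<close> by (metis add_0_right less_irrefl)
    moreover obtain k where "b - a = k + 1"
      using zr_cases[of "rp (b - a)"] \<open>b - a \<noteq> 0\<close> unfolding bex_D rp_op[symmetric] rp_inject by auto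
    ultimately show "\<exists>k. b = a + (k + 1)" using * by metis
  next
    assume "\<exists>k. b = a + (k + 1)"
    then obtain k where "b = a + (k + 1)" by blast
    moreover have "0 < k + 1" by (rule add_nonneg_pos) simp_all
    ultimately show "a < b" by (simp del: mnat_pos)
  qed
  finally show ?thesis .
qed

lemma mnat_cases: "n = 0 \<or> (\<exists>k :: mnat. n = k + 1)"
  using zr_cases[of "rp n"] unfolding bex_D rp_op[symmetric] rp_inject by auto

lemma less_Suc: "a < b + 1 \<longleftrightarrow> a \<le> (b :: mnat)"
  using peano(8)[of "rp a" "rp b"] unfolding rp_op[symmetric] ltr_rp rp_inject by auto

lemma Suc_le: "a + 1 \<le> b \<longleftrightarrow> a < (b :: mnat)"
  using less_Suc[of b a] by (simp add: not_less[symmetric])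

definition dfnN :: "(nat \<Rightarrow> ty) \<Rightarrow> ((nat \<Rightarrow> nat) \<Rightarrow> mnat) \<Rightarrow> bool" where
  "dfnN G F \<longleftrightarrow> dfn G N (\<lambda>e. rp (F e))"

lemma dfn_rp: "dfnN G F \<Longrightarrow> dfn G N (\<lambda>e. rp (F e))"
  by (simp add: dfnN_def)

lemma dfnN_ab: "dfn G N F \<Longrightarrow> dfnN G (\<lambda>e. ab (F e))"
  unfolding dfnN_def by (rule dfn_congI, assumption) (metis rp_ab_D dfn_D)

lemma dfnN_ab_var: "G i = N \<Longrightarrow> dfnN G (\<lambda>e. ab (e i))"
  by (intro dfnN_ab dfn_var)

lemma dfnN_const: "dfnN G (\<lambda>e. n)"
  by (simp add: dfnN_def dfn_const)

lemma dfnN_add: "dfnN G F \<Longrightarrow> dfnN G F' \<Longrightarrow> dfnN G (\<lambda>e. F e + F' e)"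
  unfolding dfnN_def rp_op by (rule dfn_pl)

lemma dfnN_mult: "dfnN G F \<Longrightarrow> dfnN G F' \<Longrightarrow> dfnN G (\<lambda>e. F e * F' e)"
  unfolding dfnN_def rp_op by (rule dfn_ti)

lemma dfnP_eqN: "dfnN G F \<Longrightarrow> dfnN G F' \<Longrightarrow> dfnP G (\<lambda>e. F e = F' e)"
  unfolding dfnN_def rp_inject[symmetric] by (rule dfnP_eq)

lemma dfnP_less: "dfnN G F \<Longrightarrow> dfnN G F' \<Longrightarrow> dfnP G (\<lambda>e. F e < F' e)"
  unfolding dfnN_def ltr_rp[symmetric] by (rule dfnP_ltr)

lemma dfnP_le: "dfnN G F \<Longrightarrow> dfnN G F' \<Longrightarrow> dfnP G (\<lambda>e. F e \<le> F' e)"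
  unfolding not_less[symmetric] by (intro dfnP_not dfnP_less)

lemma dfnP_exN: "dfnP (case_nat N G) (\<lambda>e. P (\<lambda>i. e (Suc i)) (ab (e 0))) \<Longrightarrow> dfnP G (\<lambda>e. \<exists>n. P e n)"
  using dfnP_ex[of G "\<lambda>e a. P e (ab a)"] unfolding bex_D ab_rp .

lemma dfnP_allN: "dfnP (case_nat N G) (\<lambda>e. P (\<lambda>i. e (Suc i)) (ab (e 0))) \<Longrightarrow> dfnP G (\<lambda>e. \<forall>n. P e n)"
  using dfnP_all[of G "\<lambda>e a. P e (ab a)"] unfolding ball_D ab_rp .

lemma dfnN_if: "dfnP G P \<Longrightarrow> dfnN G X \<Longrightarrow> dfnN G Y \<Longrightarrow> dfnN G (\<lambda>e. if P e then X e else Y e)"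
  unfolding dfnN_def if_distrib by (rule dfn_if)

text \<open>Serves functions that HOL introduces by a description, such as truncated subtraction and
  \<open>scode\<close>: their graphs are arithmetical.\<close>

lemma dfnN_graph:
  assumes "dfnP (case_nat N G) (\<lambda>e. F (\<lambda>i. e (Suc i)) = ab (e 0))"
  shows "dfnN G F"
  unfolding dfnN_def
proof (rule dfn_graph)
  show "dfnP (case_nat N G) (\<lambda>e. rp (F (\<lambda>i. e (Suc i))) = e 0)"
  proof (rule dfnP_congI[OF assms])
    fix e assume "e \<in> genv (case_nat N G)"
    then have "e 0 \<in> D N" by (rule genv_caseD)
    then show "F (\<lambda>i. e (Suc i)) = ab (e 0) \<longleftrightarrow> rp (F (\<lambda>i. e (Suc i))) = e 0"
      using rp_ab_D ab_rp by metis
  qed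
qed simp

lemma dfnN_diff:
  assumes "dfnN G F" "dfnN G F'"
  shows "dfnN G (\<lambda>e. F e - F' e)"
proof (rule dfnN_graph)
  have w: "dfnN (case_nat N G) (\<lambda>e. F (\<lambda>i. e (Suc i)))" "dfnN (case_nat N G) (\<lambda>e. F' (\<lambda>i. e (Suc i)))"
    using assms unfolding dfnN_def by (auto intro: dfn_weaken[of G N "\<lambda>e. rp (F e)"] dfn_weaken[of G N "\<lambda>e. rp (F' e)"])
  have d: "a - b = c \<longleftrightarrow> (b \<le> a \<and> b + c = a) \<or> (a < b \<and> c = 0)" for a b c :: mnat
  proof (cases "b \<le> a")
    case True
    then show ?thesis by auto
  next
    case False
    then show ?thesis by (auto simp: minus_mnat_def)
  qed
  show "dfnP (case_nat N G) (\<lambda>e. F (\<lambda>i. e (Suc i)) - F' (\<lambda>i. e (Suc i)) = ab (e 0))"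
    unfolding d
    by (intro dfnP_disj dfnP_conj dfnP_le dfnP_eqN dfnN_add dfnP_less dfnN_const w dfnN_ab_var) simp_all
qed

text \<open>Application sorted by type: \<open>nap\<close> for functions of type 1,
  \<open>tap\<close> for functionals of type 2, \<open>sap\<close> for sequences of type-1 objects
  and \<open>fap\<close> for functions on type-1 objects. Arguments and values of type 0 are
  converted to \<open>mnat\<close>.\<close>

definition nap :: "nat \<Rightarrow> mnat \<Rightarrow> mnat" where "nap f n = ab (f \<bullet> rp n)"
definition tap :: "nat \<Rightarrow> nat \<Rightarrow> mnat" where "tap f x = ab (f \<bullet> x)"
definition sap :: "nat \<Rightarrow> mnat \<Rightarrow> nat" where "sap f n = f \<bullet> rp n"
definition fap :: "nat \<Rightarrow> nat \<Rightarrow> nat" where "fap f x = f \<bullet> x"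

lemma dfnN_nap: "dfn G T1 f \<Longrightarrow> dfnN G n \<Longrightarrow> dfnN G (\<lambda>e. nap (f e) (n e))"
  unfolding nap_def by (intro dfnN_ab dfn_app[where \<sigma> = N] dfn_rp)

lemma dfnN_tap: "dfn G T2 f \<Longrightarrow> dfn G T1 x \<Longrightarrow> dfnN G (\<lambda>e. tap (f e) (x e))"
  unfolding tap_def by (intro dfnN_ab dfn_app[where \<sigma> = T1])

lemma dfn_sap: "dfn G (N \<rightarrow>\<^sub>t T1) f \<Longrightarrow> dfnN G n \<Longrightarrow> dfn G T1 (\<lambda>e. sap (f e) (n e))"
  unfolding sap_def by (intro dfn_app[where \<sigma> = N] dfn_rp)

lemma dfn_fap: "dfn G (T1 \<rightarrow>\<^sub>t T1) f \<Longrightarrow> dfn G T1 x \<Longrightarrow> dfn G T1 (\<lambda>e. fap (f e) (x e))"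
  unfolding fap_def by (intro dfn_app[where \<sigma> = T1])

lemma rp_nap: "f \<in> D T1 \<Longrightarrow> rp (nap f n) = f \<bullet> rp n"
  unfolding nap_def by (rule rp_ab_D[OF ap_D]) (assumption, rule rp_D)

lemma rp_tap: "f \<in> D T2 \<Longrightarrow> x \<in> D T1 \<Longrightarrow> rp (tap f x) = f \<bullet> x"
  unfolding tap_def by (rule rp_ab_D[OF ap_D])

lemma sap_D: "f \<in> D (N \<rightarrow>\<^sub>t T1) \<Longrightarrow> sap f n \<in> D T1"
  unfolding sap_def by (rule ap_D) (assumption, rule rp_D)

definition LamN :: "(mnat \<Rightarrow> mnat) \<Rightarrow> nat" where "LamN F = Lam N N (\<lambda>a. rp (F (ab a)))"
definition LamX :: "(mnat \<Rightarrow> nat) \<Rightarrow> nat" where "LamX F = Lam N T1 (\<lambda>a. F (ab a))"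

lemma dfn_LamN: "dfnN (case_nat N G) (\<lambda>e. F (\<lambda>i. e (Suc i)) (ab (e 0))) \<Longrightarrow> dfn G T1 (\<lambda>e. LamN (F e))"
  unfolding LamN_def by (rule dfn_Lam) (simp add: dfnN_def)

lemma dfn_LamX: "dfn (case_nat N G) T1 (\<lambda>e. F (\<lambda>i. e (Suc i)) (ab (e 0))) \<Longrightarrow> dfn G (N \<rightarrow>\<^sub>t T1) (\<lambda>e. LamX (F e))"
  unfolding LamX_def by (rule dfn_Lam)

abbreviation "G0 \<equiv> (\<lambda>_ :: nat. N)"

lemma dfn_closed_D: "dfn G0 \<tau> (\<lambda>_. p) \<Longrightarrow> p \<in> D \<tau>"
  using dfn_D genv_N by blast

lemma nap_LamN: "dfnN (case_nat N G0) (\<lambda>e. F (ab (e 0))) \<Longrightarrow> nap (LamN F) n = F n"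
  using Lam_app[of N G0 N "\<lambda>_ a. rp (F (ab a))", OF _ genv_N rp_D]
  by (simp add: nap_def LamN_def dfnN_def ab_rp)

lemma LamN_D: "dfnN (case_nat N G0) (\<lambda>e. F (ab (e 0))) \<Longrightarrow> LamN F \<in> D T1"
  by (intro dfn_closed_D dfn_LamN)

lemma sap_LamX: "dfn (case_nat N G0) T1 (\<lambda>e. F (ab (e 0))) \<Longrightarrow> sap (LamX F) n = F n"
  using Lam_app[of N G0 T1 "\<lambda>_ a. F (ab a)", OF _ genv_N rp_D]
  by (simp add: sap_def LamX_def ab_rp)

lemma LamX_D: "dfn (case_nat N G0) T1 (\<lambda>e. F (ab (e 0))) \<Longrightarrow> LamX F \<in> D (N \<rightarrow>\<^sub>t T1)"
  by (intro dfn_closed_D dfn_LamX)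

lemma fap_Lam: "dfn (case_nat T1 G0) T1 (\<lambda>e. F (e 0)) \<Longrightarrow> x \<in> D T1 \<Longrightarrow> fap (Lam T1 T1 F) x = F x"
  using Lam_app[of T1 G0 T1 "\<lambda>_. F", OF _ genv_N] by (simp add: fap_def)

lemma Lam_D: "dfn (case_nat T1 G0) T1 (\<lambda>e. F (e 0)) \<Longrightarrow> Lam T1 T1 F \<in> D (T1 \<rightarrow>\<^sub>t T1)"
  by (intro dfn_closed_D dfn_Lam)

lemma mnat_induct:
  assumes "dfnP (case_nat N G0) (\<lambda>e. P (ab (e 0)))" "P 0" "\<And>n. P n \<Longrightarrow> P (n + 1)"
  shows "P n"
proof -
  have "P (ab (rp n))"
  proof (rule ind[where P = "\<lambda>a. P (ab a)"])
    show "dfnP G0 (\<lambda>e. P (ab (e 0)))" using assms(1) by (simp add: case_nat_N)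
    show "P (ab zr)" using assms(2) by (simp add: rp_op(1)[symmetric] ab_rp)
    fix a assume a: "a \<in> D N" "P (ab a)"
    have "ab (pl a on) = ab a + 1" using rp_op(3)[of "ab a" 1] a by (metis ab_rp rp_ab_D rp_op(2))
    then show "P (ab (pl a on))" using assms(3)[OF a(2)] by simp
  qed simp
  then show ?thesis by (simp add: ab_rp)
qed

definition mrec :: "(mnat \<Rightarrow> mnat \<Rightarrow> mnat) \<Rightarrow> mnat \<Rightarrow> mnat \<Rightarrow> mnat" where
  "mrec F b n = ab (cs M Rec \<bullet> LamX (\<lambda>i. LamN (F i)) \<bullet> rp b \<bullet> rp n)"

lemma dfnN_mrec:
  assumes "dfnN (case_nat N (case_nat N G)) (\<lambda>e. F (\<lambda>i. e (Suc (Suc i))) (ab (e (Suc 0))) (ab (e 0)))"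
    "dfnN G b" "dfnN G n"
  shows "dfnN G (\<lambda>e. mrec (F e) (b e) (n e))"
  unfolding mrec_def
  by (intro dfnN_ab dfn_app[where \<sigma> = N] dfn_app[where \<sigma> = "N \<rightarrow>\<^sub>t T1"] dfn_const[OF Rec_D] dfn_LamX dfn_LamN dfn_rp assms)

lemma mrec:
  assumes "dfnN (case_nat N (case_nat N G0)) (\<lambda>e. F (ab (e (Suc 0))) (ab (e 0)))"
  shows "mrec F b 0 = b" "mrec F b (n + 1) = F n (mrec F b n)"
proof -
  have 1: "dfn (case_nat N G0) T1 (\<lambda>e. LamN (F (ab (e 0))))"
    by (intro dfn_LamN) (rule assms)
  then have L: "LamX (\<lambda>i. LamN (F i)) \<in> D (N \<rightarrow>\<^sub>t T1)" by (rule LamX_D)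
  have 2: "LamX (\<lambda>i. LamN (F i)) \<bullet> rp n = LamN (F n)" for n
    using sap_LamX[OF 1] by (simp add: sap_def)
  \<comment> \<open>The definition of \<open>F\<close> has two variables. Its section at
    \<open>i\<close> is definable because it is row \<open>i\<close> of the object just
    built.\<close>
  have 3: "dfnN (case_nat N G0) (\<lambda>e. F i (ab (e 0)))" for i
  proof -
    have "dfn (case_nat N G0) N (\<lambda>e. LamX (\<lambda>i. LamN (F i)) \<bullet> rp i \<bullet> e 0)"
      by (intro dfn_app[where \<sigma> = N] dfn_const dfn_var ap_D[OF L] rp_D) simp
    moreover have "LamX (\<lambda>i. LamN (F i)) \<bullet> rp i \<bullet> e 0 = rp (F i (ab (e 0)))" if "e \<in> genv (case_nat N G0)" for e
    proof -
      have e: "e 0 \<in> D N" using genv_caseD(1)[OF that] .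
      have "(\<lambda>_. rp i) \<in> genv G0" by (simp add: genv_def)
      from Lam_app[of N G0 N "\<lambda>e a. rp (F (ab (e 0)) (ab a))", OF _ this e]
      have "Lam N N (\<lambda>a. rp (F i (ab a))) \<bullet> e 0 = rp (F i (ab (e 0)))"
        using assms unfolding dfnN_def by (simp add: ab_rp case_nat_N)
      then show ?thesis unfolding 2 unfolding LamN_def .
    qed
    ultimately show ?thesis unfolding dfnN_def by (rule dfn_congI)
  qed
  show "mrec F b 0 = b"
    using Rec_app(1)[OF L rp_D[of b] zr_D] by (simp add: mrec_def rp_op ab_rp)
  have "cs M Rec \<bullet> LamX (\<lambda>i. LamN (F i)) \<bullet> rp b \<bullet> rp n \<in> D N"
    by (intro ap_D[where \<sigma> = N] ap_D[where \<sigma> = "N \<rightarrow>\<^sub>t T1"] Rec_D L rp_D)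
  then have "LamN (F n) \<bullet> (cs M Rec \<bullet> LamX (\<lambda>i. LamN (F i)) \<bullet> rp b \<bullet> rp n) = rp (F n (mrec F b n))"
    using nap_LamN[OF 3] LamN_D[OF 3] rp_nap by (metis mrec_def rp_ab_D)
  then show "mrec F b (n + 1) = F n (mrec F b n)"
    using Rec_app(2)[OF L rp_D[of b] rp_D[of n]] 2[of n] by (simp add: mrec_def rp_op ab_rp)
qed

end

lemma mnat_not_neg [simp]: "\<not> n < (0 :: mnat)"
  by (simp add: not_less)

lemma mnat_le_0 [simp]: "n \<le> (0 :: mnat) \<longleftrightarrow> n = 0"
  by (auto intro: antisym)

context countermodel
begin

subsection \<open>Internal functions\<close>

definition intl :: "(mnat \<Rightarrow> mnat) \<Rightarrow> bool" where
  "intl F \<longleftrightarrow> dfnN (case_nat N G0) (\<lambda>e. F (ab (e 0)))"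
definition intlP :: "(mnat \<Rightarrow> bool) \<Rightarrow> bool" where
  "intlP P \<longleftrightarrow> dfnP (case_nat N G0) (\<lambda>e. P (ab (e 0)))"
definition intl2 :: "(mnat \<Rightarrow> mnat \<Rightarrow> mnat) \<Rightarrow> bool" where
  "intl2 F \<longleftrightarrow> dfnN (case_nat N (case_nat N G0)) (\<lambda>e. F (ab (e (Suc 0))) (ab (e 0)))"
definition intlP2 :: "(mnat \<Rightarrow> mnat \<Rightarrow> bool) \<Rightarrow> bool" where
  "intlP2 P \<longleftrightarrow> dfnP (case_nat N (case_nat N G0)) (\<lambda>e. P (ab (e (Suc 0))) (ab (e 0)))"

text \<open>An internal function is named by an object of the model, so it may be composed with any
  definable argument, however it was itself defined.\<close>

lemma dfnN_intl: "intl F \<Longrightarrow> dfnN G n \<Longrightarrow> dfnN G (\<lambda>e. F (n e))"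
proof -
  assume F: "intl F" and n: "dfnN G n"
  have "dfnN G (\<lambda>e. nap (LamN F) (n e))"
    by (intro dfnN_nap n dfn_const LamN_D F[unfolded intl_def])
  then show ?thesis by (simp add: nap_LamN[OF F[unfolded intl_def]])
qed

lemma dfnN_of_bool: "dfnP G P \<Longrightarrow> dfnN G (\<lambda>e. of_bool (P e))"
  using dfnN_if[of G P "\<lambda>_. 1" "\<lambda>_. 0"] dfnN_const by (simp add: of_bool_def)

lemma dfnP_intlP:
  assumes "intlP P" "dfnN G n"
  shows "dfnP G (\<lambda>e. P (n e))"
proof -
  have "intl (\<lambda>n. of_bool (P n))"
    unfolding intl_def using assms(1) by (intro dfnN_of_bool) (simp add: intlP_def)
  from dfnP_eqN[OF dfnN_intl[OF this assms(2)] dfnN_const[of _ 1]] show ?thesis by simp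
qed

lemma dfnN_intl2:
  assumes "intl2 F" "dfnN G m" "dfnN G n"
  shows "dfnN G (\<lambda>e. F (m e) (n e))"
proof -
  have 1: "dfn (case_nat N G0) T1 (\<lambda>e. LamN (F (ab (e 0))))"
    by (rule dfn_LamN) (use assms(1) in \<open>simp add: intl2_def\<close>)
  have 2: "nap (LamN (F i)) n = F i n" for i n
  proof (rule nap_LamN)
    have "dfnN (case_nat N (case_nat N G0)) (\<lambda>e. F (ab (e (Suc 0))) (ab (e 0)))" using assms(1) by (simp add: intl2_def)
    have 3: "dfnN (case_nat N G0) (\<lambda>e. nap (sap (LamX (\<lambda>i. LamN (F i))) i) (ab (e 0)))"
      by (intro dfnN_nap dfn_sap dfn_const LamX_D 1 dfnN_const dfnN_ab_var) simp
    have 4: "nap (sap (LamX (\<lambda>i. LamN (F i))) i) (ab (e 0)) = F i (ab (e 0))" if "e \<in> genv (case_nat N G0)" for e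
    proof -
      have e: "e 0 \<in> D N" using genv_caseD(1)[OF that] .
      have g: "(\<lambda>_. rp i) \<in> genv G0" by (simp add: genv_def)
      have "Lam N N (\<lambda>a. rp (F i (ab a))) \<bullet> e 0 = rp (F i (ab (e 0)))"
        using Lam_app[of N G0 N "\<lambda>e a. rp (F (ab (e 0)) (ab a))", OF _ g e] assms(1)
        unfolding intl2_def dfnN_def by (simp add: ab_rp case_nat_N)
      then show ?thesis
        unfolding sap_LamX[OF 1] by (simp add: nap_def rp_ab_D[OF e] LamN_def ab_rp)
    qed
    show "dfnN (case_nat N G0) (\<lambda>e. F i (ab (e 0)))"
      using 3 unfolding dfnN_def by (rule dfn_congI) (use 4 in simp)
  qed
  have "dfnN G (\<lambda>e. nap (sap (LamX (\<lambda>i. LamN (F i))) (m e)) (n e))"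
    by (intro dfnN_nap dfn_sap assms dfn_const LamX_D 1)
  then show ?thesis by (simp add: sap_LamX[OF 1] 2)
qed

lemma dfnP_intlP2:
  assumes "intlP2 P" "dfnN G m" "dfnN G n"
  shows "dfnP G (\<lambda>e. P (m e) (n e))"
proof -
  have "intl2 (\<lambda>m n. of_bool (P m n))"
    unfolding intl2_def using assms(1) by (intro dfnN_of_bool) (simp add: intlP2_def)
  from dfnP_eqN[OF dfnN_intl2[OF this assms(2,3)] dfnN_const[of _ 1]] show ?thesis by simp
qed

lemmas dfn_rules = dfnP_not dfnP_conj dfnP_disj dfnP_imp dfnP_iff dfnP_const dfnP_exN dfnP_allN
  dfnP_eqN dfnP_less dfnP_le dfnN_const dfnN_add dfnN_mult dfnN_diff dfnN_if dfnN_of_bool dfnN_ab_var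
  dfnN_nap dfnN_tap dfn_sap dfn_fap dfn_var dfn_LamN dfn_LamX

text \<open>The numbers may be nonstandard, so induction is restricted to internal predicates. The
  obligation \<open>dfn\<close> is discharged by following the syntax of the statement with the
  rules for definability.\<close>

lemma induct_mnat [case_names dfn 0 Suc]:
  assumes "intlP P" "P 0" "\<And>n. P n \<Longrightarrow> P (n + 1)"
  shows "P n"
  using assms mnat_induct unfolding intlP_def by blast

lemma least_mnat:
  assumes "intlP P" "P n"
  obtains m where "P m" "\<And>k. k < m \<Longrightarrow> \<not> P k"
proof -
  have "(\<forall>k\<le>n. \<not> P k) \<or> (\<exists>m\<le>n. P m \<and> (\<forall>k<m. \<not> P k))" for n
  proof (induction n rule: induct_mnat)
  case dfn
    show ?case
      unfolding intlP_def by (intro dfn_rules dfnP_intlP[OF assms(1)]) simp_all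
  next
    case 0
    have "k \<le> 0 \<Longrightarrow> k = 0" for k :: mnat by (simp add: antisym)
    then show ?case by (metis mnat_nonneg not_less)
  next
    case (Suc n)
    have *: "k \<le> n + 1 \<longleftrightarrow> k \<le> n \<or> k = n + 1" for k :: mnat
      using less_Suc[of k n] by (auto simp: le_less)
    show ?case
    proof (cases "\<exists>m\<le>n. P m \<and> (\<forall>k<m. \<not> P k)")
      case True
      then show ?thesis unfolding * by blast
    next
      case False
      then have "\<forall>k\<le>n. \<not> P k" using Suc by blast
      then show ?thesis unfolding * using less_Suc by blast
    qed
  qed
  then show ?thesis using that assms(2) by blast
qed

lemma nk_numeral_mnat: "nk (2 :: mnat) = 2"
  using nk_numeral[of "num.Bit0 num.One"] .

subsection \<open>Powers of two\<close>

definition dbl :: nat where "dbl = val M undefined double_t"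

lemma dbl: "dbl \<in> D T1" "a \<in> D N \<Longrightarrow> dbl \<bullet> a = pl a a"
proof -
  let ?I = "cs M (Sigma N T1 N) \<bullet> cs M (Pi N T1) \<bullet> cs M (Pi N N)"
  have I: "?I \<in> D T1" by (rule ap_D[OF ap_D[OF Sigma_D Pi_D] Pi_D])
  have Ia: "?I \<bullet> a = a" if "a \<in> D N" for a
    using Sigma_app[OF Pi_D Pi_D that] Pi_app[OF that ap_D[OF Pi_D that]] by simp
  have P: "cs M Plus \<in> D (N \<rightarrow>\<^sub>t N \<rightarrow>\<^sub>t N)" using cs_D[of Plus] by simp
  have d: "dbl = cs M (Sigma N N N) \<bullet> cs M Plus \<bullet> ?I"
    by (simp add: dbl_def double_t_def id_t_def)
  show "dbl \<in> D T1" unfolding d by (rule ap_D[OF ap_D[OF Sigma_D P] I])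
  show "dbl \<bullet> a = pl a a" if "a \<in> D N"
    unfolding d using Sigma_app[OF P I that] Ia[OF that] by simp
qed

text \<open>The value of the term \<open>pow2\<close>, so that the rates of convergence in the
  formal notion of real number are exactly \<open>hp n\<close>.\<close>

definition pw :: "mnat \<Rightarrow> mnat" where
  "pw n = ab (cs M Rec \<bullet> (cs M (Pi T1 N) \<bullet> dbl) \<bullet> on \<bullet> rp n)"

lemma val_double: "val M \<rho> double_t = dbl"
  by (simp add: dbl_def double_t_def id_t_def)

lemma pw_aux: "cs M (Pi T1 N) \<bullet> dbl \<in> D (N \<rightarrow>\<^sub>t T1)" "cs M Rec \<bullet> (cs M (Pi T1 N) \<bullet> dbl) \<bullet> on \<bullet> rp n \<in> D N"
proof -
  show 1: "cs M (Pi T1 N) \<bullet> dbl \<in> D (N \<rightarrow>\<^sub>t T1)" by (rule ap_D[OF Pi_D dbl(1)])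
  show "cs M Rec \<bullet> (cs M (Pi T1 N) \<bullet> dbl) \<bullet> on \<bullet> rp n \<in> D N"
    by (rule ap_D[OF ap_D[OF ap_D[OF Rec_D 1] on_D] rp_D])
qed

lemma val_pow2: "val M \<rho> t = rp n \<Longrightarrow> val M \<rho> (pow2 t) = rp (pw n)"
  using pw_aux(2)[of n] by (simp add: pow2_def val_double pw_def rp_ab_D)

lemma pw_0 [simp]: "pw 0 = 1"
  using Rec_app(1)[OF pw_aux(1) on_D zr_D] by (simp add: pw_def rp_op(1,2)[symmetric] ab_rp)

lemma pw_Suc: "pw (n + 1) = 2 * pw n"
proof -
  have "rp (pw (n + 1)) = pl (rp (pw n)) (rp (pw n))"
    using Rec_app(2)[OF pw_aux(1) on_D rp_D[of n]] Pi_app[OF dbl(1) rp_D[of n]] dbl(2)[OF pw_aux(2)[of n]]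
      pw_aux(2)[of "n + 1"] pw_aux(2)[of n]
    by (simp add: pw_def rp_ab_D rp_op)
  then have "pw (n + 1) = pw n + pw n" by (simp only: rp_op(3)[symmetric] rp_inject)
  then show ?thesis by (simp add: mult_2)
qed

lemma dfnN_pw: "dfnN G n \<Longrightarrow> dfnN G (\<lambda>e. pw (n e))"
  unfolding pw_def
  by (intro dfnN_ab dfn_app[where \<sigma> = N] dfn_const[OF ap_D[OF ap_D[OF Rec_D pw_aux(1)] on_D]] dfn_rp)

text \<open>The source of the archimedean arguments below: it makes \<open>hp\<close> get below
  every positive rational, and it lets powers of two dominate counts and rounding errors.\<close>

lemma pw_gt: "n < pw n"
proof (induction n rule: induct_mnat)
  case dfn
  show ?case unfolding intlP_def by (intro dfn_rules dfnN_pw) simp_all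
next
  case (Suc n)
  then have "n + 1 \<le> pw n" by (simp add: Suc_le)
  moreover have "pw n < pw n + pw n" using Suc by (auto simp: le_less)
  ultimately show ?case unfolding pw_Suc mult_2 by (rule le_less_trans)
qed simp

lemma pw_pos [simp]: "0 < pw n" "pw n \<noteq> 0"
  using pw_gt[of n] mnat_nonneg[of n] by auto

lemma pw_add: "pw (m + n) = pw m * pw n"
proof (induction n rule: induct_mnat)
  case dfn
  show ?case unfolding intlP_def by (intro dfn_rules dfnN_pw) simp_all
next
  case (Suc n)
  then show ?case using pw_Suc[of "m + n"] pw_Suc[of n] by (simp add: ac_simps)
qed simp

lemma le_ex: "a \<le> b \<Longrightarrow> \<exists>k. b = a + (k :: mnat)"
  by (simp add: less_eq_mnat_def)

lemma pw_mono: "m \<le> n \<Longrightarrow> pw m \<le> pw n"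
proof -
  assume "m \<le> n"
  then obtain k where "n = m + k" using le_ex by blast
  moreover have "1 \<le> pw k" using Suc_le[of 0 "pw k"] by simp
  ultimately show ?thesis using mult_left_mono[of 1 "pw k" "pw m"] by (simp add: pw_add)
qed

lemma pw_1: "pw 1 = 2" using pw_Suc[of 0] by simp

definition hp :: "mnat \<Rightarrow> mrat" where "hp n = 1 / nk (pw n)"

lemma hp_pos [simp]: "0 < hp n" "0 \<le> hp n"
  by (simp_all add: hp_def)

lemma hp_0 [simp]: "hp 0 = 1" by (simp add: hp_def)

lemma hp_add: "hp (m + n) = hp m * hp n"
  by (simp add: hp_def pw_add)

lemma hp_1: "hp 1 = 1 / 2"
  by (simp add: hp_def pw_1 nk_numeral_mnat)

lemma hp_Suc: "hp (n + 1) = hp n / 2"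
  by (simp add: hp_add hp_1)

lemma hp_mono: "m \<le> n \<Longrightarrow> hp n \<le> hp m"
  by (simp add: hp_def pw_mono frac_le)

text \<open>A positive fraction with denominator \<open>d\<close> is at least \<open>1/d\<close>,
  because its numerator is a positive number of the model, and \<open>2^d\<close> exceeds
  \<open>d\<close>.\<close>

lemma hp_arch:
  assumes "0 < (r :: mrat)"
  obtains n where "hp n < r"
proof -
  obtain a b d where r: "0 < d" "r = (nk a - nk b) / nk d" by (rule fract_cases)
  have "nk b < nk a"
  proof (rule ccontr)
    assume "\<not> nk b < nk a"
    then have "r \<le> 0" unfolding r(2) using r(1) by (intro divide_nonpos_pos) simp_all
    then show False using assms by simp
  qed
  then have "b < a" by simp
  then have "nk (b + 1) \<le> nk a" unfolding nk_simps(5) Suc_le .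
  then have "1 \<le> nk a - nk b" by simp
  then have "1 / nk d \<le> r" unfolding r(2) using r(1) by (intro divide_right_mono) simp_all
  moreover have "hp d < 1 / nk d" unfolding hp_def using r(1) pw_gt[of d]
    by (intro divide_strict_left_mono) simp_all
  ultimately show ?thesis using that[of d] by simp
qed

lemma hp_mreal_arch:
  assumes "0 < (r :: mreal)"
  obtains n where "kr (hp n) < r"
proof -
  obtain q where q: "0 < q" "kr q \<le> r" using cmpl_arch assms by blast
  obtain n where "hp n < q" using hp_arch q(1) by blast
  then have "kr (hp n) < kr q" by simp
  then show ?thesis using q(2) that[of n] by (meson less_le_trans)
qed

subsection \<open>Coding of rationals\<close>

lemma mult_2_cancel: "2 * x = 2 * y \<Longrightarrow> x = (y :: mnat)"
  using mult_strict_left_mono[of x y 2] mult_strict_left_mono[of y x 2]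
  by (cases x y rule: linorder_cases) auto

lemma even_odd: "\<exists>k. n = 2 * k \<or> n = 2 * k + (1 :: mnat)"
proof (induction n rule: induct_mnat)
  case dfn
  show ?case unfolding intlP_def by (intro dfn_rules) simp_all
next
  case 0
  show ?case by (intro exI[of _ 0]) simp
next
  case (Suc n)
  then obtain k where "n = 2 * k \<or> n = 2 * k + 1" by blast
  then show ?case
  proof
    assume "n = 2 * k + 1"
    then have "n + 1 = 2 * (k + 1)" by (simp add: distrib_left add.assoc)
    then show ?thesis by blast
  qed blast
qed

lemma not_even_odd: "2 * a + 1 \<noteq> 2 * (b :: mnat)"
proof (cases "a < b")
  case True
  then have "2 * (a + 1) \<le> 2 * b" by (intro mult_left_mono) (simp_all add: Suc_le)
  moreover have "2 * a + 1 < 2 * (a + 1)" by (rule iffD1[OF nk_less]) (simp del: nk_less)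
  ultimately show ?thesis by (metis less_le_not_le)
next
  case False
  then have "2 * b \<le> 2 * a" by (intro mult_left_mono) simp_all
  then have "2 * b < 2 * a + 1" by (simp add: less_Suc)
  then show ?thesis by auto
qed

text \<open>Successive codes run through the diagonals \<open>s\<close>: after \<open>m = s\<close>
  the next code opens diagonal \<open>s + 1\<close> with \<open>m = 0\<close>, since
  \<open>(s + 1) * (s + 2) = s * (s + 1) + 2 * s + 2\<close>.\<close>

lemma pairing_ex: "\<exists>s m. m \<le> s \<and> 2 * q = s * (s + 1) + 2 * (m :: mnat)"
proof (induction q rule: induct_mnat)
  case dfn
  show ?case unfolding intlP_def by (intro dfn_rules) simp_all
next
  case 0
  show ?case by (intro exI[of _ 0]) simp
next
  case (Suc q)
  then obtain s m where *: "m \<le> s" "2 * q = s * (s + 1) + 2 * m" by blast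
  show ?case
  proof (cases "m = s")
    case True
    have "2 * (q + 1) = (s + 1) * (s + 1 + 1) + 2 * 0"
    proof (rule iffD1[OF nk_eq])
      have "nk (2 * q) = nk (s * (s + 1) + 2 * s)" using *(2) True by (simp only:)
      then show "nk (2 * (q + 1)) = nk ((s + 1) * (s + 1 + 1) + 2 * 0)" by (simp add: algebra_simps del: nk_eq)
    qed
    then show ?thesis using mnat_nonneg by blast
  next
    case False
    then have "m + 1 \<le> s" using * by (simp add: Suc_le)
    moreover have "2 * (q + 1) = s * (s + 1) + 2 * (m + 1)" using * by (simp add: algebra_simps)
    ultimately show ?thesis by blast
  qed
qed

text \<open>The largest value on diagonal \<open>s\<close> belongs to \<open>m = s\<close> and is
  two below the first value on diagonal \<open>s + 1\<close>.\<close>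

lemma pairing_less:
  assumes "m \<le> s" "s < s'"
  shows "s * (s + 1) + 2 * m < s' * (s' + 1) + 2 * (m' :: mnat)"
proof -
  have "s + 1 \<le> s'" using assms by (simp add: Suc_le)
  then have 1: "(s + 1) * (s + 1 + 1) \<le> s' * (s' + 1)" by (intro mult_mono) simp_all
  have 2: "(s + 1) * (s + 1 + 1) = s * (s + 1) + 2 * s + 2"
    by (rule iffD1[OF nk_eq]) (simp add: algebra_simps del: nk_eq)
  have "s * (s + 1) + 2 * m \<le> s * (s + 1) + 2 * s"
    using assms by (intro add_left_mono mult_left_mono) simp_all
  also have "\<dots> < s * (s + 1) + 2 * s + 2" by simp
  also have "\<dots> \<le> s' * (s' + 1)" using 1 unfolding 2 .
  also have "\<dots> \<le> s' * (s' + 1) + 2 * m'" by simp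
  finally show ?thesis .
qed

lemma pairing_inj:
  assumes "m \<le> s" "m' \<le> s'" "s * (s + 1) + 2 * m = s' * (s' + 1) + 2 * (m' :: mnat)"
  shows "s = s'" "m = m'"
proof -
  show "s = s'"
    using pairing_less[OF assms(1), of s' m'] pairing_less[OF assms(2), of s m] assms(3)
    by (metis less_irrefl linorder_cases)
  then show "m = m'" using assms(3) mult_2_cancel by simp
qed

definition rcode :: "mnat \<Rightarrow> mnat \<Rightarrow> mnat \<Rightarrow> mnat \<Rightarrow> bool" where
  "rcode q a b c \<longleftrightarrow> (\<exists>m. 2 * q = (m + c) * (m + c + 1) + 2 * m \<and>
     ((b = 0 \<and> m = 2 * a) \<or> (a = 0 \<and> 1 \<le> b \<and> m + 1 = 2 * b)))"

lemma rcode_ex: "\<exists>a b c. rcode q a b c"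
proof -
  obtain s m where sm: "m \<le> s" "2 * q = s * (s + 1) + 2 * m" using pairing_ex by blast
  obtain c where c: "s = m + c" using le_ex sm(1) by blast
  obtain k where "m = 2 * k \<or> m = 2 * k + 1" using even_odd by blast
  then show ?thesis
  proof
    assume "m = 2 * k"
    then have "rcode q k 0 c" using sm c by (auto simp: rcode_def)
    then show ?thesis by blast
  next
    assume k: "m = 2 * k + 1"
    then have "m + 1 = 2 * (k + 1)" by (simp add: distrib_left add.assoc)
    moreover have "1 \<le> k + 1" by simp
    ultimately have "rcode q 0 (k + 1) c" using sm c unfolding rcode_def by blast
    then show ?thesis by blast
  qed
qed

lemma rcode_unique:
  assumes "rcode q a b c" "rcode q a' b' c'"
  shows "a = a'" "b = b'" "c = c'"
proof -
  obtain m where m: "2 * q = (m + c) * (m + c + 1) + 2 * m"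
    "(b = 0 \<and> m = 2 * a) \<or> (a = 0 \<and> 1 \<le> b \<and> m + 1 = 2 * b)" using assms(1) by (auto simp: rcode_def)
  obtain m' where m': "2 * q = (m' + c') * (m' + c' + 1) + 2 * m'"
    "(b' = 0 \<and> m' = 2 * a') \<or> (a' = 0 \<and> 1 \<le> b' \<and> m' + 1 = 2 * b')" using assms(2) by (auto simp: rcode_def)
  have "m + c = m' + c'" "m = m'"
    using pairing_inj[of m "m + c" m' "m' + c'"] m(1) m'(1) by simp_all
  then show "c = c'" by simp
  from m(2) m'(2) have "a = a' \<and> b = b'"
  proof (elim disjE conjE)
    assume "b = 0" "m = 2 * a" "b' = 0" "m' = 2 * a'"
    then show ?thesis using \<open>m = m'\<close> mult_2_cancel[of a a'] by simp
  next
    assume "m = 2 * a" "m' + 1 = 2 * b'"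
    then show ?thesis using \<open>m = m'\<close> not_even_odd[of a b'] by simp
  next
    assume "m + 1 = 2 * b" "m' = 2 * a'"
    then show ?thesis using \<open>m = m'\<close> not_even_odd[of a' b] by simp
  next
    assume "a = 0" "m + 1 = 2 * b" "a' = 0" "m' + 1 = 2 * b'"
    then show ?thesis using \<open>m = m'\<close> mult_2_cancel[of b b'] by simp
  qed
  then show "a = a'" "b = b'" by simp_all
qed

definition rv :: "mnat \<Rightarrow> mnat \<Rightarrow> mnat \<Rightarrow> mrat" where "rv a b d = (nk a - nk b) / nk d"

definition dec :: "mnat \<Rightarrow> mrat" where
  "dec q = (THE r. \<exists>a b c. rcode q a b c \<and> r = rv a b (c + 1))"

lemma dec_eq: "rcode q a b c \<Longrightarrow> dec q = rv a b (c + 1)"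
  unfolding dec_def by (rule the_equality) (use rcode_unique in metis)+

end

lemma mnat_Suc_nz [simp]: "n + 1 \<noteq> (0 :: mnat)"
  using add_nonneg_pos[of n 1] by (metis less_irrefl mnat_nonneg zero_less_one)

context countermodel
begin

subsection \<open>Values of model reals\<close>

definition xs :: "nat \<Rightarrow> mnat \<Rightarrow> mrat" where "xs x n = dec (nap x n)"

definition isreal :: "nat \<Rightarrow> bool" where
  "isreal x \<longleftrightarrow> x \<in> D T1 \<and> (\<forall>n i. \<bar>xs x n - xs x (n + i)\<bar> < hp n)"

text \<open>The limit of the approximations in the completion; it exists by \<open>v_approx\<close>
  and is unique by \<open>v_eqI\<close>. All statements about reals of the model are read through
  this value.\<close>

definition v :: "nat \<Rightarrow> mreal" where
  "v x = (SOME L. \<forall>n. \<bar>L - kr (xs x n)\<bar> \<le> kr (hp n))"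

lemma isreal_D: "isreal x \<Longrightarrow> x \<in> D T1"
  by (simp add: isreal_def)

lemma v_approx:
  assumes "isreal x"
  shows "\<bar>v x - kr (xs x n)\<bar> \<le> kr (hp n)"
proof -
  \<comment> \<open>Approximations are indexed by numbers of the model, nets by small field
    elements. \<open>g\<close> translates by choosing an index whose precision is at least
    \<open>e\<close>.\<close>
  define g where "g e = (SOME n. hp n \<le> e)" for e
  have g: "hp (g e) \<le> e" if "0 < e" for e
  proof -
    obtain n where "hp n < e" using hp_arch[OF \<open>0 < e\<close>] by blast
    then have "hp n \<le> e" by simp
    then show ?thesis unfolding g_def by (rule someI)
  qed
  have ev: "\<forall>\<^sub>F e in small. \<bar>xs x (g e) - xs x n\<bar> < hp n" for n
    unfolding eventually_small
  proof (intro exI[of _ "hp n"] conjI allI impI)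
    fix e assume e: "0 < e" "e < hp n"
    have "n \<le> g e"
    proof (rule ccontr)
      assume "\<not> n \<le> g e"
      then have "hp n \<le> hp (g e)" by (intro hp_mono) simp
      then show False using g[OF e(1)] e(2) by (meson leD le_less_trans order_trans)
    qed
    then obtain i where "g e = n + i" using le_ex by blast
    then have "\<bar>xs x n - xs x (g e)\<bar> < hp n" using assms by (simp add: isreal_def)
    then show "\<bar>xs x (g e) - xs x n\<bar> < hp n" by (simp only: abs_minus_commute)
  qed simp
  have "cauchy (\<lambda>e. xs x (g e))"
    unfolding cauchy_def
  proof (intro allI impI)
    fix r :: mrat assume "0 < r"
    then obtain n where "hp n < r" using hp_arch by blast
    then have "\<forall>\<^sub>F e in small. \<bar>xs x (g e) - xs x n\<bar> < r"
      using ev[of n] by (auto elim: eventually_mono)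
    then show "\<exists>c. \<forall>\<^sub>F e in small. \<bar>xs x (g e) - c\<bar> < r" by blast
  qed
  then obtain L where L: "\<And>c r. \<forall>\<^sub>F e in small. \<bar>xs x (g e) - c\<bar> \<le> r \<Longrightarrow> \<bar>L - kr c\<bar> \<le> kr r"
    using cmpl_limit by blast
  have "\<bar>L - kr (xs x n)\<bar> \<le> kr (hp n)" for n
    by (rule L) (use ev[of n] in \<open>auto elim: eventually_mono\<close>)
  then have "\<exists>L. \<forall>n. \<bar>L - kr (xs x n)\<bar> \<le> kr (hp n)" by blast
  from someI_ex[OF this] show ?thesis unfolding v_def by blast
qed

lemma hp_2: "kr (hp n) = 2 * kr (hp (n + 1))" "kr (hp n) = 4 * kr (hp (n + 1 + 1))"
proof -
  have "hp n = 2 * hp (n + 1)" "hp n = 4 * hp (n + 1 + 1)" unfolding hp_Suc by simp_all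
  then show "kr (hp n) = 2 * kr (hp (n + 1))" "kr (hp n) = 4 * kr (hp (n + 1 + 1))"
    by (metis kr_numeral kr_simps(5))+
qed

lemma v_eqI:
  assumes "isreal x" "\<And>n. \<bar>L - kr (xs x n)\<bar> \<le> kr (hp n)"
  shows "v x = L"
proof (rule ccontr)
  assume "v x \<noteq> L"
  then have "0 < \<bar>v x - L\<bar>" by simp
  then obtain n where n: "kr (hp n) < \<bar>v x - L\<bar>" using hp_mreal_arch by blast
  have "\<bar>v x - L\<bar> \<le> kr (hp (n + 1)) + kr (hp (n + 1))"
    using v_approx[OF assms(1), of "n + 1"] assms(2)[of "n + 1"] by arith
  then show False using n hp_2(1)[of n] by simp
qed

subsection \<open>Semantics of formula schemes\<close>

text \<open>The invariant behind the HOL binders: at depth \<open>d\<close> all variables in sight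
  have smaller indices, so binding index \<open>d\<close> captures nothing and changes no
  value.\<close>

definition below :: "nat \<Rightarrow> tm \<Rightarrow> bool" where
  "below d t \<longleftrightarrow> (\<forall>v\<in>tm_vars t. fst v < d)"

lemma below_simps [simp]: "below d (Var (i, \<tau>)) \<longleftrightarrow> i < d" "below d (Con c)"
  "below d (t \<cdot> u) \<longleftrightarrow> below d t \<and> below d u"
  by (auto simp: below_def)

lemma below_Suc [simp]: "below d t \<Longrightarrow> below (Suc d) t"
  by (auto simp: below_def)

lemma below_mono: "below d t \<Longrightarrow> d \<le> d' \<Longrightarrow> below d' t"
  by (auto simp: below_def)

lemma below_pow2 [simp]: "below d t \<Longrightarrow> below d (pow2 t)"
  by (simp add: pow2_def double_t_def id_t_def)

lemma val_below [simp]: "below d t \<Longrightarrow> val M (\<rho>((d, \<tau>) := a)) t = val M \<rho> t"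
  by (rule val_upd) (auto simp: below_def)

text \<open>Continuations of real expressions are evaluated under further quantifiers, that is, in
  environments that may differ from the present one at indices from \<open>d\<close> on.\<close>

definition agree :: "nat \<Rightarrow> (var \<Rightarrow> nat) \<Rightarrow> (var \<Rightarrow> nat) \<Rightarrow> bool" where
  "agree d \<rho> \<rho>' \<longleftrightarrow> (\<forall>x. fst x < d \<longrightarrow> \<rho> x = \<rho>' x)"

lemma val_agree: "below d t \<Longrightarrow> agree d \<rho> \<rho>' \<Longrightarrow> val M \<rho>' t = val M \<rho> t"
  by (rule val_cong) (auto simp: below_def agree_def)

lemma agree_refl: "agree d \<rho> \<rho>" by (simp add: agree_def)

lemma agree_upd: "agree d \<rho> \<rho>' \<Longrightarrow> agree d \<rho> (\<rho>'((d, \<tau>) := a))"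
  by (auto simp: agree_def)

lemma agree_trans: "agree d \<rho> \<rho>' \<Longrightarrow> agree d' \<rho>' \<rho>'' \<Longrightarrow> d \<le> d' \<Longrightarrow> agree d \<rho> \<rho>''"
  by (auto simp: agree_def)

lemma agree_upd': "agree d \<rho> \<rho>' \<Longrightarrow> d \<le> d' \<Longrightarrow> agree d \<rho> (\<rho>'((d', \<tau>) := a))"
  by (auto simp: agree_def)

lemma sat_sch [simp]:
  "sat M \<rho> ((t \<^bold>= u) d) \<longleftrightarrow> val M \<rho> t = val M \<rho> u"
  "sat M \<rho> ((\<^bold>\<not> F) d) \<longleftrightarrow> \<not> sat M \<rho> (F d)"
  "sat M \<rho> ((F \<^bold>\<and> G) d) \<longleftrightarrow> sat M \<rho> (F d) \<and> sat M \<rho> (G d)"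
  "sat M \<rho> ((F \<^bold>\<or> G) d) \<longleftrightarrow> sat M \<rho> (F d) \<or> sat M \<rho> (G d)"
  "sat M \<rho> ((F \<^bold>\<longrightarrow> G) d) \<longleftrightarrow> (sat M \<rho> (F d) \<longrightarrow> sat M \<rho> (G d))"
  "sat M \<rho> ((F \<^bold>\<longleftrightarrow> G) d) \<longleftrightarrow> (sat M \<rho> (F d) \<longleftrightarrow> sat M \<rho> (G d))"
  "sat M \<rho> (all_ty \<tau> H d) \<longleftrightarrow> (\<forall>a\<in>D \<tau>. sat M (\<rho>((d, \<tau>) := a)) (H (Var (d, \<tau>)) (Suc d)))"
  "sat M \<rho> (ex_ty \<tau> H d) \<longleftrightarrow> (\<exists>a\<in>D \<tau>. sat M (\<rho>((d, \<tau>) := a)) (H (Var (d, \<tau>)) (Suc d)))"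
  by (auto simp: eq_s_def not_s_def and_s_def or_s_def imp_s_def iff_s_def all_ty_def ex_ty_def)

lemma sat_less: "val M \<rho> t = rp a \<Longrightarrow> val M \<rho> u = rp b \<Longrightarrow> sat M \<rho> ((t \<^bold>< u) d) \<longleftrightarrow> a < b"
  by (simp add: less_s_def ltr_rp)

lemma sat_le: "val M \<rho> t = rp a \<Longrightarrow> val M \<rho> u = rp b \<Longrightarrow> sat M \<rho> ((t \<^bold>\<le> u) d) \<longleftrightarrow> a \<le> b"
  by (auto simp: le_s_def sat_less rp_inject)

lemma sat_nat [simp]:
  "sat M \<rho> (all_nat H d) \<longleftrightarrow> (\<forall>n. sat M (\<rho>((d, N) := rp n)) (H (Var (d, N)) (Suc d)))"
  "sat M \<rho> (ex_nat H d) \<longleftrightarrow> (\<exists>n. sat M (\<rho>((d, N) := rp n)) (H (Var (d, N)) (Suc d)))"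
  by (simp_all add: all_nat_def ex_nat_def ball_D bex_D)

lemma sat_bounded:
  assumes "below d t" "val M \<rho> t = rp k"
  shows "sat M \<rho> (all_lt t H d) \<longleftrightarrow> (\<forall>n<k. sat M (\<rho>((d, N) := rp n)) (H (Var (d, N)) (Suc d)))"
    "sat M \<rho> (ex_lt t H d) \<longleftrightarrow> (\<exists>n<k. sat M (\<rho>((d, N) := rp n)) (H (Var (d, N)) (Suc d)))"
    "sat M \<rho> (all_le t H d) \<longleftrightarrow> (\<forall>n\<le>k. sat M (\<rho>((d, N) := rp n)) (H (Var (d, N)) (Suc d)))"
    "sat M \<rho> (ex_le t H d) \<longleftrightarrow> (\<exists>n\<le>k. sat M (\<rho>((d, N) := rp n)) (H (Var (d, N)) (Suc d)))"
proof -
  have "sat M (\<rho>((d, N) := rp n)) ((Var (d, N) \<^bold>< t) d') \<longleftrightarrow> n < k"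
    "sat M (\<rho>((d, N) := rp n)) ((Var (d, N) \<^bold>\<le> t) d') \<longleftrightarrow> n \<le> k" for n d'
    using assms sat_less[of "\<rho>((d, N) := rp n)" "Var (d, N)" n t k d']
      sat_le[of "\<rho>((d, N) := rp n)" "Var (d, N)" n t k d'] by simp_all
  then show "sat M \<rho> (all_lt t H d) \<longleftrightarrow> (\<forall>n<k. sat M (\<rho>((d, N) := rp n)) (H (Var (d, N)) (Suc d)))"
    "sat M \<rho> (ex_lt t H d) \<longleftrightarrow> (\<exists>n<k. sat M (\<rho>((d, N) := rp n)) (H (Var (d, N)) (Suc d)))"
    "sat M \<rho> (all_le t H d) \<longleftrightarrow> (\<forall>n\<le>k. sat M (\<rho>((d, N) := rp n)) (H (Var (d, N)) (Suc d)))"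
    "sat M \<rho> (ex_le t H d) \<longleftrightarrow> (\<exists>n\<le>k. sat M (\<rho>((d, N) := rp n)) (H (Var (d, N)) (Suc d)))"
    by (simp_all add: all_lt_def ex_lt_def all_le_def ex_le_def)
qed

subsection \<open>Semantics of rational and real expressions\<close>

fun below3 :: "nat \<Rightarrow> rat3 \<Rightarrow> bool" where
  "below3 d (a, b, c) \<longleftrightarrow> below d a \<and> below d b \<and> below d c"

fun ratp :: "(var \<Rightarrow> nat) \<Rightarrow> rat3 \<Rightarrow> mrat \<Rightarrow> bool" where
  "ratp \<rho> (a, b, c) r \<longleftrightarrow> (\<exists>x y z. val M \<rho> a = rp x \<and> val M \<rho> b = rp y \<and> val M \<rho> c = rp z \<and> z \<noteq> 0 \<and> r = rv x y z)"

lemma ratpI: "val M \<rho> a = rp x \<Longrightarrow> val M \<rho> b = rp y \<Longrightarrow> val M \<rho> c = rp z \<Longrightarrow> z \<noteq> 0 \<Longrightarrow> r = rv x y z \<Longrightarrow> ratp \<rho> (a, b, c) r"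
  by auto

lemma ratp_agree: "below3 d p \<Longrightarrow> agree d \<rho> \<rho>' \<Longrightarrow> ratp \<rho> p r \<Longrightarrow> ratp \<rho>' p r"
proof (cases p)
  fix a b c assume *: "below3 d p" "agree d \<rho> \<rho>'" "ratp \<rho> p r" "p = (a, b, c)"
  then have "val M \<rho>' a = val M \<rho> a" "val M \<rho>' b = val M \<rho> b" "val M \<rho>' c = val M \<rho> c"
    using val_agree[OF _ *(2)] by simp_all
  then show ?thesis using *(3,4) by simp
qed

lemma below3_mono: "below3 d p \<Longrightarrow> d \<le> d' \<Longrightarrow> below3 d' p"
  by (cases p) (auto intro: below_mono)

lemma rv_plus: "z \<noteq> 0 \<Longrightarrow> z' \<noteq> 0 \<Longrightarrow>
    rv x y z + rv x' y' z' = rv (x * z' + x' * z) (y * z' + y' * z) (z * z')"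
  by (simp add: rv_def field_simps)

lemma ratp_plus: "ratp \<rho> p r \<Longrightarrow> ratp \<rho> q s \<Longrightarrow> ratp \<rho> (rat_plus p q) (r + s)"
proof (cases p; cases q)
  fix a b c a' b' c' assume *: "ratp \<rho> p r" "ratp \<rho> q s" "p = (a, b, c)" "q = (a', b', c')"
  then obtain x y z x' y' z' where
    "val M \<rho> a = rp x" "val M \<rho> b = rp y" "val M \<rho> c = rp z" "z \<noteq> 0" "r = rv x y z"
    "val M \<rho> a' = rp x'" "val M \<rho> b' = rp y'" "val M \<rho> c' = rp z'" "z' \<noteq> 0" "s = rv x' y' z'" by auto
  then show ?thesis unfolding *(3,4) rat_plus.simps
    by (intro ratpI[of _ _ "x * z' + x' * z" _ "y * z' + y' * z" _ "z * z'"]) (simp_all add: rp_op rv_plus)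
qed

lemma ratp_minus: "ratp \<rho> p r \<Longrightarrow> ratp \<rho> (rat_minus p) (- r)"
proof (cases p)
  fix a b c assume *: "ratp \<rho> p r" "p = (a, b, c)"
  then obtain x y z where
    "val M \<rho> a = rp x" "val M \<rho> b = rp y" "val M \<rho> c = rp z" "z \<noteq> 0" "r = rv x y z" by auto
  then show ?thesis unfolding *(2) rat_minus.simps
    by (intro ratpI[of _ _ y _ x _ z]) (auto simp: rv_def field_simps)
qed

lemma below3_plus: "below3 d p \<Longrightarrow> below3 d q \<Longrightarrow> below3 d (rat_plus p q)"
  by (cases p; cases q) simp

lemma below3_minus: "below3 d p \<Longrightarrow> below3 d (rat_minus p)"
  by (cases p) simp

lemma kr_hp [simp]: "0 < kr (hp n)" "0 \<le> kr (hp n)"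
  using kr_pos[of "hp n"] by (simp_all del: kr_pos add: less_imp_le)

lemma two_rp: "pl on on = rp 2"
  using rp_op(3)[of 1 1] by (simp add: rp_op)

lemma ratp_hp: "val M \<rho> t = rp n \<Longrightarrow> ratp \<rho> (\<^bold>1, \<^bold>0, pow2 t) (hp n)"
  by (rule ratpI[of _ _ 1 _ 0 _ "pw n"]) (simp_all add: rp_op val_pow2 rv_def hp_def)

lemma ratp_2hp: "val M \<rho> t = rp n \<Longrightarrow> ratp \<rho> (\<^bold>2, \<^bold>0, pow2 t) (2 * hp n)"
  by (rule ratpI[of _ _ 2 _ 0 _ "pw n"]) (simp_all add: rp_op two_rp val_pow2 rv_def hp_def nk_numeral_mnat)

lemma sat_rat_less: "ratp \<rho> p r \<Longrightarrow> ratp \<rho> q s \<Longrightarrow> sat M \<rho> (rat_less p q d) \<longleftrightarrow> r < s"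
proof (cases p; cases q)
  fix a b c a' b' c' assume *: "ratp \<rho> p r" "ratp \<rho> q s" "p = (a, b, c)" "q = (a', b', c')"
  then obtain x y z x' y' z' where
    **: "val M \<rho> a = rp x" "val M \<rho> b = rp y" "val M \<rho> c = rp z" "z \<noteq> 0" "r = rv x y z"
    "val M \<rho> a' = rp x'" "val M \<rho> b' = rp y'" "val M \<rho> c' = rp z'" "z' \<noteq> 0" "s = rv x' y' z'" by auto
  have "sat M \<rho> (rat_less p q d) \<longleftrightarrow> x * z' + y' * z < x' * z + y * z'"
    unfolding *(3,4) rat_less.simps using ** by (intro sat_less) (simp_all add: rp_op)
  also have "\<dots> \<longleftrightarrow> nk (x * z' + y' * z) < nk (x' * z + y * z')" by (simp only: nk_less)
  also have "\<dots> \<longleftrightarrow> (nk x - nk y) * nk z' < (nk x' - nk y') * nk z" by (simp add: algebra_simps)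
  also have "\<dots> \<longleftrightarrow> r < s"
    using **(4,9) unfolding **(5,10) rv_def by (subst divide_less_eq; simp add: less_divide_eq field_simps)
  finally show ?thesis .
qed

text \<open>The continuation \<open>K\<close> may be run at any greater depth, in any extended
  environment and on any triple that denotes \<open>r\<close>; its truth must depend on the rational
  \<open>r\<close> alone.\<close>

definition reps :: "nat \<Rightarrow> (var \<Rightarrow> nat) \<Rightarrow> (rat3 \<Rightarrow> sch) \<Rightarrow> (mrat \<Rightarrow> bool) \<Rightarrow> bool" where
  "reps d \<rho> K Q \<longleftrightarrow> (\<forall>d' \<rho>' p r. d \<le> d' \<longrightarrow> agree d \<rho> \<rho>' \<longrightarrow> below3 d' p \<longrightarrow> ratp \<rho>' p r \<longrightarrow>
    (sat M \<rho>' (K p d') \<longleftrightarrow> Q r))"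

lemma repsD: "reps d \<rho> K Q \<Longrightarrow> d \<le> d' \<Longrightarrow> agree d \<rho> \<rho>' \<Longrightarrow> below3 d' p \<Longrightarrow> ratp \<rho>' p r \<Longrightarrow>
  sat M \<rho>' (K p d') \<longleftrightarrow> Q r"
  unfolding reps_def by blast

lemma sat_rat_code:
  assumes "below d q" "below d a" "below d b" "below d c"
    "val M \<rho> q = rp n" "val M \<rho> a = rp x" "val M \<rho> b = rp y" "val M \<rho> c = rp z"
  shows "sat M \<rho> (rat_code q a b c d) \<longleftrightarrow> rcode n x y z"
proof -
  have l: "sat M \<rho>' ((\<^bold>1 \<^bold>\<le> t) d') \<longleftrightarrow> 1 \<le> w" if "val M \<rho>' t = rp w" for \<rho>' t d' w
    using that by (intro sat_le) (simp_all add: rp_op)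
  show ?thesis
    using assms
    by (simp add: rat_code_def rcode_def l[of _ _ y] rp_op(3,4)[symmetric] rp_op(1,2)[symmetric] two_rp rp_inject)
qed

lemma sat_with_rat:
  assumes "below d q" "val M \<rho> q = rp n" "reps d \<rho> K Q"
  shows "sat M \<rho> (with_rat q K d) \<longleftrightarrow> Q (dec n)"
proof -
  have "sat M \<rho> (with_rat q K d) \<longleftrightarrow> (\<exists>a b c. rcode n a b c \<and> Q (rv a b (c + 1)))"
    unfolding with_rat_def sat_nat sat_sch
  proof (intro ex_cong1 arg_cong2[where f = "(\<and>)"])
    fix a b c
    let ?\<rho> = "\<rho>((d, N) := rp a, (Suc d, N) := rp b, (Suc (Suc d), N) := rp c)"
    show "sat M ?\<rho> (rat_code q (Var (d, N)) (Var (Suc d, N)) (Var (Suc (Suc d), N)) (Suc (Suc (Suc d)))) \<longleftrightarrow> rcode n a b c"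
      using assms by (intro sat_rat_code) simp_all
    have ag: "agree d \<rho> ?\<rho>" by (intro agree_upd' agree_refl) simp_all
    show "sat M ?\<rho> (K (Var (d, N), Var (Suc d, N), Var (Suc (Suc d), N) \<^bold>+ \<^bold>1) (Suc (Suc (Suc d)))) \<longleftrightarrow> Q (rv a b (c + 1))"
    proof (rule repsD[OF assms(3) _ ag])
      show "ratp ?\<rho> (Var (d, N), Var (Suc d, N), Var (Suc (Suc d), N) \<^bold>+ \<^bold>1) (rv a b (c + 1))"
        by (rule ratpI[of _ _ a _ b _ "c + 1"]) (simp_all add: rp_op)
    qed simp_all
  qed
  also have "\<dots> \<longleftrightarrow> Q (dec n)" using rcode_ex[of n] dec_eq by metis
  finally show ?thesis .
qed

definition repX :: "nat \<Rightarrow> (var \<Rightarrow> nat) \<Rightarrow> rexp \<Rightarrow> (mnat \<Rightarrow> mrat) \<Rightarrow> bool" where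
  "repX d \<rho> X f \<longleftrightarrow> (\<forall>d' \<rho>' t n K Q. d \<le> d' \<longrightarrow> agree d \<rho> \<rho>' \<longrightarrow> below d' t \<longrightarrow> val M \<rho>' t = rp n \<longrightarrow>
    reps d' \<rho>' K Q \<longrightarrow> (sat M \<rho>' (X t K d') \<longleftrightarrow> Q (f n)))"

lemma repXD: "repX d \<rho> X f \<Longrightarrow> d \<le> d' \<Longrightarrow> agree d \<rho> \<rho>' \<Longrightarrow> below d' t \<Longrightarrow> val M \<rho>' t = rp n \<Longrightarrow>
    reps d' \<rho>' K Q \<Longrightarrow> sat M \<rho>' (X t K d') \<longleftrightarrow> Q (f n)"
  unfolding repX_def by blast

lemma reps_const: 
  assumes "\<And>d' \<rho>' p r. d \<le> d' \<Longrightarrow> agree d \<rho> \<rho>' \<Longrightarrow> below3 d' p \<Longrightarrow> ratp \<rho>' p r \<Longrightarrow> sat M \<rho>' (K p d') \<longleftrightarrow> Q r"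
  shows "reps d \<rho> K Q"
  unfolding reps_def using assms by blast

definition rep :: "nat \<Rightarrow> (var \<Rightarrow> nat) \<Rightarrow> rexp \<Rightarrow> mreal \<Rightarrow> bool" where
  "rep d \<rho> X L \<longleftrightarrow> (\<exists>f. repX d \<rho> X f \<and> (\<forall>n. \<bar>L - kr (f n)\<bar> \<le> kr (hp n)))"

lemma rep_rl:
  assumes "below d t" "isreal (val M \<rho> t)"
  shows "rep d \<rho> (rl t) (v (val M \<rho> t))"
proof -
  have "repX d \<rho> (rl t) (xs (val M \<rho> t))"
    unfolding repX_def
  proof (intro allI impI)
    fix d' \<rho>' u n K Q
    assume *: "d \<le> d'" "agree d \<rho> \<rho>'" "below d' u" "val M \<rho>' u = rp n" "reps d' \<rho>' K Q"
    have "val M \<rho>' (t \<cdot> u) = rp (nap (val M \<rho> t) n)"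
      using rp_nap[OF isreal_D[OF assms(2)]] * val_agree[OF assms(1) *(2)] by simp
    then show "sat M \<rho>' (rl t u K d') \<longleftrightarrow> Q (xs (val M \<rho> t) n)"
      unfolding rl_def xs_def using * below_mono[OF assms(1)] by (intro sat_with_rat) auto
  qed
  then show ?thesis unfolding rep_def using v_approx[OF assms(2)] by blast
qed

lemma rep_rnat:
  assumes "below d t" "val M \<rho> t = rp k"
  shows "rep d \<rho> (rnat t) (kr (nk k))"
proof -
  have "repX d \<rho> (rnat t) (\<lambda>_. nk k)"
    unfolding repX_def
  proof (intro allI impI)
    fix d' \<rho>' u n K Q
    assume *: "d \<le> d'" "agree d \<rho> \<rho>'" "below d' u" "val M \<rho>' u = rp n" "reps d' \<rho>' K Q"
    show "sat M \<rho>' (rnat t u K d') \<longleftrightarrow> Q (nk k)"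
      unfolding rnat_def
    proof (rule repsD[OF *(5) order_refl agree_refl])
      show "below3 d' (t, \<^bold>0, \<^bold>1)" using below_mono[OF assms(1) *(1)] by simp
      show "ratp \<rho>' (t, \<^bold>0, \<^bold>1) (nk k)"
        by (rule ratpI[of _ _ k _ 0 _ 1]) (use val_agree[OF assms(1) *(2)] assms(2) in \<open>simp_all add: rp_op rv_def\<close>)
    qed
  qed
  then show ?thesis unfolding rep_def by (intro exI[of _ "\<lambda>_. nk k"]) simp
qed

lemma rep_plus:
  assumes "rep d \<rho> X L" "rep d \<rho> Y L'"
  shows "rep d \<rho> (X \<oplus> Y) (L + L')"
proof -
  obtain f g where f: "repX d \<rho> X f" "\<And>n. \<bar>L - kr (f n)\<bar> \<le> kr (hp n)"
    and g: "repX d \<rho> Y g" "\<And>n. \<bar>L' - kr (g n)\<bar> \<le> kr (hp n)" using assms by (auto simp: rep_def)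
  \<comment> \<open>The shift to \<open>n + 1\<close> halves both errors, which then add up to
    \<open>2^-n\<close>.\<close>
  have "repX d \<rho> (X \<oplus> Y) (\<lambda>n. f (n + 1) + g (n + 1))"
    unfolding repX_def
  proof (intro allI impI)
    fix d' \<rho>' u n K Q
    assume *: "d \<le> d'" "agree d \<rho> \<rho>'" "below d' u" "val M \<rho>' u = rp n" "reps d' \<rho>' K Q"
    have u1: "below d' (u \<^bold>+ \<^bold>1)" "val M \<rho>' (u \<^bold>+ \<^bold>1) = rp (n + 1)" using * by (simp_all add: rp_op)
    show "sat M \<rho>' ((X \<oplus> Y) u K d') \<longleftrightarrow> Q (f (n + 1) + g (n + 1))"
      unfolding rplus_def
    proof (rule repXD[OF f(1) *(1,2) u1, where Q = "\<lambda>r. Q (r + g (n + 1))"], rule reps_const)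
      fix d2 \<rho>2 p r assume p: "d' \<le> d2" "agree d' \<rho>' \<rho>2" "below3 d2 p" "ratp \<rho>2 p r"
      have "agree d \<rho> \<rho>2" "d \<le> d2" using agree_trans[OF *(2) p(2) *(1)] *(1) p(1) by auto
      moreover have "below d2 (u \<^bold>+ \<^bold>1)" "val M \<rho>2 (u \<^bold>+ \<^bold>1) = rp (n + 1)"
        using below_mono[OF u1(1) p(1)] val_agree[OF u1(1) p(2)] u1(2) by auto
      ultimately show "sat M \<rho>2 (Y (u \<^bold>+ \<^bold>1) (\<lambda>q. K (rat_plus p q)) d2) \<longleftrightarrow> Q (r + g (n + 1))"
      proof (intro repXD[OF g(1), where Q = "\<lambda>s. Q (r + s)"] reps_const)
        fix d3 \<rho>3 q s assume q: "d2 \<le> d3" "agree d2 \<rho>2 \<rho>3" "below3 d3 q" "ratp \<rho>3 q s"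
        show "sat M \<rho>3 (K (rat_plus p q) d3) \<longleftrightarrow> Q (r + s)"
        proof (rule repsD[OF *(5)])
          show "d' \<le> d3" using p q by simp
          show "agree d' \<rho>' \<rho>3" using agree_trans[OF p(2) q(2) p(1)] .
          show "below3 d3 (rat_plus p q)" using below3_plus below3_mono[OF p(3) q(1)] q(3) by blast
          show "ratp \<rho>3 (rat_plus p q) (r + s)" using ratp_plus ratp_agree[OF p(3) q(2) p(4)] q(4) by blast
        qed
      qed
    qed
  qed
  moreover have "\<bar>L + L' - kr (f (n + 1) + g (n + 1))\<bar> \<le> kr (hp n)" for n
    using f(2)[of "n + 1"] g(2)[of "n + 1"] hp_2(1)[of n] by (simp add: abs_le_iff)
  ultimately show ?thesis unfolding rep_def by blast
qed

lemma rep_neg: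
  assumes "rep d \<rho> Y L"
  shows "rep d \<rho> (\<lambda>n K. Y n (\<lambda>q. K (rat_minus q))) (- L)"
proof -
  obtain g where g: "repX d \<rho> Y g" "\<And>n. \<bar>L - kr (g n)\<bar> \<le> kr (hp n)" using assms by (auto simp: rep_def)
  have "repX d \<rho> (\<lambda>n K. Y n (\<lambda>q. K (rat_minus q))) (\<lambda>n. - g n)"
    unfolding repX_def
  proof (intro allI impI)
    fix d' \<rho>' u n K Q
    assume *: "d \<le> d'" "agree d \<rho> \<rho>'" "below d' u" "val M \<rho>' u = rp n" "reps d' \<rho>' K Q"
    show "sat M \<rho>' (Y u (\<lambda>q. K (rat_minus q)) d') \<longleftrightarrow> Q (- g n)"
    proof (rule repXD[OF g(1) *(1-4), where Q = "\<lambda>s. Q (- s)"], rule reps_const)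
      fix d2 \<rho>2 p r assume p: "d' \<le> d2" "agree d' \<rho>' \<rho>2" "below3 d2 p" "ratp \<rho>2 p r"
      show "sat M \<rho>2 (K (rat_minus p) d2) \<longleftrightarrow> Q (- r)"
        by (rule repsD[OF *(5) p(1,2) below3_minus[OF p(3)] ratp_minus[OF p(4)]])
    qed
  qed
  moreover have "\<bar>- L - kr (- g n)\<bar> \<le> kr (hp n)" for n
    using g(2)[of n] by (simp add: abs_le_iff)
  ultimately show ?thesis unfolding rep_def by blast
qed

lemma rep_minus: "rep d \<rho> X L \<Longrightarrow> rep d \<rho> Y L' \<Longrightarrow> rep d \<rho> (X \<ominus> Y) (L - L')"
  using rep_plus[OF _ rep_neg, of d \<rho> X L Y L'] by (simp add: rminus_def)

lemma rep_abs:
  assumes "rep d \<rho> Y L"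
  shows "rep d \<rho> (rabs Y) \<bar>L\<bar>"
proof -
  obtain g where g: "repX d \<rho> Y g" "\<And>n. \<bar>L - kr (g n)\<bar> \<le> kr (hp n)" using assms by (auto simp: rep_def)
  have "repX d \<rho> (rabs Y) (\<lambda>n. \<bar>g n\<bar>)"
    unfolding repX_def
  proof (intro allI impI)
    fix d' \<rho>' u n K Q
    assume *: "d \<le> d'" "agree d \<rho> \<rho>'" "below d' u" "val M \<rho>' u = rp n" "reps d' \<rho>' K Q"
    show "sat M \<rho>' (rabs Y u K d') \<longleftrightarrow> Q \<bar>g n\<bar>"
      unfolding rabs_def
    proof (rule repXD[OF g(1) *(1-4), where Q = "\<lambda>s. Q \<bar>s\<bar>"], rule reps_const)
      fix d2 \<rho>2 p r assume p: "d' \<le> d2" "agree d' \<rho>' \<rho>2" "below3 d2 p" "ratp \<rho>2 p r"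
      obtain a b e where abe: "p = (a, b, e)" by (cases p)
      then obtain x y z where xyz: "val M \<rho>2 a = rp x" "val M \<rho>2 b = rp y" "val M \<rho>2 e = rp z" "z \<noteq> 0" "r = rv x y z"
        using p(4) by auto
      have K: "sat M (\<rho>2((d2, N) := rp c)) (K (Var (d2, N), \<^bold>0, e) (Suc d2)) \<longleftrightarrow> Q (rv c 0 z)" for c
      proof (rule repsD[OF *(5)])
        show "d' \<le> Suc d2" using p(1) by simp
        show "agree d' \<rho>' (\<rho>2((d2, N) := rp c))" by (rule agree_upd'[OF p(2,1)])
        show "below3 (Suc d2) (Var (d2, N), \<^bold>0, e)" using p(3) abe by simp
        show "ratp (\<rho>2((d2, N) := rp c)) (Var (d2, N), \<^bold>0, e) (rv c 0 z)"
          by (rule ratpI[of _ _ c _ 0 _ z]) (use xyz p(3) abe in \<open>simp_all add: rp_op\<close>)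
      qed
      have "sat M \<rho>2 ((case p of (a, b, da) \<Rightarrow> \<^bold>\<exists>c. (a \<^bold>= b \<^bold>+ c \<^bold>\<or> b \<^bold>= a \<^bold>+ c) \<^bold>\<and> K (c, \<^bold>0, da)) d2) \<longleftrightarrow>
          (\<exists>c. (x = y + c \<or> y = x + c) \<and> Q (rv c 0 z))"
        using p(3) xyz unfolding abe by (simp add: K rp_op(3)[symmetric] rp_inject)
      also have "\<dots> \<longleftrightarrow> Q \<bar>r\<bar>"
      proof -
        have "rv c 0 z = \<bar>r\<bar>" if "x = y + c \<or> y = x + c" for c
          using that xyz(4) unfolding xyz(5) by (auto simp: rv_def abs_mult abs_divide)
        moreover have "\<exists>c. x = y + c \<or> y = x + c" using mnat_total by metis
        ultimately show ?thesis by metis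
      qed
      finally show "sat M \<rho>2 ((case p of (a, b, da) \<Rightarrow> \<^bold>\<exists>c. (a \<^bold>= b \<^bold>+ c \<^bold>\<or> b \<^bold>= a \<^bold>+ c) \<^bold>\<and> K (c, \<^bold>0, da)) d2) \<longleftrightarrow> Q \<bar>r\<bar>" .
    qed
  qed
  moreover have "\<bar>\<bar>L\<bar> - kr \<bar>g n\<bar>\<bar> \<le> kr (hp n)" for n
    using order_trans[OF abs_triangle_ineq3[of L "kr (g n)"] g(2)[of n]] by simp
  ultimately show ?thesis unfolding rep_def by blast
qed

lemma rep_Suc: "rep d \<rho> X L \<Longrightarrow> rep (Suc d) (\<rho>((d, \<tau>) := a)) X L"
proof -
  have "agree d \<rho> \<rho>'" if "agree (Suc d) (\<rho>((d, \<tau>) := a)) \<rho>'" for \<rho>'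
    by (rule agree_trans[OF agree_upd[OF agree_refl] that]) simp
  then have "repX (Suc d) (\<rho>((d, \<tau>) := a)) X f" if "repX d \<rho> X f" for f
    using that unfolding repX_def by (metis Suc_leD)
  then show "rep d \<rho> X L \<Longrightarrow> ?thesis" unfolding rep_def by blast
qed

text \<open>The common part of \<open>sat_rless\<close> and \<open>sat_req\<close>: at a given
  precision both comparisons reduce to a relation between two rationals that are within
  \<open>2^-n\<close> of the values.\<close>

lemma sat_rat2:
  assumes "rep d \<rho> X L" "rep d \<rho> Y L'"
    and "\<And>d' \<rho>' p q r s. below3 d' p \<Longrightarrow> below3 d' q \<Longrightarrow> ratp \<rho>' p r \<Longrightarrow> ratp \<rho>' q s \<Longrightarrow> d \<le> d' \<Longrightarrow>
      agree d \<rho> \<rho>' \<Longrightarrow> sat M \<rho>' (R p q d') \<longleftrightarrow> Q r s"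
    and "below d t" "val M \<rho> t = rp n"
  obtains r s where "\<bar>L - kr r\<bar> \<le> kr (hp n)" "\<bar>L' - kr s\<bar> \<le> kr (hp n)"
    "sat M \<rho> (X t (\<lambda>p. Y t (\<lambda>q. R p q)) d) \<longleftrightarrow> Q r s"
proof -
  obtain f g where f: "repX d \<rho> X f" "\<And>n. \<bar>L - kr (f n)\<bar> \<le> kr (hp n)"
    and g: "repX d \<rho> Y g" "\<And>n. \<bar>L' - kr (g n)\<bar> \<le> kr (hp n)" using assms by (auto simp: rep_def)
  have "sat M \<rho> (X t (\<lambda>p. Y t (\<lambda>q. R p q)) d) \<longleftrightarrow> Q (f n) (g n)"
  proof (rule repXD[OF f(1) order_refl agree_refl assms(4,5), where Q = "\<lambda>r. Q r (g n)"], rule reps_const)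
    fix d2 \<rho>2 p r assume p: "d \<le> d2" "agree d \<rho> \<rho>2" "below3 d2 p" "ratp \<rho>2 p r"
    show "sat M \<rho>2 (Y t (\<lambda>q. R p q) d2) \<longleftrightarrow> Q r (g n)"
    proof (rule repXD[OF g(1) p(1,2) below_mono[OF assms(4) p(1)]], simp add: val_agree[OF assms(4) p(2)] assms(5), rule reps_const)
      fix d3 \<rho>3 q s assume q: "d2 \<le> d3" "agree d2 \<rho>2 \<rho>3" "below3 d3 q" "ratp \<rho>3 q s"
      show "sat M \<rho>3 (R p q d3) \<longleftrightarrow> Q r s"
        using below3_mono[OF p(3) q(1)] q(3) ratp_agree[OF p(3) q(2) p(4)] q(4) agree_trans[OF p(2) q(2) p(1)]
          order_trans[OF p(1) q(1)] by (intro assms(3)) auto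
    qed
  qed
  then show ?thesis using that f(2) g(2) by blast
qed

lemma sat_rless:
  assumes "rep d \<rho> X L" "rep d \<rho> Y L'"
  shows "sat M \<rho> ((X <\<^sub>R Y) d) \<longleftrightarrow> L < L'"
proof -
  have *: "\<exists>r s. \<bar>L - kr r\<bar> \<le> kr (hp n) \<and> \<bar>L' - kr s\<bar> \<le> kr (hp n) \<and>
    (sat M (\<rho>((d, N) := rp n)) (X (Var (d, N)) (\<lambda>p. Y (Var (d, N)) (\<lambda>q. rat_less (rat_plus p (\<^bold>2, \<^bold>0, pow2 (Var (d, N)))) q)) (Suc d))
      \<longleftrightarrow> r + 2 * hp n < s)" for n
  proof (rule sat_rat2[OF assms[THEN rep_Suc[where \<tau> = N and a = "rp n"]],
        where R = "\<lambda>p q. rat_less (rat_plus p (\<^bold>2, \<^bold>0, pow2 (Var (d, N)))) q" and Q = "\<lambda>r s. r + 2 * hp n < s"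
        and t = "Var (d, N)" and n = n])
    fix d' \<rho>' p q r s
    assume a: "ratp \<rho>' p r" "ratp \<rho>' q s" "agree (Suc d) (\<rho>((d, N) := rp n)) \<rho>'"
    have "val M \<rho>' (Var (d, N)) = rp n" using val_agree[OF _ a(3), of "Var (d, N)"] by simp
    then show "sat M \<rho>' (rat_less (rat_plus p (\<^bold>2, \<^bold>0, pow2 (Var (d, N)))) q d') \<longleftrightarrow> r + 2 * hp n < s"
      by (intro sat_rat_less ratp_plus ratp_2hp a)
  qed (simp_all, blast)
  show ?thesis
  proof
    assume "sat M \<rho> ((X <\<^sub>R Y) d)"
    then obtain n where n: "sat M (\<rho>((d, N) := rp n)) (X (Var (d, N)) (\<lambda>p. Y (Var (d, N)) (\<lambda>q. rat_less (rat_plus p (\<^bold>2, \<^bold>0, pow2 (Var (d, N)))) q)) (Suc d))"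
      by (auto simp: rless_def)
    obtain r s where rs: "\<bar>L - kr r\<bar> \<le> kr (hp n)" "\<bar>L' - kr s\<bar> \<le> kr (hp n)" "r + 2 * hp n < s"
      using *[of n] n by blast
    then have "kr (r + 2 * hp n) < kr s" by (simp only: kr_less)
    then have "kr r + 2 * kr (hp n) < kr s" by simp
    then show "L < L'" using rs(1,2) by arith
  next
    assume "L < L'"
    then obtain n where n: "kr (hp n) < L' - L" using hp_mreal_arch[of "L' - L"] by auto
    \<comment> \<open>The gap exceeds \<open>4 * 2^-m\<close>. The two approximations lose at most
      \<open>2^-m\<close> each, so more than the required \<open>2 * 2^-m\<close> remains.\<close>
    define m where "m = n + 1 + 1"
    obtain r s where rs: "\<bar>L - kr r\<bar> \<le> kr (hp m)" "\<bar>L' - kr s\<bar> \<le> kr (hp m)"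
      "sat M (\<rho>((d, N) := rp m)) (X (Var (d, N)) (\<lambda>p. Y (Var (d, N)) (\<lambda>q. rat_less (rat_plus p (\<^bold>2, \<^bold>0, pow2 (Var (d, N)))) q)) (Suc d))
      \<longleftrightarrow> r + 2 * hp m < s" using *[of m] by blast
    have "kr (hp n) = 4 * kr (hp m)" unfolding m_def by (rule hp_2(2))
    then have "kr r + 2 * kr (hp m) < kr s" using rs(1,2) n by arith
    then have "kr (r + 2 * hp m) < kr s" by simp
    then have "r + 2 * hp m < s" by (simp only: kr_less)
    then show "sat M \<rho> ((X <\<^sub>R Y) d)" unfolding rless_def sat_nat using rs(3) by blast
  qed
qed

lemma sat_rle: "rep d \<rho> X L \<Longrightarrow> rep d \<rho> Y L' \<Longrightarrow> sat M \<rho> ((X \<le>\<^sub>R Y) d) \<longleftrightarrow> L \<le> L'"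
  by (simp add: rle_def sat_rless not_less)

lemma sat_req:
  assumes "rep d \<rho> X L" "rep d \<rho> Y L'"
  shows "sat M \<rho> ((X =\<^sub>R Y) d) \<longleftrightarrow> L = L'"
proof -
  let ?R = "\<lambda>p q. rat_le p (rat_plus q (\<^bold>2, \<^bold>0, pow2 (Var (d, N)))) \<^bold>\<and> rat_le q (rat_plus p (\<^bold>2, \<^bold>0, pow2 (Var (d, N))))"
  have *: "\<exists>r s. \<bar>L - kr r\<bar> \<le> kr (hp n) \<and> \<bar>L' - kr s\<bar> \<le> kr (hp n) \<and>
    (sat M (\<rho>((d, N) := rp n)) (X (Var (d, N)) (\<lambda>p. Y (Var (d, N)) (?R p)) (Suc d))
      \<longleftrightarrow> \<not> s + 2 * hp n < r \<and> \<not> r + 2 * hp n < s)" for n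
  proof (rule sat_rat2[OF assms[THEN rep_Suc[where \<tau> = N and a = "rp n"]],
        where R = ?R and Q = "\<lambda>r s. \<not> s + 2 * hp n < r \<and> \<not> r + 2 * hp n < s"
        and t = "Var (d, N)" and n = n])
    fix d' \<rho>' p q r s
    assume a: "ratp \<rho>' p r" "ratp \<rho>' q s" "agree (Suc d) (\<rho>((d, N) := rp n)) \<rho>'"
    have "val M \<rho>' (Var (d, N)) = rp n" using val_agree[OF _ a(3), of "Var (d, N)"] by simp
    then have h: "ratp \<rho>' (\<^bold>2, \<^bold>0, pow2 (Var (d, N))) (2 * hp n)" by (rule ratp_2hp)
    show "sat M \<rho>' (?R p q d') \<longleftrightarrow> \<not> s + 2 * hp n < r \<and> \<not> r + 2 * hp n < s"
      using sat_rat_less[OF ratp_plus[OF a(2) h] a(1)] sat_rat_less[OF ratp_plus[OF a(1) h] a(2)]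
      by (simp add: rat_le_def)
  qed (simp_all, blast)
  have "sat M \<rho> ((X =\<^sub>R Y) d) \<longleftrightarrow> (\<forall>n. sat M (\<rho>((d, N) := rp n)) (X (Var (d, N)) (\<lambda>p. Y (Var (d, N)) (?R p)) (Suc d)))"
    by (simp add: req_def)
  also have "\<dots> \<longleftrightarrow> L = L'"
  proof
    assume "L = L'"
    show "\<forall>n. sat M (\<rho>((d, N) := rp n)) (X (Var (d, N)) (\<lambda>p. Y (Var (d, N)) (?R p)) (Suc d))"
    proof
      fix n
      obtain r s where rs: "\<bar>L - kr r\<bar> \<le> kr (hp n)" "\<bar>L' - kr s\<bar> \<le> kr (hp n)"
        "sat M (\<rho>((d, N) := rp n)) (X (Var (d, N)) (\<lambda>p. Y (Var (d, N)) (?R p)) (Suc d))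
          \<longleftrightarrow> \<not> s + 2 * hp n < r \<and> \<not> r + 2 * hp n < s" using *[of n] by blast
      have "\<not> kr s + 2 * kr (hp n) < kr r \<and> \<not> kr r + 2 * kr (hp n) < kr s"
        using rs(1,2) \<open>L = L'\<close> by arith
      then have "\<not> kr (s + 2 * hp n) < kr r \<and> \<not> kr (r + 2 * hp n) < kr s" by simp
      then have "\<not> s + 2 * hp n < r \<and> \<not> r + 2 * hp n < s" unfolding kr_less .
      then show "sat M (\<rho>((d, N) := rp n)) (X (Var (d, N)) (\<lambda>p. Y (Var (d, N)) (?R p)) (Suc d))"
        unfolding rs(3) .
    qed
  next
    assume all: "\<forall>n. sat M (\<rho>((d, N) := rp n)) (X (Var (d, N)) (\<lambda>p. Y (Var (d, N)) (?R p)) (Suc d))"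
    show "L = L'"
    proof (rule ccontr)
      assume "L \<noteq> L'"
      then have "0 < \<bar>L - L'\<bar>" by simp
      then obtain n where n: "kr (hp n) < \<bar>L - L'\<bar>" using hp_mreal_arch by blast
      \<comment> \<open>As in \<open>sat_rless\<close>, a difference of more than
        \<open>4 * 2^-m\<close> is visible to the approximations at \<open>m\<close>.\<close>
      define m where "m = n + 1 + 1"
      obtain r s where rs: "\<bar>L - kr r\<bar> \<le> kr (hp m)" "\<bar>L' - kr s\<bar> \<le> kr (hp m)"
        "\<not> s + 2 * hp m < r \<and> \<not> r + 2 * hp m < s" using *[of m] all by blast
      then have "\<not> kr (s + 2 * hp m) < kr r \<and> \<not> kr (r + 2 * hp m) < kr s" unfolding kr_less by blast
      then have "\<not> kr s + 2 * kr (hp m) < kr r \<and> \<not> kr r + 2 * kr (hp m) < kr s" by simp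
      moreover have "kr (hp n) = 4 * kr (hp m)" unfolding m_def by (rule hp_2(2))
      ultimately show False using rs(1,2) n by arith
    qed
  qed
  finally show ?thesis .
qed

lemma sat_is_real:
  assumes "below d t" "val M \<rho> t \<in> D T1"
  shows "sat M \<rho> (is_real t d) \<longleftrightarrow> isreal (val M \<rho> t)"
proof -
  let ?x = "val M \<rho> t"
  have "sat M (\<rho>((d, N) := rp n, (Suc d, N) := rp i))
      (rl t (Var (d, N)) (\<lambda>p. rl t (Var (d, N) \<^bold>+ Var (Suc d, N)) (\<lambda>q.
        rat_less p (rat_plus q (\<^bold>1, \<^bold>0, pow2 (Var (d, N)))) \<^bold>\<and> rat_less q (rat_plus p (\<^bold>1, \<^bold>0, pow2 (Var (d, N)))))) (Suc (Suc d)))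
    \<longleftrightarrow> xs ?x n < xs ?x (n + i) + hp n \<and> xs ?x (n + i) < xs ?x n + hp n" (is "?A \<longleftrightarrow> ?B") for n i
    unfolding rl_def xs_def
  proof (rule sat_with_rat[where Q = "\<lambda>r. r < dec (nap ?x (n + i)) + hp n \<and> dec (nap ?x (n + i)) < r + hp n"])
    let ?\<rho> = "\<rho>((d, N) := rp n, (Suc d, N) := rp i)"
    show "below (Suc (Suc d)) (t \<cdot> Var (d, N))" using assms by simp
    show "val M ?\<rho> (t \<cdot> Var (d, N)) = rp (nap ?x n)"
      using rp_nap[OF assms(2)] assms(1) by simp
    show "reps (Suc (Suc d)) ?\<rho> (\<lambda>p. with_rat (t \<cdot> (Var (d, N) \<^bold>+ Var (Suc d, N))) (\<lambda>q.
        rat_less p (rat_plus q (\<^bold>1, \<^bold>0, pow2 (Var (d, N)))) \<^bold>\<and> rat_less q (rat_plus p (\<^bold>1, \<^bold>0, pow2 (Var (d, N))))))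
      (\<lambda>r. r < dec (nap ?x (n + i)) + hp n \<and> dec (nap ?x (n + i)) < r + hp n)"
    proof (rule reps_const)
      fix d2 \<rho>2 p r assume p: "Suc (Suc d) \<le> d2" "agree (Suc (Suc d)) ?\<rho> \<rho>2" "below3 d2 p" "ratp \<rho>2 p r"
      have b: "below (Suc (Suc d)) (t \<cdot> (Var (d, N) \<^bold>+ Var (Suc d, N)))" using assms by simp
      have "val M \<rho>2 (t \<cdot> (Var (d, N) \<^bold>+ Var (Suc d, N))) = rp (nap ?x (n + i))"
        using val_agree[OF b p(2)] rp_nap[OF assms(2)] assms(1) by (simp add: rp_op)
      then show "sat M \<rho>2 (with_rat (t \<cdot> (Var (d, N) \<^bold>+ Var (Suc d, N))) (\<lambda>q.
        rat_less p (rat_plus q (\<^bold>1, \<^bold>0, pow2 (Var (d, N)))) \<^bold>\<and> rat_less q (rat_plus p (\<^bold>1, \<^bold>0, pow2 (Var (d, N))))) d2)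
        \<longleftrightarrow> r < dec (nap ?x (n + i)) + hp n \<and> dec (nap ?x (n + i)) < r + hp n"
      proof (rule sat_with_rat[OF below_mono[OF b p(1)], where Q = "\<lambda>s. r < s + hp n \<and> s < r + hp n"], intro reps_const)
        fix d3 \<rho>3 q s assume q: "d2 \<le> d3" "agree d2 \<rho>2 \<rho>3" "below3 d3 q" "ratp \<rho>3 q s"
        have "agree (Suc (Suc d)) ?\<rho> \<rho>3" using agree_trans[OF p(2) q(2) p(1)] .
        from val_agree[OF _ this, of "Var (d, N)"] have "val M \<rho>3 (Var (d, N)) = rp n" by simp
        then have h: "ratp \<rho>3 (\<^bold>1, \<^bold>0, pow2 (Var (d, N))) (hp n)" by (rule ratp_hp)
        note p3 = ratp_agree[OF p(3) q(2) p(4)]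
        show "sat M \<rho>3 ((rat_less p (rat_plus q (\<^bold>1, \<^bold>0, pow2 (Var (d, N)))) \<^bold>\<and> rat_less q (rat_plus p (\<^bold>1, \<^bold>0, pow2 (Var (d, N))))) d3)
          \<longleftrightarrow> r < s + hp n \<and> s < r + hp n"
          using sat_rat_less[OF p3 ratp_plus[OF q(4) h]] sat_rat_less[OF q(4) ratp_plus[OF p3 h]] by simp
      qed
    qed
  qed
  moreover have "a < b + h \<and> b < a + h \<longleftrightarrow> \<bar>a - b\<bar> < h" for a b h :: mrat by (auto simp: abs_if)
  ultimately show ?thesis using assms(2) by (simp add: is_real_def isreal_def)
qed

end

subsection \<open>Arithmetical formulas are definable\<close>

text \<open>Quantifiers over numbers only, matching the closure of definable predicates under
  \<open>dfnP_all\<close>.\<close>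

fun arithf :: "fm \<Rightarrow> bool" where
  "arithf (Imp \<phi> \<psi>) \<longleftrightarrow> arithf \<phi> \<and> arithf \<psi>"
| "arithf (All x \<phi>) \<longleftrightarrow> snd x = N \<and> arithf \<phi>"
| "arithf _ \<longleftrightarrow> True"

text \<open>Equations for the syntactic checks on \<open>cmp8_fm\<close>, which reads approximations
  of eight reals; \<open>with_rat\<close> is not unfolded there.\<close>

lemma rl_depth: "wf (with_rat q K d) \<longleftrightarrow> ty_of q = Some N \<and>
    wf (K (Var (d, N), Var (Suc d, N), Var (Suc (Suc d), N) \<^bold>+ \<^bold>1) (Suc (Suc (Suc d))))"
  "arithf (with_rat q K d) \<longleftrightarrow>
    arithf (K (Var (d, N), Var (Suc d, N), Var (Suc (Suc d), N) \<^bold>+ \<^bold>1) (Suc (Suc (Suc d))))"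
  "fv (with_rat q K d) = (tm_vars q - {(Suc (Suc (Suc d)), N)} \<union>
    (fv (K (Var (d, N), Var (Suc d, N), Var (Suc (Suc d), N) \<^bold>+ \<^bold>1) (Suc (Suc (Suc d)))))) - {(Suc (Suc d), N), (Suc d, N), (d, N)}"
  by (auto simp: with_rat_def rat_code_def sch_defs)

context countermodel
begin

lemma dfn_val: "ty_of t = Some \<tau> \<Longrightarrow> (\<And>x. x \<in> tm_vars t \<Longrightarrow> dfn G (snd x) (\<lambda>e. F e x)) \<Longrightarrow>
    dfn G \<tau> (\<lambda>e. val M (F e) t)"
proof (induction t arbitrary: \<tau>)
  case (Con c)
  then show ?case using cs_D[of c] by (simp add: dfn_const)
next
  case (App t u)
  from App.prems(1) obtain \<sigma> where "ty_of t = Some (\<sigma> \<rightarrow>\<^sub>t \<tau>)" "ty_of u = Some \<sigma>" by (rule ty_of_App)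
  then have "dfn G (\<sigma> \<rightarrow>\<^sub>t \<tau>) (\<lambda>e. val M (F e) t)" "dfn G \<sigma> (\<lambda>e. val M (F e) u)"
    using App by simp_all
  then show ?case by (simp add: dfn_app)
qed auto

text \<open>Once its syntax has been checked, a formula becomes a definable predicate as a whole, so
  the nested continuations inside real expressions need not be traced one by one.\<close>

lemma dfnP_sat: "wf \<phi> \<Longrightarrow> arithf \<phi> \<Longrightarrow> (\<And>x. x \<in> fv \<phi> \<Longrightarrow> dfn G (snd x) (\<lambda>e. F e x)) \<Longrightarrow>
    dfnP G (\<lambda>e. sat M (F e) \<phi>)"
proof (induction \<phi> arbitrary: G F)
  case (Eq t u)
  then show ?case by (simp add: dfnP_eq dfn_val)
next
  case (Less t u)
  then show ?case by (simp add: dfnP_ltr dfn_val)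
next
  case Falsum
  then show ?case by (simp add: dfnP_const)
next
  case (Imp \<phi> \<psi>)
  then show ?case by (simp add: dfnP_imp)
next
  case (All x \<phi>)
  have "dfnP (case_nat N G) (\<lambda>e. sat M ((F (\<lambda>i. e (Suc i)))(x := e 0)) \<phi>)"
  proof (rule All.IH)
    fix z assume z: "z \<in> fv \<phi>"
    show "dfn (case_nat N G) (snd z) (\<lambda>e. ((F (\<lambda>i. e (Suc i)))(x := e 0)) z)"
    proof (cases "z = x")
      case True
      then show ?thesis using All.prems by (simp add: dfn_var)
    next
      case False
      then show ?thesis using All.prems(3)[of z] z dfn_weaken[of G "snd z" "\<lambda>e. F e z" N] by simp
    qed
  qed (use All.prems in auto)
  from dfnP_all[where P = "\<lambda>e a. sat M ((F e)(x := a)) \<phi>", OF this] show ?case using All.prems by simp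
qed

text \<open>The one comparison of reals that is shown to be definable; the others are instances of
  it, padded with zeros. Four summands on each side are what the comparison of increments of
  \<open>p + q\<close> in \<open>small_oscillation\<close> takes.\<close>

definition cmp8_fm :: fm where
  "cmp8_fm = ((((rl (Var (0, T1)) \<oplus> rl (Var (1, T1))) \<oplus> (rl (Var (2, T1)) \<oplus> rl (Var (3, T1)))) <\<^sub>R
    ((rl (Var (4, T1)) \<oplus> rl (Var (5, T1))) \<oplus> (rl (Var (6, T1)) \<oplus> rl (Var (7, T1))))) 8)"

definition cmp8 :: "nat list \<Rightarrow> bool" where
  "cmp8 l \<longleftrightarrow> sat M (\<lambda>(i, _). l ! i) cmp8_fm"

lemma cmp8_fm: "wf cmp8_fm" "arithf cmp8_fm" "fv cmp8_fm \<subseteq> (\<lambda>i. (i, T1)) ` {..<8}"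
  by (auto simp: cmp8_fm_def rless_def rplus_def rl_def rl_depth ex_nat_def ex_ty_def less_s_def pow2_def
      double_t_def id_t_def numeral_eq_Suc lessThan_Suc)

lemma cmp8_iff:
  assumes "\<forall>x\<in>set [a, b, c, d, a', b', c', d']. isreal x"
  shows "cmp8 [a, b, c, d, a', b', c', d'] \<longleftrightarrow> v a + v b + v c + v d < v a' + v b' + v c' + v d'"
proof -
  let ?l = "[a, b, c, d, a', b', c', d']"
  have r: "rep 8 (\<lambda>(i, _). ?l ! i) (rl (Var (i, T1))) (v (?l ! i))" if "i < 8" for i
  proof -
    have "?l ! i \<in> set ?l" using that by (intro nth_mem) simp
    then have "isreal (?l ! i)" using assms by blast
    then show ?thesis using rep_rl[of 8 "Var (i, T1)" "\<lambda>(i, _). ?l ! i"] that by simp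
  qed
  have "cmp8 ?l \<longleftrightarrow> (v (?l ! 0) + v (?l ! 1)) + (v (?l ! 2) + v (?l ! 3))
      < (v (?l ! 4) + v (?l ! 5)) + (v (?l ! 6) + v (?l ! 7))"
    unfolding cmp8_def cmp8_fm_def by (intro sat_rless rep_plus r) simp_all
  then show ?thesis by (simp add: add.assoc)
qed

lemma dfnP_cmp8:
  assumes "dfn G T1 a" "dfn G T1 b" "dfn G T1 c" "dfn G T1 d"
    "dfn G T1 a'" "dfn G T1 b'" "dfn G T1 c'" "dfn G T1 d'"
  shows "dfnP G (\<lambda>e. cmp8 [a e, b e, c e, d e, a' e, b' e, c' e, d' e])"
  unfolding cmp8_def
proof (rule dfnP_sat[OF cmp8_fm(1,2)])
  fix x assume "x \<in> fv cmp8_fm"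
  then obtain i where "i < 8" "x = (i, T1)" using cmp8_fm(3) by auto
  then have "x \<in> {(0, T1), (1, T1), (2, T1), (3, T1), (4, T1), (5, T1), (6, T1), (7, T1)}" by auto
  then show "dfn G (snd x) (\<lambda>e. case x of (i, _) \<Rightarrow> [a e, b e, c e, d e, a' e, b' e, c' e, d' e] ! i)"
    using assms by auto
qed

subsection \<open>Constant reals\<close>

text \<open>The code of \<open>(a - b)/d\<close> for positive \<open>d\<close>. Subtraction is
  truncated, so at most one of \<open>a - b\<close> and \<open>b - a\<close> is nonzero, as
  \<open>rat_code\<close> demands.\<close>

definition scode :: "mnat \<Rightarrow> mnat \<Rightarrow> mnat \<Rightarrow> mnat" where
  "scode a b d = (THE q. rcode q (a - b) (b - a) (d - 1))"

lemma rcode_inj: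
  assumes q: "rcode q a b c" "rcode q' a b c"
  shows "q = q'"
proof -
  obtain m where m: "2 * q = (m + c) * (m + c + 1) + 2 * m"
    "(b = 0 \<and> m = 2 * a) \<or> (a = 0 \<and> 1 \<le> b \<and> m + 1 = 2 * b)" using q(1) by (auto simp: rcode_def)
  obtain m' where m': "2 * q' = (m' + c) * (m' + c + 1) + 2 * m'"
    "(b = 0 \<and> m' = 2 * a) \<or> (a = 0 \<and> 1 \<le> b \<and> m' + 1 = 2 * b)" using q(2) by (auto simp: rcode_def)
  have "m = m'"
    using m(2) m'(2) by (auto, metis add_right_cancel)
  then show ?thesis using m(1) m'(1) mult_2_cancel[of q q'] by simp
qed

lemma rcode_scode: "rcode (scode a b d) (a - b) (b - a) (d - 1)"
proof -
  \<comment> \<open>One of two consecutive numbers is even, so the pairing equation can be solved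
    for \<open>q\<close>, whatever \<open>m\<close> and \<open>c\<close> are.\<close>
  have ex: "\<exists>q. 2 * q = (m + c) * (m + c + 1) + 2 * m" for m c :: mnat
  proof -
    have "\<exists>k. (m + c) * (m + c + 1) = 2 * k"
    proof -
      obtain k where "m + c = 2 * k \<or> m + c = 2 * k + 1" using even_odd by blast
      then show ?thesis
      proof
        assume n: "m + c = 2 * k + 1"
        have "(m + c) * (m + c + 1) = 2 * ((2 * k + 1) * (k + 1))"
          unfolding n by (rule iffD1[OF nk_eq]) (simp add: algebra_simps del: nk_eq)
        then show ?thesis by blast
      next
        assume "m + c = 2 * k"
        then have "(m + c) * (m + c + 1) = 2 * (k * (m + c + 1))" by (simp only: mult.assoc)
        then show ?thesis by blast
      qed
    qed
    then obtain k where "(m + c) * (m + c + 1) = 2 * k" by blast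
    then have "2 * (k + m) = (m + c) * (m + c + 1) + 2 * m" by (simp add: distrib_left)
    then show ?thesis by blast
  qed
  have "\<exists>q. rcode q (a - b) (b - a) (d - 1)"
  proof (cases "b \<le> a")
    case True
    obtain q where "2 * q = (2 * (a - b) + (d - 1)) * (2 * (a - b) + (d - 1) + 1) + 2 * (2 * (a - b))"
      using ex by blast
    moreover have "b - a = 0" using True by (auto simp: minus_mnat_def)
    ultimately show ?thesis unfolding rcode_def by blast
  next
    case False
    then have 0: "a - b = 0" by (simp add: minus_mnat_def)
    obtain k where k: "b = a + k" using le_ex False by (meson linear)
    then have "k \<noteq> 0" using False by auto
    then obtain j where j: "k = j + 1" using mnat_cases by blast
    have ba: "b - a = j + 1" using k j by simp
    have m: "2 * j + 1 + 1 = 2 * (j + 1)" by (simp add: distrib_left add.assoc)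
    obtain q where "2 * q = (2 * j + 1 + (d - 1)) * (2 * j + 1 + (d - 1) + 1) + 2 * (2 * j + 1)"
      using ex by blast
    moreover have "1 \<le> j + 1" by simp
    ultimately show ?thesis unfolding rcode_def 0 ba using m by blast
  qed
  then have "\<exists>!q. rcode q (a - b) (b - a) (d - 1)" using rcode_inj by blast
  then show ?thesis unfolding scode_def by (rule theI')
qed

lemma nk_diff2: "nk (a - b) - nk (b - a) = nk a - nk (b :: mnat)"
proof (cases "b \<le> a")
  case True
  then obtain k where "a = b + k" using le_ex by blast
  then show ?thesis by (cases "k = 0") (auto simp: minus_mnat_def[of b])
next
  case False
  then obtain k where "b = a + k" using le_ex by (meson linear)
  then show ?thesis by (cases "k = 0") (auto simp: minus_mnat_def[of a])
qed

lemma dec_scode: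
  assumes "d \<noteq> 0"
  shows "dec (scode a b d) = rv a b d"
proof -
  have "1 \<le> d" using assms Suc_le[of 0 d] by simp
  then have "d - 1 + 1 = d" by simp
  then show ?thesis using dec_eq[OF rcode_scode[of a b d]] nk_diff2[of a b] by (simp add: rv_def)
qed

lemma dfnN_weaken: "dfnN G F \<Longrightarrow> dfnN (case_nat \<sigma> G) (\<lambda>e. F (\<lambda>i. e (Suc i)))"
  unfolding dfnN_def by (rule dfn_weaken)

lemma dfnN_scode:
  assumes "dfnN G a" "dfnN G b" "dfnN G d"
  shows "dfnN G (\<lambda>e. scode (a e) (b e) (d e))"
proof -
  have *: "scode a b d = q \<longleftrightarrow> rcode q (a - b) (b - a) (d - 1)" for a b d q
    using rcode_scode[of a b d] rcode_inj by blast
  note w = assms[THEN dfnN_weaken[where \<sigma> = N]]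
  note w2 = w[THEN dfnN_weaken[where \<sigma> = N]]
  note w3 = w2[THEN dfnN_weaken[where \<sigma> = N]]
  show ?thesis
    by (rule dfnN_graph, unfold * rcode_def, intro dfn_rules) (use w w2 w3 in simp_all)
qed

text \<open>The rational \<open>(a - b)/d\<close> as a real with constant approximations. Grid
  points, values of \<Psi> and endpoints of nested intervals all have this form.\<close>

definition crl :: "mnat \<Rightarrow> mnat \<Rightarrow> mnat \<Rightarrow> nat" where "crl a b d = LamN (\<lambda>_. scode a b d)"

lemma dfn_crl: "dfnN G a \<Longrightarrow> dfnN G b \<Longrightarrow> dfnN G d \<Longrightarrow> dfn G T1 (\<lambda>e. crl (a e) (b e) (d e))"
  unfolding crl_def by (intro dfn_LamN dfnN_scode dfnN_weaken)

lemma crl: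
  assumes "d \<noteq> 0"
  shows "isreal (crl a b d)" "v (crl a b d) = kr (rv a b d)"
proof -
  have "xs (crl a b d) n = rv a b d" for n
    unfolding xs_def crl_def by (subst nap_LamN) (simp_all add: dfnN_const dec_scode assms)
  moreover have "crl a b d \<in> D T1" unfolding crl_def by (rule LamN_D) (rule dfnN_const)
  ultimately show r: "isreal (crl a b d)" by (simp add: isreal_def)
  show "v (crl a b d) = kr (rv a b d)"
    by (rule v_eqI[OF r]) (simp add: \<open>\<And>n. xs (crl a b d) n = rv a b d\<close>)
qed

abbreviation zrl :: nat where "zrl \<equiv> crl 0 0 1"

lemma zrl: "isreal zrl" "v zrl = 0"
  using crl[of 1 0 0] by (simp_all add: rv_def)

definition rlt :: "nat \<Rightarrow> nat \<Rightarrow> bool" where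
  "rlt x y \<longleftrightarrow> cmp8 [x, zrl, zrl, zrl, y, zrl, zrl, zrl]"

lemma rlt_iff: "isreal x \<Longrightarrow> isreal y \<Longrightarrow> rlt x y \<longleftrightarrow> v x < v y"
  unfolding rlt_def by (subst cmp8_iff) (simp_all add: zrl)

lemma dfnP_rlt: "dfn G T1 x \<Longrightarrow> dfn G T1 y \<Longrightarrow> dfnP G (\<lambda>e. rlt (x e) (y e))"
  unfolding rlt_def by (intro dfnP_cmp8 dfn_crl dfnN_const)

lemmas dfn_rules' = dfn_rules dfnN_pw dfnP_rlt dfn_crl

subsection \<open>Semantics of the notions of real analysis\<close>

definition unit :: "nat \<Rightarrow> bool" where "unit x \<longleftrightarrow> isreal x \<and> 0 \<le> v x \<and> v x \<le> 1"

lemma unit_real: "unit x \<Longrightarrow> isreal x" by (simp add: unit_def)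

lemma sat_all_real:
  "sat M \<rho> (all_real H d) \<longleftrightarrow> (\<forall>x. isreal x \<longrightarrow> sat M (\<rho>((d, T1) := x)) (H (Var (d, T1)) (Suc d)))"
  unfolding all_real_def using isreal_D by (auto simp: sat_is_real)

lemma sat_ex_real:
  "sat M \<rho> (ex_real H d) \<longleftrightarrow> (\<exists>x. isreal x \<and> sat M (\<rho>((d, T1) := x)) (H (Var (d, T1)) (Suc d)))"
  unfolding ex_real_def using isreal_D by (auto simp: sat_is_real)

lemma rep_0: "rep d \<rho> (rnat \<^bold>0) 0" and rep_1: "rep d \<rho> (rnat \<^bold>1) 1"
  using rep_rnat[of d "\<^bold>0" \<rho> 0] rep_rnat[of d "\<^bold>1" \<rho> 1] by (simp_all add: rp_op)

lemma sat_in_unit: "below d t \<Longrightarrow> isreal (val M \<rho> t) \<Longrightarrow> sat M \<rho> (in_unit t d) \<longleftrightarrow> unit (val M \<rho> t)"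
  by (simp add: in_Icc_def unit_def sat_rle[OF rep_0 rep_rl] sat_rle[OF rep_rl rep_1])

definition rfun :: "nat \<Rightarrow> bool" where
  "rfun f \<longleftrightarrow> (\<forall>x. unit x \<longrightarrow> isreal (fap f x)) \<and>
    (\<forall>x y. unit x \<longrightarrow> unit y \<longrightarrow> v x = v y \<longrightarrow> v (fap f x) = v (fap f y))"

lemma sat_real_fun:
  assumes "below d t" "val M \<rho> t \<in> D (T1 \<rightarrow>\<^sub>t T1)"
  shows "sat M \<rho> (real_fun (rnat \<^bold>0) (rnat \<^bold>1) t d) \<longleftrightarrow> rfun (val M \<rho> t)"
proof -
  let ?f = "val M \<rho> t"
  have 1: "(\<forall>x. isreal x \<longrightarrow> unit x \<longrightarrow> isreal (fap ?f x)) \<longleftrightarrow> (\<forall>x. unit x \<longrightarrow> isreal (fap ?f x))"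
    using unit_real by blast
  have 2: "sat M \<rho> (all_real (\<lambda>x. in_unit x \<^bold>\<longrightarrow> is_real (t \<cdot> x)) d) \<longleftrightarrow> (\<forall>x. isreal x \<longrightarrow> unit x \<longrightarrow> isreal (fap ?f x))"
    unfolding sat_all_real
    using assms by (auto simp: sat_in_unit sat_is_real fap_def isreal_D ap_D)
  have 3: "sat M \<rho> (all_real (\<lambda>x. all_real (\<lambda>y. in_unit x \<^bold>\<and> in_unit y \<^bold>\<and> rl x =\<^sub>R rl y \<^bold>\<longrightarrow>
        rl (t \<cdot> x) =\<^sub>R rl (t \<cdot> y))) d) \<longleftrightarrow>
      (\<forall>x y. unit x \<longrightarrow> unit y \<longrightarrow> v x = v y \<longrightarrow> v (fap ?f x) = v (fap ?f y))"
    if "\<forall>x. unit x \<longrightarrow> isreal (fap ?f x)"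
    unfolding sat_all_real
    using assms that unit_real by (auto simp: sat_in_unit sat_req[OF rep_rl rep_rl] fap_def)
  show ?thesis unfolding real_fun_def sat_sch 2 1 rfun_def using 3 by blast
qed

lemma sat_positive_fun:
  assumes "below d t" "val M \<rho> t \<in> D (T1 \<rightarrow>\<^sub>t T1)"
  shows "sat M \<rho> (positive_fun (rnat \<^bold>0) (rnat \<^bold>1) t d) \<longleftrightarrow>
    rfun (val M \<rho> t) \<and> (\<forall>x. unit x \<longrightarrow> 0 < v (fap (val M \<rho> t) x))"
proof -
  let ?f = "val M \<rho> t"
  have "sat M \<rho> (all_real (\<lambda>x. in_unit x \<^bold>\<longrightarrow> rnat \<^bold>0 <\<^sub>R rl (t \<cdot> x)) d) \<longleftrightarrow> (\<forall>x. unit x \<longrightarrow> 0 < v (fap ?f x))"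
    if "\<forall>x. unit x \<longrightarrow> isreal (fap ?f x)"
    unfolding sat_all_real
    using assms that unit_real by (auto simp: sat_in_unit sat_rless[OF rep_0 rep_rl] fap_def)
  then show ?thesis
    unfolding positive_fun_def sat_sch sat_real_fun[OF assms] by (auto simp: rfun_def)
qed

lemma sat_nondecreasing:
  assumes "below d t" "rfun (val M \<rho> t)"
  shows "sat M \<rho> (nondecreasing (rnat \<^bold>0) (rnat \<^bold>1) t d) \<longleftrightarrow>
    (\<forall>x y. unit x \<longrightarrow> unit y \<longrightarrow> v x \<le> v y \<longrightarrow> v (fap (val M \<rho> t) x) \<le> v (fap (val M \<rho> t) y))"
proof -
  have "\<forall>x. unit x \<longrightarrow> isreal (fap (val M \<rho> t) x)" using assms(2) by (simp add: rfun_def)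
  then show ?thesis
    unfolding nondecreasing_def sat_all_real
    using assms unit_real by (auto simp: sat_in_unit sat_rle[OF rep_rl rep_rl] fap_def)
qed

text \<open>The partial sums have to form an object of the model, so bounds on \<open>s\<close> are
  obtained by internal induction along \<open>S\<close>.\<close>

definition issum :: "(mnat \<Rightarrow> mreal) \<Rightarrow> mnat \<Rightarrow> mreal \<Rightarrow> bool" where
  "issum z n s \<longleftrightarrow> (\<exists>S\<in>D (N \<rightarrow>\<^sub>t T1). (\<forall>i\<le>n. isreal (sap S i)) \<and> v (sap S 0) = 0 \<and>
    (\<forall>i<n. v (sap S (i + 1)) = v (sap S i) + z i) \<and> s = v (sap S n))"

lemma sat_is_sum:
  assumes t: "below d t" "val M \<rho> t = rp n" and s: "below d s" "isreal (val M \<rho> s)"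
    and Z: "\<And>\<rho>' d' u i. d \<le> d' \<Longrightarrow> agree d \<rho> \<rho>' \<Longrightarrow> below d' u \<Longrightarrow> val M \<rho>' u = rp i \<Longrightarrow> i < n \<Longrightarrow> rep d' \<rho>' (Z u) (z i)"
  shows "sat M \<rho> (is_sum Z t s d) \<longleftrightarrow> issum z n (v (val M \<rho> s))"
proof -
  have "sat M (\<rho>((d, N \<rightarrow>\<^sub>t T1) := S)) ((all_le t (\<lambda>i. is_real (Var (d, N \<rightarrow>\<^sub>t T1) \<cdot> i)) \<^bold>\<and>
     rl (Var (d, N \<rightarrow>\<^sub>t T1) \<cdot> \<^bold>0) =\<^sub>R rnat \<^bold>0 \<^bold>\<and>
     all_lt t (\<lambda>i. rl (Var (d, N \<rightarrow>\<^sub>t T1) \<cdot> (i \<^bold>+ \<^bold>1)) =\<^sub>R rl (Var (d, N \<rightarrow>\<^sub>t T1) \<cdot> i) \<oplus> Z i) \<^bold>\<and>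
     rl s =\<^sub>R rl (Var (d, N \<rightarrow>\<^sub>t T1) \<cdot> t)) (Suc d)) \<longleftrightarrow>
    (\<forall>i\<le>n. isreal (sap S i)) \<and> v (sap S 0) = 0 \<and>
    (\<forall>i<n. v (sap S (i + 1)) = v (sap S i) + z i) \<and> v (val M \<rho> s) = v (sap S n)"
    (is "sat M ?\<rho> _ \<longleftrightarrow> _") if S: "S \<in> D (N \<rightarrow>\<^sub>t T1)" for S
  proof -
    let ?S = "Var (d, N \<rightarrow>\<^sub>t T1)"
    have t': "below (Suc d) t" "val M ?\<rho> t = rp n" using t by simp_all
    have 1: "sat M ?\<rho> (all_le t (\<lambda>i. is_real (?S \<cdot> i)) (Suc d)) \<longleftrightarrow> (\<forall>i\<le>n. isreal (sap S i))"
      unfolding sat_bounded[OF t'] using sap_D[OF S] by (simp add: sat_is_real sap_def)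
    have 2: "sat M ?\<rho> ((rl (?S \<cdot> \<^bold>0) =\<^sub>R rnat \<^bold>0) (Suc d)) \<longleftrightarrow> v (sap S 0) = 0" if "isreal (sap S 0)"
      using sat_req[OF rep_rl[of "Suc d" "?S \<cdot> \<^bold>0" ?\<rho>] rep_0] that by (simp add: sap_def rp_op)
    have 3: "sat M ?\<rho> (all_lt t (\<lambda>i. rl (?S \<cdot> (i \<^bold>+ \<^bold>1)) =\<^sub>R rl (?S \<cdot> i) \<oplus> Z i) (Suc d)) \<longleftrightarrow>
       (\<forall>i<n. v (sap S (i + 1)) = v (sap S i) + z i)" if r: "\<forall>i\<le>n. isreal (sap S i)"
      unfolding sat_bounded[OF t']
    proof (intro all_cong1 imp_cong refl)
      fix i assume i: "i < n"
      let ?\<rho>' = "?\<rho>((Suc d, N) := rp i)"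
      have ri: "isreal (sap S i)" "isreal (sap S (i + 1))" using r i by (auto simp: Suc_le)
      have v: "val M ?\<rho>' (?S \<cdot> (Var (Suc d, N) \<^bold>+ \<^bold>1)) = sap S (i + 1)" "val M ?\<rho>' (?S \<cdot> Var (Suc d, N)) = sap S i"
        by (simp_all add: sap_def rp_op)
      have "rep (Suc (Suc d)) ?\<rho>' (Z (Var (Suc d, N))) (z i)"
        by (rule Z) (use i in \<open>auto intro!: agree_upd' agree_refl\<close>)
      moreover have "rep (Suc (Suc d)) ?\<rho>' (rl (?S \<cdot> (Var (Suc d, N) \<^bold>+ \<^bold>1))) (v (sap S (i + 1)))"
        "rep (Suc (Suc d)) ?\<rho>' (rl (?S \<cdot> Var (Suc d, N))) (v (sap S i))"
        using rep_rl[of "Suc (Suc d)" _ ?\<rho>'] ri v by (metis below_simps lessI less_SucI)+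
      ultimately show "sat M ?\<rho>' ((rl (?S \<cdot> (Var (Suc d, N) \<^bold>+ \<^bold>1)) =\<^sub>R rl (?S \<cdot> Var (Suc d, N)) \<oplus> Z (Var (Suc d, N))) (Suc (Suc d)))
        \<longleftrightarrow> v (sap S (i + 1)) = v (sap S i) + z i"
        by (intro sat_req rep_plus)
    qed
    have 4: "sat M ?\<rho> ((rl s =\<^sub>R rl (?S \<cdot> t)) (Suc d)) \<longleftrightarrow> v (val M \<rho> s) = v (sap S n)" if "isreal (sap S n)"
      using sat_req[OF rep_rl[of "Suc d" s ?\<rho>] rep_rl[of "Suc d" "?S \<cdot> t" ?\<rho>]] that s t by (simp add: sap_def)
    show ?thesis unfolding sat_sch 1 using 2 3 4 mnat_nonneg[of n] by auto
  qed
  then show ?thesis unfolding is_sum_def issum_def sat_sch(8) by (intro bex_cong[OF refl])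
qed

definition partition :: "mnat \<Rightarrow> nat \<Rightarrow> bool" where
  "partition n X \<longleftrightarrow> (\<forall>i\<le>n. isreal (sap X i)) \<and> v (sap X 0) = 0 \<and> v (sap X n) = 1 \<and>
    (\<forall>i<n. v (sap X i) < v (sap X (i + 1)))"

lemma sat_is_partition:
  assumes t: "below d t" "val M \<rho> t = rp n" and x: "below d x" "val M \<rho> x \<in> D (N \<rightarrow>\<^sub>t T1)"
  shows "sat M \<rho> (is_partition (rnat \<^bold>0) (rnat \<^bold>1) t x d) \<longleftrightarrow> partition n (val M \<rho> x)"
proof -
  let ?X = "val M \<rho> x"
  have 1: "sat M \<rho> (all_le t (\<lambda>i. is_real (x \<cdot> i)) d) \<longleftrightarrow> (\<forall>i\<le>n. isreal (sap ?X i))"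
    unfolding sat_bounded[OF t] using sap_D[OF x(2)] x(1) by (simp add: sat_is_real sap_def)
  have 2: "sat M \<rho> ((rl (x \<cdot> \<^bold>0) =\<^sub>R rnat \<^bold>0) d) \<longleftrightarrow> v (sap ?X 0) = 0" if "isreal (sap ?X 0)"
    using sat_req[OF rep_rl[of d "x \<cdot> \<^bold>0" \<rho>] rep_0] that x by (simp add: sap_def rp_op)
  have 3: "sat M \<rho> ((rl (x \<cdot> t) =\<^sub>R rnat \<^bold>1) d) \<longleftrightarrow> v (sap ?X n) = 1" if "isreal (sap ?X n)"
    using sat_req[OF rep_rl[of d "x \<cdot> t" \<rho>] rep_1] that x t by (simp add: sap_def)
  have 4: "sat M \<rho> (all_lt t (\<lambda>i. rl (x \<cdot> i) <\<^sub>R rl (x \<cdot> (i \<^bold>+ \<^bold>1))) d) \<longleftrightarrow> (\<forall>i<n. v (sap ?X i) < v (sap ?X (i + 1)))"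
    if r: "\<forall>i\<le>n. isreal (sap ?X i)"
    unfolding sat_bounded[OF t]
  proof (intro all_cong1 imp_cong refl)
    fix i assume i: "i < n"
    have ri: "isreal (sap ?X i)" "isreal (sap ?X (i + 1))" using r i by (auto simp: Suc_le)
    then show "sat M (\<rho>((d, N) := rp i)) ((rl (x \<cdot> Var (d, N)) <\<^sub>R rl (x \<cdot> (Var (d, N) \<^bold>+ \<^bold>1))) (Suc d)) \<longleftrightarrow> v (sap ?X i) < v (sap ?X (i + 1))"
      using sat_rless[OF rep_rl[of "Suc d" "x \<cdot> Var (d, N)" "\<rho>((d, N) := rp i)"]
          rep_rl[of "Suc d" "x \<cdot> (Var (d, N) \<^bold>+ \<^bold>1)" "\<rho>((d, N) := rp i)"]] x by (simp add: sap_def rp_op)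
  qed
  show ?thesis unfolding is_partition_def partition_def sat_sch 1 using 2 3 4 mnat_nonneg[of n] by auto
qed

end

context countermodel
begin

subsection \<open>Finite sums and counting\<close>

definition msum :: "(mnat \<Rightarrow> mnat) \<Rightarrow> mnat \<Rightarrow> mnat" where
  "msum F n = mrec (\<lambda>i a. a + F i) 0 n"

lemma dfnN_msum:
  assumes "dfnN (case_nat N G) (\<lambda>e. F (\<lambda>i. e (Suc i)) (ab (e 0)))" "dfnN G n"
  shows "dfnN G (\<lambda>e. msum (F e) (n e))"
  unfolding msum_def
  by (intro dfnN_mrec dfnN_add dfnN_ab_var dfnN_const assms(2))
    (use dfnN_weaken[OF assms(1), of N] in simp_all)

lemma msum:
  assumes "intl F"
  shows "msum F 0 = 0" "msum F (n + 1) = msum F n + F n"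
proof -
  have *: "dfnN (case_nat N (case_nat N G0)) (\<lambda>e. ab (e 0) + F (ab (e (Suc 0))))"
    by (intro dfn_rules dfnN_intl[OF assms]) simp_all
  show "msum F 0 = 0" "msum F (n + 1) = msum F n + F n"
    unfolding msum_def by (rule mrec[OF *])+
qed

lemmas dfn_rules2 = dfn_rules' dfnN_msum

lemma intl_msum: "intl F \<Longrightarrow> intl (msum F)"
  unfolding intl_def[of "msum F"] by (intro dfn_rules2 dfnN_intl[of F]) simp_all

lemma le_Suc_iff: "m \<le> n + 1 \<longleftrightarrow> m \<le> n \<or> m = n + (1 :: mnat)"
  using less_Suc[of m n] by (auto simp: le_less)

lemma msum_le:
  assumes "intl F" "intl G" "\<And>i. i < n \<Longrightarrow> F i \<le> G i"
  shows "msum F n \<le> msum G n"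
proof -
  have "m \<le> n \<longrightarrow> msum F m \<le> msum G m" for m
  proof (induction m rule: induct_mnat)
    case dfn
    show ?case unfolding intlP_def
      by (intro dfn_rules2 dfnN_intl[OF intl_msum[OF assms(1)]] dfnN_intl[OF intl_msum[OF assms(2)]]) simp_all
  next
    case (Suc m)
    then show ?case
      using assms(3)[of m] by (auto simp: msum[OF assms(1)] msum[OF assms(2)] Suc_le intro!: add_mono)
  qed (simp add: msum assms)
  then show ?thesis by simp
qed

lemma msum_cong: "intl F \<Longrightarrow> intl G \<Longrightarrow> (\<And>i. i < n \<Longrightarrow> F i = G i) \<Longrightarrow> msum F n = msum G n"
  by (intro antisym msum_le) auto

lemma msum_add:
  assumes "intl F" "intl G"
  shows "msum (\<lambda>i. F i + G i) n = msum F n + msum G n"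
proof (induction n rule: induct_mnat)
  have FG: "intl (\<lambda>i. F i + G i)" unfolding intl_def
    by (intro dfn_rules2 dfnN_intl[OF assms(1)] dfnN_intl[OF assms(2)]) simp_all
  {
    case dfn
    show ?case unfolding intlP_def
      by (intro dfn_rules2 dfnN_intl[OF assms(1)] dfnN_intl[OF assms(2)]) simp_all
  next
    case 0
    show ?case by (simp add: msum assms FG)
  next
    case (Suc n)
    then show ?case unfolding msum(2)[OF FG] msum(2)[OF assms(1)] msum(2)[OF assms(2)] by (simp add: ac_simps)
  }
qed

lemma msum_mult:
  assumes "intl F"
  shows "msum (\<lambda>i. c * F i) n = c * msum F n"
proof (induction n rule: induct_mnat)
  have FG: "intl (\<lambda>i. c * F i)" unfolding intl_def
    by (intro dfn_rules2 dfnN_intl[OF assms(1)]) simp_all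
  {
    case dfn
    show ?case unfolding intlP_def
      by (intro dfn_rules2 dfnN_intl[OF assms(1)]) simp_all
  next
    case 0
    show ?case by (simp add: msum assms FG)
  next
    case (Suc n)
    then show ?case by (simp add: msum[OF FG] msum[OF assms(1)] distrib_left)
  }
qed

text \<open>For the right endpoints in a sum over consecutive pairs.\<close>

lemma msum_shift:
  assumes "intl F"
  shows "F 0 + msum (\<lambda>i. F (i + 1)) n = msum F (n + 1)"
proof (induction n rule: induct_mnat)
  have FG: "intl (\<lambda>i. F (i + 1))" unfolding intl_def
    by (intro dfn_rules2 dfnN_intl[OF assms(1)]) simp_all
  {
    case dfn
    show ?case unfolding intlP_def
      by (intro dfn_rules2 dfnN_intl[OF assms(1)]) simp_all
  next
    case 0
    show ?case using msum(2)[OF assms, of 0] by (simp add: msum assms FG)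
  next
    case (Suc n)
    have "F 0 + msum (\<lambda>i. F (i + 1)) (n + 1) = (F 0 + msum (\<lambda>i. F (i + 1)) n) + F (n + 1)"
      unfolding msum(2)[OF FG] by (simp only: add.assoc)
    then show ?case unfolding Suc msum(2)[OF assms, of "n + 1"] .
  }
qed

lemma msum_ge:
  assumes "intl F" "i < n"
  shows "F i \<le> msum F n"
proof -
  have "i < n \<longrightarrow> F i \<le> msum F n"
  proof (induction n rule: induct_mnat)
    case dfn
    show ?case unfolding intlP_def by (intro dfn_rules2 dfnN_intl[OF assms(1)]) simp_all
  next
    case (Suc n)
    show ?case
    proof
      assume "i < n + 1"
      then consider "i < n" | "i = n" using less_Suc by (auto simp: le_less)
      then show "F i \<le> msum F (n + 1)"
        using Suc by cases (auto simp: msum[OF assms(1)] add_increasing2)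
    qed
  qed simp
  with assms show ?thesis by simp
qed

definition cnt :: "(mnat \<Rightarrow> bool) \<Rightarrow> mnat \<Rightarrow> mnat" where
  "cnt P n = msum (\<lambda>i. of_bool (P i)) n"

lemma intl_of_bool: "intlP P \<Longrightarrow> intl (\<lambda>i. of_bool (P i))"
  unfolding intl_def by (intro dfn_rules2 dfnP_intlP) simp_all

lemma dfnN_cnt:
  assumes "dfnP (case_nat N G) (\<lambda>e. P (\<lambda>i. e (Suc i)) (ab (e 0)))" "dfnN G n"
  shows "dfnN G (\<lambda>e. cnt (P e) (n e))"
  unfolding cnt_def by (intro dfnN_msum dfnN_of_bool assms)

lemmas dfn_rules3 = dfn_rules2 dfnN_cnt

lemma cnt: 
  assumes "intlP P"
  shows "cnt P 0 = 0" "cnt P (n + 1) = cnt P n + of_bool (P n)"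
  unfolding cnt_def by (rule msum[OF intl_of_bool[OF assms]])+

lemma cnt_or: 
  assumes "intlP P" "intlP Q"
  shows "cnt (\<lambda>i. P i \<or> Q i) n \<le> cnt P n + cnt Q n"
proof -
  have "intlP (\<lambda>i. P i \<or> Q i)" unfolding intlP_def
    by (intro dfn_rules2 dfnP_intlP[OF assms(1)] dfnP_intlP[OF assms(2)]) simp_all
  moreover have "intl (\<lambda>i. of_bool (P i) + of_bool (Q i))" unfolding intl_def
    by (intro dfn_rules2 dfnP_intlP[OF assms(1)] dfnP_intlP[OF assms(2)]) simp_all
  ultimately have "cnt (\<lambda>i. P i \<or> Q i) n \<le> msum (\<lambda>i. of_bool (P i) + of_bool (Q i)) n"
    unfolding cnt_def by (intro msum_le intl_of_bool) auto
  then show ?thesis by (simp add: msum_add intl_of_bool assms cnt_def)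
qed

text \<open>The number \<open>i\<close> found is the counted number with exactly \<open>j\<close>
  counted numbers before it. Thus \<open>cnt\<close> numbers a definable set without gaps, and a
  sequence of its elements can be chosen.\<close>

lemma cnt_enum:
  assumes "intlP P"
  shows "j < cnt P n \<longrightarrow> (\<exists>i<n. P i \<and> cnt P i = j)"
proof (induction n rule: induct_mnat)
  case dfn
  show ?case unfolding intlP_def by (intro dfn_rules3 dfnP_intlP[OF assms]) simp_all
next
  case 0
  show ?case by (simp add: cnt[OF assms])
next
  case (Suc n)
  show ?case
  proof
    assume j: "j < cnt P (n + 1)"
    have le: "i < n \<Longrightarrow> i < n + 1" for i using less_Suc by (meson less_imp_le)
    show "\<exists>i<n + 1. P i \<and> cnt P i = j"
    proof (cases "j < cnt P n")
      case True
      then show ?thesis using Suc le by blast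
    next
      case False
      then have "P n" "j < cnt P n + 1" using j by (auto simp: cnt[OF assms] of_bool_def split: if_splits)
      then have "j = cnt P n" using False less_Suc[of j "cnt P n"] by auto
      then show ?thesis using \<open>P n\<close> by (intro exI[of _ n]) simp
    qed
  qed
qed

lemma intl_choice:
  assumes "intlP2 P"
  obtains f where "intl f" "\<And>n m. P n m \<Longrightarrow> P n (f n)"
proof -
  have "dfnP (case_nat N (case_nat N G0)) (\<lambda>e. P (ab (e (Suc 0))) (ab (e 0)))"
    using assms by (simp add: intlP2_def)
  from dfn_choice[of "case_nat N G0" "\<lambda>e a. P (ab (e 0)) (ab a)", OF this]
  obtain F where F: "dfn (case_nat N G0) N F"
    "\<And>e a. e \<in> genv (case_nat N G0) \<Longrightarrow> a \<in> D N \<Longrightarrow> P (ab (e 0)) (ab a) \<Longrightarrow> P (ab (e 0)) (ab (F e))" by blast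
  \<comment> \<open>\<open>F\<close> depends on a whole assignment; setting all entries but the
    first to \<open>zr\<close> leaves a function of one number.\<close>
  define f where "f n = nap (Lam N N (\<lambda>a. F (case_nat a (\<lambda>_. zr)))) n" for n
  have g: "case_nat (rp n) (\<lambda>_. zr) \<in> genv (case_nat N G0)" for n
    by (rule genv_case[OF rp_D genv_N])
  have F': "dfn (case_nat N G0) N (\<lambda>e. F (case_nat (e 0) (\<lambda>_. zr)))"
  proof -
    obtain F0 where F0: "dfn0 (case_nat N G0) N F0" "\<forall>e\<in>genv (case_nat N G0). F e = F0 e"
      using F(1) by (auto simp: dfn_def)
    have "dfn (case_nat N G0) \<tau> (\<lambda>e. F (case_nat (e 0) (\<lambda>_. zr)))" if "dfn0 (case_nat N G0) \<tau> F" for \<tau> F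
      using that
    proof (induction rule: dfn0.induct)
      case (const p \<tau>)
      then show ?case by (rule dfn_const)
    next
      case (var i)
      show ?case
      proof (cases i)
        case 0
        have "dfn (case_nat N G0) N (\<lambda>e. e 0)" by (rule dfn_var) simp
        then show ?thesis unfolding 0 by simp
      next
        case (Suc j)
        have "dfn (case_nat N G0) N (\<lambda>e. zr)" by (rule dfn_const) simp
        then show ?thesis unfolding Suc by simp
      qed
    next
      case (app \<sigma> \<tau> F X)
      show ?case by (rule dfn_app[OF app.IH])
    qed
    from this[OF F0(1)] show ?thesis
      by (rule dfn_congI) (use F0(2) genv_case[OF genv_caseD(1) genv_N] in auto)
  qed
  have L: "Lam N N (\<lambda>a. F (case_nat a (\<lambda>_. zr))) \<in> D T1"
    by (intro dfn_closed_D dfn_Lam F')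
  have fn: "f n = ab (F (case_nat (rp n) (\<lambda>_. zr)))" for n
    unfolding f_def nap_def
    using Lam_app[of N G0 N "\<lambda>_ a. F (case_nat a (\<lambda>_. zr))", OF F' genv_N rp_D] by simp
  have "intl f" unfolding intl_def f_def by (intro dfn_rules dfn_const L) simp_all
  moreover have "P n (f n)" if "P n m" for n m
    using F(2)[OF g[of n] rp_D[of m]] that unfolding fn by (simp add: ab_rp)
  ultimately show ?thesis using that by blast
qed

text \<open>Only neighbouring points are compared by \<open>partition\<close>. The induction that
  joins them is stated with \<open>rlt\<close>, because the values \<open>v\<close> are not objects
  of the model.\<close>

lemma partition_less:
  assumes X: "X \<in> D (N \<rightarrow>\<^sub>t T1)" and p: "partition n X" and "i < j" "j \<le> n"
  shows "v (sap X i) < v (sap X j)"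
proof -
  have "j \<le> n \<longrightarrow> (\<forall>i<j. rlt (sap X i) (sap X j))" for j
  proof (induction j rule: induct_mnat)
    case dfn
    show ?case unfolding intlP_def by (intro dfn_rules2 dfn_const[OF X]) simp_all
  next
    case (Suc j)
    show ?case
    proof (intro impI allI)
      fix i assume j: "j + 1 \<le> n" and i: "i < j + 1"
      have "i \<le> j" using i by (simp add: less_Suc)
      moreover have "j < n" using j by (simp add: Suc_le)
      ultimately have jn: "j < n" "j \<le> n" "i \<le> n" by auto
      have r: "isreal (sap X i)" "isreal (sap X j)" "isreal (sap X (j + 1))"
        using p jn j by (auto simp: partition_def)
      have s: "v (sap X j) < v (sap X (j + 1))" using p jn by (simp add: partition_def)
      show "rlt (sap X i) (sap X (j + 1))"
      proof (cases "i = j")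
        case True
        then show ?thesis using s r by (simp add: rlt_iff)
      next
        case False
        then have "i < j" using i less_Suc[of i j] by auto
        then show ?thesis using Suc jn s r by (auto simp: rlt_iff)
      qed
    qed
  qed simp
  from this[of j] have "rlt (sap X i) (sap X j)" using assms by blast
  moreover have "i \<le> n" using assms by auto
  ultimately show ?thesis using p assms(4) by (subst rlt_iff[symmetric]) (auto simp: partition_def)
qed

lemma partition_unit:
  assumes X: "X \<in> D (N \<rightarrow>\<^sub>t T1)" and p: "partition n X" and i: "i \<le> n"
  shows "unit (sap X i)"
proof -
  have "v (sap X 0) = 0" "v (sap X n) = 1" "isreal (sap X i)" using p i by (auto simp: partition_def)
  moreover have "v (sap X 0) \<le> v (sap X i)"
    using partition_less[OF X p, of 0 i] i by (cases "i = 0") auto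
  moreover have "v (sap X i) \<le> v (sap X n)"
    using partition_less[OF X p, of i n] i by (cases "i = n") (auto simp: le_less)
  ultimately show ?thesis by (simp add: unit_def)
qed

lemma sat_bounded_variation:
  assumes f: "below d t" "rfun (val M \<rho> t)"
    and k: "\<And>n X s. X \<in> D (N \<rightarrow>\<^sub>t T1) \<Longrightarrow> partition n X \<Longrightarrow>
      issum (\<lambda>i. \<bar>v (fap (val M \<rho> t) (sap X i)) - v (fap (val M \<rho> t) (sap X (i + 1)))\<bar>) n s \<Longrightarrow> s \<le> kr (nk k)"
  shows "sat M \<rho> (bounded_variation (rnat \<^bold>0) (rnat \<^bold>1) t d)"
  unfolding bounded_variation_def sat_nat
proof (intro exI[of _ k] allI)
  fix n
  let ?f = "val M \<rho> t"
  let ?k = "Var (d, N)" and ?n = "Var (Suc d, N)" and ?x = "Var (Suc (Suc d), N \<rightarrow>\<^sub>t T1)"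
  let ?Z = "\<lambda>i. rabs (rl (t \<cdot> (?x \<cdot> i)) \<ominus> rl (t \<cdot> (?x \<cdot> (i \<^bold>+ \<^bold>1))))"
  let ?\<rho>1 = "\<rho>((d, N) := rp k, (Suc d, N) := rp n)"
  show "sat M ?\<rho>1 (all_ty (N \<rightarrow>\<^sub>t T1) (\<lambda>x. is_partition (rnat \<^bold>0) (rnat \<^bold>1) ?n x \<^bold>\<longrightarrow>
     (\<^bold>\<forall>\<^sub>R s. is_sum (\<lambda>i. rabs (rl (t \<cdot> (x \<cdot> i)) \<ominus> rl (t \<cdot> (x \<cdot> (i \<^bold>+ \<^bold>1))))) ?n s \<^bold>\<longrightarrow> rl s \<le>\<^sub>R rnat ?k)) (Suc (Suc d)))"
    unfolding sat_sch sat_all_real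
  proof (intro ballI impI allI)
    fix X x
    let ?\<rho>2 = "?\<rho>1((Suc (Suc d), N \<rightarrow>\<^sub>t T1) := X)"
    let ?s = "Var (Suc (Suc (Suc d)), T1)"
    let ?\<rho>3 = "?\<rho>2((Suc (Suc (Suc d)), T1) := x)"
    assume X: "X \<in> D (N \<rightarrow>\<^sub>t T1)" and p: "sat M ?\<rho>2 (is_partition (rnat \<^bold>0) (rnat \<^bold>1) ?n ?x (Suc (Suc (Suc d))))"
      and x: "isreal x" and s: "sat M ?\<rho>3 (is_sum ?Z ?n ?s (Suc (Suc (Suc (Suc d)))))"
    have p: "partition n X" using p X by (subst (asm) sat_is_partition[where n = n]) simp_all
    define z where "z = (\<lambda>i. \<bar>v (fap ?f (sap X i)) - v (fap ?f (sap X (i + 1)))\<bar>)"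
    have "issum z n (v (val M ?\<rho>3 ?s))"
    proof (rule iffD1[OF sat_is_sum s])
      fix \<rho>' d' u i
      assume a: "Suc (Suc (Suc (Suc d))) \<le> d'" "agree (Suc (Suc (Suc (Suc d)))) ?\<rho>3 \<rho>'" "below d' u" "val M \<rho>' u = rp i" "i < n"
      have b: "below (Suc (Suc (Suc (Suc d)))) t" "below (Suc (Suc (Suc (Suc d)))) ?x" using f by simp_all
      have "val M \<rho>' t = ?f" "val M \<rho>' ?x = X"
        using val_agree[OF b(1) a(2)] val_agree[OF b(2) a(2)] f by simp_all
      then have v: "val M \<rho>' (t \<cdot> (?x \<cdot> u)) = fap ?f (sap X i)" "val M \<rho>' (t \<cdot> (?x \<cdot> (u \<^bold>+ \<^bold>1))) = fap ?f (sap X (i + 1))"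
        using a(4) by (simp_all add: fap_def sap_def rp_op)
      have "unit (sap X i)" "unit (sap X (i + 1))"
        using partition_unit[OF X p] a(5) by (auto simp: Suc_le)
      then have r: "isreal (fap ?f (sap X i))" "isreal (fap ?f (sap X (i + 1)))"
        using f by (auto simp: rfun_def)
      have "below d' t" "below d' ?x" using below_mono[OF b(1) a(1)] below_mono[OF b(2) a(1)] by auto
      then have "below d' (t \<cdot> (?x \<cdot> u))" "below d' (t \<cdot> (?x \<cdot> (u \<^bold>+ \<^bold>1)))" using a(3) by simp_all
      then have "rep d' \<rho>' (rl (t \<cdot> (?x \<cdot> u))) (v (fap ?f (sap X i)))"
        "rep d' \<rho>' (rl (t \<cdot> (?x \<cdot> (u \<^bold>+ \<^bold>1)))) (v (fap ?f (sap X (i + 1))))"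
        using rep_rl[of d' _ \<rho>'] v r by metis+
      then show "rep d' \<rho>' (?Z u) (z i)"
        unfolding z_def by (intro rep_abs rep_minus)
    qed (use x in simp_all)
    then have "v x \<le> kr (nk k)" using k[OF X p, of "v x"] by (simp add: z_def)
    then show "sat M ?\<rho>3 ((rl ?s \<le>\<^sub>R rnat ?k) (Suc (Suc (Suc (Suc d)))))"
      using sat_rle[OF rep_rl[of "Suc (Suc (Suc (Suc d)))" ?s ?\<rho>3] rep_rnat[of "Suc (Suc (Suc (Suc d)))" ?k ?\<rho>3 k]] x by simp
  qed
qed

end

subsection \<open>The function \<open>\<Psi>\<close>\<close>

text \<open>\<open>bound\<close> is the size bound in pigeonhole form: any \<open>g(n) + 1\<close>
  points of the unit interval with height below \<open>n\<close> contain a repetition.\<close>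

locale hwc = countermodel +
  fixes H g :: nat
  assumes H: "H \<in> D T2" and g: "g \<in> D T1"
    and H_ext: "isreal x \<Longrightarrow> isreal y \<Longrightarrow> v x = v y \<Longrightarrow> tap H x = tap H y"
    and bound: "X \<in> D (N \<rightarrow>\<^sub>t T1) \<Longrightarrow> (\<And>i. i \<le> nap g n \<Longrightarrow> unit (sap X i)) \<Longrightarrow>
      (\<And>i. i \<le> nap g n \<Longrightarrow> tap H (sap X i) < n) \<Longrightarrow>
      \<exists>i\<le>nap g n. \<exists>j\<le>nap g n. i \<noteq> j \<and> v (sap X i) = v (sap X j)"
begin

text \<open>\<open>g\<close> is taken at \<open>b + 1\<close> because its size bounds concern
  heights strictly below the argument.\<close>

definition hH :: "mnat \<Rightarrow> mnat" where "hH b = b + 4 + nap g (b + 1)"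
definition hh :: "nat \<Rightarrow> mnat" where "hh x = hH (tap H x)"

lemma dfnN_hH: "dfnN G b \<Longrightarrow> dfnN G (\<lambda>e. hH (b e))"
  unfolding hH_def by (intro dfn_rules dfn_const[OF g])

lemma dfnN_hh: "dfn G T1 x \<Longrightarrow> dfnN G (\<lambda>e. hh (x e))"
  unfolding hh_def by (intro dfnN_hH dfn_rules dfn_const[OF H])

definition Psi :: nat where "Psi = Lam T1 T1 (\<lambda>x. crl 1 0 (pw (hh x)))"

lemma Psi_aux: "dfn (case_nat T1 G0) T1 (\<lambda>e. crl 1 0 (pw (hh (e 0))))"
  by (intro dfn_rules' dfnN_hh) simp_all

lemma Psi_D: "Psi \<in> D (T1 \<rightarrow>\<^sub>t T1)"
  unfolding Psi_def by (rule Lam_D[OF Psi_aux])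

lemma Psi: 
  assumes "isreal x"
  shows "isreal (fap Psi x)" "v (fap Psi x) = kr (hp (hh x))"
proof -
  have "fap Psi x = crl 1 0 (pw (hh x))"
    unfolding Psi_def by (rule fap_Lam[OF Psi_aux]) (use assms in \<open>rule isreal_D\<close>)
  then show "isreal (fap Psi x)" "v (fap Psi x) = kr (hp (hh x))"
    using crl[of "pw (hh x)" 1 0] by (simp_all add: rv_def hp_def)
qed

lemma hh_ext: "isreal x \<Longrightarrow> isreal y \<Longrightarrow> v x = v y \<Longrightarrow> hh x = hh y"
  unfolding hh_def using H_ext[of x y] by simp

lemma Psi_rfun: "rfun Psi"
  unfolding rfun_def
proof (intro conjI allI impI)
  show "isreal (fap Psi x)" if "unit x" for x using Psi(1)[OF unit_real[OF that]] .
  show "v (fap Psi x) = v (fap Psi y)" if "unit x" "unit y" "v x = v y" for x y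
    using unit_real[OF that(1)] unit_real[OF that(2)] that(3) hh_ext[of x y] by (simp add: Psi(2))
qed

lemma Psi_pos: "unit x \<Longrightarrow> 0 < v (fap Psi x)"
  using Psi unit_real by simp

lemma tap_le_hh: "tap H x \<le> hh x"
  unfolding hh_def hH_def by (simp add: add.assoc)

text \<open>Otherwise \<open>cnt_enum\<close> and \<open>intl_choice\<close> arrange
  \<open>g(b + 1) + 1\<close> of the counted points in a sequence of the model. They are distinct
  because the counts before them differ, and this contradicts \<open>bound\<close>.\<close>

lemma cnt_level:
  assumes X: "X \<in> D (N \<rightarrow>\<^sub>t T1)" and Q: "intlP Q"
    and u: "\<And>i. i < k \<Longrightarrow> Q i \<Longrightarrow> unit (sap X i)"
    and inj: "\<And>i j. i < k \<Longrightarrow> j < k \<Longrightarrow> Q i \<Longrightarrow> Q j \<Longrightarrow> i \<noteq> j \<Longrightarrow> v (sap X i) \<noteq> v (sap X j)"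
  shows "cnt (\<lambda>i. Q i \<and> tap H (sap X i) = b) k \<le> nap g (b + 1)"
proof (rule ccontr)
  define R where "R = (\<lambda>i. Q i \<and> tap H (sap X i) = b)"
  assume "\<not> ?thesis"
  then have lt: "nap g (b + 1) < cnt R k" by (simp add: R_def)
  have R: "intlP R" unfolding R_def intlP_def
    by (intro dfn_rules dfnP_intlP[OF Q] dfn_const[OF X] dfn_const[OF H]) simp_all
  have P2: "intlP2 (\<lambda>j i. i < k \<and> R i \<and> cnt R i = j)"
    unfolding intlP2_def by (intro dfn_rules3 dfnP_intlP[OF R]) simp_all
  obtain f where f: "intl f" "\<And>j i. i < k \<and> R i \<and> cnt R i = j \<Longrightarrow> f j < k \<and> R (f j) \<and> cnt R (f j) = j"
    using intl_choice[OF P2] by blast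
  have fj: "f j < k \<and> R (f j) \<and> cnt R (f j) = j" if "j \<le> nap g (b + 1)" for j
  proof -
    have "j < cnt R k" using that lt by (rule le_less_trans)
    then obtain i where "i < k" "R i" "cnt R i = j" using cnt_enum[OF R, of j k] by blast
    then show ?thesis using f(2)[of i j] by blast
  qed
  define Y where "Y = LamX (\<lambda>j. sap X (f j))"
  have Y_aux: "dfn (case_nat N G0) T1 (\<lambda>e. sap X (f (ab (e 0))))"
    by (intro dfn_rules dfn_const[OF X] dfnN_intl[OF f(1)]) simp_all
  have Yj: "sap Y j = sap X (f j)" for j
    unfolding Y_def by (rule sap_LamX[OF Y_aux])
  have "\<exists>i\<le>nap g (b + 1). \<exists>j\<le>nap g (b + 1). i \<noteq> j \<and> v (sap Y i) = v (sap Y j)"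
  proof (rule bound)
    show "Y \<in> D (N \<rightarrow>\<^sub>t T1)" unfolding Y_def by (rule LamX_D[OF Y_aux])
    show "unit (sap Y i)" if "i \<le> nap g (b + 1)" for i
      using fj[OF that] u by (simp add: Yj R_def)
    show "tap H (sap Y i) < b + 1" if "i \<le> nap g (b + 1)" for i
      using fj[OF that] by (simp add: Yj R_def)
  qed
  then obtain i j where "i \<le> nap g (b + 1)" "j \<le> nap g (b + 1)" "i \<noteq> j" "v (sap X (f i)) = v (sap X (f j))"
    unfolding Yj by blast
  then show False using fj[of i] fj[of j] inj[of "f i" "f j"] unfolding R_def by metis
qed

text \<open>The bound \<open>1/8\<close> for sums of \<Psi>, multiplied by the common denominator
  \<open>2^m\<close>, so that it concerns numbers and admits internal induction. \<open>Q\<close>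
  selects the indices to be summed; among these the points are distinct.\<close>

lemma weights:
  assumes X: "X \<in> D (N \<rightarrow>\<^sub>t T1)" and Q: "intlP Q"
    and u: "\<And>i. i < k \<Longrightarrow> Q i \<Longrightarrow> unit (sap X i)"
    and inj: "\<And>i j. i < k \<Longrightarrow> j < k \<Longrightarrow> Q i \<Longrightarrow> Q j \<Longrightarrow> i \<noteq> j \<Longrightarrow> v (sap X i) \<noteq> v (sap X j)"
    and m: "\<And>i. i < k \<Longrightarrow> Q i \<Longrightarrow> hh (sap X i) \<le> m"
  shows "8 * msum (\<lambda>i. if Q i then pw (m - hh (sap X i)) else 0) k \<le> pw m"
proof -
  let ?P = "pw m"
  define w where "w = (\<lambda>i. if Q i then pw (m - hh (sap X i)) else 0)"
  define h where "h i = tap H (sap X i)" for i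
  note dr = dfn_rules3 dfnP_intlP[OF Q] dfn_const[OF X] dfn_const[OF H] dfnN_hh
  have w: "intl w" unfolding intl_def w_def by (intro dr) simp_all
  have hi: "intl h" unfolding intl_def h_def by (intro dr) simp_all
  have lt: "intl (\<lambda>i. if h i < b then w i else 0)" for b
    unfolding intl_def by (intro dr dfnN_intl[OF w] dfnN_intl[OF hi]) simp_all
  have eq: "intl (\<lambda>i. if h i = b then w i else 0)" for b
    unfolding intl_def by (intro dr dfnN_intl[OF w] dfnN_intl[OF hi]) simp_all
  have R: "intlP (\<lambda>i. Q i \<and> h i = b)" for b
    unfolding intlP_def by (intro dr dfnN_intl[OF hi]) simp_all
  \<comment> \<open>All points of level \<open>b\<close> have the same weight, and there are fewer
    than \<open>2^g(b + 1)\<close> of them. Multiplying the weight by this power, by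
    \<open>2^b\<close> and by \<open>16 = 2^4\<close> gives exactly \<open>2^m\<close>.\<close>
  have step: "16 * pw b * msum (\<lambda>i. if h i = b then w i else 0) k \<le> ?P" for b
  proof (cases "\<exists>i<k. Q i \<and> h i = b")
    case True
    then have hb: "hH b \<le> m" using m by (auto simp: h_def hh_def)
    have Rk: "intl (\<lambda>i. pw (m - hH b) * of_bool (Q i \<and> h i = b))"
      unfolding intl_def by (intro dr dfnN_intl[OF hi]) simp_all
    have "msum (\<lambda>i. if h i = b then w i else 0) k = msum (\<lambda>i. pw (m - hH b) * of_bool (Q i \<and> h i = b)) k"
      by (rule msum_cong[OF eq Rk]) (auto simp: w_def h_def hh_def)
    also have "\<dots> = pw (m - hH b) * cnt (\<lambda>i. Q i \<and> h i = b) k"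
      unfolding cnt_def by (rule msum_mult[OF intl_of_bool[OF R]])
    also have "\<dots> \<le> pw (m - hH b) * pw (nap g (b + 1))"
      using cnt_level[OF X Q u inj, of k b] pw_gt[of "nap g (b + 1)"]
      by (intro mult_left_mono) (auto simp: h_def)
    finally have "16 * pw b * msum (\<lambda>i. if h i = b then w i else 0) k
        \<le> 16 * pw b * (pw (m - hH b) * pw (nap g (b + 1)))"
      by (rule mult_left_mono) simp
    also have "\<dots> = ?P"
    proof -
      have "m = (m - hH b) + (b + 4 + nap g (b + 1))" using hb by (simp add: hH_def)
      then have "?P = pw (m - hH b) * (pw b * pw 4 * pw (nap g (b + 1)))" by (metis pw_add)
      moreover have "pw 4 = 16"
      proof -
        have "pw (1 + 1 + 1 + 1) = 16" unfolding pw_add pw_1 by simp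
        then show ?thesis by simp
      qed
      ultimately show ?thesis by (simp add: ac_simps)
    qed
    finally show ?thesis .
  next
    case False
    have z: "intl (\<lambda>i. 0)" unfolding intl_def by (rule dfnN_const)
    have "msum (\<lambda>i. if h i = b then w i else 0) k = msum (\<lambda>i. 0 * 0) k"
      by (rule msum_cong[OF eq]) (use False z in \<open>auto simp: w_def\<close>)
    also have "\<dots> = 0" using msum_mult[OF z, of 0 k] by simp
    finally show ?thesis by simp
  qed
  \<comment> \<open>Divided by \<open>2^m * 2^b\<close> this says that eight times the weight of the
    levels below \<open>b\<close> is at most \<open>1 - 2^-b\<close>, a partial sum of the geometric
    series.\<close>
  have main: "8 * msum (\<lambda>i. if h i < b then w i else 0) k * pw b + ?P \<le> ?P * pw b" for b
  proof (induction b rule: induct_mnat)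
    case dfn
    show ?case unfolding intlP_def by (intro dr dfnN_intl[OF w] dfnN_intl[OF hi]) simp_all
  next
    case 0
    have z: "intl (\<lambda>i. 0)" unfolding intl_def by (rule dfnN_const)
    have "msum (\<lambda>i. if h i < 0 then w i else 0) k = msum (\<lambda>i. 0 * 0) k" by simp
    also have "\<dots> = 0" using msum_mult[OF z, of 0 k] by simp
    finally have "msum (\<lambda>i. if h i < 0 then w i else 0) k = 0" .
    then show ?case by simp
  next
    case (Suc b)
    let ?s = "msum (\<lambda>i. if h i < b then w i else 0) k"
    let ?t = "msum (\<lambda>i. if h i = b then w i else 0) k"
    have sum: "intl (\<lambda>i. (if h i < b then w i else 0) + (if h i = b then w i else 0))"
      unfolding intl_def by (intro dr dfnN_intl[OF w] dfnN_intl[OF hi]) simp_all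
    have "msum (\<lambda>i. if h i < b + 1 then w i else 0) k
        = msum (\<lambda>i. (if h i < b then w i else 0) + (if h i = b then w i else 0)) k"
      by (rule msum_cong[OF lt sum]) (auto simp: less_Suc)
    also have "\<dots> = ?s + ?t" by (rule msum_add[OF lt eq])
    finally have e: "msum (\<lambda>i. if h i < b + 1 then w i else 0) k = ?s + ?t" .
    have "nk (8 * ?s * pw b + ?P) \<le> nk (?P * pw b)" "nk (16 * pw b * ?t) \<le> nk ?P"
      using Suc step[of b] by (simp_all only: nk_simps(5))
    then have "nk (8 * (?s + ?t) * (2 * pw b) + ?P) \<le> nk (?P * (2 * pw b))"
      by (simp add: algebra_simps del: nk_simps(5))
    then show ?case unfolding e pw_Suc by (simp only: nk_simps(5))
  qed
  \<comment> \<open>The height of a summed point is at most its \<open>hh\<close>, hence at most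
    \<open>m\<close>, so the levels below \<open>m + 1\<close> exhaust the sum.\<close>
  have eqw: "msum (\<lambda>i. if h i < m + 1 then w i else 0) k = msum w k"
  proof (rule msum_cong[OF lt w])
    fix i assume i: "i < k"
    have "h i < m + 1" if "Q i"
      using m[OF i that] tap_le_hh[of "sap X i"] by (simp add: h_def less_Suc)
    then show "(if h i < m + 1 then w i else 0) = w i" by (auto simp: w_def)
  qed
  have "8 * msum w k * pw (m + 1) \<le> ?P * pw (m + 1)"
    using main[of "m + 1"] unfolding eqw by (meson add_increasing2 le_add_same_cancel1 mnat_nonneg order_trans order_refl)
  then have "8 * msum w k \<le> ?P" by (rule mult_right_le_imp_le) (simp only: pw_pos)
  then show ?thesis unfolding w_def .
qed

lemma hp_pw_diff: "h \<le> m \<Longrightarrow> hp h = nk (pw (m - h)) / nk (pw m)"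
proof -
  assume "h \<le> m"
  then have "m = (m - h) + h" by simp
  then have "pw m = pw (m - h) * pw h" by (metis pw_add)
  then show ?thesis by (simp add: hp_def field_simps)
qed

text \<open>Each summand is at most the sum of two neighbouring values of \<Psi>, and every
  partition point occurs in at most two summands; so the variation is at most
  \<open>2/8\<close>.\<close>

lemma Psi_variation:
  assumes X: "X \<in> D (N \<rightarrow>\<^sub>t T1)" and p: "partition n X"
    and s: "issum (\<lambda>i. \<bar>v (fap Psi (sap X i)) - v (fap Psi (sap X (i + 1)))\<bar>) n s"
  shows "s \<le> kr (nk 1)"
proof -
  \<comment> \<open>A common upper bound of the heights; their sum is one that visibly exists in the
    model.\<close>
  define m where "m = msum (\<lambda>i. hh (sap X i)) (n + 1)"
  define w where "w = (\<lambda>i. pw (m - hh (sap X i)))"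
  note dr = dfn_rules3 dfn_const[OF X] dfnN_hh
  have hi: "intl (\<lambda>i. hh (sap X i))" unfolding intl_def by (intro dr) simp_all
  have w: "intl w" unfolding intl_def w_def by (intro dr) simp_all
  have w1: "intl (\<lambda>i. w (i + 1))" unfolding intl_def by (intro dr dfnN_intl[OF w]) simp_all
  have ww: "intl (\<lambda>i. w i + w (i + 1))" unfolding intl_def by (intro dr dfnN_intl[OF w]) simp_all
  have m: "hh (sap X i) \<le> m" if "i < n + 1" for i
    unfolding m_def using hi that by (rule msum_ge)
  have unit: "unit (sap X i)" if "i < n + 1" for i
    using partition_unit[OF X p] that by (simp add: less_Suc)
  have "8 * msum (\<lambda>i. if True then pw (m - hh (sap X i)) else 0) (n + 1) \<le> pw m"
  proof (rule weights[OF X])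
    show "intlP (\<lambda>_. True)" unfolding intlP_def by (rule dfnP_const)
    show "v (sap X i) \<noteq> v (sap X j)" if "i < n + 1" "j < n + 1" "i \<noteq> j" for i j
      using partition_less[OF X p, of i j] partition_less[OF X p, of j i] that
      by (auto simp: less_Suc neq_iff)
  qed (use m unit in auto)
  then have W: "8 * msum w (n + 1) \<le> pw m" by (simp add: w_def)
  have hpw: "hp (hh (sap X i)) = nk (w i) / nk (pw m)" if "i < n + 1" for i
    unfolding w_def by (rule hp_pw_diff[OF m[OF that]])
  obtain S where S: "S \<in> D (N \<rightarrow>\<^sub>t T1)" "\<And>i. i \<le> n \<Longrightarrow> isreal (sap S i)" "v (sap S 0) = 0"
    "\<And>i. i < n \<Longrightarrow> v (sap S (i + 1)) = v (sap S i) + \<bar>v (fap Psi (sap X i)) - v (fap Psi (sap X (i + 1)))\<bar>"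
    "s = v (sap S n)" using s by (auto simp: issum_def)
  let ?T = "msum (\<lambda>i. w i + w (i + 1))"
  let ?c = "\<lambda>j. crl (?T j) 0 (pw m)"
  have c: "isreal (?c j)" "v (?c j) = kr (nk (?T j) / nk (pw m))" for j
    using crl[of "pw m"] by (simp_all add: rv_def)
  \<comment> \<open>The partial sum is at most the rational \<open>?c j\<close>, expressed by
    \<open>rlt\<close> to be definable.\<close>
  have "j \<le> n \<longrightarrow> \<not> rlt (?c j) (sap S j)" for j
  proof (induction j rule: induct_mnat)
    case dfn
    show ?case unfolding intlP_def by (intro dr dfnN_intl[OF w] dfn_const[OF S(1)]) simp_all
  next
    case 0
    show ?case using S(2)[of 0] S(3) c[of 0] by (simp add: rlt_iff msum[OF ww])
  next
    case (Suc j)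
    show ?case
    proof
      assume "j + 1 \<le> n"
      then have j: "j < n" "j < n + 1" "j + 1 < n + 1" "j \<le> n" by (auto simp: Suc_le less_Suc)
      have IH: "v (sap S j) \<le> kr (nk (?T j) / nk (pw m))"
        using Suc j(4) c[of j] S(2)[OF j(4)] by (simp add: rlt_iff not_less)
      let ?a = "nk (w j) / nk (pw m)" and ?b = "nk (w (j + 1)) / nk (pw m)"
      have "v (fap Psi (sap X j)) = kr ?a" "v (fap Psi (sap X (j + 1))) = kr ?b"
        using Psi(2)[OF unit_real[OF unit[OF j(2)]]] Psi(2)[OF unit_real[OF unit[OF j(3)]]]
          hpw[OF j(2)] hpw[OF j(3)] by simp_all
      then have "v (sap S (j + 1)) = v (sap S j) + kr \<bar>?a - ?b\<bar>" using S(4)[OF j(1)] by simp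
      also have "\<dots> \<le> kr (nk (?T j) / nk (pw m)) + kr (?a + ?b)"
      proof -
        have "0 \<le> ?a" "0 \<le> ?b" by simp_all
        then have "\<bar>?a - ?b\<bar> \<le> ?a + ?b" by (simp add: abs_le_iff)
        then show ?thesis using IH by (intro add_mono) (simp_all only: kr_le)
      qed
      also have "\<dots> = kr (nk (?T (j + 1)) / nk (pw m))"
        unfolding kr_simps(3)[symmetric] msum(2)[OF ww] by (simp add: add_divide_distrib add.assoc)
      finally show "\<not> rlt (?c (j + 1)) (sap S (j + 1))"
        using c[of "j + 1"] S(2)[OF \<open>j + 1 \<le> n\<close>] by (simp add: rlt_iff not_less)
    qed
  qed
  from this[of n] have "s \<le> kr (nk (?T n) / nk (pw m))"
    using S(2)[of n] S(5) c[of n] by (simp add: rlt_iff not_less)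
  also have "\<dots> \<le> kr 1"
  proof -
    have "?T n = msum w n + msum (\<lambda>i. w (i + 1)) n" by (rule msum_add[OF w w1])
    also have "\<dots> \<le> msum w (n + 1) + msum w (n + 1)"
    proof (rule add_mono)
      show "msum w n \<le> msum w (n + 1)" unfolding msum(2)[OF w] by simp
      show "msum (\<lambda>i. w (i + 1)) n \<le> msum w (n + 1)"
        unfolding msum_shift[OF w, symmetric] by simp
    qed
    finally have "nk (?T n) \<le> nk (msum w (n + 1) + msum w (n + 1))" by (simp only: nk_simps(5))
    then have 1: "nk (?T n) \<le> 2 * nk (msum w (n + 1))" by (simp del: nk_simps(5))
    have "nk (8 * msum w (n + 1)) \<le> nk (pw m)" using W by (simp only: nk_simps(5))
    then have 2: "8 * nk (msum w (n + 1)) \<le> nk (pw m)" by (simp del: nk_simps(5))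
    have "0 \<le> nk (msum w (n + 1))" by simp
    with 1 2 have "nk (?T n) \<le> nk (pw m)" by linarith
    then have "nk (?T n) / nk (pw m) \<le> 1" by (simp add: divide_le_eq)
    then show ?thesis by (simp only: kr_le)
  qed
  finally show ?thesis by simp
qed

lemma sat_BV_Psi:
  assumes "below d t" "val M \<rho> t = Psi"
  shows "sat M \<rho> (bounded_variation (rnat \<^bold>0) (rnat \<^bold>1) t d)"
  by (rule sat_bounded_variation[where k = 1]) (use assms Psi_rfun Psi_variation in simp_all)

end

context countermodel
begin

subsection \<open>Semantics of the principles\<close>

text \<open>Brings the formal size bound into the pigeonhole form of the locale \<open>hwc\<close>:
  if the points were distinct, one of them would have to violate \<open>P\<close>.\<close>

lemma sat_finite_bound:
  assumes k: "below d t" "val M \<rho> t = rp k" and fb: "sat M \<rho> (finite_bound P t d)"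
    and X: "X \<in> D (N \<rightarrow>\<^sub>t T1)" "\<And>i. i \<le> k \<Longrightarrow> isreal (sap X i)"
    and P: "\<And>i. i \<le> k \<Longrightarrow> sat M (\<rho>((d, N \<rightarrow>\<^sub>t T1) := X, (Suc d, N) := rp i)) (P (Var (d, N \<rightarrow>\<^sub>t T1) \<cdot> Var (Suc d, N)) (Suc (Suc d)))"
  shows "\<exists>i\<le>k. \<exists>j\<le>k. i \<noteq> j \<and> v (sap X i) = v (sap X j)"
proof (rule ccontr)
  assume neg: "\<not> ?thesis"
  let ?x = "Var (d, N \<rightarrow>\<^sub>t T1)"
  let ?\<rho> = "\<rho>((d, N \<rightarrow>\<^sub>t T1) := X)"
  have t: "below (Suc d) t" "val M ?\<rho> t = rp k" using k by simp_all
  have 1: "sat M ?\<rho> (all_le t (\<lambda>i. is_real (?x \<cdot> i)) (Suc d))"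
    unfolding sat_bounded[OF t] using X sap_D[OF X(1)] by (simp add: sat_is_real sap_def)
  have 2: "sat M ?\<rho> (all_le t (\<lambda>i. all_le t (\<lambda>j. (\<^bold>\<not> i \<^bold>= j) \<^bold>\<longrightarrow> (\<^bold>\<not> rl (?x \<cdot> i) =\<^sub>R rl (?x \<cdot> j)))) (Suc d))"
    unfolding sat_bounded[OF t]
  proof (intro allI impI)
    fix i assume i: "i \<le> k"
    have t': "below (Suc (Suc d)) t" "val M (?\<rho>((Suc d, N) := rp i)) t = rp k" using t by simp_all
    show "sat M (?\<rho>((Suc d, N) := rp i)) (all_le t (\<lambda>j. (\<^bold>\<not> Var (Suc d, N) \<^bold>= j) \<^bold>\<longrightarrow>
        (\<^bold>\<not> rl (?x \<cdot> Var (Suc d, N)) =\<^sub>R rl (?x \<cdot> j))) (Suc (Suc d)))"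
      unfolding sat_bounded[OF t']
    proof (intro allI impI)
      fix j assume j: "j \<le> k"
      let ?\<rho>' = "?\<rho>((Suc d, N) := rp i, (Suc (Suc d), N) := rp j)"
      have "isreal (val M ?\<rho>' (?x \<cdot> Var (Suc d, N)))" "isreal (val M ?\<rho>' (?x \<cdot> Var (Suc (Suc d), N)))"
        using X(2)[OF i] X(2)[OF j] by (simp_all add: sap_def)
      then have "sat M ?\<rho>' ((rl (?x \<cdot> Var (Suc d, N)) =\<^sub>R rl (?x \<cdot> Var (Suc (Suc d), N))) (Suc (Suc (Suc d))))
          \<longleftrightarrow> v (val M ?\<rho>' (?x \<cdot> Var (Suc d, N))) = v (val M ?\<rho>' (?x \<cdot> Var (Suc (Suc d), N)))"
        by (intro sat_req rep_rl) simp_all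
      then show "sat M ?\<rho>' (((\<^bold>\<not> Var (Suc d, N) \<^bold>= Var (Suc (Suc d), N)) \<^bold>\<longrightarrow>
        (\<^bold>\<not> rl (?x \<cdot> Var (Suc d, N)) =\<^sub>R rl (?x \<cdot> Var (Suc (Suc d), N)))) (Suc (Suc (Suc d))))"
        using neg i j by (auto simp: rp_inject sap_def)
    qed
  qed
  have "sat M ?\<rho> (ex_le t (\<lambda>i. \<^bold>\<not> P (?x \<cdot> i)) (Suc d))"
    using fb 1 2 X(1) unfolding finite_bound_def sat_sch by blast
  then obtain i where "i \<le> k" "\<not> sat M (?\<rho>((Suc d, N) := rp i)) (P (?x \<cdot> Var (Suc d, N)) (Suc (Suc d)))"
    unfolding sat_bounded[OF t] sat_sch by blast
  with P show False by blast
qed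

lemma hwc_if_sat:
  assumes "sat M \<rho> (height_width_countable in_unit 0)"
  shows "\<exists>H g. hwc H g"
proof -
  obtain H g where H: "H \<in> D T2" and g: "g \<in> D T1"
    and r: "sat M (\<rho>((0, T2) := H, (Suc 0, T1) := g)) (real_to_nat (Var (0, T2)) (Suc (Suc 0)))"
    and b: "\<And>n. sat M (\<rho>((0, T2) := H, (Suc 0, T1) := g, (Suc (Suc 0), N) := rp n))
      (finite_bound (\<lambda>x. in_unit x \<^bold>\<and> Var (0, T2) \<cdot> x \<^bold>< Var (Suc (Suc 0), N)) (Var (Suc 0, T1) \<cdot> Var (Suc (Suc 0), N)) (Suc (Suc (Suc 0))))"
    using assms unfolding height_width_countable_def sat_sch sat_nat by blast
  have "hwc H g"
  proof (unfold_locales)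
    show "H \<in> D T2" "g \<in> D T1" by fact+
    show "tap H x = tap H y" if "isreal x" "isreal y" "v x = v y" for x y
    proof -
      let ?\<rho> = "\<rho>((0, T2) := H, (Suc 0, T1) := g, (Suc (Suc 0), T1) := x, (Suc (Suc (Suc 0)), T1) := y)"
      have "sat M ?\<rho> ((rl (Var (Suc (Suc 0), T1)) =\<^sub>R rl (Var (Suc (Suc (Suc 0)), T1))) (Suc (Suc (Suc (Suc 0)))))
         \<longleftrightarrow> v (val M ?\<rho> (Var (Suc (Suc 0), T1))) = v (val M ?\<rho> (Var (Suc (Suc (Suc 0)), T1)))"
        by (intro sat_req rep_rl) (use that in simp_all)
      moreover have "sat M ?\<rho> ((rl (Var (Suc (Suc 0), T1)) =\<^sub>R rl (Var (Suc (Suc (Suc 0)), T1))) (Suc (Suc (Suc (Suc 0)))))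
        \<longrightarrow> H \<bullet> x = H \<bullet> y"
        using r that unfolding real_to_nat_def sat_all_real by simp
      ultimately show ?thesis using that by (simp add: tap_def)
    qed
    show "\<exists>i\<le>nap g n. \<exists>j\<le>nap g n. i \<noteq> j \<and> v (sap X i) = v (sap X j)"
      if X: "X \<in> D (N \<rightarrow>\<^sub>t T1)" "\<And>i. i \<le> nap g n \<Longrightarrow> unit (sap X i)"
        "\<And>i. i \<le> nap g n \<Longrightarrow> tap H (sap X i) < n" for X n
    proof (rule sat_finite_bound[OF _ _ b[of n] X(1)])
      show "below (Suc (Suc (Suc 0))) (Var (Suc 0, T1) \<cdot> Var (Suc (Suc 0), N))" by simp
      show "val M (\<rho>((0, T2) := H, (Suc 0, T1) := g, (Suc (Suc 0), N) := rp n)) (Var (Suc 0, T1) \<cdot> Var (Suc (Suc 0), N)) = rp (nap g n)"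
        by (simp add: rp_nap[OF g])
      fix i assume i: "i \<le> nap g n"
      show "isreal (sap X i)" using X(2)[OF i] by (rule unit_real)
      let ?\<rho> = "\<rho>((0, T2) := H, (Suc 0, T1) := g, (Suc (Suc 0), N) := rp n, (Suc (Suc (Suc 0)), N \<rightarrow>\<^sub>t T1) := X, (Suc (Suc (Suc (Suc 0))), N) := rp i)"
      let ?t = "Var (Suc (Suc (Suc 0)), N \<rightarrow>\<^sub>t T1) \<cdot> Var (Suc (Suc (Suc (Suc 0))), N)"
      have v: "val M ?\<rho> ?t = sap X i" by (simp add: sap_def)
      have "sat M ?\<rho> (in_unit ?t (Suc (Suc (Suc (Suc (Suc 0))))))"
        by (subst sat_in_unit) (use X(2)[OF i] unit_real v in simp_all)
      moreover have "val M ?\<rho> (Var (0, T2) \<cdot> ?t) = rp (tap H (sap X i))"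
        using rp_tap[OF H sap_D[OF X(1)]] v by simp
      then have "sat M ?\<rho> ((Var (0, T2) \<cdot> ?t \<^bold>< Var (Suc (Suc 0), N)) (Suc (Suc (Suc (Suc (Suc 0))))))"
        using X(3)[OF i] by (subst sat_less[of _ _ "tap H (sap X i)" _ n]) simp_all
      ultimately show "sat M ?\<rho> ((in_unit ?t \<^bold>\<and> Var (0, T2) \<cdot> ?t \<^bold>< Var (Suc (Suc 0), N)) (Suc (Suc (Suc (Suc (Suc 0))))))"
        by simp
    qed
  qed
  then show ?thesis by blast
qed

lemma sat_in_ball:
  assumes "rep d \<rho> Y L" "rep d \<rho> R r" "below d t" "isreal (val M \<rho> t)"
  shows "sat M \<rho> (in_ball Y R t d) \<longleftrightarrow> \<bar>v (val M \<rho> t) - L\<bar> < r"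
  unfolding in_ball_def by (intro sat_rless rep_abs rep_minus rep_rl assms)

lemma sat_in_Ioo:
  assumes "rep d \<rho> A L" "rep d \<rho> B L'" "below d t" "isreal (val M \<rho> t)"
  shows "sat M \<rho> (in_Ioo A B t d) \<longleftrightarrow> L < v (val M \<rho> t) \<and> v (val M \<rho> t) < L'"
  unfolding in_Ioo_def sat_sch
  using sat_rless[OF assms(1) rep_rl[OF assms(3,4)]] sat_rless[OF rep_rl[OF assms(3,4)] assms(2)] by simp

definition cov :: "nat \<Rightarrow> nat \<Rightarrow> mnat \<Rightarrow> mreal \<Rightarrow> bool" where
  "cov f y k r \<longleftrightarrow> (\<exists>i\<le>k. \<bar>r - v (sap y i)\<bar> < v (fap f (sap y i)))"

lemma sat_cov:
  assumes f: "below d f" "rfun (val M \<rho> f)" and y: "below d y" "\<And>i. i \<le> k \<Longrightarrow> unit (sap (val M \<rho> y) i)"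
    and t: "below d t" "val M \<rho> t = rp k" and x: "below d x" "isreal (val M \<rho> x)"
  shows "sat M \<rho> (ex_le t (\<lambda>i. in_ball (rl (y \<cdot> i)) (rl (f \<cdot> (y \<cdot> i))) x) d) \<longleftrightarrow>
    cov (val M \<rho> f) (val M \<rho> y) k (v (val M \<rho> x))"
  unfolding sat_bounded[OF t] cov_def
proof (intro ex_cong1 conj_cong refl)
  fix i assume i: "i \<le> k"
  let ?\<rho> = "\<rho>((d, N) := rp i)"
  have v: "val M ?\<rho> (y \<cdot> Var (d, N)) = sap (val M \<rho> y) i"
    "val M ?\<rho> (f \<cdot> (y \<cdot> Var (d, N))) = fap (val M \<rho> f) (sap (val M \<rho> y) i)" "val M ?\<rho> x = val M \<rho> x"
    using f y x by (simp_all add: sap_def fap_def)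
  have r: "isreal (sap (val M \<rho> y) i)" "isreal (fap (val M \<rho> f) (sap (val M \<rho> y) i))"
    using y(2)[OF i] f(2) unit_real by (auto simp: rfun_def)
  have "rep (Suc d) ?\<rho> (rl (y \<cdot> Var (d, N))) (v (sap (val M \<rho> y) i))"
    using rep_rl[of "Suc d" "y \<cdot> Var (d, N)" ?\<rho>] r(1) y(1) unfolding v by simp
  moreover have "rep (Suc d) ?\<rho> (rl (f \<cdot> (y \<cdot> Var (d, N)))) (v (fap (val M \<rho> f) (sap (val M \<rho> y) i)))"
    using rep_rl[of "Suc d" "f \<cdot> (y \<cdot> Var (d, N))" ?\<rho>] r(2) y(1) f(1) unfolding v by simp
  ultimately have "sat M ?\<rho> (in_ball (rl (y \<cdot> Var (d, N))) (rl (f \<cdot> (y \<cdot> Var (d, N)))) x (Suc d))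
    \<longleftrightarrow> \<bar>v (val M ?\<rho> x) - v (sap (val M \<rho> y) i)\<bar> < v (fap (val M \<rho> f) (sap (val M \<rho> y) i))"
    by (rule sat_in_ball) (use x v in simp_all)
  then show "sat M ?\<rho> (in_ball (rl (y \<cdot> Var (d, N))) (rl (f \<cdot> (y \<cdot> Var (d, N)))) x (Suc d))
    \<longleftrightarrow> \<bar>v (val M \<rho> x) - v (sap (val M \<rho> y) i)\<bar> < v (fap (val M \<rho> f) (sap (val M \<rho> y) i))"
    unfolding v .
qed

lemma sat_points:
  assumes y: "below d y" "val M \<rho> y \<in> D (N \<rightarrow>\<^sub>t T1)" and t: "below d t" "val M \<rho> t = rp k"
    and s: "sat M \<rho> (all_le t (\<lambda>i. is_real (y \<cdot> i) \<^bold>\<and> in_unit (y \<cdot> i)) d)" and i: "i \<le> k"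
  shows "unit (sap (val M \<rho> y) i)"
proof -
  let ?\<rho> = "\<rho>((d, N) := rp i)"
  have v: "val M ?\<rho> (y \<cdot> Var (d, N)) = sap (val M \<rho> y) i" using y(1) by (simp add: sap_def)
  have *: "sat M ?\<rho> (is_real (y \<cdot> Var (d, N)) (Suc d))" "sat M ?\<rho> (in_unit (y \<cdot> Var (d, N)) (Suc d))"
    using s i unfolding sat_bounded[OF t] sat_sch by blast+
  have "isreal (sap (val M \<rho> y) i)"
    using *(1) sat_is_real[of "Suc d" "y \<cdot> Var (d, N)" ?\<rho>] sap_D[OF y(2)] y(1) unfolding v by simp
  then show ?thesis using *(2) sat_in_unit[of "Suc d" "y \<cdot> Var (d, N)" ?\<rho>] y(1) unfolding v by simp
qed

lemma HBU_cov:
  assumes s: "sat M \<rho> (HBU_BV 0)" and f: "f \<in> D (T1 \<rightarrow>\<^sub>t T1)" "rfun f" "\<And>x. unit x \<Longrightarrow> 0 < v (fap f x)"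
    and bv: "\<And>d \<rho> t. below d t \<Longrightarrow> val M \<rho> t = f \<Longrightarrow> sat M \<rho> (bounded_variation (rnat \<^bold>0) (rnat \<^bold>1) t d)"
  obtains y k where "y \<in> D (N \<rightarrow>\<^sub>t T1)" "\<And>i. i \<le> k \<Longrightarrow> unit (sap y i)" "\<And>x. unit x \<Longrightarrow> cov f y k (v x)"
proof -
  let ?f = "Var (0, T1 \<rightarrow>\<^sub>t T1)" and ?k = "Var (Suc 0, N)" and ?y = "Var (Suc (Suc 0), N \<rightarrow>\<^sub>t T1)"
  let ?x = "Var (Suc (Suc (Suc 0)), T1)"
  let ?\<rho>1 = "\<rho>((0, T1 \<rightarrow>\<^sub>t T1) := f)"
  have "sat M ?\<rho>1 (positive_fun (rnat \<^bold>0) (rnat \<^bold>1) ?f (Suc 0))"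
    by (subst sat_positive_fun) (use f in simp_all)
  moreover have "sat M ?\<rho>1 (bounded_variation (rnat \<^bold>0) (rnat \<^bold>1) ?f (Suc 0))"
    by (rule bv) simp_all
  ultimately obtain k y where y: "y \<in> D (N \<rightarrow>\<^sub>t T1)"
    and p: "sat M (?\<rho>1((Suc 0, N) := rp k, (Suc (Suc 0), N \<rightarrow>\<^sub>t T1) := y)) (all_le ?k (\<lambda>i. is_real (?y \<cdot> i) \<^bold>\<and> in_unit (?y \<cdot> i)) (Suc (Suc (Suc 0))))"
    and c: "sat M (?\<rho>1((Suc 0, N) := rp k, (Suc (Suc 0), N \<rightarrow>\<^sub>t T1) := y)) ((\<^bold>\<forall>\<^sub>R x. in_unit x \<^bold>\<longrightarrow> ex_le ?k (\<lambda>i. in_ball (rl (?y \<cdot> i)) (rl (?f \<cdot> (?y \<cdot> i))) x)) (Suc (Suc (Suc 0))))"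
    using s f(1) unfolding HBU_BV_def sat_sch sat_nat by blast
  let ?\<rho> = "?\<rho>1((Suc 0, N) := rp k, (Suc (Suc 0), N \<rightarrow>\<^sub>t T1) := y)"
  have u: "unit (sap y i)" if "i \<le> k" for i
    using sat_points[OF _ _ _ _ p that] y by simp
  have "cov f y k (v x)" if x: "unit x" for x
  proof -
    let ?\<rho>' = "?\<rho>((Suc (Suc (Suc 0)), T1) := x)"
    have "sat M ?\<rho>' (in_unit ?x (Suc (Suc (Suc (Suc 0)))))"
      by (subst sat_in_unit) (use x unit_real in simp_all)
    then have "sat M ?\<rho>' (ex_le ?k (\<lambda>i. in_ball (rl (?y \<cdot> i)) (rl (?f \<cdot> (?y \<cdot> i))) ?x) (Suc (Suc (Suc (Suc 0)))))"
      using c x unit_real unfolding sat_all_real sat_sch by blast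
    then have "cov (val M ?\<rho>' ?f) (val M ?\<rho>' ?y) k (v (val M ?\<rho>' ?x))"
      by (subst (asm) sat_cov[where k = k]) (use f u x unit_real in simp_all)
    then show ?thesis by simp
  qed
  with y u that show ?thesis by blast
qed

text \<open>Measure enters the refutation only as a decomposition of the union of balls into
  disjoint open intervals, so these intervals are handed over together with the sum of their
  lengths.\<close>

lemma WHBU_cov:
  assumes s: "sat M \<rho> (WHBU_BV 0)" and f: "f \<in> D (T1 \<rightarrow>\<^sub>t T1)" "rfun f" "\<And>x. unit x \<Longrightarrow> 0 < v (fap f x)"
    and bv: "\<And>d \<rho> t. below d t \<Longrightarrow> val M \<rho> t = f \<Longrightarrow> sat M \<rho> (bounded_variation (rnat \<^bold>0) (rnat \<^bold>1) t d)"
    and eps: "isreal \<epsilon>" "0 < v \<epsilon>"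
  obtains y k l a b m where "y \<in> D (N \<rightarrow>\<^sub>t T1)" "\<And>i. i \<le> k \<Longrightarrow> unit (sap y i)"
    "a \<in> D (N \<rightarrow>\<^sub>t T1)" "b \<in> D (N \<rightarrow>\<^sub>t T1)"
    "\<And>j. j < l \<Longrightarrow> isreal (sap a j) \<and> isreal (sap b j) \<and> v (sap a j) \<le> v (sap b j)"
    "\<And>i j x. i < l \<Longrightarrow> j < l \<Longrightarrow> i \<noteq> j \<Longrightarrow> isreal x \<Longrightarrow>
      \<not> (v (sap a i) < v x \<and> v x < v (sap b i) \<and> v (sap a j) < v x \<and> v x < v (sap b j))"
    "\<And>x. isreal x \<Longrightarrow> cov f y k (v x) \<longleftrightarrow> (\<exists>j<l. v (sap a j) < v x \<and> v x < v (sap b j))"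
    "issum (\<lambda>j. v (sap b j) - v (sap a j)) l m" "1 - v \<epsilon> \<le> m"
proof -
  let ?f = "Var (0, T1 \<rightarrow>\<^sub>t T1)" and ?e = "Var (Suc 0, T1)" and ?k = "Var (Suc (Suc 0), N)"
  let ?y = "Var (Suc (Suc (Suc 0)), N \<rightarrow>\<^sub>t T1)" and ?m = "Var (Suc (Suc (Suc (Suc 0))), T1)"
  let ?l = "Var (Suc (Suc (Suc (Suc (Suc 0)))), N)" and ?a = "Var (Suc (Suc (Suc (Suc (Suc (Suc 0))))), N \<rightarrow>\<^sub>t T1)"
  let ?b = "Var (Suc (Suc (Suc (Suc (Suc (Suc (Suc 0)))))), N \<rightarrow>\<^sub>t T1)"
  let ?d8 = "Suc (Suc (Suc (Suc (Suc (Suc (Suc (Suc 0)))))))"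
  let ?\<rho>1 = "\<rho>((0, T1 \<rightarrow>\<^sub>t T1) := f)"
  let ?P = "\<lambda>x. ex_le ?k (\<lambda>i. in_ball (rl (?y \<cdot> i)) (rl (?f \<cdot> (?y \<cdot> i))) x)"
  have 1: "sat M ?\<rho>1 (positive_fun (rnat \<^bold>0) (rnat \<^bold>1) ?f (Suc 0))"
    by (subst sat_positive_fun) (use f in simp_all)
  have 2: "sat M ?\<rho>1 (bounded_variation (rnat \<^bold>0) (rnat \<^bold>1) ?f (Suc 0))"
    by (rule bv) simp_all
  let ?\<rho>2 = "?\<rho>1((Suc 0, T1) := \<epsilon>)"
  have "sat M ?\<rho>2 ((rnat \<^bold>0 <\<^sub>R rl ?e) (Suc (Suc 0))) \<longleftrightarrow> 0 < v (val M ?\<rho>2 ?e)"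
    by (intro sat_rless rep_0 rep_rl) (use eps in simp_all)
  then have "sat M ?\<rho>2 ((rnat \<^bold>0 <\<^sub>R rl ?e) (Suc (Suc 0)))" using eps by simp
  then obtain k y where y: "y \<in> D (N \<rightarrow>\<^sub>t T1)"
    and p: "sat M (?\<rho>2((Suc (Suc 0), N) := rp k, (Suc (Suc (Suc 0)), N \<rightarrow>\<^sub>t T1) := y)) (all_le ?k (\<lambda>i. is_real (?y \<cdot> i) \<^bold>\<and> in_unit (?y \<cdot> i)) (Suc (Suc (Suc (Suc 0)))))"
    and c: "sat M (?\<rho>2((Suc (Suc 0), N) := rp k, (Suc (Suc (Suc 0)), N \<rightarrow>\<^sub>t T1) := y)) ((\<^bold>\<exists>\<^sub>R m. has_measure ?P m \<^bold>\<and>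
            rnat \<^bold>1 \<ominus> rl ?e \<le>\<^sub>R rl m) (Suc (Suc (Suc (Suc 0)))))"
    using s f(1) 1 2 eps(1) unfolding WHBU_BV_def sat_sch sat_nat sat_all_real by blast
  let ?\<rho>3 = "?\<rho>2((Suc (Suc 0), N) := rp k, (Suc (Suc (Suc 0)), N \<rightarrow>\<^sub>t T1) := y)"
  have u: "unit (sap y i)" if "i \<le> k" for i
    using sat_points[OF _ _ _ _ p that] y by simp
  obtain m where m: "isreal m" and hm: "sat M (?\<rho>3((Suc (Suc (Suc (Suc 0))), T1) := m)) (has_measure ?P ?m (Suc (Suc (Suc (Suc (Suc 0))))))"
    and me: "sat M (?\<rho>3((Suc (Suc (Suc (Suc 0))), T1) := m)) ((rnat \<^bold>1 \<ominus> rl ?e \<le>\<^sub>R rl ?m) (Suc (Suc (Suc (Suc (Suc 0))))))"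
    using c unfolding sat_ex_real sat_sch by blast
  let ?\<rho>4 = "?\<rho>3((Suc (Suc (Suc (Suc 0))), T1) := m)"
  have "sat M ?\<rho>4 ((rnat \<^bold>1 \<ominus> rl ?e \<le>\<^sub>R rl ?m) (Suc (Suc (Suc (Suc (Suc 0)))))) \<longleftrightarrow> 1 - v (val M ?\<rho>4 ?e) \<le> v (val M ?\<rho>4 ?m)"
    by (intro sat_rle rep_minus rep_1 rep_rl) (use eps m in simp_all)
  with me have m1: "1 - v \<epsilon> \<le> v m" by simp
  obtain l a b where a: "a \<in> D (N \<rightarrow>\<^sub>t T1)" and b: "b \<in> D (N \<rightarrow>\<^sub>t T1)"
    and ab: "sat M (?\<rho>4((Suc (Suc (Suc (Suc (Suc 0)))), N) := rp l, (Suc (Suc (Suc (Suc (Suc (Suc 0))))), N \<rightarrow>\<^sub>t T1) := a, (Suc (Suc (Suc (Suc (Suc (Suc (Suc 0)))))), N \<rightarrow>\<^sub>t T1) := b))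
      (all_lt ?l (\<lambda>j. is_real (?a \<cdot> j) \<^bold>\<and> is_real (?b \<cdot> j) \<^bold>\<and> rl (?a \<cdot> j) \<le>\<^sub>R rl (?b \<cdot> j)) ?d8)"
    and dis: "sat M (?\<rho>4((Suc (Suc (Suc (Suc (Suc 0)))), N) := rp l, (Suc (Suc (Suc (Suc (Suc (Suc 0))))), N \<rightarrow>\<^sub>t T1) := a, (Suc (Suc (Suc (Suc (Suc (Suc (Suc 0)))))), N \<rightarrow>\<^sub>t T1) := b))
      (all_lt ?l (\<lambda>i. all_lt ?l (\<lambda>j. (\<^bold>\<not> i \<^bold>= j) \<^bold>\<longrightarrow>
       (\<^bold>\<not> (\<^bold>\<exists>\<^sub>R x. in_Ioo (rl (?a \<cdot> i)) (rl (?b \<cdot> i)) x \<^bold>\<and> in_Ioo (rl (?a \<cdot> j)) (rl (?b \<cdot> j)) x)))) ?d8)"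
    and un: "sat M (?\<rho>4((Suc (Suc (Suc (Suc (Suc 0)))), N) := rp l, (Suc (Suc (Suc (Suc (Suc (Suc 0))))), N \<rightarrow>\<^sub>t T1) := a, (Suc (Suc (Suc (Suc (Suc (Suc (Suc 0)))))), N \<rightarrow>\<^sub>t T1) := b))
      ((\<^bold>\<forall>\<^sub>R x. ?P x \<^bold>\<longleftrightarrow> ex_lt ?l (\<lambda>j. in_Ioo (rl (?a \<cdot> j)) (rl (?b \<cdot> j)) x)) ?d8)"
    and su: "sat M (?\<rho>4((Suc (Suc (Suc (Suc (Suc 0)))), N) := rp l, (Suc (Suc (Suc (Suc (Suc (Suc 0))))), N \<rightarrow>\<^sub>t T1) := a, (Suc (Suc (Suc (Suc (Suc (Suc (Suc 0)))))), N \<rightarrow>\<^sub>t T1) := b))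
      (is_sum (\<lambda>j. rl (?b \<cdot> j) \<ominus> rl (?a \<cdot> j)) ?l ?m ?d8)"
    using hm unfolding has_measure_def sat_sch sat_nat by blast
  let ?\<rho>5 = "?\<rho>4((Suc (Suc (Suc (Suc (Suc 0)))), N) := rp l, (Suc (Suc (Suc (Suc (Suc (Suc 0))))), N \<rightarrow>\<^sub>t T1) := a, (Suc (Suc (Suc (Suc (Suc (Suc (Suc 0)))))), N \<rightarrow>\<^sub>t T1) := b)"
  have l: "below ?d8 ?l" "val M ?\<rho>5 ?l = rp l" by simp_all
  have va: "val M \<rho>' (?a \<cdot> u) = sap a i" "val M \<rho>' (?b \<cdot> u) = sap b i"
    if "agree ?d8 ?\<rho>5 \<rho>'" "val M \<rho>' u = rp i" for \<rho>' u i
  proof -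
    have "val M \<rho>' ?a = a" "val M \<rho>' ?b = b"
      using val_agree[OF _ that(1), of ?a] val_agree[OF _ that(1), of ?b] by simp_all
    then show "val M \<rho>' (?a \<cdot> u) = sap a i" "val M \<rho>' (?b \<cdot> u) = sap b i"
      using that(2) by (simp_all add: sap_def)
  qed
  have AB: "isreal (sap a j) \<and> isreal (sap b j) \<and> v (sap a j) \<le> v (sap b j)" if j: "j < l" for j
  proof -
    let ?\<rho>6 = "?\<rho>5((?d8, N) := rp j)"
    let ?j = "Var (?d8, N)"
    have v6: "val M ?\<rho>6 (?a \<cdot> ?j) = sap a j" "val M ?\<rho>6 (?b \<cdot> ?j) = sap b j"
      by (rule va; simp add: agree_upd agree_refl)+
    have *: "sat M ?\<rho>6 (is_real (?a \<cdot> ?j) (Suc ?d8))" "sat M ?\<rho>6 (is_real (?b \<cdot> ?j) (Suc ?d8))"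
      "sat M ?\<rho>6 ((rl (?a \<cdot> ?j) \<le>\<^sub>R rl (?b \<cdot> ?j)) (Suc ?d8))"
      using ab j unfolding sat_bounded[OF l] sat_sch by blast+
    have r: "isreal (sap a j)" "isreal (sap b j)"
      using *(1) *(2) sat_is_real[of "Suc ?d8" "?a \<cdot> ?j" ?\<rho>6] sat_is_real[of "Suc ?d8" "?b \<cdot> ?j" ?\<rho>6]
        sap_D[OF a] sap_D[OF b] unfolding v6 by simp_all
    have "rep (Suc ?d8) ?\<rho>6 (rl (?a \<cdot> ?j)) (v (sap a j))" "rep (Suc ?d8) ?\<rho>6 (rl (?b \<cdot> ?j)) (v (sap b j))"
      using rep_rl[of "Suc ?d8" "?a \<cdot> ?j" ?\<rho>6] rep_rl[of "Suc ?d8" "?b \<cdot> ?j" ?\<rho>6] r unfolding v6 by simp_all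
    from sat_rle[OF this] r *(3) show ?thesis by simp
  qed
  have Ioo: "sat M \<rho>' (in_Ioo (rl (?a \<cdot> u)) (rl (?b \<cdot> u)) t d') \<longleftrightarrow> v (sap a j) < v (val M \<rho>' t) \<and> v (val M \<rho>' t) < v (sap b j)"
    if "agree ?d8 ?\<rho>5 \<rho>'" "?d8 \<le> d'" "val M \<rho>' u = rp j" "below d' u" "j < l" "below d' t" "isreal (val M \<rho>' t)" for \<rho>' d' u t j
  proof (rule sat_in_Ioo)
    note v' = va[OF that(1,3)]
    show "rep d' \<rho>' (rl (?a \<cdot> u)) (v (sap a j))" "rep d' \<rho>' (rl (?b \<cdot> u)) (v (sap b j))"
      using rep_rl[of d' "?a \<cdot> u" \<rho>'] rep_rl[of d' "?b \<cdot> u" \<rho>'] AB[OF that(5)] that(2,4) unfolding v' by simp_all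
  qed (use that in simp_all)
  have D: "\<not> (v (sap a i) < v x \<and> v x < v (sap b i) \<and> v (sap a j) < v x \<and> v x < v (sap b j))"
    if ij: "i < l" "j < l" "i \<noteq> j" and x: "isreal x" for i j x
  proof
    assume A: "v (sap a i) < v x \<and> v x < v (sap b i) \<and> v (sap a j) < v x \<and> v x < v (sap b j)"
    let ?\<rho>6 = "?\<rho>5((?d8, N) := rp i)"
    let ?\<rho>7 = "?\<rho>6((Suc ?d8, N) := rp j)"
    let ?\<rho>8 = "?\<rho>7((Suc (Suc ?d8), T1) := x)"
    let ?i = "Var (?d8, N)" and ?j = "Var (Suc ?d8, N)" and ?x = "Var (Suc (Suc ?d8), T1)"
    have l6: "below (Suc ?d8) ?l" "val M ?\<rho>6 ?l = rp l" by simp_all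
    have "sat M ?\<rho>6 (all_lt ?l (\<lambda>j. (\<^bold>\<not> ?i \<^bold>= j) \<^bold>\<longrightarrow>
       (\<^bold>\<not> (\<^bold>\<exists>\<^sub>R x. in_Ioo (rl (?a \<cdot> ?i)) (rl (?b \<cdot> ?i)) x \<^bold>\<and> in_Ioo (rl (?a \<cdot> j)) (rl (?b \<cdot> j)) x))) (Suc ?d8))"
      using dis ij(1) unfolding sat_bounded[OF l] by blast
    then have "sat M ?\<rho>7 (((\<^bold>\<not> ?i \<^bold>= ?j) \<^bold>\<longrightarrow>
       (\<^bold>\<not> (\<^bold>\<exists>\<^sub>R x. in_Ioo (rl (?a \<cdot> ?i)) (rl (?b \<cdot> ?i)) x \<^bold>\<and> in_Ioo (rl (?a \<cdot> ?j)) (rl (?b \<cdot> ?j)) x))) (Suc (Suc ?d8)))"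
      using ij(2) unfolding sat_bounded[OF l6] by blast
    moreover have "\<not> sat M ?\<rho>7 ((?i \<^bold>= ?j) (Suc (Suc ?d8)))"
      using ij(3) by (simp add: sat_sch rp_inject)
    ultimately have "\<not> sat M ?\<rho>7 ((\<^bold>\<exists>\<^sub>R x. in_Ioo (rl (?a \<cdot> ?i)) (rl (?b \<cdot> ?i)) x \<^bold>\<and> in_Ioo (rl (?a \<cdot> ?j)) (rl (?b \<cdot> ?j)) x) (Suc (Suc ?d8)))"
      unfolding sat_sch by blast
    then have "\<not> (sat M ?\<rho>8 (in_Ioo (rl (?a \<cdot> ?i)) (rl (?b \<cdot> ?i)) ?x (Suc (Suc (Suc ?d8)))) \<and>
       sat M ?\<rho>8 (in_Ioo (rl (?a \<cdot> ?j)) (rl (?b \<cdot> ?j)) ?x (Suc (Suc (Suc ?d8)))))"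
      using x unfolding sat_ex_real sat_sch by blast
    moreover have "agree ?d8 ?\<rho>5 ?\<rho>8" by (intro agree_upd' agree_refl) simp_all
    ultimately show False
      using Ioo[of ?\<rho>8 "Suc (Suc (Suc ?d8))" ?i i ?x] Ioo[of ?\<rho>8 "Suc (Suc (Suc ?d8))" ?j j ?x] A x ij by simp
  qed
  have U: "cov f y k (v x) \<longleftrightarrow> (\<exists>j<l. v (sap a j) < v x \<and> v x < v (sap b j))" if x: "isreal x" for x
  proof -
    let ?\<rho>6 = "?\<rho>5((?d8, T1) := x)"
    let ?x = "Var (?d8, T1)"
    have l6: "below (Suc ?d8) ?l" "val M ?\<rho>6 ?l = rp l" by simp_all
    have "sat M ?\<rho>6 (?P ?x (Suc ?d8)) \<longleftrightarrow> cov (val M ?\<rho>6 ?f) (val M ?\<rho>6 ?y) k (v (val M ?\<rho>6 ?x))"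
      by (rule sat_cov) (use f u x in simp_all)
    then have 1: "sat M ?\<rho>6 (?P ?x (Suc ?d8)) \<longleftrightarrow> cov f y k (v x)" by simp
    have 2: "sat M ?\<rho>6 (ex_lt ?l (\<lambda>j. in_Ioo (rl (?a \<cdot> j)) (rl (?b \<cdot> j)) ?x) (Suc ?d8)) \<longleftrightarrow>
        (\<exists>j<l. v (sap a j) < v x \<and> v x < v (sap b j))"
      unfolding sat_bounded[OF l6]
    proof (intro ex_cong1 conj_cong refl)
      fix j assume j: "j < l"
      let ?\<rho>7 = "?\<rho>6((Suc ?d8, N) := rp j)"
      have "agree ?d8 ?\<rho>5 ?\<rho>7" by (intro agree_upd' agree_refl) simp_all
      then show "sat M ?\<rho>7 (in_Ioo (rl (?a \<cdot> Var (Suc ?d8, N))) (rl (?b \<cdot> Var (Suc ?d8, N))) ?x (Suc (Suc ?d8)))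
        \<longleftrightarrow> v (sap a j) < v x \<and> v x < v (sap b j)"
        using Ioo[of ?\<rho>7 "Suc (Suc ?d8)" "Var (Suc ?d8, N)" j ?x] x j by simp
    qed
    show ?thesis using un x 1 2 unfolding sat_all_real sat_sch by blast
  qed
  have "sat M ?\<rho>5 (is_sum (\<lambda>j. rl (?b \<cdot> j) \<ominus> rl (?a \<cdot> j)) ?l ?m ?d8) \<longleftrightarrow>
      issum (\<lambda>j. v (sap b j) - v (sap a j)) l (v (val M ?\<rho>5 ?m))"
  proof (rule sat_is_sum)
    fix \<rho>' d' u i
    assume *: "?d8 \<le> d'" "agree ?d8 ?\<rho>5 \<rho>'" "below d' u" "val M \<rho>' u = rp i" "i < l"
    note v' = va[OF *(2,4)]
    show "rep d' \<rho>' (rl (?b \<cdot> u) \<ominus> rl (?a \<cdot> u)) (v (sap b i) - v (sap a i))"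
      using rep_minus[OF rep_rl[of d' "?b \<cdot> u" \<rho>'] rep_rl[of d' "?a \<cdot> u" \<rho>']] AB[OF *(5)] *(1,3)
      unfolding v' by simp
  qed (use m in simp_all)
  with su have S: "issum (\<lambda>j. v (sap b j) - v (sap a j)) l (v m)" by simp
  show ?thesis by (rule that[OF y u a b AB D U S m1])
qed

lemma Jordan_decomp:
  assumes s: "sat M \<rho> (Jordan 0)" and f: "f \<in> D (T1 \<rightarrow>\<^sub>t T1)" "rfun f"
    and bv: "\<And>d \<rho> t. below d t \<Longrightarrow> val M \<rho> t = f \<Longrightarrow> sat M \<rho> (bounded_variation (rnat \<^bold>0) (rnat \<^bold>1) t d)"
  obtains p q where "p \<in> D (T1 \<rightarrow>\<^sub>t T1)" "q \<in> D (T1 \<rightarrow>\<^sub>t T1)" "rfun p" "rfun q"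
    "\<And>x y. unit x \<Longrightarrow> unit y \<Longrightarrow> v x \<le> v y \<Longrightarrow> v (fap p x) \<le> v (fap p y)"
    "\<And>x y. unit x \<Longrightarrow> unit y \<Longrightarrow> v x \<le> v y \<Longrightarrow> v (fap q x) \<le> v (fap q y)"
    "\<And>x. unit x \<Longrightarrow> v (fap f x) = v (fap p x) - v (fap q x)"
proof -
  let ?f = "Var (0, T1 \<rightarrow>\<^sub>t T1)" and ?p = "Var (Suc 0, T1 \<rightarrow>\<^sub>t T1)" and ?q = "Var (Suc (Suc 0), T1 \<rightarrow>\<^sub>t T1)"
  let ?\<rho>1 = "\<rho>((0, T1 \<rightarrow>\<^sub>t T1) := f)"
  have "sat M ?\<rho>1 (real_fun (rnat \<^bold>0) (rnat \<^bold>1) ?f (Suc 0))"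
    by (subst sat_real_fun) (use f in simp_all)
  moreover have "sat M ?\<rho>1 (bounded_variation (rnat \<^bold>0) (rnat \<^bold>1) ?f (Suc 0))"
    by (rule bv) simp_all
  ultimately obtain p q where p: "p \<in> D (T1 \<rightarrow>\<^sub>t T1)" and q: "q \<in> D (T1 \<rightarrow>\<^sub>t T1)"
    and 1: "sat M (?\<rho>1((Suc 0, T1 \<rightarrow>\<^sub>t T1) := p, (Suc (Suc 0), T1 \<rightarrow>\<^sub>t T1) := q)) (real_fun (rnat \<^bold>0) (rnat \<^bold>1) ?p (Suc (Suc (Suc 0))))"
    and 2: "sat M (?\<rho>1((Suc 0, T1 \<rightarrow>\<^sub>t T1) := p, (Suc (Suc 0), T1 \<rightarrow>\<^sub>t T1) := q)) (nondecreasing (rnat \<^bold>0) (rnat \<^bold>1) ?p (Suc (Suc (Suc 0))))"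
    and 3: "sat M (?\<rho>1((Suc 0, T1 \<rightarrow>\<^sub>t T1) := p, (Suc (Suc 0), T1 \<rightarrow>\<^sub>t T1) := q)) (real_fun (rnat \<^bold>0) (rnat \<^bold>1) ?q (Suc (Suc (Suc 0))))"
    and 4: "sat M (?\<rho>1((Suc 0, T1 \<rightarrow>\<^sub>t T1) := p, (Suc (Suc 0), T1 \<rightarrow>\<^sub>t T1) := q)) (nondecreasing (rnat \<^bold>0) (rnat \<^bold>1) ?q (Suc (Suc (Suc 0))))"
    and 5: "sat M (?\<rho>1((Suc 0, T1 \<rightarrow>\<^sub>t T1) := p, (Suc (Suc 0), T1 \<rightarrow>\<^sub>t T1) := q)) ((\<^bold>\<forall>\<^sub>R x. in_unit x \<^bold>\<longrightarrow> rl (?f \<cdot> x) =\<^sub>R rl (?p \<cdot> x) \<ominus> rl (?q \<cdot> x)) (Suc (Suc (Suc 0))))"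
    using s f(1) unfolding Jordan_def sat_sch by blast
  let ?\<rho> = "?\<rho>1((Suc 0, T1 \<rightarrow>\<^sub>t T1) := p, (Suc (Suc 0), T1 \<rightarrow>\<^sub>t T1) := q)"
  have rp: "rfun p" and rq: "rfun q"
    using sat_real_fun[of "Suc (Suc (Suc 0))" ?p ?\<rho>] sat_real_fun[of "Suc (Suc (Suc 0))" ?q ?\<rho>] 1 3 p q by simp_all
  have mono: "v (fap p x) \<le> v (fap p y)" "v (fap q x) \<le> v (fap q y)" if "unit x" "unit y" "v x \<le> v y" for x y
    using sat_nondecreasing[of "Suc (Suc (Suc 0))" ?p ?\<rho>] sat_nondecreasing[of "Suc (Suc (Suc 0))" ?q ?\<rho>] 2 4 rp rq that by simp_all
  have "v (fap f x) = v (fap p x) - v (fap q x)" if x: "unit x" for x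
  proof -
    let ?\<rho>' = "?\<rho>((Suc (Suc (Suc 0)), T1) := x)"
    let ?x = "Var (Suc (Suc (Suc 0)), T1)"
    have v: "val M ?\<rho>' (?f \<cdot> ?x) = fap f x" "val M ?\<rho>' (?p \<cdot> ?x) = fap p x" "val M ?\<rho>' (?q \<cdot> ?x) = fap q x"
      by (simp_all add: fap_def)
    have r: "isreal (fap f x)" "isreal (fap p x)" "isreal (fap q x)"
      using x f(2) rp rq by (simp_all add: rfun_def)
    have "sat M ?\<rho>' (in_unit ?x (Suc (Suc (Suc (Suc 0)))))"
      by (subst sat_in_unit) (use x unit_real in simp_all)
    then have "sat M ?\<rho>' ((rl (?f \<cdot> ?x) =\<^sub>R rl (?p \<cdot> ?x) \<ominus> rl (?q \<cdot> ?x)) (Suc (Suc (Suc (Suc 0)))))"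
      using 5 unit_real[OF x] unfolding sat_all_real sat_sch by blast
    moreover have "sat M ?\<rho>' ((rl (?f \<cdot> ?x) =\<^sub>R rl (?p \<cdot> ?x) \<ominus> rl (?q \<cdot> ?x)) (Suc (Suc (Suc (Suc 0))))) \<longleftrightarrow>
        v (val M ?\<rho>' (?f \<cdot> ?x)) = v (val M ?\<rho>' (?p \<cdot> ?x)) - v (val M ?\<rho>' (?q \<cdot> ?x))"
      by (intro sat_req rep_minus rep_rl) (unfold v, use r in simp_all)
    ultimately show ?thesis unfolding v by blast
  qed
  with p q rp rq mono that show ?thesis by blast
qed

end

context countermodel
begin

subsection \<open>Counting grid points\<close>

lemma cnt_le_mono:
  assumes "intlP C"
  shows "m \<le> n \<Longrightarrow> cnt C m \<le> cnt C n"
proof -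
  have "m \<le> n \<longrightarrow> cnt C m \<le> cnt C n"
  proof (induction n rule: induct_mnat)
    case dfn
    show ?case unfolding intlP_def by (intro dfn_rules3 dfnP_intlP[OF assms]) simp_all
  next
    case (Suc n)
    have "cnt C n \<le> cnt C (n + 1)" unfolding cnt[OF assms] by simp
    then show ?case using Suc le_Suc_iff[of m n] by (metis order_refl order_trans)
  qed simp
  then show "m \<le> n \<Longrightarrow> cnt C m \<le> cnt C n" by simp
qed

text \<open>\<open>s\<close> and \<open>t\<close> are the first and the last number counted, and the
  others lie between them. So a set of small diameter has few elements.\<close>

lemma cnt_span:
  assumes C: "intlP C"
  shows "cnt C n = 0 \<or> (\<exists>s t. s \<le> t \<and> t < n \<and> C s \<and> C t \<and> cnt C n + s \<le> t + 1)"
proof (induction n rule: induct_mnat)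
  case dfn
  show ?case unfolding intlP_def by (intro dfn_rules3 dfnP_intlP[OF C]) simp_all
next
  case 0
  show ?case by (simp add: cnt[OF C])
next
  case (Suc n)
  have nn: "n < n + 1" by (simp add: less_Suc)
  show ?case
  proof (cases "C n")
    case False
    have "t < n \<Longrightarrow> t < n + 1" for t using nn by (rule less_trans[rotated])
    then show ?thesis using Suc False by (simp add: cnt[OF C]) blast
  next
    case True
    from Suc show ?thesis
    proof (elim disjE exE conjE)
      assume "cnt C n = 0"
      then show ?thesis using True nn
        by (intro disjI2 exI[of _ n]) (simp add: cnt(2)[OF C] add.commute[of 1])
    next
      fix s t assume *: "s \<le> t" "t < n" "C s" "C t" "cnt C n + s \<le> t + 1"
      have "cnt C (n + 1) + s = cnt C n + s + 1" unfolding cnt(2)[OF C] using True by (simp add: ac_simps)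
      also have "\<dots> \<le> n + 1" using *(2,5) Suc_le[of t n] by (intro add_right_mono) (metis order_trans)
      finally show ?thesis using * True nn by (intro disjI2 exI[of _ s] exI[of _ n]) auto
    qed
  qed
qed

text \<open>The converse estimate to \<open>cnt_span\<close>: up to \<open>a\<close> nothing has to
  be counted, and from \<open>a\<close> on every step adds one.\<close>

lemma cnt_interval:
  assumes C: "intlP C" and "\<And>s. a \<le> s \<Longrightarrow> s < b \<Longrightarrow> C s" "b \<le> n"
  shows "b \<le> a + cnt C n"
proof -
  have "m \<le> b \<longrightarrow> m \<le> a + cnt C m" for m
  proof (induction m rule: induct_mnat)
    case dfn
    show ?case unfolding intlP_def by (intro dfn_rules3 dfnP_intlP[OF C]) simp_all
  next
    case (Suc m)
    show ?case
    proof
      assume m: "m + 1 \<le> b"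
      show "m + 1 \<le> a + cnt C (m + 1)"
      proof (cases "a \<le> m")
        case True
        then have "C m" using m assms(2) by (simp add: Suc_le)
        moreover have "m \<le> a + cnt C m" using Suc m by (simp add: Suc_le)
        ultimately show ?thesis by (simp add: cnt[OF C] add.assoc[symmetric])
      next
        case False
        then show ?thesis by (intro add_increasing2) (simp_all add: Suc_le)
      qed
    qed
  qed simp
  then have "b \<le> a + cnt C b" by simp
  also have "\<dots> \<le> a + cnt C n" using cnt_le_mono[OF C assms(3)] by simp
  finally show ?thesis .
qed

text \<open>The grid has mesh \<open>1/L\<close> and starts at -1 instead of 0, since balls around
  points of the unit interval may stick out of it.\<close>

lemma grid:
  assumes "L \<noteq> 0"
  shows "isreal (crl s L L)" "v (crl s L L) = kr (nk s / nk L - 1)"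
  using crl[OF assms, of s L] assms by (simp_all add: rv_def diff_divide_distrib)

lemma cnt_disjoint:
  assumes P: "intlP P" and Q: "intlP Q" and "\<And>i. \<not> (P i \<and> Q i)"
  shows "cnt (\<lambda>i. P i \<or> Q i) n = cnt P n + cnt Q n"
proof -
  have "(\<lambda>i. of_bool (P i \<or> Q i) :: mnat) = (\<lambda>i. of_bool (P i) + of_bool (Q i))"
    using assms(3) by (auto simp: fun_eq_iff)
  then show ?thesis unfolding cnt_def by (simp add: msum_add intl_of_bool P Q)
qed

lemma real_dense:
  assumes "p < q"
  obtains x where "isreal x" "p < v x" "v x < q"
proof -
  obtain r where r: "0 < r" "kr r \<le> q - p" using assms cmpl_arch[of "q - p"] by auto
  then have "0 < r / 3" by simp
  \<comment> \<open>A rational within \<open>r / 3\<close> of \<open>p + r / 2\<close> keeps a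
    distance of at least \<open>r / 6\<close> from \<open>p\<close> and from
    \<open>q\<close>.\<close>
  then obtain c where c: "\<bar>(p + kr (r / 2)) - kr c\<bar> \<le> kr (r / 3)" by (rule cmpl_dense)
  obtain a b d where d: "0 < d" "c = (nk a - nk b) / nk d" by (rule fract_cases)
  have "kr (r / 2) = kr (r / 3) + kr (r / 6)" "kr r = kr (r / 2) + kr (r / 3) + kr (r / 6)"
    unfolding kr_simps(3)[symmetric] by simp_all
  moreover have "0 < kr (r / 6)" using r by simp
  ultimately have "p < kr c" "kr c < q" using c r(2) by (simp_all only: abs_le_iff) linarith+
  then show ?thesis using that[of "crl a b d"] crl[of d a b] d by (simp add: rv_def)
qed

end

section \<open>Refutation of the two covering principles\<close>

context hwc
begin

text \<open>The balls of radius \<open>\<Psi>\<close> are so small that finitely many of them catch at most a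
  quarter of the points of a sufficiently fine grid.\<close>

lemma grid_count:
  assumes y: "y \<in> D (N \<rightarrow>\<^sub>t T1)" and u: "\<And>i. i \<le> k \<Longrightarrow> unit (sap y i)" and L: "L \<noteq> 0"
  shows "intlP (\<lambda>s. cov Psi y k (v (crl s L L)))"
    "4 * cnt (\<lambda>s. cov Psi y k (v (crl s L L))) n \<le> L + 4 * (k + 1)"
proof -
  define m where "m = msum (\<lambda>i. hh (sap y i)) (k + 1)"
  \<comment> \<open>Centres may repeat, but \<open>weights\<close> asks for distinct points;
    \<open>Q i\<close> says that the centre with index \<open>i\<close> did not occur
    earlier.\<close>
  define Q where "Q = (\<lambda>i. \<forall>j. j < i \<longrightarrow> rlt (sap y j) (sap y i) \<or> rlt (sap y i) (sap y j))"
  \<comment> \<open>Membership in the ball with index \<open>i\<close>, split into two strict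
    inequalities between sums so that \<open>cmp8\<close> can express it.\<close>
  define C where "C = (\<lambda>i s. cmp8 [crl s L L, zrl, zrl, zrl, sap y i, fap Psi (sap y i), zrl, zrl] \<and>
    cmp8 [sap y i, zrl, zrl, zrl, crl s L L, fap Psi (sap y i), zrl, zrl])"
  define R where "R = (\<lambda>j s. \<exists>i. i < j \<and> Q i \<and> C i s)"
  define w where "w = (\<lambda>i. if Q i then pw (m - hh (sap y i)) else 0)"
  have K: "i < k + 1 \<longleftrightarrow> i \<le> k" for i by (rule less_Suc)
  note dr = dfn_rules3 dfn_const[OF y] dfnN_hh dfnP_cmp8 dfn_const[OF Psi_D]
  have hi: "intl (\<lambda>i. hh (sap y i))" unfolding intl_def by (intro dr) simp_all
  have Q: "intlP Q" unfolding intlP_def Q_def by (intro dr) simp_all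
  note dr = dr dfnP_intlP[OF Q]
  have C: "intlP2 C" unfolding intlP2_def C_def by (intro dr) simp_all
  have Ci: "intlP (C i)" for i unfolding intlP_def C_def by (intro dr) simp_all
  note dr = dr dfnP_intlP2[OF C]
  have R: "intlP (R j)" for j unfolding intlP_def R_def by (intro dr) simp_all
  have w: "intl w" unfolding intl_def w_def by (intro dr) simp_all
  have r: "isreal (sap y i)" if "i \<le> k" for i using u[OF that] by (rule unit_real)
  have C_iff: "C i s \<longleftrightarrow> \<bar>v (crl s L L) - v (sap y i)\<bar> < v (fap Psi (sap y i))" if "i \<le> k" for i s
    unfolding C_def using r[OF that] Psi(1)[OF r[OF that]] grid(1)[OF L]
    by (subst cmp8_iff; simp add: zrl abs_less_iff)+ (auto simp: less_diff_eq diff_less_eq ac_simps)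
  have cov_iff: "cov Psi y k (v (crl s L L)) \<longleftrightarrow> R (k + 1) s" for s
  proof
    assume "cov Psi y k (v (crl s L L))"
    then obtain i where i: "i \<le> k" "\<bar>v (crl s L L) - v (sap y i)\<bar> < v (fap Psi (sap y i))"
      by (auto simp: cov_def)
    \<comment> \<open>The first index with the same centre satisfies \<open>Q\<close> and, since
      \<Psi> respects equality of reals, has the same ball.\<close>
    let ?E = "\<lambda>j. \<not> rlt (sap y j) (sap y i) \<and> \<not> rlt (sap y i) (sap y j)"
    have E: "intlP ?E" unfolding intlP_def by (intro dr) simp_all
    have "?E i" using r[OF i(1)] by (simp add: rlt_iff)
    then obtain i' where i': "?E i'" "\<And>j. j < i' \<Longrightarrow> \<not> ?E j" using least_mnat[OF E] by blast
    then have "i' \<le> i" using \<open>?E i\<close> by (meson not_less)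
    then have k: "i' \<le> k" using i(1) by simp
    have e: "v (sap y i') = v (sap y i)" using i'(1) r[OF k] r[OF i(1)] by (simp add: rlt_iff not_less)
    have "Q i'" unfolding Q_def
    proof (intro allI impI)
      fix j assume j: "j < i'"
      then have "j \<le> k" using k by simp
      then show "rlt (sap y j) (sap y i') \<or> rlt (sap y i') (sap y j)"
        using i'(2)[OF j] r[OF k] r[OF i(1)] r[of j] e by (simp add: rlt_iff)
    qed
    moreover have "C i' s" unfolding C_iff[OF k] using i(2) e hh_ext[OF r[OF k] r[OF i(1)] e]
      by (simp add: Psi(2) r k i(1))
    ultimately show "R (k + 1) s" unfolding R_def K using k by blast
  next
    assume "R (k + 1) s"
    then obtain i where "i \<le> k" "C i s" unfolding R_def K by blast
    then show "cov Psi y k (v (crl s L L))" using C_iff by (auto simp: cov_def)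
  qed
  then show "intlP (\<lambda>s. cov Psi y k (v (crl s L L)))" using R by simp
  have m: "hh (sap y i) \<le> m" if "i < k + 1" for i
    unfolding m_def using hi that by (rule msum_ge)
  have W: "8 * msum w (k + 1) \<le> pw m" unfolding w_def
  proof (rule weights[OF y Q])
    show "v (sap y i) \<noteq> v (sap y j)" if "i < k + 1" "j < k + 1" "Q i" "Q j" "i \<noteq> j" for i j
      using that r[of i] r[of j] unfolding Q_def K by (auto simp: neq_iff rlt_iff)
  qed (use u m in \<open>simp_all add: K\<close>)
  \<comment> \<open>Grid points in a ball of radius \<open>r\<close> span less than
    \<open>2 * r\<close>, so at most \<open>2 * r * L + 1\<close> of them exist. Here
    \<open>r\<close> is \<open>w i / 2^m\<close>, and the inequality is multiplied by
    \<open>2^m\<close>.\<close>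
  have ball: "cnt (C i) n * pw m \<le> 2 * L * w i + pw m" if i: "i \<le> k" and Qi: "Q i" for i
    using cnt_span[OF Ci, of i n]
  proof (elim disjE exE conjE)
    fix s t assume *: "s \<le> t" "t < n" "C i s" "C i t" "cnt (C i) n + s \<le> t + 1"
    let ?h = "nk (w i) / nk (pw m)"
    have h: "v (fap Psi (sap y i)) = kr ?h"
      using m[of i] i Qi hp_pw_diff[of "hh (sap y i)" m] by (simp add: w_def K Psi(2) r)
    have "kr (nk t / nk L - 1) < kr (nk s / nk L - 1) + (kr ?h + kr ?h)"
      using *(3,4) unfolding C_iff[OF i] h grid(2)[OF L] by (simp only: abs_less_iff) linarith
    then have "nk t / nk L - 1 < nk s / nk L - 1 + (?h + ?h)" by (simp only: kr_simps(3)[symmetric] kr_less)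
    then have "(nk t - nk s) / nk L < 2 * nk (w i) / nk (pw m)" by (simp add: diff_divide_distrib)
    then have 1: "(nk t - nk s) * nk (pw m) < 2 * nk (w i) * nk L" using L by (simp add: field_simps)
    have "nk (cnt (C i) n + s) \<le> nk (t + 1)" using *(5) by (simp only: nk_simps(5))
    then have "nk (cnt (C i) n) \<le> (nk t - nk s) + 1" by (simp del: nk_simps(5))
    then have "nk (cnt (C i) n) * nk (pw m) \<le> ((nk t - nk s) + 1) * nk (pw m)"
      by (rule mult_right_mono) simp
    also have "\<dots> \<le> 2 * nk (w i) * nk L + nk (pw m)" using 1 by (simp add: distrib_right)
    finally have "nk (cnt (C i) n * pw m) \<le> nk (2 * L * w i + pw m)"
      by (simp add: ac_simps del: nk_simps(5))
    then show ?thesis by (simp only: nk_simps(5))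
  qed simp
  \<comment> \<open>Union bound over the balls: a new centre adds at most its own count, a repeated
    one adds no grid point.\<close>
  have "j \<le> k + 1 \<longrightarrow> cnt (R j) n * pw m \<le> 2 * L * msum w j + j * pw m" for j
  proof (induction j rule: induct_mnat)
    case dfn
    show ?case unfolding intlP_def R_def by (intro dr dfnN_intl[OF w]) simp_all
  next
    case 0
    have "cnt (R 0) n = 0" using cnt_enum[OF R, of 0 0 n] by (auto simp: R_def)
    then show ?case by simp
  next
    case (Suc j)
    show ?case
    proof
      assume "j + 1 \<le> k + 1"
      then have j: "j \<le> k" "j \<le> k + 1" by (simp_all add: add_increasing2)
      have eq: "R (j + 1) = (if Q j then (\<lambda>s. R j s \<or> C j s) else R j)"
        unfolding R_def less_Suc by (auto simp: fun_eq_iff le_less)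
      show "cnt (R (j + 1)) n * pw m \<le> 2 * L * msum w (j + 1) + (j + 1) * pw m"
      proof (cases "Q j")
        case True
        have "cnt (R (j + 1)) n * pw m \<le> (cnt (R j) n + cnt (C j) n) * pw m"
          unfolding eq using True cnt_or[OF R Ci, of j j n] by (intro mult_right_mono) simp_all
        also have "\<dots> \<le> (2 * L * msum w j + j * pw m) + (2 * L * w j + pw m)"
          unfolding distrib_right using Suc j ball[OF j(1) True] by (intro add_mono) simp_all
        finally show ?thesis unfolding msum(2)[OF w] by (simp add: algebra_simps)
      next
        case False
        then have "w j = 0" by (simp add: w_def)
        have "cnt (R (j + 1)) n * pw m \<le> 2 * L * msum w j + j * pw m" 
          unfolding eq using Suc j False by simp
        also have "\<dots> \<le> 2 * L * msum w j + (j + 1) * pw m"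
          by (intro add_left_mono mult_right_mono) simp_all
        finally show ?thesis unfolding msum(2)[OF w] using \<open>w j = 0\<close> by simp
      qed
    qed
  qed
  then have main: "cnt (R (k + 1)) n * pw m \<le> 2 * L * msum w (k + 1) + (k + 1) * pw m" by simp
  have "4 * cnt (R (k + 1)) n * pw m = 4 * (cnt (R (k + 1)) n * pw m)" by (simp add: ac_simps)
  also have "\<dots> \<le> 4 * (2 * L * msum w (k + 1) + (k + 1) * pw m)" by (rule mult_left_mono[OF main]) simp
  \<comment> \<open>Multiplying by 4 turns the factor 2 of the diameters into the 8 of
    \<open>weights\<close>.\<close>
  also have "\<dots> = L * (8 * msum w (k + 1)) + 4 * (k + 1) * pw m" by (simp add: algebra_simps)
  also have "\<dots> \<le> L * pw m + 4 * (k + 1) * pw m" by (intro add_right_mono mult_left_mono W) simp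
  also have "\<dots> = (L + 4 * (k + 1)) * pw m" by (simp add: distrib_right)
  finally have "4 * cnt (R (k + 1)) n \<le> L + 4 * (k + 1)" by (rule mult_right_le_imp_le) simp
  then show "4 * cnt (\<lambda>s. cov Psi y k (v (crl s L L))) n \<le> L + 4 * (k + 1)" using cov_iff by simp
qed

text \<open>A cover of the unit interval would catch the \<open>L\<close> grid points from 0 up to
  but excluding 1, whereas \<open>grid_count\<close> leaves fewer than \<open>L / 2\<close> caught
  points.\<close>

lemma HBU_refuted: "\<not> sat M \<rho> (HBU_BV 0)"
proof
  assume "sat M \<rho> (HBU_BV 0)"
  then obtain y k where y: "y \<in> D (N \<rightarrow>\<^sub>t T1)" "\<And>i. i \<le> k \<Longrightarrow> unit (sap y i)"
    and c: "\<And>x. unit x \<Longrightarrow> cov Psi y k (v x)"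
    using HBU_cov[OF _ Psi_D Psi_rfun Psi_pos sat_BV_Psi] by blast
  \<comment> \<open>A mesh so fine that \<open>L\<close> exceeds the rounding term
    \<open>4 * (k + 1)\<close> of \<open>grid_count\<close>.\<close>
  let ?L = "pw (4 * (k + 1))"
  let ?U = "cnt (\<lambda>s. cov Psi y k (v (crl s ?L ?L))) (?L + ?L)"
  note gc = grid_count[OF y, where L = ?L]
  have "?L + ?L \<le> ?L + ?U"
  proof (rule cnt_interval[OF gc(1)])
    fix s assume s: "?L \<le> s" "s < ?L + ?L"
    have "nk ?L \<le> nk s" "nk s < nk (?L + ?L)" using s by (simp_all only: nk_simps(5) nk_less)
    then have "unit (crl s ?L ?L)"
      unfolding unit_def by (simp add: grid divide_le_eq le_divide_eq del: nk_simps(5) nk_less kr_diff flip: kr_simps(1,2))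
    then show "cov Psi y k (v (crl s ?L ?L))" by (rule c)
  qed simp_all
  then have "nk (?L + ?L) \<le> nk (?L + ?U)" "nk (4 * ?U) \<le> nk (?L + 4 * (k + 1))" "nk (4 * (k + 1)) < nk ?L"
    using gc(2)[where n = "?L + ?L"] pw_gt[of "4 * (k + 1)"] by (simp_all only: nk_simps(5) nk_less pw_pos simp_thms)
  moreover have "0 < nk ?L" by simp
  ultimately show False by (simp only: nk_simps(3,4) nk_numeral)
qed

text \<open>For \<epsilon> = 1/2 the measure would be at least 1/2. Each of the \<open>l\<close>
  disjoint intervals is at most as long as its number of grid points plus one, divided by
  \<open>L\<close>, and together they catch the same grid points as the balls; so the measure is at
  most \<open>1/4 + (k + 1 + l)/L\<close>.\<close>

lemma WHBU_refuted: "\<not> sat M \<rho> (WHBU_BV 0)"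
proof
  assume s: "sat M \<rho> (WHBU_BV 0)"
  let ?e = "crl 1 0 2"
  have e: "isreal ?e" "v ?e = kr (1 / 2)" using crl[of 2 1 0] by (simp_all add: rv_def nk_numeral_mnat)
  then have "0 < v ?e" by simp
  note w = WHBU_cov[OF s Psi_D Psi_rfun Psi_pos sat_BV_Psi e(1) this]
  obtain y k l a b m where y: "y \<in> D (N \<rightarrow>\<^sub>t T1)" "\<And>i. i \<le> k \<Longrightarrow> unit (sap y i)"
    and a: "a \<in> D (N \<rightarrow>\<^sub>t T1)" and b: "b \<in> D (N \<rightarrow>\<^sub>t T1)"
    and ab: "\<And>j. j < l \<Longrightarrow> isreal (sap a j) \<and> isreal (sap b j) \<and> v (sap a j) \<le> v (sap b j)"
    and disj: "\<And>i j x. i < l \<Longrightarrow> j < l \<Longrightarrow> i \<noteq> j \<Longrightarrow> isreal x \<Longrightarrow>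
      \<not> (v (sap a i) < v x \<and> v x < v (sap b i) \<and> v (sap a j) < v x \<and> v x < v (sap b j))"
    and c: "\<And>x. isreal x \<Longrightarrow> cov Psi y k (v x) \<longleftrightarrow> (\<exists>j<l. v (sap a j) < v x \<and> v x < v (sap b j))"
    and sum: "issum (\<lambda>j. v (sap b j) - v (sap a j)) l m" and m: "1 - v ?e \<le> m"
    by (rule w) blast+
  \<comment> \<open>The rounding errors are \<open>k + 1\<close> from \<open>grid_count\<close> and
    \<open>l\<close> from the ends of the intervals; this \<open>L\<close> makes them smaller than
    \<open>L / 4\<close> in total.\<close>
  define L where "L = pw (4 * (k + 1) + 4 * l)"
  have L: "L \<noteq> 0" by (simp add: L_def)
  let ?t = "\<lambda>s. crl s L L"
  note t = grid[OF L]
  define B where "B = (\<lambda>j s. rlt (sap a j) (?t s) \<and> rlt (?t s) (sap b j))"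
  note dr = dfn_rules3 dfn_const[OF a] dfn_const[OF b]
  have B: "intlP2 B" unfolding intlP2_def B_def by (intro dr) simp_all
  have Bj: "intlP (B j)" for j unfolding intlP_def B_def by (intro dr) simp_all
  note dr = dr dfnP_intlP2[OF B]
  \<comment> \<open>The grid then reaches from -1 to 2, which contains all balls, since \<Psi> is at
    most 1.\<close>
  define n where "n = 3 * L"
  define f where "f = (\<lambda>j. cnt (B j) n)"
  have f: "intl f" unfolding intl_def f_def by (intro dr) simp_all
  have B_iff: "B j s \<longleftrightarrow> v (sap a j) < v (?t s) \<and> v (?t s) < v (sap b j)" if "j < l" for j s
    using ab[OF that] t by (simp add: B_def rlt_iff)
  have range: "- 1 < v x \<and> v x < 2"
    if r: "j < l" "isreal x" "v (sap a j) < v x" "v x < v (sap b j)" for j x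
  proof -
    obtain i where i: "i \<le> k" "\<bar>v x - v (sap y i)\<bar> < v (fap Psi (sap y i))"
      using c[OF r(2)] r(1,3,4) unfolding cov_def by blast
    have "0 \<le> v (sap y i)" "v (sap y i) \<le> 1" "isreal (sap y i)" using y(2)[OF i(1)] by (auto simp: unit_def)
    moreover have "kr (hp (hh (sap y i))) \<le> kr 1" using hp_mono[of 0 "hh (sap y i)"] by (simp only: kr_le hp_0 mnat_nonneg)
    ultimately show ?thesis using i(2) by (simp add: Psi abs_less_iff)
  qed
  \<comment> \<open>Let \<open>lo\<close> be the first grid index beyond the left end and
    \<open>hi\<close> the first one not before the right end. The indices from \<open>lo\<close> to
    \<open>hi - 1\<close> fall into the interval, and the interval fits between the points
    \<open>lo - 1\<close> and \<open>hi\<close>.\<close>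
  have len: "v (sap b j) - v (sap a j) \<le> kr ((nk (f j) + 1) / nk L)" if j: "j < l" for j
  proof (cases "v (sap a j) < v (sap b j)")
    case False
    have "0 \<le> kr ((nk (f j) + 1) / nk L)" using kr_le[of 0 "(nk (f j) + 1) / nk L"] by (simp del: kr_le)
    then show ?thesis using False by simp
  next
    case True
    \<comment> \<open>If the left end were below -1, the nonempty interval would contain a point
      that no ball reaches.\<close>
    have a1: "- 1 \<le> v (sap a j)"
    proof (rule ccontr)
      assume "\<not> ?thesis"
      then obtain x where "isreal x" "v (sap a j) < v x" "v x < min (v (sap b j)) (- 1)"
        using True real_dense[of "v (sap a j)" "min (v (sap b j)) (- 1)"] by auto
      then show False using range[OF j, of x] by simp
    qed
    have b2: "v (sap b j) \<le> 2"
    proof (rule ccontr)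
      assume "\<not> ?thesis"
      then obtain x where "isreal x" "max (v (sap a j)) 2 < v x" "v x < v (sap b j)"
        using True real_dense[of "max (v (sap a j)) 2" "v (sap b j)"] by auto
      then show False using range[OF j, of x] by simp
    qed
    have tn: "v (?t n) = 2" unfolding t(2) n_def using L by simp
    have t0: "v (?t 0) = - 1" unfolding t(2) by simp
    have p1: "intlP (\<lambda>s. rlt (sap a j) (?t s))" and p2: "intlP (\<lambda>s. \<not> rlt (?t s) (sap b j))"
      unfolding intlP_def by (intro dr; simp)+
    have "rlt (sap a j) (?t n)" using ab[OF j] t(1) True b2 tn by (simp add: rlt_iff)
    then obtain lo where lo: "v (sap a j) < v (?t lo)" "\<And>s. s < lo \<Longrightarrow> v (?t s) \<le> v (sap a j)"
      using least_mnat[OF p1] ab[OF j] t(1) by (metis rlt_iff not_less)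
    have bn: "\<not> rlt (?t n) (sap b j)" using ab[OF j] t(1) b2 tn by (simp add: rlt_iff)
    then obtain hi where hi: "v (sap b j) \<le> v (?t hi)" "\<And>s. s < hi \<Longrightarrow> v (?t s) < v (sap b j)"
      using least_mnat[OF p2] ab[OF j] t(1) by (metis rlt_iff not_less)
    have "hi \<le> n" using hi(2)[of n] hi(2)[of n] bn ab[OF j] t(1) by (metis rlt_iff not_less)
    have "hi \<le> lo + f j" unfolding f_def
    proof (rule cnt_interval[OF Bj _ \<open>hi \<le> n\<close>])
      fix s assume s: "lo \<le> s" "s < hi"
      have "v (?t lo) \<le> v (?t s)" unfolding t(2) using s L by (simp add: divide_right_mono del: kr_diff)
      then show "B j s" unfolding B_iff[OF j] using lo(1) hi(2)[OF s(2)] by simp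
    qed
    then have h: "nk hi \<le> nk (lo + f j)" by (simp only: nk_simps(5))
    \<comment> \<open>The grid starts at -1, which is not beyond the left end, so \<open>lo\<close>
      has a predecessor.\<close>
    have "lo \<noteq> 0" using lo(1) t0 a1 by auto
    then obtain s where s: "lo = s + 1" using mnat_cases by blast
    have "v (?t s) \<le> v (sap a j)" using lo(2)[of s] by (simp add: s less_Suc)
    then have "v (sap b j) - v (sap a j) \<le> v (?t hi) - v (?t s)" using hi(1) by simp
    also have "\<dots> = kr ((nk hi - nk s) / nk L)" unfolding t(2) kr_diff[symmetric] by (simp add: diff_divide_distrib del: kr_diff)
    also have "\<dots> \<le> kr ((nk (f j) + 1) / nk L)" unfolding kr_le
      by (rule divide_right_mono) (use h s in \<open>simp_all del: nk_simps(5)\<close>)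
    finally show ?thesis .
  qed
  obtain S where S: "S \<in> D (N \<rightarrow>\<^sub>t T1)" "\<And>i. i \<le> l \<Longrightarrow> isreal (sap S i)" "v (sap S 0) = 0"
    "\<And>i. i < l \<Longrightarrow> v (sap S (i + 1)) = v (sap S i) + (v (sap b i) - v (sap a i))" "m = v (sap S l)"
    using sum by (auto simp: issum_def)
  let ?c = "\<lambda>j. crl (msum f j + j) 0 L"
  have cc: "isreal (?c j)" "v (?c j) = kr (nk (msum f j + j) / nk L)" for j
    using crl[OF L] by (simp_all add: rv_def)
  have "j \<le> l \<longrightarrow> \<not> rlt (?c j) (sap S j)" for j
  proof (induction j rule: induct_mnat)
    case dfn
    show ?case unfolding intlP_def by (intro dr dfnN_intl[OF f] dfn_const[OF S(1)]) simp_all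
  next
    case 0
    show ?case using S(2)[of 0] S(3) cc[of 0] by (simp add: rlt_iff msum[OF f])
  next
    case (Suc j)
    show ?case
    proof
      assume j1: "j + 1 \<le> l"
      then have j: "j < l" "j \<le> l" by (auto simp: Suc_le)
      have IH: "v (sap S j) \<le> kr (nk (msum f j + j) / nk L)"
        using Suc j(2) cc[of j] S(2)[OF j(2)] by (simp add: rlt_iff not_less)
      have "v (sap S (j + 1)) \<le> kr (nk (msum f j + j) / nk L) + kr ((nk (f j) + 1) / nk L)"
        unfolding S(4)[OF j(1)] by (rule add_mono[OF IH len[OF j(1)]])
      also have "\<dots> = kr (nk (msum f (j + 1) + (j + 1)) / nk L)"
        unfolding kr_simps(3)[symmetric] msum(2)[OF f] by (simp add: add_divide_distrib ac_simps)
      finally show "\<not> rlt (?c (j + 1)) (sap S (j + 1))"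
        using cc[of "j + 1"] S(2)[OF j1] by (simp add: rlt_iff not_less)
    qed
  qed
  from this[of l] have ml: "m \<le> kr (nk (msum f l + l) / nk L)"
    using S(2)[of l] S(5) cc[of l] by (simp add: rlt_iff not_less)
  define U where "U = (\<lambda>j s. \<exists>i. i < j \<and> B i s)"
  have U: "intlP (U j)" for j unfolding intlP_def U_def by (intro dr) simp_all
  \<comment> \<open>Here disjointness enters: no grid point is counted for two intervals, so the
    counts add up to the count of the union.\<close>
  have "j \<le> l \<longrightarrow> msum f j = cnt (U j) n" for j
  proof (induction j rule: induct_mnat)
    case dfn
    show ?case unfolding intlP_def U_def by (intro dr dfnN_intl[OF f]) simp_all
  next
    case 0
    show ?case using cnt_enum[OF U, of 0 0 n] by (auto simp: U_def msum[OF f])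
  next
    case (Suc j)
    show ?case
    proof
      assume "j + 1 \<le> l"
      then have j: "j < l" "j \<le> l" by (auto simp: Suc_le)
      have "U (j + 1) = (\<lambda>s. U j s \<or> B j s)"
        unfolding U_def less_Suc by (auto simp: fun_eq_iff le_less)
      moreover have "cnt (\<lambda>s. U j s \<or> B j s) n = cnt (U j) n + cnt (B j) n"
      proof (rule cnt_disjoint[OF U Bj])
        fix s show "\<not> (U j s \<and> B j s)"
        proof
          assume "U j s \<and> B j s"
          then obtain i where i: "i < j" "B i s" "B j s" by (auto simp: U_def)
          then have "i < l" using j(1) by simp
          then show False using disj[OF \<open>i < l\<close> j(1) _ t(1)[of s]] i B_iff j(1) by blast
        qed
      qed
      ultimately show "msum f (j + 1) = cnt (U (j + 1)) n" unfolding msum(2)[OF f] using Suc j(2) by (simp add: f_def)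
    qed
  qed
  then have ms: "msum f l = cnt (U l) n" by simp
  have "U l = (\<lambda>s. cov Psi y k (v (?t s)))"
    using c[OF t(1)] B_iff by (auto simp: U_def fun_eq_iff)
  then have 1: "4 * msum f l \<le> L + 4 * (k + 1)" unfolding ms using grid_count(2)[OF y L] by simp
  have "1 - v ?e = kr (1 - 1 / 2)" unfolding e by (simp only: kr_diff kr_simps(2))
  then have "kr (1 - 1 / 2) \<le> kr (nk (msum f l + l) / nk L)" using m ml by (metis order_trans)
  then have "1 - 1 / 2 \<le> nk (msum f l + l) / nk L" by (simp only: kr_le)
  moreover have "1 - 1 / 2 = (1 / 2 :: mrat)" by simp
  ultimately have "1 / 2 \<le> nk (msum f l + l) / nk L" by simp
  then have 2: "nk L \<le> 2 * nk (msum f l + l)" using L by (simp add: field_simps)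
  have 3: "nk (4 * msum f l) \<le> nk (L + 4 * (k + 1))" using 1 by (simp only: nk_simps(5))
  have 4: "nk (4 * (k + 1) + 4 * l) < nk L" unfolding L_def nk_less by (rule pw_gt)
  show False using 2 3 4 by (simp del: nk_simps(5) nk_less)
qed

end

context countermodel
begin

subsection \<open>Nested intervals\<close>

abbreviation pw4 :: "mnat \<Rightarrow> mnat" where "pw4 n \<equiv> pw n * pw n"

lemma pw4_Suc: "pw4 (n + 1) = 4 * pw4 n"
  unfolding pw_Suc by (simp only: ac_simps) (simp add: mult.assoc[symmetric])

text \<open>The left ends \<open>c n / 4^n\<close> increase and stay inside all earlier intervals,
  whose lengths \<open>4^-n\<close> are at most \<open>2^-n\<close>; so the sequence of their codes
  already is a real in the formal sense.\<close>

lemma limit_point: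
  assumes c: "intl c" and step: "\<And>n. c (n + 1) = 4 * c n + 1 \<or> c (n + 1) = 4 * c n + 2"
  obtains x where "isreal x" "\<And>n. kr (nk (c n) / nk (pw4 n)) \<le> v x" "\<And>n. v x \<le> kr ((nk (c n) + 1) / nk (pw4 n))"
proof -
  \<comment> \<open>Nesting over \<open>k\<close> steps at once, with denominators cleared so that
    the induction is about numbers.\<close>
  have nest: "c n * pw4 k \<le> c (n + k) \<and> c (n + k) + 1 \<le> (c n + 1) * pw4 k" for n k
  proof (induction k rule: induct_mnat)
    case dfn
    show ?case unfolding intlP_def by (intro dfn_rules3 dfnN_intl[OF c]) simp_all
  next
    case (Suc k)
    have "4 * a + 1 + 1 \<le> 4 * (a + 1)" "4 * a + 2 + 1 \<le> 4 * (a + 1)" for a :: mnat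
      unfolding distrib_left add.assoc by (intro add_left_mono; simp)+
    then have 1: "4 * c (n + k) \<le> c (n + (k + 1))" "c (n + (k + 1)) + 1 \<le> 4 * (c (n + k) + 1)"
      using step[of "n + k"] unfolding add.assoc[symmetric, of n] by auto
    have "c n * pw4 (k + 1) = 4 * (c n * pw4 k)" "(c n + 1) * pw4 (k + 1) = 4 * ((c n + 1) * pw4 k)"
      unfolding pw4_Suc by (simp_all only: mult.left_commute)
    moreover have "4 * (c n * pw4 k) \<le> 4 * c (n + k)" "4 * (c (n + k) + 1) \<le> 4 * ((c n + 1) * pw4 k)"
      using Suc by (intro mult_left_mono; simp)+
    ultimately show ?case using 1 by (metis order_trans)
  qed simp
  let ?q = "\<lambda>n. nk (c n) / nk (pw4 n)"
  have q: "?q n \<le> ?q (n + k)" "?q (n + k) < (nk (c n) + 1) / nk (pw4 n)" for n k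
  proof -
    have e: "nk (pw4 (n + k)) = nk (pw4 n) * nk (pw4 k)" unfolding pw_add by (simp add: ac_simps)
    have "nk (c n * pw4 k) \<le> nk (c (n + k))" "nk (c (n + k) + 1) \<le> nk ((c n + 1) * pw4 k)"
      using nest[of n k] by (simp_all only: nk_simps(5))
    then have *: "nk (c n) * nk (pw4 k) \<le> nk (c (n + k))" "nk (c (n + k)) < (nk (c n) + 1) * nk (pw4 k)"
      by (simp_all only: nk_simps(2-4))
    have pos: "0 < nk (pw4 k)" "0 < nk (pw4 n) * nk (pw4 k)" by simp_all
    have "?q n = (nk (c n) * nk (pw4 k)) / (nk (pw4 n) * nk (pw4 k))" by simp
    also have "\<dots> \<le> ?q (n + k)" unfolding e using *(1) pos(2) by (intro divide_right_mono) simp_all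
    finally show "?q n \<le> ?q (n + k)" .
    have "?q (n + k) < ((nk (c n) + 1) * nk (pw4 k)) / (nk (pw4 n) * nk (pw4 k))"
      unfolding e by (rule divide_strict_right_mono[OF *(2) pos(2)])
    then show "?q (n + k) < (nk (c n) + 1) / nk (pw4 n)" by simp
  qed
  define x where "x = LamN (\<lambda>n. scode (c n) 0 (pw4 n))"
  have X: "dfnN (case_nat N G0) (\<lambda>e. scode (c (ab (e 0))) 0 (pw4 (ab (e 0))))"
    by (intro dfnN_scode dfn_rules3 dfnN_intl[OF c]) simp_all
  have xs: "xs x n = ?q n" for n
    unfolding xs_def x_def nap_LamN[OF X] by (simp add: dec_scode rv_def)
  have hp4: "1 / nk (pw4 n) \<le> hp n" for n
  proof -
    have "nk (pw n) * 1 \<le> nk (pw n) * nk (pw n)"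
      using pw_mono[of 0 n] nk_simps(5)[of 1 "pw n"] by (intro mult_left_mono) (simp_all del: nk_simps(5))
    then show ?thesis unfolding hp_def by (intro divide_left_mono) simp_all
  qed
  have r: "isreal x"
    unfolding isreal_def
  proof (intro conjI allI)
    show "x \<in> D T1" unfolding x_def by (rule LamN_D[OF X])
    fix n i
    show "\<bar>xs x n - xs x (n + i)\<bar> < hp n"
      using q[of n i] hp4[of n] unfolding xs add_divide_distrib by linarith
  qed
  have lo: "kr (?q n) \<le> v x" for n
  proof (rule ccontr)
    assume "\<not> ?thesis"
    then obtain m where m: "kr (hp m) < kr (?q n) - v x" using hp_mreal_arch[of "kr (?q n) - v x"] by auto
    have "kr (hp (n + m)) \<le> kr (hp m)" "kr (?q n) \<le> kr (?q (n + m))" using q(1)[of n m] hp_mono[of m "n + m"] by simp_all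
    then show False using m v_approx[OF r, of "n + m"] unfolding xs abs_le_iff by linarith
  qed
  have hi: "v x \<le> kr ((nk (c n) + 1) / nk (pw4 n))" for n
  proof (rule ccontr)
    let ?b = "kr ((nk (c n) + 1) / nk (pw4 n))"
    assume "\<not> ?thesis"
    then obtain m where m: "kr (hp m) < v x - ?b" using hp_mreal_arch[of "v x - ?b"] by auto
    have "kr (?q (n + m)) < ?b" unfolding kr_less by (rule q(2))
    moreover have "kr (hp (n + m)) \<le> kr (hp m)" using hp_mono[of m "n + m"] by simp
    ultimately show False using m v_approx[OF r, of "n + m"] unfolding xs abs_le_iff by linarith
  qed
  show ?thesis by (rule that[OF r lo hi])
qed

text \<open>Supplies the number \<open>C\<close> with which the halving in
  \<open>small_oscillation\<close> starts: a bound for the increment of \<open>p + q\<close> over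
  the whole unit interval.\<close>

lemma mreal_le_nk: "\<exists>C. x \<le> kr (nk (C :: mnat))"
proof -
  obtain q :: mrat where q: "\<bar>x - kr q\<bar> \<le> kr 1" using cmpl_dense[of 1 x] by auto
  obtain a b d :: mnat where d: "0 < d" "q = (nk a - nk b) / nk d" by (rule fract_cases)
  have "nk 1 \<le> nk d" using d(1) Suc_le[of 0 d] by (simp only: nk_simps(5)) simp
  then have "nk a * 1 \<le> nk a * nk d" by (intro mult_left_mono) simp_all
  then have "nk a - nk b \<le> nk a * nk d" using nk_nonneg[of b] by (simp del: nk_nonneg)
  then have "q \<le> nk a" using d by (simp add: divide_le_eq)
  then have "kr q + kr 1 \<le> kr (nk (a + 1))" unfolding kr_simps(3)[symmetric] kr_le by simp
  then show ?thesis using q by (intro exI[of _ "a + 1"]) (simp only: abs_le_iff, linarith)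
qed

text \<open>By monotonicity the increments of \<open>p + q\<close> over the second and the third
  quarter of an interval add up to at most the increment over the whole, so the smaller of the two
  is at most half of it.\<close>

lemma small_oscillation:
  assumes D: "p \<in> D (T1 \<rightarrow>\<^sub>t T1)" "q \<in> D (T1 \<rightarrow>\<^sub>t T1)" and rf: "rfun p" "rfun q"
    and mono: "\<And>x y. unit x \<Longrightarrow> unit y \<Longrightarrow> v x \<le> v y \<Longrightarrow> v (fap p x) \<le> v (fap p y)"
      "\<And>x y. unit x \<Longrightarrow> unit y \<Longrightarrow> v x \<le> v y \<Longrightarrow> v (fap q x) \<le> v (fap q y)"
  obtains c C where "intl c" "\<And>n. c (n + 1) = 4 * c n + 1 \<or> c (n + 1) = 4 * c n + 2" "\<And>n. c n < pw4 n"
    "\<And>n. v (fap p (crl (c n + 1) 0 (pw4 n))) + v (fap q (crl (c n + 1) 0 (pw4 n)))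
      \<le> v (fap p (crl (c n) 0 (pw4 n))) + v (fap q (crl (c n) 0 (pw4 n))) + kr (nk C * hp n)"
proof -
  let ?G = "\<lambda>n c. crl c 0 (pw4 n)"
  let ?u = "\<lambda>x. v (fap p x) + v (fap q x)"
  \<comment> \<open>The increment over the second quarter is smaller than that over the third.
    Moving the value at the midpoint to one side removes the subtractions and leaves two sums of
    four reals.\<close>
  let ?T = "\<lambda>n c. cmp8 [fap p (?G (n + 1) (4 * c + 2)), fap q (?G (n + 1) (4 * c + 2)),
      fap p (?G (n + 1) (4 * c + 2)), fap q (?G (n + 1) (4 * c + 2)),
      fap p (?G (n + 1) (4 * c + 1)), fap q (?G (n + 1) (4 * c + 1)),
      fap p (?G (n + 1) (4 * c + 3)), fap q (?G (n + 1) (4 * c + 3))]"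
  define F where "F = (\<lambda>n c. if ?T n c then 4 * c + 1 else 4 * c + 2)"
  define c where "c = mrec F 0"
  note dr = dfn_rules3 dfnP_cmp8 dfn_const[OF D(1)] dfn_const[OF D(2)]
  have F: "dfnN (case_nat N (case_nat N G0)) (\<lambda>e. F (ab (e (Suc 0))) (ab (e 0)))"
    unfolding F_def by (intro dr) simp_all
  note c_simps = mrec[OF F, of 0, folded c_def]
  have F2: "intl2 F" unfolding intl2_def by (rule F)
  have c: "intl c" unfolding intl_def c_def
    by (intro dfnN_mrec dfnN_intl2[OF F2] dr) simp_all
  have lt: "c n < pw4 n" for n
  proof (induction n rule: induct_mnat)
    case dfn
    show ?case unfolding intlP_def by (intro dr dfnN_intl[OF c]) simp_all
  next
    case (Suc n)
    have "nk (c n + 1) \<le> nk (pw4 n)" using Suc by (simp only: nk_simps(5) Suc_le)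
    then have "nk (4 * c n + 2) < nk (4 * pw4 n)" by (simp del: nk_less nk_simps(5))
    moreover have "nk (c (n + 1)) \<le> nk (4 * c n + 2)" unfolding c_simps F_def by (simp del: nk_simps(5))
    ultimately have "nk (c (n + 1)) < nk (4 * pw4 n)" by (rule le_less_trans[rotated])
    then show ?case unfolding pw4_Suc by (simp only: nk_less)
  qed (simp add: c_simps)
  have G: "isreal (?G n a)" "v (?G n a) = kr (nk a / nk (pw4 n))" for n a
    using crl[of "pw4 n" a 0] by (simp_all add: rv_def)
  have Gu: "unit (?G n a)" if "a \<le> pw4 n" for n a
  proof -
    have "nk a \<le> nk (pw4 n)" using that by (simp only: nk_simps(5))
    then have "nk a / nk (pw4 n) \<le> 1" by (simp only: divide_le_eq) simp
    moreover have "0 \<le> nk a / nk (pw4 n)" by simp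
    ultimately have "kr 0 \<le> kr (nk a / nk (pw4 n))" "kr (nk a / nk (pw4 n)) \<le> kr 1" by (simp_all only: kr_le)
    then show ?thesis unfolding unit_def G(2) using G(1) by simp
  qed
  have u_mono: "?u x \<le> ?u y" if "unit x" "unit y" "v x \<le> v y" for x y
    using mono(1)[OF that] mono(2)[OF that] by simp
  have r: "isreal (fap p x)" "isreal (fap q x)" if "unit x" for x using that rf by (simp_all add: rfun_def)
  obtain C where C: "?u (?G 0 1) - ?u (?G 0 0) \<le> kr (nk C)" using mreal_le_nk by blast
  let ?z = "\<lambda>n. crl C 0 (pw n)"
  have z: "isreal (?z n)" "v (?z n) = kr (nk C * hp n)" for n
    using crl[of "pw n" C 0] by (simp_all add: rv_def hp_def)
  \<comment> \<open>The bound on the increment as a negated instance of \<open>cmp8\<close>, the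
    form in which it can be proved by internal induction.\<close>
  have osc: "\<not> cmp8 [fap p (?G n (c n)), fap q (?G n (c n)), ?z n, zrl, fap p (?G n (c n + 1)), fap q (?G n (c n + 1)), zrl, zrl]
      \<longleftrightarrow> ?u (?G n (c n + 1)) \<le> ?u (?G n (c n)) + kr (nk C * hp n)" for n
  proof -
    have "c n \<le> pw4 n" "c n + 1 \<le> pw4 n" using lt[of n] by (simp_all add: Suc_le)
    then show ?thesis using z(1) zrl(1) r[OF Gu] by (subst cmp8_iff) (simp_all add: z(2) zrl(2) not_less)
  qed
  have "\<not> cmp8 [fap p (?G n (c n)), fap q (?G n (c n)), ?z n, zrl, fap p (?G n (c n + 1)), fap q (?G n (c n + 1)), zrl, zrl]" for n
  proof (induction n rule: induct_mnat)
    case dfn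
    show ?case unfolding intlP_def by (intro dr dfnN_intl[OF c]) simp_all
  next
    case 0
    show ?case unfolding osc using C by (simp add: c_simps)
  next
    case (Suc n)
    let ?c = "c n"
    have "?c + 1 \<le> pw4 n" using lt[of n] by (simp add: Suc_le)
    then have "4 * (?c + 1) \<le> pw4 (n + 1)" unfolding pw4_Suc by (rule mult_left_mono) simp
    moreover have "4 * ?c + 3 \<le> 4 * (?c + 1)" "4 * ?c + 2 \<le> 4 * (?c + 1)" "4 * ?c + 1 \<le> 4 * (?c + 1)" "4 * ?c \<le> 4 * (?c + 1)"
      unfolding distrib_left by (simp_all add: add_increasing2)
    ultimately have u: "unit (?G (n + 1) (4 * ?c + 3))" "unit (?G (n + 1) (4 * ?c + 2))"
      "unit (?G (n + 1) (4 * ?c + 1))" "unit (?G (n + 1) (4 * ?c))" "unit (?G (n + 1) (4 * (?c + 1)))"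
      by (meson Gu order_trans order_refl)+
    have u': "unit (?G n ?c)" "unit (?G n (?c + 1))" using lt[of n] by (simp_all add: Gu Suc_le)
    have le: "v (?G (n + 1) a) \<le> v (?G (n + 1) b)" if "a \<le> b" for a b
    proof -
      have "nk a \<le> nk b" using that by (simp only: nk_simps(5))
      then show ?thesis unfolding G(2) kr_le by (rule divide_right_mono) simp
    qed
    have e4: "v (?G (n + 1) (4 * a)) = v (?G n a)" for a
      unfolding G(2) unfolding pw4_Suc by simp
    have IH: "?u (?G n (?c + 1)) \<le> ?u (?G n ?c) + kr (nk C * hp n)" using Suc unfolding osc .
    have 1: "?u (?G n ?c) \<le> ?u (?G (n + 1) (4 * ?c + 1))" 
      by (rule u_mono[OF u'(1) u(3)]) (unfold e4[symmetric], intro le, simp)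
    have 2: "?u (?G (n + 1) (4 * ?c + 3)) \<le> ?u (?G n (?c + 1))" 
      by (rule u_mono[OF u(1) u'(2)]) (unfold e4[symmetric], intro le, simp add: distrib_left)
    have T: "?T n ?c \<longleftrightarrow> ?u (?G (n + 1) (4 * ?c + 2)) + ?u (?G (n + 1) (4 * ?c + 2)) < ?u (?G (n + 1) (4 * ?c + 1)) + ?u (?G (n + 1) (4 * ?c + 3))"
      using r[OF u(1)] r[OF u(2)] r[OF u(3)] by (subst cmp8_iff) (simp_all add: algebra_simps)
    have h: "kr (nk C * hp n) = kr (nk C * hp (n + 1)) + kr (nk C * hp (n + 1))"
      using hp_2(1)[of n] by (simp add: algebra_simps)
    show ?case unfolding osc
    proof (cases "?T n ?c")
      case True
      have e: "c (n + 1) = 4 * ?c + 1" unfolding c_simps F_def using True by simp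
      have e': "c (n + 1) + 1 = 4 * ?c + 2" unfolding e by (simp add: add.assoc)
      show "?u (?G (n + 1) (c (n + 1) + 1)) \<le> ?u (?G (n + 1) (c (n + 1))) + kr (nk C * hp (n + 1))"
        unfolding e' unfolding e using T[THEN iffD1, OF True] IH 1 2 h by linarith
    next
      case False
      have e: "c (n + 1) = 4 * ?c + 2" unfolding c_simps F_def using False by simp
      have e': "c (n + 1) + 1 = 4 * ?c + 3" unfolding e by (simp add: add.assoc)
      show "?u (?G (n + 1) (c (n + 1) + 1)) \<le> ?u (?G (n + 1) (c (n + 1))) + kr (nk C * hp (n + 1))"
        unfolding e' unfolding e using False[unfolded T] IH 1 2 h by linarith
    qed
  qed
  then have "?u (?G n (c n + 1)) \<le> ?u (?G n (c n)) + kr (nk C * hp n)" for n unfolding osc .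
  moreover have "c (n + 1) = 4 * c n + 1 \<or> c (n + 1) = 4 * c n + 2" for n
    unfolding c_simps F_def by simp
  ultimately show ?thesis using that c lt by blast
qed

end

lemma (in hwc) Jordan_refuted: "\<not> sat M \<rho> (Jordan 0)"
proof
  assume "sat M \<rho> (Jordan 0)"
  note J = Jordan_decomp[OF this Psi_D Psi_rfun sat_BV_Psi]
  obtain p q where D: "p \<in> D (T1 \<rightarrow>\<^sub>t T1)" "q \<in> D (T1 \<rightarrow>\<^sub>t T1)" and rf: "rfun p" "rfun q"
    and mono: "\<And>x y. unit x \<Longrightarrow> unit y \<Longrightarrow> v x \<le> v y \<Longrightarrow> v (fap p x) \<le> v (fap p y)"
      "\<And>x y. unit x \<Longrightarrow> unit y \<Longrightarrow> v x \<le> v y \<Longrightarrow> v (fap q x) \<le> v (fap q y)"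
    and diff: "\<And>x. unit x \<Longrightarrow> v (fap Psi x) = v (fap p x) - v (fap q x)"
    by (rule J) blast+
  obtain c C where c: "intl c" "\<And>n. c (n + 1) = 4 * c n + 1 \<or> c (n + 1) = 4 * c n + 2" "\<And>n. c n < pw4 n"
    and osc: "\<And>n. v (fap p (crl (c n + 1) 0 (pw4 n))) + v (fap q (crl (c n + 1) 0 (pw4 n)))
      \<le> v (fap p (crl (c n) 0 (pw4 n))) + v (fap q (crl (c n) 0 (pw4 n))) + kr (nk C * hp n)"
    using small_oscillation[OF D rf mono] by blast
  obtain x where x: "isreal x" "\<And>n. kr (nk (c n) / nk (pw4 n)) \<le> v x" "\<And>n. v x \<le> kr ((nk (c n) + 1) / nk (pw4 n))"
    using limit_point[OF c(1,2)] by blast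
  \<comment> \<open>As \<open>C\<close> is less than \<open>2^C\<close>, the oscillation
    \<open>C * 2^-n\<close> is smaller than \<open>2^-(hh x + 1)\<close>, which is half of
    \<Psi>(x).\<close>
  define n where "n = hh x + 1 + C"
  let ?a = "nk (c n) / nk (pw4 n)" and ?b = "(nk (c n) + 1) / nk (pw4 n)"
  let ?A = "crl (c n) 0 (pw4 n)" and ?B = "crl (c n + 1) 0 (pw4 n)"
  have AB: "isreal ?A" "v ?A = kr ?a" "isreal ?B" "v ?B = kr ?b"
    using crl[of "pw4 n" _ 0] by (simp_all add: rv_def)
  have "nk (c n + 1) \<le> nk (pw4 n)" using c(3)[of n] by (simp only: nk_simps(5) Suc_le)
  then have "?b \<le> 1" by (simp only: divide_le_eq) simp
  then have ab: "kr 0 \<le> kr ?a" "kr ?a \<le> kr ?b" "kr ?b \<le> kr 1"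
    by (simp_all only: kr_le) (simp_all add: divide_right_mono)
  then have uAB: "unit ?A" "unit ?B" unfolding unit_def AB(2,4) using AB(1,3) unfolding kr_simps(1,2)
    by (blast intro: order_trans)+
  have ux: "unit x" using x(1) x(2)[of n] x(3)[of n] ab by (simp add: unit_def)
  \<comment> \<open>\<Psi>(x) - \<Psi>(y) is \<open>(p x - p y) + (q y - q x)\<close>, and on the
    interval these differences are at most the increments of \<open>p\<close> and of
    \<open>q\<close>. So \<Psi>(y) exceeds \<Psi>(x)/2, which forces \<open>hh y\<close> to be at
    most \<open>hh x\<close>.\<close>
  have small: "tap H y < hh x + 1" if y: "unit y" "kr ?a \<le> v y" "v y \<le> kr ?b" for y
  proof -
    have "v (fap p ?A) \<le> v (fap p y)" "v (fap p x) \<le> v (fap p ?B)" "v (fap q y) \<le> v (fap q ?B)" "v (fap q ?A) \<le> v (fap q x)"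
      by (rule mono; use uAB ux y AB x(2)[of n] x(3)[of n] in \<open>simp add: AB(2,4)\<close>)+
    then have "v (fap Psi x) - v (fap Psi y) \<le> kr (nk C * hp n)"
      using osc[of n] diff[OF ux] diff[OF y(1)] by linarith
    moreover have "nk C * hp n < hp (hh x + 1)"
    proof -
      have "nk C < nk (pw C)" unfolding nk_less by (rule pw_gt)
      then have "nk C * hp C < 1" by (simp add: hp_def divide_less_eq)
      then have "hp (hh x + 1) * (nk C * hp C) < hp (hh x + 1) * 1" by (rule mult_strict_left_mono) simp
      then show ?thesis unfolding n_def hp_add[of "hh x + 1"] by (simp only: ac_simps mult_1_right)
    qed
    ultimately have "kr (hp (hh x)) - kr (hp (hh y)) < kr (hp (hh x + 1))"
      unfolding Psi(2)[OF x(1)] Psi(2)[OF unit_real[OF y(1)]] by (meson kr_less le_less_trans)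
    then have "kr (hp (hh x + 1)) < kr (hp (hh y))" using hp_2(1)[of "hh x"] by simp
    then have "\<not> hh x + 1 \<le> hh y" using hp_mono[of "hh x + 1" "hh y"] by auto
    then show ?thesis using tap_le_hh[of y] by simp
  qed
  \<comment> \<open>The interval is divided into \<open>F\<close> equal parts. The left ends of the
    parts are \<open>F\<close> distinct points, one more than the size bound for heights below
    \<open>hh x + 1\<close> allows.\<close>
  define F where "F = nap g (hh x + 1) + 1"
  define Y where "Y = LamX (\<lambda>i. crl (c n * F + i) 0 (pw4 n * F))"
  have F0: "F \<noteq> 0" by (simp add: F_def)
  have Y_aux: "dfn (case_nat N G0) T1 (\<lambda>e. crl (c n * F + ab (e 0)) 0 (pw4 n * F))"
    by (intro dfn_rules3) simp_all
  have Y: "isreal (sap Y i)" "v (sap Y i) = kr ((nk (c n) * nk F + nk i) / (nk (pw4 n) * nk F))" for i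
    unfolding Y_def sap_LamX[OF Y_aux] using crl[of "pw4 n * F" "c n * F + i" 0] F0 by (simp_all add: rv_def)
  have Yi: "unit (sap Y i) \<and> tap H (sap Y i) < hh x + 1" if "i \<le> nap g (hh x + 1)" for i
  proof -
    have "nk i \<le> nk F" "0 \<le> nk i" using that unfolding F_def by (simp_all add: add_increasing2)
    have P: "0 < nk (pw4 n) * nk F" using F0 by simp
    have "?a = (nk (c n) * nk F) / (nk (pw4 n) * nk F)" "?b = (nk (c n) * nk F + nk F) / (nk (pw4 n) * nk F)"
      using F0 by (simp_all add: field_simps)
    then have "kr ?a \<le> v (sap Y i)" "v (sap Y i) \<le> kr ?b"
      unfolding Y(2) kr_le using \<open>nk i \<le> nk F\<close> \<open>0 \<le> nk i\<close> P by (simp_all only:) (intro divide_right_mono; simp)+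
    moreover from this have "unit (sap Y i)" using ab Y(1) by (simp add: unit_def)
    ultimately show ?thesis using small by blast
  qed
  have "Y \<in> D (N \<rightarrow>\<^sub>t T1)" unfolding Y_def by (rule LamX_D[OF Y_aux])
  from bound[OF this, of "hh x + 1"] Yi obtain i j where "i \<noteq> j" "v (sap Y i) = v (sap Y j)" by blast
  then show False unfolding Y(2) using F0 by simp
qed

subsection \<open>The theorem\<close>

text \<open>Typing and closedness in executable form, with a list of the variables in scope, so that
  they can be evaluated on the concrete sentences.\<close>

fun tscoped :: "var list \<Rightarrow> tm \<Rightarrow> bool" where
  "tscoped G (Var x) \<longleftrightarrow> List.member G x"
| "tscoped G (Con c) \<longleftrightarrow> True"
| "tscoped G (t \<cdot> u) \<longleftrightarrow> tscoped G t \<and> tscoped G u"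

fun scoped :: "var list \<Rightarrow> fm \<Rightarrow> bool" where
  "scoped G (Eq t u) \<longleftrightarrow> ty_of t = Some N \<and> ty_of u = Some N \<and> tscoped G t \<and> tscoped G u"
| "scoped G (Less t u) \<longleftrightarrow> ty_of t = Some N \<and> ty_of u = Some N \<and> tscoped G t \<and> tscoped G u"
| "scoped G Falsum \<longleftrightarrow> True"
| "scoped G (Imp \<phi> \<psi>) \<longleftrightarrow> scoped G \<phi> \<and> scoped G \<psi>"
| "scoped G (All x \<phi>) \<longleftrightarrow> scoped (x # G) \<phi>"

lemma tscoped: "tscoped G t \<Longrightarrow> tm_vars t \<subseteq> set G"
  by (induction t) auto

lemma scoped: "scoped G \<phi> \<Longrightarrow> wf \<phi> \<and> fv \<phi> \<subseteq> set G"
proof (induction \<phi> arbitrary: G)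
  case (All x \<phi>)
  then show ?case using All.IH[of "x # G"] by auto
qed (auto dest: tscoped)

lemma goals_closed:
  assumes "\<phi> \<in> goals"
  shows "wf \<phi>" "fv \<phi> = {}"
proof -
  have "scoped [] (Jordan 0)" "scoped [] (HBU_BV 0)" "scoped [] (WHBU_BV 0)" "scoped [] (NIN_alt' 0)"
    by code_simp+
  then have "scoped [] \<phi>" using assms by (auto simp: goals_def imp_s_def)
  then show "wf \<phi>" "fv \<phi> = {}" using scoped[of "[]" \<phi>] by auto
qed

lemma (in countermodel) goals_sat: "\<phi> \<in> goals \<Longrightarrow> sat M \<rho> \<phi>"
  unfolding goals_def NIN_alt'_def
  using hwc_if_sat[of \<rho>] hwc.Jordan_refuted[of _ _ \<rho>] hwc.HBU_refuted[of _ _ \<rho>] hwc.WHBU_refuted[of _ _ \<rho>]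
  by (auto simp: imp_s_def not_s_def)

lemma goals_provable:
  assumes "\<phi> \<in> goals"
  shows "ACA0_omega \<union> FIN \<turnstile> \<phi>"
proof (rule completeness)
  show "ACA0_omega \<union> FIN \<turnstile> ext_axiom \<rho> \<tau> 0" for \<rho> \<tau>
    unfolding proves_def by (rule deriv.Axiom) (auto simp: ACA0_omega_def RCA0_omega_def wf_ext_axiom)
  show "wf \<phi>" "fv \<phi> = {}" using goals_closed[OF assms] by simp_all
  fix S :: "nat str" and \<rho> assume S: "is_model (ACA0_omega \<union> FIN) S" "\<rho> \<in> env S"
  show "sat S \<rho> \<phi>"
  proof (rule ccontr)
    assume "\<not> ?thesis"
    \<comment> \<open>A model that refutes a goal exists, so the choice in \<open>S0\<close> hits
      such a model. It may refute another of the three goals, but \<open>goals_sat\<close> excludes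
      all of them.\<close>
    then have "\<exists>S :: nat str. is_model (ACA0_omega \<union> FIN) S \<and> (\<exists>\<phi>\<in>goals. \<exists>\<rho>\<in>env S. \<not> sat S \<rho> \<phi>)"
      using assms S by blast
    from someI_ex[OF this, folded S0_def]
    obtain \<psi> \<rho>' where "good" "\<psi> \<in> goals" "\<not> sat S0 \<rho>' \<psi>" by (auto simp: good_def)
    then show False using countermodel.goals_sat[of \<psi> \<rho>'] by (simp add: countermodel_def)
  qed
qed

theorem theorem3p15:
  shows "ACA0_omega \<union> FIN \<turnstile> (Jordan \<^bold>\<longrightarrow> NIN_alt') 0
       \<and> ACA0_omega \<union> FIN \<turnstile> (HBU_BV \<^bold>\<longrightarrow> NIN_alt') 0
       \<and> ACA0_omega \<union> FIN \<turnstile> (WHBU_BV \<^bold>\<longrightarrow> NIN_alt') 0"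
  by (simp add: goals_provable goals_def)

end
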